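(* Let $M=(|M|,\mathcal{O}_M)$ be a $\mathbb{Z}$-graded manifold of dimension $(p_j)_{j\in\mathbb{Z}}$, and let $\mathcal{W}$ be the $\mathbb{Z}$-graded vector space with $\dim\mathcal{W}_0=0$ and $\dim\mathcal{W}_j=p_j$ for $j\neq0$ used in its local model $\mathbb{R}^{(p_j)}$. Then the graded tangent bundle $\mathrm{Vec}_M$ is a locally free sheaf of $\mathcal{O}_M$-modules such that, for any trivialising open subset $V\subseteq|M|$, its restriction to $V$ satisfies $$\mathrm{Vec}_M|_V\;\simeq\;\Big(\mathcal{O}_M|_V\underset{\mathcal{C}^\infty_V}{\otimes}\mathrm{Vec}_V\Big)\;\oplus\;\Big(\mathcal{O}_M|_V\underset{\mathbb{R}}{\otimes}\mathcal{W}^*\Big).$$ If $(t_i,w_\alpha)_{i,\alpha}$ is a local coordinate system on $M$, then every vector field $X$ admits the following splitting on a trivialising open set $V$: $$X=\sum_i X_{0,i}\frac{\partial}{\partial t_i}+\sum_\alpha X_{1,\alpha}\frac{\partial}{\partial w_\alpha},$$ where $X_{0,i}=X(t_i)\in\mathcal{O}_M(V)$ and $X_{1,\alpha}=X(w_\alpha)\in\mathcal{O}_M(V)$ for all $i,\alpha$.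
   Context: A $\mathbb{Z}$-graded vector space is a direct sum $\mathcal{V}=\bigoplus_{i\in\mathbb{Z}}\mathcal{V}_i$ of real vector spaces with $\dim\mathcal{V}_i<\infty$ for all $i$; $|\cdot|$ is the degree of homogeneous elements. A graded basis is a sequence of homogeneous elements such that those of degree $i$ form a basis of $\mathcal{V}_i$. The dual $\mathcal{V}^*$ is graded by $(\mathcal{V}^* )_i=(\mathcal{V}_{-i})^*$. $\mathbf{S}\mathcal{W}$ is the quotient of the tensor algebra $\bigotimes\mathcal{W}$ by the ideal generated by $u\otimes v-(-1)^{|u||v|}v\otimes u$ ($u,v$ homogeneous), and $\overline{\mathbf{S}\mathcal{W}}$ is its completion by formal power series in a graded basis. Graded domain: for non-negative integers $(p_j)_{j\in\mathbb{Z}}$ and $\mathcal{W}$ a graded vector space with $\dim\mathcal{W}_0=0$, $\dim\mathcal{W}_j=p_j$ for $j\ne0$, a $\mathbb{Z}$-graded domain of dimension $(p_j)_j$ is $U^{(p_j)}=(U,\mathcal{O}_U)$ with $U\subseteq\mathbb{R}^{p_0}$ open and $\mathcal{O}_U(V)=\mathcal{C}^\infty_{\mathbb{R}^{p_0}}(V)\otimes\overline{\mathbf{S}\mathcal{W}}$ for all open $V\subseteq U$; its sections over $V$ are the formal series $f_0+\sum_{K\ge1}\sum_{\alpha_1\leqslant\ldots\leqslant\alpha_K}f_{\alpha_1\ldots\alpha_K}w_{\alpha_1}\cdots w_{\alpha_K}$ with smooth coefficients on $V$, for $(w_\alpha)_\alpha$ a graded basis of $\mathcal{W}$ (monomials that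 vanish by supercommutativity being omitted). $\mathbb{R}^{(p_j)}$ is the graded domain with $U=\mathbb{R}^{p_0}$. A global coordinate system on $U^{(p_j)}$ is $(t_i,w_\alpha)_{i,\alpha}$ with $(t_1,\dots,t_{p_0})$ a global coordinate system on $U$ and $(w_\alpha)_\alpha$ a graded basis of $\mathcal{W}$. A $\mathbb{Z}$-graded locally ringed space is a topological space with a sheaf of associative unital supercommutative ($ab=(-1)^{|a||b|}ba$) $\mathbb{Z}$-graded rings all of whose stalks have a unique maximal homogeneous ideal. Morphisms are pairs (continuous map, morphism of sheaves of associative unital supercommutative graded rings) for which the preimage of the maximal homogeneous ideal under each induced stalk map is the maximal homogeneous ideal. Graded manifold: $M=(|M|,\mathcal{O}_M)$ with $|M|$ Hausdorff second-countable, $\mathcal{O}_M$ a sheaf of associative unital supercommutative $\mathbb{Z}$-graded algebras, such that $M$ is a $\mathbb{Z}$-graded locally ringed space locally isomorphic to $\mathbb{R}^{(p_j)}$: every point of $|M|$ has an open neighbourhood $V$ with an isomorphism $\phi_V$ of graded locally ringed spaces from $(V,\mathcal{O}_M|_V)$ onto $(\widetilde V,\mathcal{O}_{\mathbb{R}^{(p_j)}}|_{\widetilde V})$, $\widetilde V\subseteq\mathbb{R}^{p_0}$ open. Such $V$ is called a trivialising open set. The pullbacks to trivialising open sets of a global coordinate system $(t_i,w_\alpha)_{i,\alpha}$ on $\mathbb{R}^{(p_j)}$ form a local coordinate system on $M$, denoted by the same symbols. On a trivialising open set $V$, $\mathcal{C}^\infty_V$ denotes the sheaf of smooth functions of the $p_0$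 degree-zero coordinates (the smooth structure transported from $\widetilde V$), embedded in $\mathcal{O}_M|_V$ through the trivialisation, and $\mathrm{Vec}_V$ is the ordinary (non-graded) sheaf of smooth vector fields on $V$. Vector fields: a derivation of degree $k$ on an open $V\subseteq|M|$ is a map $X_V^k:\mathcal{O}_M(V)\to\mathcal{O}_M(V)$ sending sections of degree $m$ to sections of degree $m+k$ with $X_V^k(fg)=X_V^k(f)g+(-1)^{k|f|}fX_V^k(g)$ for all $f,g$. A vector field $X$ on $M$ is an $\mathbb{R}$-linear derivation of $\mathcal{O}_M$, i.e. a family of maps $X_V:\mathcal{O}_M(V)\to\mathcal{O}_M(V)$ for all open $V\subseteq|M|$, compatible with restrictions, with $X_V=\sum_{k\in\mathbb{Z}}X_V^k$, each $X_V^k$ a derivation of degree $k$. The graded tangent bundle $\mathrm{Vec}_M$ is the sheaf assigning to each open $V$ the graded vector space of derivations of $\mathcal{O}_M|_V$. In coordinates, $\frac{\partial}{\partial t_i}$ (degree $0$) and $\frac{\partial}{\partial w_\alpha}$ (degree $-|w_\alpha|$, the basis of $\mathcal{W}^*$ dual to $(w_\alpha)_\alpha$) are the $\mathbb{R}$-linear derivations, extended by the Leibniz rule, with $\frac{\partial}{\partial t_i}(t_j)=\delta_{ij}$, $\frac{\partial}{\partial t_i}(w_\beta)=0$, $\frac{\partial}{\partial w_\alpha}(w_\beta)=\delta_{\alpha\beta}$, $\frac{\partial}{\partial w_\alpha}(t_j)=0$.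
   Formalization: Only finitely many p_j are assumed non-zero (W finite-dimensional): otherwise Σ w_α ∂/∂w_α is a vector field outside the algebraic tensor product and the isomorphism fails. Trivialisations are taken ℝ-linear, and gradings and sums of X^k in the completed (formal series) sense. *)

theory Defs
  imports "HOL-Analysis.Analysis" "HOL-Algebra.Module" "HOL-Algebra.Free_Abelian_Groups" "HOL-Algebra.Ideal_Product" "HOL-Library.Multiset"
begin

section \<open>Graded algebras and graded modules\<close>

record ('r, 'a) graded = "('r, 'a) module" +
  hpart :: "int \<Rightarrow> 'a set"

text \<open>
  A formal power series in variables of non-zero degree may have infinitely many non-zero
  homogeneous components. Hence a grading \<open>(G\<^sub>k)\<close> of \<open>G\<close> is understood in the completed sense
  \<open>\<Oplus>\<^sub>k G\<^sub>k \<subseteq> G \<subseteq> \<Prod>\<^sub>k G\<^sub>k\<close>: each element is determined by its homogeneous components.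
\<close>

definition formal_grading :: "('r, 'a) graded \<Rightarrow> bool" where
  "formal_grading G \<longleftrightarrow>
     (\<forall>k. additive_subgroup (hpart G k) G) \<and>
     (\<exists>\<pi>. (\<forall>k. \<forall>x\<in>carrier G. \<pi> k x \<in> hpart G k) \<and>
          (\<forall>k. \<forall>x\<in>carrier G. \<forall>y\<in>carrier G. \<pi> k (x \<oplus>\<^bsub>G\<^esub> y) = \<pi> k x \<oplus>\<^bsub>G\<^esub> \<pi> k y) \<and>
          (\<forall>k l. \<forall>x\<in>hpart G k. \<pi> l x = (if l = k then x else \<zero>\<^bsub>G\<^esub>)) \<and>
          (\<forall>x\<in>carrier G. (\<forall>k. \<pi> k x = \<zero>\<^bsub>G\<^esub>) \<longrightarrow> x = \<zero>\<^bsub>G\<^esub>))"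

definition real_ring :: "real ring" where
  "real_ring = \<lparr>carrier = UNIV, mult = (*), one = 1, ring.zero = 0, ring.add = (+)\<rparr>"

definition signed :: "('r, 'a) graded \<Rightarrow> int \<Rightarrow> 'a \<Rightarrow> 'a" where
  "signed A n x = (if even n then x else \<ominus>\<^bsub>A\<^esub> x)"

definition supercomm_algebra :: "(real, 'a) graded \<Rightarrow> bool" where
  "supercomm_algebra A \<longleftrightarrow>
     ring A \<and> module real_ring A \<and>
     (\<forall>r. \<forall>a\<in>carrier A. \<forall>b\<in>carrier A.
        (r \<odot>\<^bsub>A\<^esub> a) \<otimes>\<^bsub>A\<^esub> b = r \<odot>\<^bsub>A\<^esub> (a \<otimes>\<^bsub>A\<^esub> b) \<and> a \<otimes>\<^bsub>A\<^esub> (r \<odot>\<^bsub>A\<^esub> b) = r \<odot>\<^bsub>A\<^esub> (a \<otimes>\<^bsub>A\<^esub> b)) \<and>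
     formal_grading A \<and>
     (\<forall>r k. \<forall>a\<in>hpart A k. r \<odot>\<^bsub>A\<^esub> a \<in> hpart A k) \<and>
     \<one>\<^bsub>A\<^esub> \<in> hpart A 0 \<and>
     (\<forall>k l. \<forall>a\<in>hpart A k. \<forall>b\<in>hpart A l.
        a \<otimes>\<^bsub>A\<^esub> b \<in> hpart A (k + l) \<and> a \<otimes>\<^bsub>A\<^esub> b = signed A (k * l) (b \<otimes>\<^bsub>A\<^esub> a))"

definition graded_module :: "('q, 'a) graded \<Rightarrow> ('a, 'm) graded \<Rightarrow> bool" where
  "graded_module A F \<longleftrightarrow>
     abelian_group F \<and>
     (\<forall>a\<in>carrier A. \<forall>x\<in>carrier F. a \<odot>\<^bsub>F\<^esub> x \<in> carrier F) \<and>
     (\<forall>a\<in>carrier A. \<forall>b\<in>carrier A. \<forall>x\<in>carrier F.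
        (a \<oplus>\<^bsub>A\<^esub> b) \<odot>\<^bsub>F\<^esub> x = a \<odot>\<^bsub>F\<^esub> x \<oplus>\<^bsub>F\<^esub> b \<odot>\<^bsub>F\<^esub> x \<and>
        (a \<otimes>\<^bsub>A\<^esub> b) \<odot>\<^bsub>F\<^esub> x = a \<odot>\<^bsub>F\<^esub> (b \<odot>\<^bsub>F\<^esub> x)) \<and>
     (\<forall>a\<in>carrier A. \<forall>x\<in>carrier F. \<forall>y\<in>carrier F.
        a \<odot>\<^bsub>F\<^esub> (x \<oplus>\<^bsub>F\<^esub> y) = a \<odot>\<^bsub>F\<^esub> x \<oplus>\<^bsub>F\<^esub> a \<odot>\<^bsub>F\<^esub> y) \<and>
     (\<forall>x\<in>carrier F. \<one>\<^bsub>A\<^esub> \<odot>\<^bsub>F\<^esub> x = x) \<and>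
     formal_grading F \<and>
     (\<forall>k l. \<forall>a\<in>hpart A k. \<forall>x\<in>hpart F l. a \<odot>\<^bsub>F\<^esub> x \<in> hpart F (k + l))"

definition derivation :: "(real, 'a) graded \<Rightarrow> int \<Rightarrow> ('a \<Rightarrow> 'a) \<Rightarrow> bool" where
  "derivation A k D \<longleftrightarrow>
     (\<forall>f\<in>carrier A. D f \<in> carrier A) \<and>
     (\<forall>f\<in>carrier A. \<forall>g\<in>carrier A. D (f \<oplus>\<^bsub>A\<^esub> g) = D f \<oplus>\<^bsub>A\<^esub> D g) \<and>
     (\<forall>r. \<forall>f\<in>carrier A. D (r \<odot>\<^bsub>A\<^esub> f) = r \<odot>\<^bsub>A\<^esub> D f) \<and>
     (\<forall>m. \<forall>f\<in>hpart A m. D f \<in> hpart A (m + k)) \<and>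
     (\<forall>m. \<forall>f\<in>hpart A m. \<forall>g\<in>carrier A.
        D (f \<otimes>\<^bsub>A\<^esub> g) = (D f \<otimes>\<^bsub>A\<^esub> g) \<oplus>\<^bsub>A\<^esub> signed A (k * m) (f \<otimes>\<^bsub>A\<^esub> D g))"

definition homogeneous_ideal :: "('r, 'a) graded \<Rightarrow> 'a set \<Rightarrow> bool" where
  "homogeneous_ideal A I \<longleftrightarrow> ideal I A \<and> I = genideal A (I \<inter> (\<Union>k. hpart A k))"

definition max_hom_ideal :: "('r, 'a) graded \<Rightarrow> 'a set \<Rightarrow> bool" where
  "max_hom_ideal A I \<longleftrightarrow>
     homogeneous_ideal A I \<and> I \<noteq> carrier A \<and>
     (\<forall>J. homogeneous_ideal A J \<and> I \<subseteq> J \<and> J \<noteq> carrier A \<longrightarrow> J = I)"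

primrec ideal_power :: "('a, 'b) ring_scheme \<Rightarrow> 'a set \<Rightarrow> nat \<Rightarrow> 'a set" where
  "ideal_power R I 0 = carrier R"
| "ideal_power R I (Suc n) = ideal_prod R I (ideal_power R I n)"

definition nonzero_degree_ideal :: "('r, 'a) graded \<Rightarrow> 'a set" where
  "nonzero_degree_ideal A = genideal A (\<Union>k\<in>-{0}. hpart A k)"


section \<open>Sheaves\<close>

text \<open>
  Only the values of \<open>sec\<close> and \<open>res\<close> at open sets of \<open>base\<close> matter; \<open>res S U V\<close> is the restriction
  from \<open>U\<close> to \<open>V \<subseteq> U\<close>. For sheaves of algebras the scalars \<open>'r\<close> are the reals, for a sheaf of
  modules over \<open>M\<close> they are the sections of \<open>M\<close>.
\<close>

record ('x, 'r, 'a) gpresheaf =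
  base :: "'x topology"
  sec :: "'x set \<Rightarrow> ('r, 'a) graded"
  res :: "'x set \<Rightarrow> 'x set \<Rightarrow> 'a \<Rightarrow> 'a"

definition restrict_sheaf :: "('x, 'r, 'a) gpresheaf \<Rightarrow> 'x set \<Rightarrow> ('x, 'r, 'a) gpresheaf" where
  "restrict_sheaf S V = S\<lparr>base := subtopology (base S) V\<rparr>"

definition is_presheaf :: "('x, 'r, 'a) gpresheaf \<Rightarrow> bool" where
  "is_presheaf S \<longleftrightarrow>
     (\<forall>U V. openin (base S) U \<and> openin (base S) V \<and> V \<subseteq> U \<longrightarrow>
        (\<forall>s\<in>carrier (sec S U). res S U V s \<in> carrier (sec S V)) \<and>
        (\<forall>s\<in>carrier (sec S U). \<forall>t\<in>carrier (sec S U).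
           res S U V (s \<oplus>\<^bsub>sec S U\<^esub> t) = res S U V s \<oplus>\<^bsub>sec S V\<^esub> res S U V t) \<and>
        (\<forall>k. \<forall>s\<in>hpart (sec S U) k. res S U V s \<in> hpart (sec S V) k)) \<and>
     (\<forall>U. openin (base S) U \<longrightarrow> (\<forall>s\<in>carrier (sec S U). res S U U s = s)) \<and>
     (\<forall>U V W. openin (base S) U \<and> openin (base S) V \<and> openin (base S) W \<and> W \<subseteq> V \<and> V \<subseteq> U \<longrightarrow>
        (\<forall>s\<in>carrier (sec S U). res S V W (res S U V s) = res S U W s))"

text \<open>The last clause says that each \<open>hpart\<close> is a subsheaf.\<close>

definition is_sheaf :: "('x, 'r, 'a) gpresheaf \<Rightarrow> bool" where
  "is_sheaf S \<longleftrightarrow> is_presheaf S \<and>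
     (\<forall>\<V> s. (\<forall>V\<in>\<V>. openin (base S) V \<and> s V \<in> carrier (sec S V)) \<and>
        (\<forall>V\<in>\<V>. \<forall>W\<in>\<V>. res S V (V \<inter> W) (s V) = res S W (V \<inter> W) (s W)) \<longrightarrow>
        (\<exists>!t. t \<in> carrier (sec S (\<Union>\<V>)) \<and> (\<forall>V\<in>\<V>. res S (\<Union>\<V>) V t = s V))) \<and>
     (\<forall>\<V> t k. (\<forall>V\<in>\<V>. openin (base S) V) \<and> t \<in> carrier (sec S (\<Union>\<V>)) \<and>
        (\<forall>V\<in>\<V>. res S (\<Union>\<V>) V t \<in> hpart (sec S V) k) \<longrightarrow> t \<in> hpart (sec S (\<Union>\<V>)) k)"

definition algebra_sheaf :: "('x, real, 'a) gpresheaf \<Rightarrow> bool" where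
  "algebra_sheaf M \<longleftrightarrow> is_sheaf M \<and>
     (\<forall>U. openin (base M) U \<longrightarrow> supercomm_algebra (sec M U)) \<and>
     (\<forall>U V. openin (base M) U \<and> openin (base M) V \<and> V \<subseteq> U \<longrightarrow>
        res M U V \<in> ring_hom (sec M U) (sec M V) \<and>
        (\<forall>r. \<forall>f\<in>carrier (sec M U). res M U V (r \<odot>\<^bsub>sec M U\<^esub> f) = r \<odot>\<^bsub>sec M V\<^esub> res M U V f))"

definition module_sheaf :: "('x, 'q, 'a) gpresheaf \<Rightarrow> ('x, 'a, 'm) gpresheaf \<Rightarrow> bool" where
  "module_sheaf M F \<longleftrightarrow> base F = base M \<and> is_sheaf F \<and>
     (\<forall>U. openin (base M) U \<longrightarrow> graded_module (sec M U) (sec F U)) \<and>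
     (\<forall>U V. openin (base M) U \<and> openin (base M) V \<and> V \<subseteq> U \<longrightarrow>
        (\<forall>f\<in>carrier (sec M U). \<forall>x\<in>carrier (sec F U).
           res F U V (f \<odot>\<^bsub>sec F U\<^esub> x) = res M U V f \<odot>\<^bsub>sec F V\<^esub> res F U V x))"

definition module_sheaf_iso ::
  "('x, 'q, 'a) gpresheaf \<Rightarrow> ('x, 'a, 'm) gpresheaf \<Rightarrow> ('x, 'a, 'n) gpresheaf \<Rightarrow> bool" where
  "module_sheaf_iso M F G \<longleftrightarrow>
     (\<exists>\<Theta>. \<forall>U. openin (base M) U \<longrightarrow>
        bij_betw (\<Theta> U) (carrier (sec F U)) (carrier (sec G U)) \<and>
        (\<forall>x\<in>carrier (sec F U). \<forall>y\<in>carrier (sec F U).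
           \<Theta> U (x \<oplus>\<^bsub>sec F U\<^esub> y) = \<Theta> U x \<oplus>\<^bsub>sec G U\<^esub> \<Theta> U y) \<and>
        (\<forall>f\<in>carrier (sec M U). \<forall>x\<in>carrier (sec F U).
           \<Theta> U (f \<odot>\<^bsub>sec F U\<^esub> x) = f \<odot>\<^bsub>sec G U\<^esub> \<Theta> U x) \<and>
        (\<forall>k. \<Theta> U ` hpart (sec F U) k = hpart (sec G U) k) \<and>
        (\<forall>V. openin (base M) V \<and> V \<subseteq> U \<longrightarrow>
           (\<forall>x\<in>carrier (sec F U). \<Theta> V (res F U V x) = res G U V (\<Theta> U x))))"

text \<open>The free module on generators of degrees \<open>ds ! 0, ds ! 1, \<dots>\<close>.\<close>

definition free_module_sheaf :: "('x, 'q, 'a) gpresheaf \<Rightarrow> int list \<Rightarrow> ('x, 'a, nat \<Rightarrow> 'a) gpresheaf" where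
  "free_module_sheaf M ds =
     (let I = {..<length ds} in
      \<lparr>base = base M,
       sec = (\<lambda>U. \<lparr>carrier = (\<Pi>\<^sub>E i\<in>I. carrier (sec M U)), mult = undefined, one = undefined,
                   ring.zero = (\<lambda>i\<in>I. \<zero>\<^bsub>sec M U\<^esub>),
                   ring.add = (\<lambda>u v. \<lambda>i\<in>I. u i \<oplus>\<^bsub>sec M U\<^esub> v i),
                   smult = (\<lambda>f u. \<lambda>i\<in>I. f \<otimes>\<^bsub>sec M U\<^esub> u i),
                   hpart = (\<lambda>k. \<Pi>\<^sub>E i\<in>I. hpart (sec M U) (k - ds ! i))\<rparr>),
       res = (\<lambda>U V u. \<lambda>i\<in>I. res M U V (u i))\<rparr>)"

definition locally_free :: "('x, 'q, 'a) gpresheaf \<Rightarrow> ('x, 'a, 'm) gpresheaf \<Rightarrow> bool" where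
  "locally_free M F \<longleftrightarrow>
     (\<forall>x\<in>topspace (base M). \<exists>V ds. openin (base M) V \<and> x \<in> V \<and>
        module_sheaf_iso (restrict_sheaf M V) (restrict_sheaf F V)
          (free_module_sheaf (restrict_sheaf M V) ds))"

definition direct_sum_sheaf ::
  "('x, 'a, 'm) gpresheaf \<Rightarrow> ('x, 'a, 'n) gpresheaf \<Rightarrow> ('x, 'a, 'm \<times> 'n) gpresheaf" where
  "direct_sum_sheaf F G =
     \<lparr>base = base F,
      sec = (\<lambda>U. \<lparr>carrier = carrier (sec F U) \<times> carrier (sec G U), mult = undefined, one = undefined,
                  ring.zero = (\<zero>\<^bsub>sec F U\<^esub>, \<zero>\<^bsub>sec G U\<^esub>),
                  ring.add = (\<lambda>(x, y) (x', y'). (x \<oplus>\<^bsub>sec F U\<^esub> x', y \<oplus>\<^bsub>sec G U\<^esub> y')),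
                  smult = (\<lambda>f (x, y). (f \<odot>\<^bsub>sec F U\<^esub> x, f \<odot>\<^bsub>sec G U\<^esub> y)),
                  hpart = (\<lambda>k. hpart (sec F U) k \<times> hpart (sec G U) k)\<rparr>),
      res = (\<lambda>U V (x, y). (res F U V x, res G U V y))\<rparr>"


subsection \<open>Stalks and sheafification\<close>

definition germ :: "('x, 'r, 'a) gpresheaf \<Rightarrow> 'x \<Rightarrow> 'x set \<Rightarrow> 'a \<Rightarrow> ('x set \<times> 'a) set" where
  "germ S x V s =
     {(W, t). openin (base S) W \<and> x \<in> W \<and> t \<in> carrier (sec S W) \<and>
        (\<exists>N. openin (base S) N \<and> x \<in> N \<and> N \<subseteq> V \<inter> W \<and> res S V N s = res S W N t)}"

definition germ_op ::
  "('x, 'r, 'a) gpresheaf \<Rightarrow> 'x \<Rightarrow> ('x set \<Rightarrow> 'a \<Rightarrow> 'a \<Rightarrow> 'a) \<Rightarrow>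
   ('x set \<times> 'a) set \<Rightarrow> ('x set \<times> 'a) set \<Rightarrow> ('x set \<times> 'a) set" where
  "germ_op S x f A B =
     (let (V, s) = (SOME r. r \<in> A); (W, t) = (SOME r. r \<in> B)
      in germ S x (V \<inter> W) (f (V \<inter> W) (res S V (V \<inter> W) s) (res S W (V \<inter> W) t)))"

definition stalk :: "('x, 'r, 'a) gpresheaf \<Rightarrow> 'x \<Rightarrow> ('r, ('x set \<times> 'a) set) graded" where
  "stalk S x =
     \<lparr>carrier = {germ S x V s | V s. openin (base S) V \<and> x \<in> V \<and> s \<in> carrier (sec S V)},
      mult = germ_op S x (\<lambda>V. mult (sec S V)),
      one = germ S x (topspace (base S)) \<one>\<^bsub>sec S (topspace (base S))\<^esub>,
      ring.zero = germ S x (topspace (base S)) \<zero>\<^bsub>sec S (topspace (base S))\<^esub>,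
      ring.add = germ_op S x (\<lambda>V. add (sec S V)),
      smult = (\<lambda>r A. let (V, s) = (SOME r. r \<in> A) in germ S x V (r \<odot>\<^bsub>sec S V\<^esub> s)),
      hpart = (\<lambda>k. {germ S x V s | V s. openin (base S) V \<and> x \<in> V \<and> s \<in> hpart (sec S V) k})\<rparr>"

text \<open>
  Sections of the sheafification of a presheaf \<open>P\<close> of \<open>M\<close>-modules are the families of germs
  that are locally given by sections of \<open>P\<close>.
\<close>

definition germ_smult ::
  "('x, 'q, 'a) gpresheaf \<Rightarrow> ('x, 'a, 'm) gpresheaf \<Rightarrow> 'x \<Rightarrow> 'x set \<Rightarrow> 'a \<Rightarrow>
   ('x set \<times> 'm) set \<Rightarrow> ('x set \<times> 'm) set" where
  "germ_smult M P x U f A =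
     (let (W, s) = (SOME r. r \<in> A)
      in germ P x (U \<inter> W) (res M U (U \<inter> W) f \<odot>\<^bsub>sec P (U \<inter> W)\<^esub> res P W (U \<inter> W) s))"

definition germ_families ::
  "('x, 'a, 'm) gpresheaf \<Rightarrow> ('x set \<Rightarrow> 'm set) \<Rightarrow> 'x set \<Rightarrow> ('x \<Rightarrow> ('x set \<times> 'm) set) set" where
  "germ_families P C U =
     {\<sigma> \<in> extensional U. \<forall>x\<in>U. \<exists>N s. openin (base P) N \<and> x \<in> N \<and> N \<subseteq> U \<and> s \<in> C N \<and>
        (\<forall>y\<in>N. \<sigma> y = germ P y N s)}"

definition sheafify ::
  "('x, 'q, 'a) gpresheaf \<Rightarrow> ('x, 'a, 'm) gpresheaf \<Rightarrow> ('x, 'a, 'x \<Rightarrow> ('x set \<times> 'm) set) gpresheaf" where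
  "sheafify M P =
     \<lparr>base = base P,
      sec = (\<lambda>U. \<lparr>carrier = germ_families P (\<lambda>N. carrier (sec P N)) U,
                  mult = undefined, one = undefined,
                  ring.zero = (\<lambda>x\<in>U. germ P x U \<zero>\<^bsub>sec P U\<^esub>),
                  ring.add = (\<lambda>\<sigma> \<tau>. \<lambda>x\<in>U. \<sigma> x \<oplus>\<^bsub>stalk P x\<^esub> \<tau> x),
                  smult = (\<lambda>f \<sigma>. \<lambda>x\<in>U. germ_smult M P x U f (\<sigma> x)),
                  hpart = (\<lambda>k. germ_families P (\<lambda>N. hpart (sec P N) k) U)\<rparr>),
      res = (\<lambda>U V \<sigma>. restrict \<sigma> V)\<rparr>"


subsection \<open>Tensor products\<close>

text \<open>
  \<open>A \<otimes>\<^sub>R B\<close> is the free abelian group on \<open>A \<times> B\<close> modulo the usual relations, as a left module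
  over \<open>A\<close>. The right action of \<open>R\<close> on \<open>A\<close> is \<open>act\<close>, its left action on \<open>B\<close> is the scalar
  multiplication of \<open>B\<close>. In both applications below \<open>R\<close> is concentrated in degree \<open>0\<close>.
\<close>

definition tensor_relations ::
  "('q, 'a) graded \<Rightarrow> ('r, 'b) graded \<Rightarrow> 'r set \<Rightarrow> ('a \<Rightarrow> 'r \<Rightarrow> 'a) \<Rightarrow> (('a \<times> 'b) \<Rightarrow>\<^sub>0 int) set" where
  "tensor_relations A B R act =
     {frag_of (a \<oplus>\<^bsub>A\<^esub> a', b) - frag_of (a, b) - frag_of (a', b) | a a' b.
        a \<in> carrier A \<and> a' \<in> carrier A \<and> b \<in> carrier B} \<union>
     {frag_of (a, b \<oplus>\<^bsub>B\<^esub> b') - frag_of (a, b) - frag_of (a, b') | a b b'.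
        a \<in> carrier A \<and> b \<in> carrier B \<and> b' \<in> carrier B} \<union>
     {frag_of (act a r, b) - frag_of (a, r \<odot>\<^bsub>B\<^esub> b) | a r b.
        a \<in> carrier A \<and> r \<in> R \<and> b \<in> carrier B}"

definition tensor_null ::
  "('q, 'a) graded \<Rightarrow> ('r, 'b) graded \<Rightarrow> 'r set \<Rightarrow> ('a \<Rightarrow> 'r \<Rightarrow> 'a) \<Rightarrow> (('a \<times> 'b) \<Rightarrow>\<^sub>0 int) set" where
  "tensor_null A B R act =
     generate (free_Abelian_group (carrier A \<times> carrier B)) (tensor_relations A B R act)"

definition tensor ::
  "('q, 'a) graded \<Rightarrow> ('r, 'b) graded \<Rightarrow> 'r set \<Rightarrow> ('a \<Rightarrow> 'r \<Rightarrow> 'a) \<Rightarrow>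
   ('a, (('a \<times> 'b) \<Rightarrow>\<^sub>0 int) set) graded" where
  "tensor A B R act =
     (let F = free_Abelian_group (carrier A \<times> carrier B); N = tensor_null A B R act in
      \<lparr>carrier = carrier (F Mod N), mult = undefined, one = undefined,
       ring.zero = one (F Mod N),
       ring.add = mult (F Mod N),
       smult = (\<lambda>f C. (frag_extend (\<lambda>(a, b). frag_of (f \<otimes>\<^bsub>A\<^esub> a, b)) ` C) <#>\<^bsub>F\<^esub> N),
       hpart = (\<lambda>k. (\<lambda>c. N #>\<^bsub>F\<^esub> c) `
          generate F {frag_of (a, b) | a b. \<exists>i. a \<in> hpart A i \<and> b \<in> hpart B (k - i)})\<rparr>)"

definition tensor_presheaf ::
  "('x, 'q, 'a) gpresheaf \<Rightarrow> ('x, 'r, 'b) gpresheaf \<Rightarrow> ('x set \<Rightarrow> 'r set) \<Rightarrow> ('x set \<Rightarrow> 'a \<Rightarrow> 'r \<Rightarrow> 'a) \<Rightarrow>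
   ('x, 'a, (('a \<times> 'b) \<Rightarrow>\<^sub>0 int) set) gpresheaf" where
  "tensor_presheaf M B R act =
     \<lparr>base = base M,
      sec = (\<lambda>U. tensor (sec M U) (sec B U) (R U) (act U)),
      res = (\<lambda>U V C. (frag_extend (\<lambda>(a, b). frag_of (res M U V a, res B U V b)) ` C)
              <#>\<^bsub>free_Abelian_group (carrier (sec M V) \<times> carrier (sec B V))\<^esub>
              tensor_null (sec M V) (sec B V) (R V) (act V))\<rparr>"

definition tensor_sheaf ::
  "('x, 'q, 'a) gpresheaf \<Rightarrow> ('x, 'r, 'b) gpresheaf \<Rightarrow> ('x set \<Rightarrow> 'r set) \<Rightarrow> ('x set \<Rightarrow> 'a \<Rightarrow> 'r \<Rightarrow> 'a) \<Rightarrow>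
   ('x, 'a, 'x \<Rightarrow> ('x set \<times> (('a \<times> 'b) \<Rightarrow>\<^sub>0 int) set) set) gpresheaf" where
  "tensor_sheaf M B R act = sheafify M (tensor_presheaf M B R act)"


section \<open>Graded locally ringed spaces\<close>

definition graded_locally_ringed_space :: "('x, real, 'a) gpresheaf \<Rightarrow> bool" where
  "graded_locally_ringed_space M \<longleftrightarrow>
     algebra_sheaf M \<and> (\<forall>x\<in>topspace (base M). \<exists>!I. max_hom_ideal (stalk M x) I)"

definition preim :: "('x, 'r, 'a) gpresheaf \<Rightarrow> ('x \<Rightarrow> 'y) \<Rightarrow> 'y set \<Rightarrow> 'x set" where
  "preim X h V = {x \<in> topspace (base X). h x \<in> V}"

definition stalk_map ::
  "('x, 'r, 'a) gpresheaf \<Rightarrow> ('x \<Rightarrow> 'y) \<Rightarrow> ('y set \<Rightarrow> 'b \<Rightarrow> 'a) \<Rightarrow> 'x \<Rightarrow>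
   ('y set \<times> 'b) set \<Rightarrow> ('x set \<times> 'a) set" where
  "stalk_map X h H x A = (let (V, s) = (SOME r. r \<in> A) in germ X x (preim X h V) (H V s))"

text \<open>
  \<open>H V\<close> is the pullback from sections over \<open>V\<close> to sections over the preimage of \<open>V\<close>. As structure
  sheaves are sheaves of real algebras, pullbacks are required to be \<open>\<real>\<close>-linear. (This does not
  follow from being a ring homomorphism: if there are formal variables of total degree \<open>0\<close>,
  \<open>\<real>\<close> has other ring embeddings into the formal power series.)
\<close>

definition graded_morphism ::
  "('x, real, 'a) gpresheaf \<Rightarrow> ('y, real, 'b) gpresheaf \<Rightarrow> ('x \<Rightarrow> 'y) \<Rightarrow> ('y set \<Rightarrow> 'b \<Rightarrow> 'a) \<Rightarrow> bool" where
  "graded_morphism X Y h H \<longleftrightarrow>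
     continuous_map (base X) (base Y) h \<and>
     (\<forall>V. openin (base Y) V \<longrightarrow>
        H V \<in> ring_hom (sec Y V) (sec X (preim X h V)) \<and>
        (\<forall>r. \<forall>f\<in>carrier (sec Y V). H V (r \<odot>\<^bsub>sec Y V\<^esub> f) = r \<odot>\<^bsub>sec X (preim X h V)\<^esub> H V f) \<and>
        (\<forall>k. \<forall>f\<in>hpart (sec Y V) k. H V f \<in> hpart (sec X (preim X h V)) k)) \<and>
     (\<forall>V W. openin (base Y) V \<and> openin (base Y) W \<and> W \<subseteq> V \<longrightarrow>
        (\<forall>f\<in>carrier (sec Y V).
           H W (res Y V W f) = res X (preim X h V) (preim X h W) (H V f))) \<and>
     (\<forall>x\<in>topspace (base X). \<forall>I J. max_hom_ideal (stalk X x) I \<and> max_hom_ideal (stalk Y (h x)) J \<longrightarrow>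
        {A \<in> carrier (stalk Y (h x)). stalk_map X h H x A \<in> I} = J)"

definition graded_iso ::
  "('x, real, 'a) gpresheaf \<Rightarrow> ('y, real, 'b) gpresheaf \<Rightarrow> ('x \<Rightarrow> 'y) \<Rightarrow> ('y set \<Rightarrow> 'b \<Rightarrow> 'a) \<Rightarrow> bool" where
  "graded_iso X Y h H \<longleftrightarrow> graded_morphism X Y h H \<and>
     (\<exists>k K. graded_morphism Y X k K \<and>
        (\<forall>x\<in>topspace (base X). k (h x) = x) \<and>
        (\<forall>y\<in>topspace (base Y). h (k y) = y) \<and>
        (\<forall>U. openin (base X) U \<longrightarrow> (\<forall>f\<in>carrier (sec X U). H (preim Y k U) (K U f) = f)) \<and>
        (\<forall>V. openin (base Y) V \<longrightarrow> (\<forall>g\<in>carrier (sec Y V). K (preim X h V) (H V g) = g)))"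


section \<open>The local model\<close>

text \<open>Smooth functions on an open subset \<open>U\<close> of \<open>Euclidean_space n\<close>, the model of \<open>\<real>\<^sup>n\<close> inside
  \<open>nat \<Rightarrow> real\<close>: all iterated partial derivatives exist and are continuous.\<close>

definition partial_deriv :: "nat \<Rightarrow> ((nat \<Rightarrow> real) \<Rightarrow> real) \<Rightarrow> (nat \<Rightarrow> real) \<Rightarrow> real" where
  "partial_deriv i f x = deriv (\<lambda>s. f (x(i := s))) (x i)"

primrec ck_on :: "nat \<Rightarrow> nat \<Rightarrow> (nat \<Rightarrow> real) set \<Rightarrow> ((nat \<Rightarrow> real) \<Rightarrow> real) \<Rightarrow> bool" where
  "ck_on n 0 U f \<longleftrightarrow> continuous_map (subtopology (Euclidean_space n) U) euclideanreal f"
| "ck_on n (Suc k) U f \<longleftrightarrow>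
     continuous_map (subtopology (Euclidean_space n) U) euclideanreal f \<and>
     (\<forall>i<n. (\<forall>x\<in>U. (\<lambda>s. f (x(i := s))) differentiable at (x i)) \<and> ck_on n k U (partial_deriv i f))"

definition smooth_fun_on :: "nat \<Rightarrow> (nat \<Rightarrow> real) set \<Rightarrow> ((nat \<Rightarrow> real) \<Rightarrow> real) \<Rightarrow> bool" where
  "smooth_fun_on n U f \<longleftrightarrow> (\<forall>k. ck_on n k U f)"

text \<open>
  The generator \<open>(j, i)\<close> is the \<open>i\<close>-th basis vector of the degree-\<open>j\<close> part of \<open>W\<close>. A monomial is the
  multiset of its generators; it is understood as the product in increasing (lexicographic)
  order, and it vanishes if an odd generator is repeated.
\<close>

type_synonym gen = "int \<times> nat"

definition gens :: "(int \<Rightarrow> nat) \<Rightarrow> gen set" where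
  "gens p = {(j, i). j \<noteq> 0 \<and> i < p j}"

definition gen_less :: "gen \<Rightarrow> gen \<Rightarrow> bool" where
  "gen_less a b \<longleftrightarrow> fst a < fst b \<or> (fst a = fst b \<and> snd a < snd b)"

definition monomials :: "(int \<Rightarrow> nat) \<Rightarrow> gen multiset set" where
  "monomials p = {m. set_mset m \<subseteq> gens p \<and> (\<forall>a\<in>#m. odd (fst a) \<longrightarrow> count m a = 1)}"

definition mono_degree :: "gen multiset \<Rightarrow> int" where
  "mono_degree m = (\<Sum>a\<in>#m. fst a)"

text \<open>Reordering the concatenation of the ordered words of \<open>m\<close> and \<open>m'\<close> costs one sign for each
  pair of odd generators that has to be exchanged.\<close>

definition mono_sign :: "gen multiset \<Rightarrow> gen multiset \<Rightarrow> real" where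
  "mono_sign m m' =
     (- 1) ^ card {(a, b). a \<in># m \<and> b \<in># m' \<and> odd (fst a) \<and> odd (fst b) \<and> gen_less b a}"

text \<open>Formal series with smooth coefficients on \<open>U\<close>; coefficients are set to \<open>0\<close> outside \<open>U\<close>.\<close>

type_synonym series = "gen multiset \<Rightarrow> (nat \<Rightarrow> real) \<Rightarrow> real"

definition series_on :: "(int \<Rightarrow> nat) \<Rightarrow> (nat \<Rightarrow> real) set \<Rightarrow> series set" where
  "series_on p U =
     {s. (\<forall>m. smooth_fun_on (p 0) U (s m)) \<and> (\<forall>m x. m \<notin> monomials p \<or> x \<notin> U \<longrightarrow> s m x = 0)}"

definition series_mult :: "(int \<Rightarrow> nat) \<Rightarrow> series \<Rightarrow> series \<Rightarrow> series" where
  "series_mult p s t = (\<lambda>m x. if m \<in> monomials p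
     then \<Sum>m'\<in>{m'. m' \<subseteq># m}. mono_sign m' (m - m') * s m' x * t (m - m') x else 0)"

definition fun_series :: "(nat \<Rightarrow> real) set \<Rightarrow> ((nat \<Rightarrow> real) \<Rightarrow> real) \<Rightarrow> series" where
  "fun_series U f = (\<lambda>m x. if m = {#} \<and> x \<in> U then f x else 0)"

definition linear_series :: "(nat \<Rightarrow> real) set \<Rightarrow> (gen \<Rightarrow> real) \<Rightarrow> series" where
  "linear_series U v = (\<lambda>m x. if size m = 1 \<and> x \<in> U then v (the_elem (set_mset m)) else 0)"

definition graded_domain :: "(int \<Rightarrow> nat) \<Rightarrow> (nat \<Rightarrow> real, real, series) gpresheaf" where
  "graded_domain p =
     \<lparr>base = Euclidean_space (p 0),
      sec = (\<lambda>U. \<lparr>carrier = series_on p U,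
                  mult = series_mult p,
                  one = fun_series U (\<lambda>x. 1),
                  ring.zero = (\<lambda>m x. 0),
                  ring.add = (\<lambda>s t m x. s m x + t m x),
                  smult = (\<lambda>r s m x. r * s m x),
                  hpart = (\<lambda>k. {s \<in> series_on p U. \<forall>m. mono_degree m \<noteq> k \<longrightarrow> s m = (\<lambda>x. 0)})\<rparr>),
      res = (\<lambda>U V s m x. if x \<in> V then s m x else 0)\<rparr>"

definition graded_vs :: "(int \<Rightarrow> nat) \<Rightarrow> (real, gen \<Rightarrow> real) graded" where
  "graded_vs p =
     \<lparr>carrier = {v. finite {a. v a \<noteq> 0} \<and> {a. v a \<noteq> 0} \<subseteq> gens p},
      mult = undefined, one = undefined, ring.zero = (\<lambda>a. 0),
      ring.add = (\<lambda>v w a. v a + w a),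
      smult = (\<lambda>r v a. r * v a),
      hpart = (\<lambda>j. {v. {a. v a \<noteq> 0} \<subseteq> {a \<in> gens p. fst a = j}})\<rparr>"

text \<open>\<open>(W\<^sup>*)\<^sub>k = (W\<^sub>-\<^sub>k)\<^sup>*\<close>, and \<open>W\<^sup>*\<close> is the direct sum of these spaces; functionals are set to \<open>0\<close>
  outside \<open>W\<close>.\<close>

definition graded_dual :: "(real, 'w) graded \<Rightarrow> (real, 'w \<Rightarrow> real) graded" where
  "graded_dual W =
     (let L = {\<xi>. (\<forall>v. v \<notin> carrier W \<longrightarrow> \<xi> v = 0) \<and>
                  (\<forall>v\<in>carrier W. \<forall>w\<in>carrier W. \<xi> (v \<oplus>\<^bsub>W\<^esub> w) = \<xi> v + \<xi> w) \<and>
                  (\<forall>r. \<forall>v\<in>carrier W. \<xi> (r \<odot>\<^bsub>W\<^esub> v) = r * \<xi> v) \<and>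
                  finite {j. \<exists>v\<in>hpart W j. \<xi> v \<noteq> 0}} in
      \<lparr>carrier = L, mult = undefined, one = undefined, ring.zero = (\<lambda>v. 0),
       ring.add = (\<lambda>\<xi> \<eta> v. \<xi> v + \<eta> v),
       smult = (\<lambda>r \<xi> v. r * \<xi> v),
       hpart = (\<lambda>k. {\<xi> \<in> L. \<forall>j. j \<noteq> - k \<longrightarrow> (\<forall>v\<in>hpart W j. \<xi> v = 0)})\<rparr>)"

definition constant_presheaf :: "'x topology \<Rightarrow> ('r, 'a) graded \<Rightarrow> ('x, 'r, 'a) gpresheaf" where
  "constant_presheaf X A = \<lparr>base = X, sec = (\<lambda>U. A), res = (\<lambda>U V a. a)\<rparr>"


section \<open>Graded manifolds\<close>

definition trivialisation ::
  "(int \<Rightarrow> nat) \<Rightarrow> ('x, real, 'a) gpresheaf \<Rightarrow> 'x set \<Rightarrow> (nat \<Rightarrow> real) set \<Rightarrow>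
   ('x \<Rightarrow> nat \<Rightarrow> real) \<Rightarrow> ((nat \<Rightarrow> real) set \<Rightarrow> series \<Rightarrow> 'a) \<Rightarrow> bool" where
  "trivialisation p M V V' h H \<longleftrightarrow>
     openin (base M) V \<and> openin (Euclidean_space (p 0)) V' \<and>
     graded_iso (restrict_sheaf M V) (restrict_sheaf (graded_domain p) V') h H"

definition graded_manifold :: "(int \<Rightarrow> nat) \<Rightarrow> ('x, real, 'a) gpresheaf \<Rightarrow> bool" where
  "graded_manifold p M \<longleftrightarrow>
     Hausdorff_space (base M) \<and> second_countable (base M) \<and>
     graded_locally_ringed_space M \<and>
     (\<forall>x\<in>topspace (base M). \<exists>V V' h H. x \<in> V \<and> trivialisation p M V V' h H)"

text \<open>
  The sheaf of smooth functions of the degree-\<open>0\<close> coordinates on a trivialising open set \<open>V\<close>,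
  concentrated in degree \<open>0\<close>, and its embedding into the structure sheaf.
\<close>

definition smooth_sheaf ::
  "nat \<Rightarrow> ('x, real, 'a) gpresheaf \<Rightarrow> 'x set \<Rightarrow> ('x \<Rightarrow> nat \<Rightarrow> real) \<Rightarrow> ('x, real, 'x \<Rightarrow> real) gpresheaf" where
  "smooth_sheaf n M V h =
     (let C = (\<lambda>U. {f. smooth_fun_on n (h ` U) (\<lambda>y. f (inv_into V h y)) \<and> (\<forall>x. x \<notin> U \<longrightarrow> f x = 0)}) in
      \<lparr>base = subtopology (base M) V,
       sec = (\<lambda>U. \<lparr>carrier = C U,
                   mult = (\<lambda>f g x. f x * g x), one = indicator U, ring.zero = (\<lambda>x. 0),
                   ring.add = (\<lambda>f g x. f x + g x),
                   smult = (\<lambda>r f x. r * f x),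
                   hpart = (\<lambda>k. if k = 0 then C U else {\<lambda>x. 0})\<rparr>),
       res = (\<lambda>U U' f x. if x \<in> U' then f x else 0)\<rparr>)"

definition smooth_embed ::
  "'x set \<Rightarrow> ('x \<Rightarrow> nat \<Rightarrow> real) \<Rightarrow> ((nat \<Rightarrow> real) set \<Rightarrow> series \<Rightarrow> 'a) \<Rightarrow> 'x set \<Rightarrow> ('x \<Rightarrow> real) \<Rightarrow> 'a" where
  "smooth_embed V h H U f = H (h ` U) (fun_series (h ` U) (\<lambda>y. f (inv_into V h y)))"


subsection \<open>Vector fields\<close>

text \<open>A derivation over \<open>V\<close> is a family \<open>X\<close> with \<open>X U\<close> acting on the sections over \<open>U\<close>, for all open
  \<open>U \<subseteq> V\<close>; it is \<open>undefined\<close> at all other arguments.\<close>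

definition sheaf_endo :: "('x, real, 'a) gpresheaf \<Rightarrow> 'x set \<Rightarrow> ('x set \<Rightarrow> 'a \<Rightarrow> 'a) set" where
  "sheaf_endo M V =
     {X. (\<forall>U f. \<not> (openin (base M) U \<and> U \<subseteq> V \<and> f \<in> carrier (sec M U)) \<longrightarrow> X U f = undefined) \<and>
         (\<forall>U. openin (base M) U \<and> U \<subseteq> V \<longrightarrow>
            (\<forall>f\<in>carrier (sec M U). X U f \<in> carrier (sec M U)) \<and>
            (\<forall>f\<in>carrier (sec M U). \<forall>g\<in>carrier (sec M U).
               X U (f \<oplus>\<^bsub>sec M U\<^esub> g) = X U f \<oplus>\<^bsub>sec M U\<^esub> X U g) \<and>
            (\<forall>r. \<forall>f\<in>carrier (sec M U). X U (r \<odot>\<^bsub>sec M U\<^esub> f) = r \<odot>\<^bsub>sec M U\<^esub> X U f) \<and>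
            (\<forall>W. openin (base M) W \<and> W \<subseteq> U \<longrightarrow>
               (\<forall>f\<in>carrier (sec M U). X W (res M U W f) = res M U W (X U f))))}"

definition derivations :: "('x, real, 'a) gpresheaf \<Rightarrow> 'x set \<Rightarrow> int \<Rightarrow> ('x set \<Rightarrow> 'a \<Rightarrow> 'a) set" where
  "derivations M V k =
     {X \<in> sheaf_endo M V. \<forall>U. openin (base M) U \<and> U \<subseteq> V \<longrightarrow> derivation (sec M U) k (X U)}"

text \<open>
  \<open>f = \<Sum>\<^sub>k F k\<close> over \<open>U\<close> in the sense of formal power series: in each stalk the sum converges for
  the adic topology of the ideal generated by the elements of non-zero degree.
\<close>

definition formal_sum :: "('x, real, 'a) gpresheaf \<Rightarrow> 'x set \<Rightarrow> (int \<Rightarrow> 'a) \<Rightarrow> 'a \<Rightarrow> bool" where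
  "formal_sum M U F f \<longleftrightarrow>
     (\<forall>x\<in>U. \<forall>n. \<exists>K\<^sub>0. finite K\<^sub>0 \<and> (\<forall>K. finite K \<and> K\<^sub>0 \<subseteq> K \<longrightarrow>
        germ M x U (f \<ominus>\<^bsub>sec M U\<^esub> finsum (sec M U) F K)
          \<in> ideal_power (stalk M x) (nonzero_degree_ideal (stalk M x)) n))"

definition vector_fields :: "('x, real, 'a) gpresheaf \<Rightarrow> 'x set \<Rightarrow> ('x set \<Rightarrow> 'a \<Rightarrow> 'a) set" where
  "vector_fields M V =
     {X \<in> sheaf_endo M V. \<exists>D. (\<forall>k. D k \<in> derivations M V k) \<and>
        (\<forall>U. openin (base M) U \<and> U \<subseteq> V \<longrightarrow>
           (\<forall>f\<in>carrier (sec M U). formal_sum M U (\<lambda>k. D k U f) (X U f)))}"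

definition tangent_sheaf ::
  "('x, real, 'a) gpresheaf \<Rightarrow> ('x, 'a, 'x set \<Rightarrow> 'a \<Rightarrow> 'a) gpresheaf" where
  "tangent_sheaf M =
     (let ext = (\<lambda>V X U f. if openin (base M) U \<and> U \<subseteq> V \<and> f \<in> carrier (sec M U) then X U f else undefined) in
      \<lparr>base = base M,
       sec = (\<lambda>V. \<lparr>carrier = vector_fields M V, mult = undefined, one = undefined,
                   ring.zero = ext V (\<lambda>U f. \<zero>\<^bsub>sec M U\<^esub>),
                   ring.add = (\<lambda>X Y. ext V (\<lambda>U f. X U f \<oplus>\<^bsub>sec M U\<^esub> Y U f)),
                   smult = (\<lambda>g X. ext V (\<lambda>U f. res M V U g \<otimes>\<^bsub>sec M U\<^esub> X U f)),
                   hpart = derivations M V\<rparr>),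
       res = (\<lambda>V V' X. ext V' X)\<rparr>)"

text \<open>The ordinary vector fields on the underlying smooth manifold, i.e. the derivations of its sheaf
  of smooth functions.\<close>

definition ordinary_tangent_sheaf ::
  "('x, real, 'a) gpresheaf \<Rightarrow> ('x, 'a, 'x set \<Rightarrow> 'a \<Rightarrow> 'a) gpresheaf" where
  "ordinary_tangent_sheaf S =
     (tangent_sheaf S)\<lparr>sec := (\<lambda>V. (sec (tangent_sheaf S) V)\<lparr>carrier := derivations S V 0\<rparr>)\<rparr>"

text \<open>\<open>(O\<^sub>M|\<^sub>V \<otimes> Vec\<^sub>V) \<oplus> (O\<^sub>M|\<^sub>V \<otimes> W\<^sup>*)\<close>, the tensor products being over the smooth functions
  and over \<open>\<real>\<close>, respectively.\<close>

definition split_tangent_sheaf where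
  "split_tangent_sheaf p M V h H =
     direct_sum_sheaf
       (tensor_sheaf (restrict_sheaf M V)
          (ordinary_tangent_sheaf (smooth_sheaf (p 0) M V h))
          (\<lambda>U. carrier (sec (smooth_sheaf (p 0) M V h) U))
          (\<lambda>U a f. a \<otimes>\<^bsub>sec M U\<^esub> smooth_embed V h H U f))
       (tensor_sheaf (restrict_sheaf M V)
          (constant_presheaf (subtopology (base M) V) (graded_dual (graded_vs p)))
          (\<lambda>U. UNIV)
          (\<lambda>U a r. r \<odot>\<^bsub>sec M U\<^esub> a))"


subsection \<open>Coordinates\<close>

text \<open>Global coordinates on \<open>\<real>\<^sup>n\<close>: the components of a diffeomorphism onto an open subset.\<close>

definition global_coordinates :: "nat \<Rightarrow> (nat \<Rightarrow> (nat \<Rightarrow> real) \<Rightarrow> real) \<Rightarrow> bool" where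
  "global_coordinates n t \<longleftrightarrow>
     (let E = topspace (Euclidean_space n); T = (\<lambda>x i. if i < n then t i x else 0) in
      (\<forall>i<n. smooth_fun_on n E (t i)) \<and>
      inj_on T E \<and> openin (Euclidean_space n) (T ` E) \<and>
      (\<forall>i<n. smooth_fun_on n (T ` E) (\<lambda>y. inv_into E T y i)))"

definition graded_basis :: "(int \<Rightarrow> nat) \<Rightarrow> (gen \<Rightarrow> gen \<Rightarrow> real) \<Rightarrow> bool" where
  "graded_basis p w \<longleftrightarrow>
     (\<forall>(j, i)\<in>gens p. w (j, i) \<in> hpart (graded_vs p) j) \<and>
     (\<forall>j. j \<noteq> 0 \<longrightarrow> (\<forall>v\<in>hpart (graded_vs p) j.
        \<exists>!c. (\<forall>i\<ge>p j. c i = 0) \<and> v = (\<lambda>a. \<Sum>i<p j. c i * w (j, i) a)))"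

text \<open>\<open>\<tau> i\<close>, \<open>\<omega> a\<close> are the local coordinates over \<open>V\<close> as sections, \<open>Dt i\<close> and \<open>Dw a\<close> stand for
  \<open>\<partial>/\<partial>t\<^sub>i\<close> and \<open>\<partial>/\<partial>w\<^sub>a\<close>.\<close>

definition coordinate_derivations ::
  "(int \<Rightarrow> nat) \<Rightarrow> ('x, real, 'a) gpresheaf \<Rightarrow> 'x set \<Rightarrow> (nat \<Rightarrow> 'a) \<Rightarrow> (gen \<Rightarrow> 'a) \<Rightarrow>
   (nat \<Rightarrow> 'x set \<Rightarrow> 'a \<Rightarrow> 'a) \<Rightarrow> (gen \<Rightarrow> 'x set \<Rightarrow> 'a \<Rightarrow> 'a) \<Rightarrow> bool" where
  "coordinate_derivations p M V \<tau> \<omega> Dt Dw \<longleftrightarrow>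
     (\<forall>i<p 0. Dt i \<in> derivations M V 0 \<and>
        (\<forall>j<p 0. Dt i V (\<tau> j) = (if i = j then \<one>\<^bsub>sec M V\<^esub> else \<zero>\<^bsub>sec M V\<^esub>)) \<and>
        (\<forall>b\<in>gens p. Dt i V (\<omega> b) = \<zero>\<^bsub>sec M V\<^esub>)) \<and>
     (\<forall>a\<in>gens p. Dw a \<in> derivations M V (- fst a) \<and>
        (\<forall>b\<in>gens p. Dw a V (\<omega> b) = (if a = b then \<one>\<^bsub>sec M V\<^esub> else \<zero>\<^bsub>sec M V\<^esub>)) \<and>
        (\<forall>j<p 0. Dw a V (\<tau> j) = \<zero>\<^bsub>sec M V\<^esub>))"

end

theory Submission
  imports Defs "HOL-Algebra.RingHom"
begin

text \<open>
  A trivialisation identifies sections with formal series, so that the partial derivatives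
  \<open>\<partial>\<^sub>\<iota>\<close> along the degree-zero coordinates and along the generators are derivations. By Hadamard's
  lemma a smooth function is, modulo products of two functions that vanish at a point, a linear
  combination of the coordinates, and a series without constant term is a linear combination of
  the generators; induction on the order of monomials then shows that a homogeneous derivation is
  determined by its values on the coordinates. Hence every vector field is
  \<open>\<Sum>\<^sub>\<iota> X(x\<^sub>\<iota>) \<partial>\<^sub>\<iota>\<close>, and the tangent sheaf is free over a trivialising open set. Both tensor products
  have explicit bases, so they are free of the same degrees and already sheaves. For general
  coordinates, the Jacobian matrix is inverted by the chain rule on the degree-zero coordinates
  and by the base change of \<open>W\<close> on the others.
\<close>

text \<open>A vector field is only a formal sum of homogeneous derivations, convergent in the adic
  topology of each stalk. In a chart the n-th power of the ideal generated by the elements of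
  nonzero degree consists exactly of the germs of series without monomials of size below n, so
  convergence means that each coefficient is eventually constant. This, and the fact that arbitrary
  sections may serve as coefficients of a vector field, rests on the finiteness of the set of
  generators, which bounds the degrees of the monomials of a given size. A derivation may lower the
  order of a series, since the derivative of a generator can have a constant term. The induction
  therefore runs over the size of the monomial whose coefficient is read off, for all sections at
  once. Hadamard's lemma is applied at the very point y where that coefficient is evaluated: the
  factors x_i - y_i vanish there, so the derivatives of the unknown cofactors drop out. It also
  yields the chain rule, as smoothness is defined by iterated partial derivatives only.\<close>

abbreviation (input) "opn S \<equiv> openin (base S)"
abbreviation (input) "eopn n \<equiv> openin (Euclidean_space n)"
abbreviation (input) "sects S U \<equiv> carrier (sec S U)"

section \<open>Smooth functions on open subsets of Euclidean space\<close>

abbreviation eucl :: "nat => (nat => real) set" where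
 "eucl n \<equiv> topspace (Euclidean_space n)"

lemma eucl_iff: "x : eucl n \<longleftrightarrow> (\<forall>i\<ge>n. x i = 0)"
 by (simp add: topspace_Euclidean_space)

lemma Euclidean_space_eq: "Euclidean_space n = top_of_set (eucl n)"
 unfolding Euclidean_space_def by (simp add: euclidean_product_topology)

lemma openin_eucl_iff: "eopn n U \<longleftrightarrow> (\<exists>T. open T & U = eucl n \<inter> T)"
 by (subst Euclidean_space_eq) (auto simp: openin_open)

lemma open_subset_eucl: "eopn n U ==> U \<subseteq> eucl n"
 by (rule openin_subset)

lemma continuous_map_eucl:
 assumes "eopn n U"
 shows "continuous_map (subtopology (Euclidean_space n) U) euclideanreal f \<longleftrightarrow> continuous_on U f"
proof -
 have "subtopology (Euclidean_space n) U = top_of_set U"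
  using open_subset_eucl[OF assms] by (subst Euclidean_space_eq) (simp add: subtopology_subtopology Int_absorb1)
 then show ?thesis by simp
qed

lemma continuous_on_upd:
 fixes f :: "'a::topological_space => nat => real"
 assumes "continuous_on S f" "continuous_on S g"
 shows "continuous_on S (%x. (f x)(i := g x))"
proof (rule continuous_on_coordinatewise_then_product)
 fix j
 show "continuous_on S (%x. ((f x)(i := g x)) j)"
  using assms continuous_on_product_then_coordinatewise[OF assms(1), of j]
  by (cases "j = i") auto
qed

lemma upd_in_eucl: "x : eucl n ==> i < n ==> x(i := s) : eucl n"
 by (auto simp: eucl_iff)

text \<open>A partial derivative at a point of an open set only sees values in that set; every
  localisation of \<open>ck_on\<close> below rests on this.\<close>

lemma eventually_upd_in_open:
 assumes "eopn n U" "x : U" "i < n"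
 shows "\<forall>\<^sub>F s in nhds (x i). x(i := s) : U"
proof -
 obtain T where T: "open T" "U = eucl n \<inter> T" using assms(1) by (auto simp: openin_eucl_iff)
 have "continuous_on UNIV (%s. x(i := s))"
  by (intro continuous_on_upd continuous_on_const continuous_on_id)
 then have "open ((%s. x(i := s)) -` T)" using T(1) by (simp add: open_vimage)
 moreover have "x i : (%s. x(i := s)) -` T" using assms(2) T by simp
 ultimately have "\<forall>\<^sub>F s in nhds (x i). s : (%s. x(i := s)) -` T" by (rule eventually_nhds_in_open)
 then show ?thesis
  by (rule eventually_mono) (use T assms upd_in_eucl in auto)
qed

lemma has_partial_deriv:
 assumes "ck_on n (Suc k) U f" "x : U" "i < n"
 shows "((%s. f (x(i := s))) has_real_derivative partial_deriv i f x) (at (x i))"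
 using assms unfolding partial_deriv_def by (simp add: DERIV_deriv_iff_real_differentiable)

lemma has_partial_deriv_upd:
 assumes "ck_on n (Suc k) U f" "x(i := s) : U" "i < n"
 shows "((%s. f (x(i := s))) has_real_derivative partial_deriv i f (x(i := s))) (at s)"
 using has_partial_deriv[OF assms] by simp

lemma partial_deriv_eqI:
 "((%s. f (x(i := s))) has_real_derivative D) (at (x i)) ==> partial_deriv i f x = D"
 unfolding partial_deriv_def by (rule DERIV_imp_deriv)

lemma eventually_eq_upd:
 assumes "eopn n U" "!!x. x : U ==> f x = g x" "x : U" "i < n"
 shows "\<forall>\<^sub>F s in nhds (x i). f (x(i := s)) = g (x(i := s))"
 using eventually_upd_in_open[OF assms(1,3,4)] by (rule eventually_mono) (use assms(2) in auto)

lemma partial_deriv_cong: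
 assumes "eopn n U" "!!x. x : U ==> f x = g x" "x : U" "i < n"
 shows "partial_deriv i f x = partial_deriv i g x"
 unfolding partial_deriv_def
 by (rule deriv_cong_ev[OF eventually_eq_upd[OF assms] refl])

text \<open>The induction varies both functions because agreement on the open set passes to their
  partial derivatives, although the functions may differ elsewhere.\<close>

lemma ck_on_cong_imp:
 assumes "eopn n U"
 shows "(!!x. x : U ==> f x = g x) ==> ck_on n k U f ==> ck_on n k U g"
proof (induction k arbitrary: f g)
 case 0
 then show ?case using assms by (simp add: continuous_map_eucl cong: continuous_on_cong)
next
 case (Suc k)
 have "(%s. g (x(i := s))) differentiable at (x i)" if "x : U" "i < n" for x i
 proof -
  have "((%s. f (x(i := s))) has_real_derivative partial_deriv i f x) (at (x i))"
   by (rule has_partial_deriv[OF Suc.prems(2) that])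
  then have "((%s. g (x(i := s))) has_real_derivative partial_deriv i f x) (at (x i))"
   using eventually_eq_upd[OF assms Suc.prems(1) that] by (subst (asm) DERIV_cong_ev) auto
  then show ?thesis using real_differentiable_def by blast
 qed
 moreover have "ck_on n k U (partial_deriv i g)" if "i < n" for i
  using Suc.IH[of "partial_deriv i f" "partial_deriv i g"] Suc.prems that
   partial_deriv_cong[OF assms Suc.prems(1) _ that] by simp
 moreover have "continuous_on U g"
  using Suc.prems assms by (simp add: continuous_map_eucl cong: continuous_on_cong)
 ultimately show ?case using assms by (simp add: continuous_map_eucl)
qed

lemma smooth_cong_imp:
 assumes "eopn n U" "!!x. x : U ==> f x = g x" "smooth_fun_on n U f"
 shows "smooth_fun_on n U g"
 using assms ck_on_cong_imp[OF assms(1,2)] by (auto simp: smooth_fun_on_def)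

text \<open>Lets derivatives be given by formulas: \<open>partial_deriv\<close> is a
  \<open>deriv\<close> and agrees with them on \<open>U\<close> only, and agreement on an open set
  is enough.\<close>

lemma ck_onI:
 assumes "eopn n U" "continuous_on U f"
  and "!!i x. i < n ==> x : U ==> ((%s. f (x(i := s))) has_real_derivative g i x) (at (x i))"
  and "!!i. i < n ==> ck_on n k U (g i)"
 shows "ck_on n (Suc k) U f"
proof -
 have "ck_on n k U (partial_deriv i f)" if i: "i < n" for i
 proof (rule ck_on_cong_imp[OF assms(1) _ assms(4)[OF i]])
  fix x assume "x : U"
  from partial_deriv_eqI[OF assms(3)[OF i this]] show "g i x = partial_deriv i f x" by simp
 qed
 then show ?thesis
  using assms by (auto simp: continuous_map_eucl real_differentiable_def)
qed

lemma ck_on_continuous: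
 assumes "eopn n U" "ck_on n k U f"
 shows "continuous_on U f"
 using assms by (cases k) (auto simp: continuous_map_eucl)

lemma ck_on_Suc_imp: "ck_on n (Suc k) U f ==> ck_on n k U f"
 by (induction k arbitrary: f) auto

lemma ck_on_subset:
 assumes "eopn n U" "eopn n W" "W \<subseteq> U"
 shows "ck_on n k U f ==> ck_on n k W f"
 by (induction k arbitrary: f)
  (use assms continuous_on_subset in \<open>auto simp: continuous_map_eucl\<close>)

lemma smooth_subset:
 assumes "eopn n U" "eopn n W" "W \<subseteq> U" "smooth_fun_on n U f"
 shows "smooth_fun_on n W f"
 using assms ck_on_subset by (auto simp: smooth_fun_on_def)

lemma ck_on_const:
 assumes "eopn n U"
 shows "ck_on n k U (%x. c)"
proof (induction k arbitrary: c)
 case (Suc k)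
 show ?case
  by (rule ck_onI[OF assms, of _ "%_ _. 0"]) (use Suc in \<open>auto intro!: continuous_intros\<close>)
qed (use assms in \<open>auto simp: continuous_map_eucl\<close>)

lemma ck_on_coord:
 assumes "eopn n U"
 shows "ck_on n k U (%x. x j)"
proof (cases k)
 case 0
 then show ?thesis using assms
  by (simp add: continuous_map_eucl continuous_on_subset[OF continuous_on_product_coordinates])
next
 case (Suc k)
 show ?thesis unfolding Suc
 proof (rule ck_onI[OF assms, of _ "%i x. if i = j then 1 else 0"])
  fix i x
  show "((%s. (x(i := s)) j) has_real_derivative (if i = j then 1 else 0)) (at (x i))"
   by (cases "i = j") (auto intro!: derivative_eq_intros)
 qed (auto simp: continuous_on_subset[OF continuous_on_product_coordinates] ck_on_const[OF assms])
qed

lemma ck_on_add: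
 assumes "eopn n U"
 shows "ck_on n k U f ==> ck_on n k U g ==> ck_on n k U (%x. f x + g x)"
proof (induction k arbitrary: f g)
 case 0
 then show ?case using assms by (simp add: continuous_map_eucl continuous_on_add)
next
 case (Suc k)
 show ?case
 proof (rule ck_onI[OF assms, of _ "%i x. partial_deriv i f x + partial_deriv i g x"])
  show "continuous_on U (%x. f x + g x)"
   using Suc.prems by (intro continuous_on_add ck_on_continuous[OF assms])
  fix i assume i: "i < n"
  show "ck_on n k U (%x. partial_deriv i f x + partial_deriv i g x)"
   using Suc.prems i by (intro Suc.IH) auto
  fix x assume "x : U"
  then show "((%s. f (x(i := s)) + g (x(i := s))) has_real_derivative
    partial_deriv i f x + partial_deriv i g x) (at (x i))"
   using i by (intro DERIV_add has_partial_deriv[OF Suc.prems(1)] has_partial_deriv[OF Suc.prems(2)])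
 qed
qed

lemma ck_on_mult:
 assumes "eopn n U"
 shows "ck_on n k U f ==> ck_on n k U g ==> ck_on n k U (%x. f x * g x)"
proof (induction k arbitrary: f g)
 case 0
 then show ?case using assms by (simp add: continuous_map_eucl continuous_on_mult)
next
 case (Suc k)
 have *: "((%s. f (x(i := s)) * g (x(i := s))) has_real_derivative
   partial_deriv i f x * g x + partial_deriv i g x * f x) (at (x i))" if "i < n" "x : U" for i x
  using DERIV_mult[OF has_partial_deriv[OF Suc.prems(1) that(2,1)]
    has_partial_deriv[OF Suc.prems(2) that(2,1)]] by (simp only: fun_upd_triv)
 have "ck_on n k U (%x. partial_deriv i f x * g x + partial_deriv i g x * f x)" if "i < n" for i
  using Suc.prems that
  by (intro ck_on_add[OF assms] Suc.IH ck_on_Suc_imp[OF Suc.prems(1)] ck_on_Suc_imp[OF Suc.prems(2)]) auto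
 moreover have "continuous_on U (%x. f x * g x)"
  using Suc.prems by (intro continuous_on_mult ck_on_continuous[OF assms])
 ultimately show ?case
  by (intro ck_onI[OF assms, of _ "%i x. partial_deriv i f x * g x + partial_deriv i g x * f x"] *)
qed

lemma smooth_const: "eopn n U ==> smooth_fun_on n U (%x. c)"
 by (simp add: smooth_fun_on_def ck_on_const)

lemma smooth_coord: "eopn n U ==> smooth_fun_on n U (%x. x j)"
 by (simp add: smooth_fun_on_def ck_on_coord)

lemma smooth_add:
 "eopn n U ==> smooth_fun_on n U f ==> smooth_fun_on n U g ==>
  smooth_fun_on n U (%x. f x + g x)"
 by (simp add: smooth_fun_on_def ck_on_add)

lemma smooth_mult:
 "eopn n U ==> smooth_fun_on n U f ==> smooth_fun_on n U g ==>
  smooth_fun_on n U (%x. f x * g x)"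
 by (simp add: smooth_fun_on_def ck_on_mult)

lemma smooth_partial_deriv:
 assumes "smooth_fun_on n U f" "i < n"
 shows "smooth_fun_on n U (partial_deriv i f)"
 unfolding smooth_fun_on_def
proof
 fix k show "ck_on n k U (partial_deriv i f)"
  using assms unfolding smooth_fun_on_def by (metis ck_on.simps(2))
qed

lemma smooth_has_partial_deriv:
 assumes "smooth_fun_on n U f" "x : U" "i < n"
 shows "((%s. f (x(i := s))) has_real_derivative partial_deriv i f x) (at (x i))"
 using assms has_partial_deriv[of n 0] unfolding smooth_fun_on_def by blast

lemma smooth_continuous:
 "eopn n U ==> smooth_fun_on n U f ==> continuous_on U f"
 using ck_on_continuous unfolding smooth_fun_on_def by blast

subsection \<open>Hadamard's lemma\<close>

text \<open>Boxes rather than balls: a coordinate may be replaced by any value between it and the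
  centre without leaving the set.\<close>

definition box_at :: "nat => (nat => real) => real => (nat => real) set" where
 "box_at n y e = {x : eucl n. \<forall>i<n. \<bar>x i - y i\<bar> < e}"

lemma openin_box_at: "eopn n (box_at n y e)"
proof -
 have "open (\<Inter>i\<in>{..<n}. {x::nat => real. \<bar>x i - y i\<bar> < e})"
  by (intro open_INT ballI open_Collect_less continuous_intros) auto
 then show ?thesis
  unfolding openin_eucl_iff box_at_def by (intro exI conjI) auto
qed

lemma box_at_center: "y : eucl n ==> e > 0 ==> y : box_at n y e"
 by (auto simp: box_at_def)

lemma open_contains_box:
 assumes "eopn n U" "y : U"
 obtains e where "e > 0" "box_at n y e \<subseteq> U"
proof -
 obtain T where T: "open T" "U = eucl n \<inter> T" using assms(1) by (auto simp: openin_eucl_iff)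
 have "openin (product_topology (%i. euclideanreal) UNIV) T"
  using T(1) by (simp add: euclidean_product_topology)
 moreover have "y : T" using assms(2) T(2) by simp
 ultimately have "\<exists>X. y : (\<Pi>\<^sub>E i\<in>UNIV. X i) & (\<forall>i. openin euclideanreal (X i)) \<and>
   finite {i. X i ~= topspace euclideanreal} & (\<Pi>\<^sub>E i\<in>UNIV. X i) \<subseteq> T"
  by (rule product_topology_open_contains_basis)
 then obtain X where X: "y : (\<Pi>\<^sub>E i\<in>UNIV. X i)" "\<forall>i. openin euclideanreal (X i)" "(\<Pi>\<^sub>E i\<in>UNIV. X i) \<subseteq> T"
  by blast
 have "\<exists>e. e > 0 & (\<forall>s. \<bar>s - y i\<bar> < e --> s : X i)" for i :: nat
 proof -
  have "open (X i)" "y i : X i" using X(1,2) by auto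
  then show ?thesis unfolding open_dist dist_real_def by blast
 qed
 then have "\<forall>i. \<exists>e. e > 0 & (\<forall>s. \<bar>s - y i\<bar> < e --> s : X i)" by blast
 from choice[OF this] obtain d where d0: "\<forall>i. d i > 0 & (\<forall>s. \<bar>s - y i\<bar> < d i --> s : X i)"
  by blast
 then have d: "!!i. d i > 0" "!!i s. \<bar>s - y i\<bar> < d i ==> s : X i" by blast+
 \<comment> \<open>The 1 keeps the minimum defined for n = 0. Coordinates from n onwards vanish on
   the whole space and impose no bound.\<close>
 define e where "e = Min (insert 1 (d ` {..<n}))"
 have e: "e > 0" "!!i. i < n ==> e \<le> d i"
  using d(1) by (auto simp: e_def)
 have "x : U" if x: "x : box_at n y e" for x
 proof -
  have "x i : X i" for i
  proof (cases "i < n")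
   case True
   then show ?thesis using x d(2)[of "x i" i] e(2)[of i] by (force simp: box_at_def)
  next
   case False
   then have "x i = y i" using x assms(2) T(2) by (auto simp: box_at_def eucl_iff)
   then show ?thesis using d by simp
  qed
  then show ?thesis using X(3) T(2) x by (auto simp: box_at_def)
 qed
 then show ?thesis using that e(1) by blast
qed

text \<open>For j = 0 this is the mean of f along the segment on which the coordinate i moves from
  its value in y to its value in x. The weight is there because differentiating along i produces a
  factor u.\<close>

definition ray_mean :: "(nat => real) => nat => nat => ((nat => real) => real) => (nat => real) => real" where
 "ray_mean y i j f x = integral (cbox 0 1) (%u. u ^ j * f (x(i := y i + u * (x i - y i))))"

lemma ray_in_box:
 assumes "x : box_at n y e" "u : cbox 0 (1::real)" "i < n"
 shows "x(i := y i + u * (x i - y i)) : box_at n y e"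
proof -
 have "\<bar>u * (x i - y i)\<bar> \<le> \<bar>x i - y i\<bar>"
  using assms(2) by (simp add: abs_mult mult_left_le_one_le)
 then have "\<bar>u * (x i - y i)\<bar> < e"
  using assms by (auto simp: box_at_def)
 then show ?thesis using assms by (auto simp: box_at_def eucl_iff)
qed

lemma continuous_on_ray:
 assumes "continuous_on (box_at n y e) f" "i < n"
 shows "continuous_on (box_at n y e \<times> cbox 0 1) (%(x, u). u ^ j * f (x(i := y i + u * (x i - y i))))"
proof -
 have c: "continuous_on (box_at n y e \<times> cbox 0 (1::real)) (%z. fst z i)"
  by (rule continuous_on_product_then_coordinatewise) (intro continuous_intros)
 have "continuous_on (box_at n y e \<times> cbox 0 (1::real))
   (%z. (fst z)(i := y i + snd z * (fst z i - y i)))"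
  by (intro continuous_on_upd continuous_intros c)
 then have "continuous_on (box_at n y e \<times> cbox 0 (1::real))
   (%z. f ((fst z)(i := y i + snd z * (fst z i - y i))))"
  by (rule continuous_on_compose2[OF assms(1)])
   (use ray_in_box[OF _ _ assms(2)] in auto)
 then have "continuous_on (box_at n y e \<times> cbox 0 (1::real))
   (%z. snd z ^ j * f ((fst z)(i := y i + snd z * (fst z i - y i))))"
  by (intro continuous_intros)
 then show ?thesis by (simp add: case_prod_beta)
qed

text \<open>Differentiation under the integral sign. The derivative along i raises the exponent of
  the weight, so the induction has to run over all j.\<close>

lemma ck_on_ray_mean:
 assumes "i < n"
 shows "ck_on n k (box_at n y e) f ==> ck_on n k (box_at n y e) (ray_mean y i j f)"
proof (induction k arbitrary: f j)
 case 0
 then have "continuous_on (box_at n y e) f" by (simp add: continuous_map_eucl openin_box_at)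
 from integral_continuous_on_param[OF continuous_on_ray[OF this assms]] show ?case
  by (simp add: continuous_map_eucl openin_box_at ray_mean_def[abs_def])
next
 case (Suc k)
 let ?B = "box_at n y e"
 \<comment> \<open>Only in direction i does the chain rule give a factor u.\<close>
 define J where "J l = (if l = i then Suc j else j)" for l
 have Jeq: "u ^ j * ((if l = i then u else 1) * c) = u ^ J l * c" for u c :: real and l
  by (simp add: J_def)
 show ?case
 proof (rule ck_onI[OF openin_box_at, where g = "%l. ray_mean y i (J l) (partial_deriv l f)"])
  have "continuous_on ?B f" using Suc.prems by (rule ck_on_continuous[OF openin_box_at])
  from integral_continuous_on_param[OF continuous_on_ray[OF this assms]]
  show "continuous_on ?B (ray_mean y i j f)" by (simp add: ray_mean_def[abs_def])
  fix l assume l: "l < n"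
  then have cl: "ck_on n k ?B (partial_deriv l f)" using Suc.prems by simp
  then show "ck_on n k ?B (ray_mean y i (J l) (partial_deriv l f))" by (rule Suc.IH)
  fix x assume x: "x : ?B"
  \<comment> \<open>The slice of the box in direction l is an open interval, hence convex, as the
    Leibniz rule for integrals demands.\<close>
  define U where "U = {s. \<bar>s - y l\<bar> < e}"
  have xU: "x(l := s) : ?B" if "s : U" for s
   using x that l by (auto simp: box_at_def U_def eucl_iff)
  have U: "open U" "convex U" "x l : U"
  proof -
   have "U = {y l - e <..< y l + e}" by (auto simp: U_def)
   then show "open U" "convex U" by auto
   show "x l : U" using x l by (auto simp: U_def box_at_def)
  qed
  have cu: "continuous_on (U \<times> cbox 0 (1::real)) (%z. (x(l := fst z), snd z))"
   by (intro continuous_on_Pair continuous_on_upd continuous_intros)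
  have "((%s. integral (cbox 0 1) (%u. u ^ j * f ((x(l := s))(i := y i + u * ((x(l := s)) i - y i)))))
   has_real_derivative
    integral (cbox 0 1) (%u. u ^ J l * partial_deriv l f ((x(l := x l))(i := y i + u * ((x(l := x l)) i - y i)))))
    (at (x l) within U)"
  proof (rule leibniz_rule_field_derivative[OF _ _ _ U(3,2)])
   fix s and u :: real assume s: "s : U" and u: "u : cbox 0 1"
   have inB: "(x(l := s))(i := y i + u * ((x(l := s)) i - y i)) : ?B"
    by (rule ray_in_box[OF xU[OF s] u assms])
   have "((%s. f ((x(l := s))(i := y i + u * ((x(l := s)) i - y i)))) has_real_derivative
     (if l = i then u else 1) * partial_deriv l f ((x(l := s))(i := y i + u * ((x(l := s)) i - y i)))) (at s)"
   proof (cases "l = i")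
    case True
    have 1: "((%v. f (x(i := v))) has_real_derivative partial_deriv i f (x(i := y i + u * (s - y i))))
      (at (y i + u * (s - y i)))"
     by (rule has_partial_deriv_upd[OF Suc.prems]) (use inB True assms in auto)
    have 2: "((%s. y i + u * (s - y i)) has_real_derivative u) (at s)"
     by (auto intro!: derivative_eq_intros)
    have "((%s. f (x(i := y i + u * (s - y i)))) has_real_derivative partial_deriv i f (x(i := y i + u * (s - y i))) * u) (at s)"
     by (rule DERIV_chain2[OF 1 2])
    then show ?thesis using True by (simp add: mult.commute)
   next
    case False
    define x' where "x' = x(i := y i + u * (x i - y i))"
    have eq: "(x(l := s))(i := y i + u * ((x(l := s)) i - y i)) = x'(l := s)" for s
     using False by (simp add: x'_def fun_upd_twist)
    have "((%s. f (x'(l := s))) has_real_derivative partial_deriv l f (x'(l := s))) (at s)"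
     by (rule has_partial_deriv_upd[OF Suc.prems _ l]) (use inB eq in simp)
    then show ?thesis unfolding eq using False by simp
   qed
   then have "((%s. u ^ j * f ((x(l := s))(i := y i + u * ((x(l := s)) i - y i)))) has_real_derivative
     u ^ j * ((if l = i then u else 1) * partial_deriv l f ((x(l := s))(i := y i + u * ((x(l := s)) i - y i))))) (at s)"
    by (rule DERIV_cmult)
   then show "((%s. u ^ j * f ((x(l := s))(i := y i + u * ((x(l := s)) i - y i)))) has_real_derivative
     u ^ J l * partial_deriv l f ((x(l := s))(i := y i + u * ((x(l := s)) i - y i)))) (at s within U)"
    unfolding Jeq by (rule has_field_derivative_at_within)
  next
   fix s assume s: "s : U"
   have "continuous_on (cbox 0 1) (%u. (%(x, u). u ^ j * f (x(i := y i + u * (x i - y i)))) (x(l := s), u))"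
    by (rule continuous_on_compose2[OF continuous_on_ray[OF \<open>continuous_on ?B f\<close> assms]])
     (use xU[OF s] in \<open>auto intro!: continuous_intros\<close>)
   then show "(%u. u ^ j * f ((x(l := s))(i := y i + u * ((x(l := s)) i - y i)))) integrable_on cbox 0 1"
    by (intro integrable_continuous) simp
  next
   have "continuous_on ?B (partial_deriv l f)" using cl by (rule ck_on_continuous[OF openin_box_at])
   have "continuous_on (U \<times> cbox 0 1) (%z. (%(x, u). u ^ J l * partial_deriv l f (x(i := y i + u * (x i - y i))))
     (x(l := fst z), snd z))"
    by (rule continuous_on_compose2[OF continuous_on_ray[OF \<open>continuous_on ?B (partial_deriv l f)\<close> assms, of "J l"] cu])
     (use xU in auto)
   then show "continuous_on (U \<times> cbox 0 1)
     (%(s, u). u ^ J l * partial_deriv l f ((x(l := s))(i := y i + u * ((x(l := s)) i - y i))))"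
    by (simp only: case_prod_unfold fst_conv snd_conv)
  qed
  then show "((%s. ray_mean y i j f (x(l := s))) has_real_derivative
    ray_mean y i (J l) (partial_deriv l f) x) (at (x l))"
   using at_within_open[OF U(3,1)] by (simp only: ray_mean_def fun_upd_triv)
 qed
qed

text \<open>The fundamental theorem of calculus along the segment that moves the coordinate i
  only.\<close>

lemma ray_mean_eq:
 assumes "smooth_fun_on n (box_at n y e) f" "x : box_at n y e" "i < n"
 shows "f x = f (x(i := y i)) + (x i - y i) * ray_mean y i 0 (partial_deriv i f) x"
proof -
 have ck: "ck_on n (Suc 0) (box_at n y e) f" using assms(1) unfolding smooth_fun_on_def by blast
 have d: "((%u. f (x(i := y i + u * (x i - y i)))) has_real_derivative
   partial_deriv i f (x(i := y i + u * (x i - y i))) * (x i - y i)) (at u)" if "u : {0..1}" for u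
 proof -
  have 1: "((%v. f (x(i := v))) has_real_derivative partial_deriv i f (x(i := y i + u * (x i - y i))))
      (at (y i + u * (x i - y i)))"
   by (rule has_partial_deriv_upd[OF ck]) (use ray_in_box[OF assms(2) _ assms(3)] that assms in auto)
  have 2: "((%u. y i + u * (x i - y i)) has_real_derivative (x i - y i)) (at u)"
   by (auto intro!: derivative_eq_intros)
  show ?thesis by (rule DERIV_chain2[OF 1 2])
 qed
 have "((%u. partial_deriv i f (x(i := y i + u * (x i - y i))) * (x i - y i)) has_integral
   f (x(i := y i + 1 * (x i - y i))) - f (x(i := y i + 0 * (x i - y i)))) {0..1}"
  by (rule fundamental_theorem_of_calculus, simp,
    unfold has_real_derivative_iff_has_vector_derivative[symmetric])
   (rule has_field_derivative_at_within[OF d])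
 then have "integral {0..1} (%u. partial_deriv i f (x(i := y i + u * (x i - y i))) * (x i - y i)) =
   f x - f (x(i := y i))"
  by (subst integral_unique) simp_all
 then show ?thesis by (simp add: ray_mean_def mult.commute)
qed

lemma smooth_ray_mean:
 "smooth_fun_on n (box_at n y e) f ==> i < n ==> smooth_fun_on n (box_at n y e) (ray_mean y i j f)"
 unfolding smooth_fun_on_def using ck_on_ray_mean by blast

text \<open>The coordinates are set to those of y one after the other, each step costing one term;
  the box contains all intermediate points.\<close>

lemma hadamard:
 assumes f: "smooth_fun_on n (box_at n y e) f" and y: "y : eucl n"
 obtains g where "!!i. i < n ==> smooth_fun_on n (box_at n y e) (g i)"
  "!!x. x : box_at n y e ==> f x = f y + (\<Sum>i<n. (x i - y i) * g i x)"
proof -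
 let ?B = "box_at n y e"
 define R where "R m x = (%i. if i < m then y i else x i)" for m :: nat and x
 have inB: "R m x : ?B" if "x : ?B" for m x
  using that y by (force simp: R_def box_at_def eucl_iff)
 have Rn: "R n x = y" if "x : ?B" for x
  using that y by (auto simp: R_def box_at_def eucl_iff)
 \<comment> \<open>Smoothness of \<open>f \<circ> R m\<close> is carried along in the induction,
   since the next step differentiates this function.\<close>
 have "\<exists>g. (\<forall>i<n. smooth_fun_on n ?B (g i)) & smooth_fun_on n ?B (f \<circ> R m) \<and>
   (\<forall>x\<in>?B. f x = f (R m x) + (\<Sum>i<m. (x i - y i) * g i x))" if "m \<le> n" for m
  using that
 proof (induction m)
  case 0
  show ?case using f by (intro exI[of _ "%_ _. 0"]) (auto simp: R_def o_def smooth_const openin_box_at)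
 next
  case (Suc m)
  then obtain g where g: "\<forall>i<n. smooth_fun_on n ?B (g i)" "smooth_fun_on n ?B (f \<circ> R m)"
   "\<forall>x\<in>?B. f x = f (R m x) + (\<Sum>i<m. (x i - y i) * g i x)" using Suc.IH[OF Suc_leD[OF Suc.prems]] by blast
  have m: "m < n" using Suc.prems by simp
  define q where "q = ray_mean y m 0 (partial_deriv m (f \<circ> R m))"
  have q: "smooth_fun_on n ?B q"
   unfolding q_def by (intro smooth_ray_mean smooth_partial_deriv g(2) m)
  have eq: "f (R m x) = f (R (Suc m) x) + (x m - y m) * q x" if "x : ?B" for x
  proof -
   have "R m (x(m := y m)) = R (Suc m) x" by (auto simp: R_def fun_eq_iff less_Suc_eq)
   then show ?thesis using ray_mean_eq[OF g(2) that m] by (simp add: q_def)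
  qed
  \<comment> \<open>Subtracting the term just found gives smoothness of the next function without a
    chain rule, which is itself derived from this lemma.\<close>
  have "smooth_fun_on n ?B (%x. (f \<circ> R m) x + (- 1) * ((x m + (- y m)) * q x))"
   by (intro smooth_add smooth_mult smooth_const smooth_coord openin_box_at g(2) q)
  then have "smooth_fun_on n ?B (f \<circ> R (Suc m))"
   by (rule smooth_cong_imp[OF openin_box_at, rotated]) (simp add: eq)
  then show ?case using g q eq m
   by (intro exI[of _ "g(m := q)"]) (auto simp del: o_apply)
 qed
 from this[of n] obtain g where "\<forall>i<n. smooth_fun_on n ?B (g i)"
   "\<forall>x\<in>?B. f x = f (R n x) + (\<Sum>i<n. (x i - y i) * g i x)" by auto
 then show ?thesis using that[of g] Rn by simp
qed

text \<open>Smoothness is defined along coordinate lines only. In the Hadamard expansion at the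
  point of the curve, the difference quotient of f becomes a sum of difference quotients of
  coordinates times continuous functions.\<close>

lemma smooth_chain:
 assumes W: "eopn n W" and f: "smooth_fun_on n W f" and y: "\<gamma> s0 : W"
  and ev: "\<forall>\<^sub>F s in nhds s0. \<gamma> s : W"
  and d: "!!i. i < n ==> ((%s. \<gamma> s i) has_real_derivative \<gamma>' i) (at s0)"
 shows "((%s. f (\<gamma> s)) has_real_derivative (\<Sum>i<n. \<gamma>' i * partial_deriv i f (\<gamma> s0))) (at s0)"
proof -
 let ?y = "\<gamma> s0"
 have yE: "?y : eucl n" using y open_subset_eucl[OF W] by auto
 obtain e where e: "e > 0" "box_at n ?y e \<subseteq> W" using open_contains_box[OF W y] .
 obtain g where g: "!!i. i < n ==> smooth_fun_on n (box_at n ?y e) (g i)"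
  "!!x. x : box_at n ?y e ==> f x = f ?y + (\<Sum>i<n. (x i - ?y i) * g i x)"
  using hadamard[OF smooth_subset[OF W openin_box_at e(2) f] yE] by blast
 have yB: "?y : box_at n ?y e" by (rule box_at_center[OF yE e(1)])
 \<comment> \<open>Stated for every curve c through the point: the coordinate lines identify the
   cofactor \<open>g i\<close> with the partial derivative, and the given curve then yields the
   claim.\<close>
 have *: "((%s. f (c s)) has_real_derivative (\<Sum>i<n. c' i * g i ?y)) (at t)"
  if c0: "c t = ?y" and ev: "\<forall>\<^sub>F s in nhds t. c s : W"
   and dc: "!!i. i < n ==> ((%s. c s i) has_real_derivative c' i) (at t)" for c c' t
 proof -
  have cc: "isCont (%s. c s i) t" if "i < n" for i by (rule DERIV_isCont[OF dc[OF that]])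
  have "\<forall>\<^sub>F s in nhds t. \<bar>c s i - ?y i\<bar> < e" if "i < n" for i
  proof -
   have "((%s. c s i) \<longlongrightarrow> ?y i) (nhds t)"
    using cc[OF that] c0 unfolding isCont_def by (simp add: tendsto_nhds_iff)
   from tendstoD[OF this e(1)] show ?thesis by (simp add: dist_real_def)
  qed
  then have "\<forall>\<^sub>F s in nhds t. \<forall>i\<in>{..<n}. \<bar>c s i - ?y i\<bar> < e"
   by (intro eventually_ball_finite) simp_all
  with ev have evB: "\<forall>\<^sub>F s in nhds t. c s : box_at n ?y e"
   by eventually_elim (use open_subset_eucl[OF W] in \<open>auto simp: box_at_def\<close>)
  \<comment> \<open>Convergence in the product topology is coordinatewise; coordinates from n
    onwards vanish along the curve near t.\<close>
  have "limitin (product_topology (%i. euclideanreal) UNIV) c ?y (at t)"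
   unfolding limitin_componentwise
  proof (intro conjI ballI)
   fix i
   show "limitin euclideanreal (%s. c s i) (?y i) (at t)"
   proof (cases "i < n")
    case True
    then show ?thesis using cc[OF True] c0 by (simp add: isCont_def)
   next
    case False
    have "\<forall>\<^sub>F s in at t. c s i = ?y i"
     using ev unfolding eventually_at_filter
     by eventually_elim (use False open_subset_eucl[OF W] yE in \<open>auto simp: eucl_iff\<close>)
    then show ?thesis by (simp add: tendsto_eventually)
   qed
  qed auto
  then have cl: "(c \<longlongrightarrow> ?y) (at t)" by (simp add: euclidean_product_topology)
  have evB': "\<forall>\<^sub>F s in at t. c s : box_at n ?y e"
   using evB unfolding eventually_at_filter by eventually_elim simp
  have gc: "((%s. g i (c s)) \<longlongrightarrow> g i ?y) (at t)" if "i < n" for i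
   by (rule continuous_on_tendsto_compose[OF smooth_continuous[OF openin_box_at g(1)[OF that]] cl yB evB'])
  have "((%s. \<Sum>i<n. (c s i - c t i) / (s - t) * g i (c s)) \<longlongrightarrow> (\<Sum>i<n. c' i * g i ?y)) (at t)"
   by (intro tendsto_sum tendsto_mult gc) (use dc in \<open>auto simp: has_field_derivative_iff\<close>)
  moreover have "\<forall>\<^sub>F s in at t. (\<Sum>i<n. (c s i - c t i) / (s - t) * g i (c s)) = (f (c s) - f (c t)) / (s - t)"
   using evB' by eventually_elim (use g(2) in \<open>simp add: c0 sum_divide_distrib\<close>)
  ultimately show ?thesis
   unfolding has_field_derivative_iff by (rule Lim_transform_eventually)
 qed
 have "partial_deriv i f ?y = g i ?y" if i: "i < n" for i
 proof (rule partial_deriv_eqI)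
  have "((%s. f (?y(i := s))) has_real_derivative (\<Sum>j<n. (if j = i then 1 else 0) * g j ?y)) (at (?y i))"
  proof (rule *)
   show "\<forall>\<^sub>F s in nhds (?y i). ?y(i := s) : W" by (rule eventually_upd_in_open[OF W y i])
   show "((%s. (?y(i := s)) j) has_real_derivative (if j = i then 1 else 0)) (at (?y i))" for j
    by (cases "j = i") (auto intro!: derivative_eq_intros)
  qed simp
  then show "((%s. f (?y(i := s))) has_real_derivative g i ?y) (at (?y i))"
   using i by (subst (asm) sum.remove[of _ i]) auto
 qed
 with *[OF refl ev d] show ?thesis by simp
qed

text \<open>The chain rule for the curve that T traces along a coordinate line.\<close>

lemma smooth_comp_partial:
 assumes U: "eopn n U" and W: "eopn n W"
  and T: "!!l. l < n ==> smooth_fun_on n U (%x. T x l)" "!!x. x : U ==> T x : W"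
  and f: "smooth_fun_on n W f" and "i < n" "x : U"
 shows "((%s. f (T (x(i := s)))) has_real_derivative
   (\<Sum>l<n. partial_deriv i (%x. T x l) x * partial_deriv l f (T x))) (at (x i))"
proof -
 have "((%s. f (T (x(i := s)))) has_real_derivative
   (\<Sum>l<n. partial_deriv i (%x. T x l) x * partial_deriv l f (T (x(i := x i))))) (at (x i))"
 proof (rule smooth_chain[OF W f])
  show "\<forall>\<^sub>F s in nhds (x i). T (x(i := s)) : W"
   using eventually_upd_in_open[OF U assms(7,6)] by eventually_elim (rule T(2))
  show "((%s. T (x(i := s)) l) has_real_derivative partial_deriv i (%x. T x l) x) (at (x i))"
   if "l < n" for l
   by (rule smooth_has_partial_deriv[OF T(1)[OF that] assms(7,6)])
 qed (use T(2) assms(7) in simp)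
 then show ?thesis by simp
qed

text \<open>A partial derivative of the composition is a sum of products of a partial derivative of
  the map with a composition of the same kind, so the induction on the order varies f.\<close>

lemma smooth_comp:
 assumes U: "eopn n U" and W: "eopn n W"
  and T: "!!l. l < n ==> smooth_fun_on n U (%x. T x l)" "!!x. x : U ==> T x : W"
  and f: "smooth_fun_on n W f"
 shows "smooth_fun_on n U (%x. f (T x))"
proof -
 have "continuous_on U T"
 proof (rule continuous_on_coordinatewise_then_product)
  fix i
  show "continuous_on U (%x. T x i)"
  proof (cases "i < n")
   case True
   then show ?thesis using smooth_continuous[OF U T(1)] by simp
  next
   case False
   then have "T x i = 0" if "x : U" for x
    using T(2)[OF that] open_subset_eucl[OF W] by (auto simp: eucl_iff)
   then show ?thesis by (simp cong: continuous_on_cong)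
  qed
 qed
 then have cont: "continuous_on U (%x. f (T x))" if "smooth_fun_on n W f" for f
  using continuous_on_compose2[OF smooth_continuous[OF W that]] T(2) by blast
 have "ck_on n k U (%x. f (T x))" if "smooth_fun_on n W f" for k
  using that
 proof (induction k arbitrary: f)
  case 0
  then show ?case using cont by (simp add: continuous_map_eucl[OF U])
 next
  case (Suc k)
  show ?case
  proof (rule ck_onI[OF U cont[OF Suc.prems] smooth_comp_partial[OF U W T Suc.prems]])
   fix i assume i: "i < n"
   have k: "ck_on n k U (%x. partial_deriv i (%x. T x l) x * partial_deriv l f (T x))" if "l < n" for l
    using smooth_partial_deriv[OF T(1)[OF that] i] Suc.IH[OF smooth_partial_deriv[OF Suc.prems that]]
    unfolding smooth_fun_on_def by (intro ck_on_mult[OF U]) auto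
   have "ck_on n k U (%x. \<Sum>l\<in>L. partial_deriv i (%x. T x l) x * partial_deriv l f (T x))"
    if "finite L" "L \<subseteq> {..<n}" for L
    using that by (induction L) (auto intro!: ck_on_add[OF U] ck_on_const[OF U] k)
   then show "ck_on n k U (%x. \<Sum>l<n. partial_deriv i (%x. T x l) x * partial_deriv l f (T x))"
    by simp
  qed
 qed
 then show ?thesis using f by (simp add: smooth_fun_on_def)
qed

section \<open>Formal series\<close>

abbreviation sg :: "int => real" where "sg n \<equiv> (if even n then 1 else - 1)"

section \<open>Signs of reordered products of generators\<close>

definition gsign :: "gen => gen => real" where
 "gsign a b = (if odd (fst a) & odd (fst b) & gen_less b a then - 1 else 1)"

text \<open>\<open>mono_sign\<close> counts inverted pairs of odd generators; this product over all
  pairs is multiplicative in each argument and so allows one generator to be split off at a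
  time.\<close>

definition multisign :: "gen multiset => gen multiset => real" where
 "multisign x z = (\<Prod>a\<in>#x. \<Prod>b\<in>#z. gsign a b)"

lemma multisign_plus_right: "multisign x (z + z') = multisign x z * multisign x z'"
 by (simp add: multisign_def prod_mset.distrib)

lemma multisign_empty [simp]: "multisign {#} z = 1" "multisign x {#} = 1"
 by (simp_all add: multisign_def)

lemma multisign_add_left: "multisign (add_mset a x) z = multisign {#a#} z * multisign x z"
 by (simp add: multisign_def)

lemma multisign_add_right: "multisign x (add_mset a z) = multisign x {#a#} * multisign x z"
 using multisign_plus_right[of x "{#a#}" z] by simp

lemma gsign_square: "gsign a b * gsign a b = 1"
 by (simp add: gsign_def)

lemma multisign_square: "multisign {#a#} z * multisign {#a#} z = 1"
proof (induction z)
 case (add b z)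
 have "multisign {#a#} (add_mset b z) * multisign {#a#} (add_mset b z) =
   (gsign a b * gsign a b) * (multisign {#a#} z * multisign {#a#} z)"
  by (simp add: multisign_def ac_simps)
 then show ?case unfolding gsign_square add by simp
qed simp

lemma multisign_square': "multisign {#a#} z * (multisign {#a#} z * r) = r"
 using multisign_square[of a z] by (simp flip: mult.assoc)

lemma mono_degree_simps [simp]:
 "mono_degree {#} = 0" "mono_degree (add_mset a m) = fst a + mono_degree m"
 "mono_degree (x + z) = mono_degree x + mono_degree z"
 by (simp_all add: mono_degree_def)

text \<open>For each b different from a exactly one of the orders (a, b), (b, a) is inverted, and it
  contributes a sign precisely if b is odd.\<close>

lemma multisign_swap:
 assumes "odd (fst a)" "a \<notin># x"
 shows "multisign x {#a#} * multisign {#a#} x = sg (mono_degree x)"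
 using assms(2)
proof (induction x)
 case (add b x)
 have "gsign b a * gsign a b = sg (fst b)"
  using add.prems assms(1) by (auto simp: gsign_def gen_less_def prod_eq_iff)
 then have 1: "multisign {#b#} {#a#} * multisign {#a#} {#b#} = sg (fst b)"
  by (simp add: multisign_def)
 have 2: "multisign x {#a#} * multisign {#a#} x = sg (mono_degree x)" using add by simp
 have "multisign (add_mset b x) {#a#} * multisign {#a#} (add_mset b x) =
   (multisign {#b#} {#a#} * multisign {#a#} {#b#}) * (multisign x {#a#} * multisign {#a#} x)"
  by (simp add: multisign_add_left[of b x "{#a#}"] multisign_add_right[of "{#a#}" b x] algebra_simps)
 then show ?case unfolding 1 2 by simp
qed simp

lemma multisign_swap_even:
 assumes "even (fst a)"
 shows "multisign x {#a#} * multisign {#a#} x = 1"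
 using assms by (simp add: multisign_def gsign_def)

lemma monomials_subset:
 assumes "m : monomials p" "x \<subseteq># m"
 shows "x : monomials p"
proof -
 have "count x a = 1" if "a \<in># x" "odd (fst a)" for a
 proof -
  have "a \<in># m" using that(1) assms(2) by (rule mset_subset_eqD[rotated])
  then have "count m a = 1" using assms(1) that(2) by (auto simp: monomials_def)
  moreover have "count x a \<le> count m a" using assms(2) by (rule mset_subset_eq_count)
  moreover have "count x a > 0" using that(1) by simp
  ultimately show ?thesis by linarith
 qed
 then show ?thesis using assms set_mset_mono[OF assms(2)] by (auto simp: monomials_def)
qed

lemma monomials_addD: "add_mset a m : monomials p ==> m : monomials p"
 by (rule monomials_subset) auto

lemma monomials_addD_gen: "add_mset a m : monomials p ==> a : gens p"
 by (auto simp: monomials_def)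

lemma monomials_addD_odd: "add_mset a m : monomials p ==> odd (fst a) ==> a \<notin># m"
 unfolding monomials_def not_in_iff by (drule CollectD, drule conjunct2, drule bspec[of _ _ a]) auto

lemma series_onI:
 assumes "!!m. smooth_fun_on (p 0) U (s m)" "!!m y. m \<notin> monomials p ==> s m y = 0"
  "!!m y. y \<notin> U ==> s m y = 0"
 shows "s : series_on p U"
 using assms by (auto simp: series_on_def)

lemma empty_monomial [simp]: "{#} : monomials p"
 by (simp add: monomials_def)

lemma single_monomial: "a : gens p ==> {#a#} : monomials p"
 by (simp add: monomials_def)

text \<open>The product sees multiplicities and the count does not; in a monomial odd generators
  occur once, and even ones contribute the factor 1.\<close>

lemma mono_sign_eq:
 assumes "x : monomials p" "z : monomials p"
 shows "mono_sign x z = multisign x z"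
proof -
 have c: "r ^ count z b = r" if "z : monomials p" "b \<in># z" "odd (fst b)" for r :: real and b z
  using that by (auto simp: monomials_def)
 have 1: "(\<Prod>b\<in>#z. gsign a b) = (\<Prod>b\<in>set_mset z. gsign a b)" for a
  unfolding image_prod_mset_multiplicity
  by (rule prod.cong) (use c[OF assms(2)] in \<open>auto simp: gsign_def\<close>)
 have "multisign x z = (\<Prod>a\<in>set_mset x. \<Prod>b\<in>set_mset z. gsign a b)"
  unfolding multisign_def 1 image_prod_mset_multiplicity[of "%a. prod (gsign a) (set_mset z)"]
 proof (rule prod.cong[OF refl])
  fix a assume "a \<in># x"
  then show "(\<Prod>b\<in>set_mset z. gsign a b) ^ count x a = (\<Prod>b\<in>set_mset z. gsign a b)"
   using c[OF assms(1)] by (cases "odd (fst a)") (simp_all add: gsign_def)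
 qed
 also have "\<dots> = (\<Prod>(a, b)\<in>set_mset x \<times> set_mset z. gsign a b)"
  by (rule prod.cartesian_product)
 also have "\<dots> = (\<Prod>c\<in>{(a, b). a \<in># x & b \<in># z & odd (fst a) & odd (fst b) & gen_less b a}. - 1)"
  by (rule prod.mono_neutral_cong_right) (auto simp: gsign_def split: if_splits)
 finally show ?thesis by (simp add: mono_sign_def)
qed

text \<open>Pairs instead of submultisets keep the two factors symmetric, so that a generator can be
  removed from either of them.\<close>

definition splits :: "gen multiset => (gen multiset \<times> gen multiset) set" where
 "splits m = {(x, z). x + z = m}"

lemma splits_eq: "splits m = (%x. (x, m - x)) ` {x. x \<subseteq># m}"
 by (force simp: splits_def subset_mset.add_diff_inverse)

lemma finite_splits: "finite (splits m)"
proof (induction m)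
 case (add a m)
 have "splits (add_mset a m) \<subseteq> (%(x, z). (add_mset a x, z)) ` splits m \<union> (%(x, z). (x, add_mset a z)) ` splits m"
 proof clarify
  fix x z assume xz: "(x, z) : splits (add_mset a m)"
   and nz: "(x, z) \<notin> (%(x, z). (x, add_mset a z)) ` splits m"
  then have eq: "x + z = add_mset a m" by (simp add: splits_def)
  then have "a \<in># x \<or> a \<in># z" by (metis union_iff union_single_eq_member)
  then show "(x, z) : (%(x, z). (add_mset a x, z)) ` splits m"
  proof
   assume "a \<in># x"
   then obtain x' where "x = add_mset a x'" by (metis insert_DiffM)
   with eq show ?thesis by (force simp: splits_def)
  next
   assume "a \<in># z"
   then obtain z' where "z = add_mset a z'" by (metis insert_DiffM)
   with eq nz show ?thesis by (force simp: splits_def)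
  qed
 qed
 then show ?case using add by (meson finite_UnI finite_imageI finite_subset)
qed (simp add: splits_def)

text \<open>Submultisets of a monomial are monomials, so the multiplicative sign applies to every
  term.\<close>

lemma series_mult_splits:
 assumes "m : monomials p"
 shows "series_mult p s t m y = (\<Sum>(x, z)\<in>splits m. multisign x z * s x y * t z y)"
proof -
 have "(\<Sum>(x, z)\<in>splits m. multisign x z * s x y * t z y) =
   (\<Sum>x\<in>{x. x \<subseteq># m}. multisign x (m - x) * s x y * t (m - x) y)"
  unfolding splits_eq by (subst sum.reindex) (auto simp: inj_on_def)
 also have "\<dots> = (\<Sum>x\<in>{x. x \<subseteq># m}. mono_sign x (m - x) * s x y * t (m - x) y)"
  by (rule sum.cong) (use assms in \<open>auto simp: mono_sign_eq[OF monomials_subset monomials_subset] diff_subset_eq_self\<close>)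
 finally show ?thesis using assms by (simp add: series_mult_def)
qed

text \<open>Adding a to the left component is a bijection from the splits of m onto those splits of
  the larger multiset whose left component contains a; the hypothesis disposes of the
  others.\<close>

lemma sum_splits_left:
 assumes "!!x z. x + z = add_mset a m ==> a \<notin># x ==> F x z = 0"
 shows "(\<Sum>(x, z)\<in>splits (add_mset a m). F x z) = (\<Sum>(x, z)\<in>splits m. (F (add_mset a x) z :: real))"
proof -
 have "(\<Sum>(x, z)\<in>splits (add_mset a m). F x z) = (\<Sum>(x, z)\<in>(%(x, z). (add_mset a x, z)) ` splits m. F x z)"
 proof (rule sum.mono_neutral_right)
  show "\<forall>i\<in>splits (add_mset a m) - (%(x, z). (add_mset a x, z)) ` splits m. (case i of (x, z) => F x z) = 0"
  proof clarify
   fix x z assume xz: "(x, z) : splits (add_mset a m)" "(x, z) \<notin> (%(x, z). (add_mset a x, z)) ` splits m"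
   have "a \<notin># x"
   proof
    assume "a \<in># x"
    then obtain x' where "x = add_mset a x'" by (metis insert_DiffM)
    with xz show False by (force simp: splits_def)
   qed
   with xz assms show "F x z = 0" by (auto simp: splits_def)
  qed
 qed (rule finite_splits, auto simp: splits_def)
 also have "\<dots> = (\<Sum>(x, z)\<in>splits m. F (add_mset a x) z)"
  by (subst sum.reindex) (auto simp: inj_on_def case_prod_unfold intro!: sum.cong)
 finally show ?thesis .
qed

lemma sum_splits_right:
 assumes "!!x z. x + z = add_mset a m ==> a \<notin># z ==> F x z = 0"
 shows "(\<Sum>(x, z)\<in>splits (add_mset a m). F x z) = (\<Sum>(x, z)\<in>splits m. (F x (add_mset a z) :: real))"
proof -
 have swap: "(\<Sum>(x, z)\<in>splits m. G x z) = (\<Sum>(x, z)\<in>splits m. G z x)" for m and G :: "_ => _ => real"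
  by (rule sum.reindex_bij_witness[of _ prod.swap prod.swap]) (auto simp: splits_def add.commute)
 have "(\<Sum>(x, z)\<in>splits (add_mset a m). F x z) = (\<Sum>(x, z)\<in>splits (add_mset a m). F z x)"
  by (rule swap[of F])
 also have "\<dots> = (\<Sum>(x, z)\<in>splits m. F z (add_mset a x))"
 proof (rule sum_splits_left)
  fix x z assume xz: "x + z = add_mset a m" "a \<notin># x"
  have "z + x = add_mset a m" unfolding xz(1)[symmetric] by (rule add.commute)
  from assms[OF this xz(2)] show "F z x = 0" .
 qed
 also have "\<dots> = (\<Sum>(x, z)\<in>splits m. F x (add_mset a z))"
  by (rule swap[of "%x z. F z (add_mset a x)"])
 finally show ?thesis .
qed

text \<open>The factor \<open>count m a + 1\<close> is the exponent of \<open>w\<^sub>a\<close> in the differentiated monomial; the sign comes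
  from moving \<open>w\<^sub>a\<close> to the front.\<close>

definition dw :: "gen => series => series" where
 "dw a s = (%m y. real (count m a + 1) * multisign {#a#} m * s (add_mset a m) y)"

definition dt :: "nat => (nat => real) set => series => series" where
 "dt i U s = (%m y. if y : U then partial_deriv i (s m) y else 0)"

lemma series_onD:
 assumes "s : series_on p U"
 shows "smooth_fun_on (p 0) U (s m)" "m \<notin> monomials p ==> s m y = 0" "y \<notin> U ==> s m y = 0"
 using assms by (auto simp: series_on_def)

text \<open>If \<open>add_mset a m\<close> is a monomial, the exponent of w_a in it is the sum of
  its exponents in both parts of every split, and the two resulting sums are the two terms of the
  Leibniz rule. If it is not, then the left-hand side vanishes, and the terms on the right vanish or
  cancel. Homogeneity of s enters when w_a is moved across its monomials.\<close>

lemma dw_leibniz: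
 assumes s: "s : series_on p U" and t: "t : series_on p U"
  and hom: "!!m. mono_degree m ~= d ==> s m y = 0"
 shows "dw a (series_mult p s t) m y =
   series_mult p (dw a s) t m y + sg (fst a * d) * series_mult p s (dw a t) m y"
proof (cases "m : monomials p")
 case False
 then have "add_mset a m \<notin> monomials p" using monomials_addD by blast
 with False show ?thesis by (simp add: dw_def series_mult_def)
next
 case m: True
 let ?\<sigma> = multisign
 show ?thesis
 proof (cases "add_mset a m : monomials p")
  case True
  \<comment> \<open>w_a is differentiated in the left factor. Its sign against z occurs once in
    moving it to the front and once in the product, and so disappears.\<close>
  have 1: "(\<Sum>(x, z)\<in>splits (add_mset a m). real (count x a) * (?\<sigma> {#a#} m * (?\<sigma> x z * s x y * t z y))) =
    series_mult p (dw a s) t m y"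
  proof -
   have "real (count (add_mset a x) a) * (?\<sigma> {#a#} m * (?\<sigma> (add_mset a x) z * s (add_mset a x) y * t z y)) =
     ?\<sigma> x z * dw a s x y * t z y" if "x + z = m" for x z
   proof -
    have "real (count (add_mset a x) a) * (?\<sigma> {#a#} m * (?\<sigma> (add_mset a x) z * s (add_mset a x) y * t z y)) =
      (?\<sigma> {#a#} z * ?\<sigma> {#a#} z) * (?\<sigma> x z * (real (count x a + 1) * ?\<sigma> {#a#} x * s (add_mset a x) y) * t z y)"
     by (simp add: multisign_add_left[of a x z] multisign_plus_right algebra_simps flip: that)
    then show ?thesis unfolding multisign_square by (simp add: dw_def)
   qed
   then show ?thesis
    unfolding series_mult_splits[OF m]
    by (subst sum_splits_left) (auto simp: not_in_iff splits_def intro!: sum.cong)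
  qed
  \<comment> \<open>w_a is differentiated in the right factor and has to pass x, whose degree is d
    wherever s has a nonzero coefficient.\<close>
  have 2: "(\<Sum>(x, z)\<in>splits (add_mset a m). real (count z a) * (?\<sigma> {#a#} m * (?\<sigma> x z * s x y * t z y))) =
    sg (fst a * d) * series_mult p s (dw a t) m y"
  proof -
   have *: "?\<sigma> x {#a#} * ?\<sigma> {#a#} x * s x y = sg (fst a * d) * s x y" if "x + z = m" for x z
   proof (cases "even (fst a)")
    case True
    then show ?thesis using multisign_swap_even[OF True] by simp
   next
    case False
    then have "a \<notin># x" using monomials_addD_odd[OF \<open>add_mset a m : monomials p\<close>] that by auto
    then show ?thesis using multisign_swap[OF False] hom[of x] False by (cases "mono_degree x = d") auto
   qed
   have "real (count (add_mset a z) a) * (?\<sigma> {#a#} m * (?\<sigma> x (add_mset a z) * s x y * t (add_mset a z) y)) =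
     sg (fst a * d) * (?\<sigma> x z * s x y * dw a t z y)" if "x + z = m" for x z
   proof -
    have "real (count (add_mset a z) a) * (?\<sigma> {#a#} m * (?\<sigma> x (add_mset a z) * s x y * t (add_mset a z) y)) =
      (?\<sigma> x {#a#} * ?\<sigma> {#a#} x * s x y) * (?\<sigma> x z * (real (count z a + 1) * ?\<sigma> {#a#} z * t (add_mset a z) y))"
     by (simp add: multisign_add_right[of x a z] multisign_plus_right algebra_simps flip: that)
    then show ?thesis unfolding *[OF that] by (simp add: dw_def)
   qed
   then have "(\<Sum>(x, z)\<in>splits m. real (count (add_mset a z) a) * (?\<sigma> {#a#} m * (?\<sigma> x (add_mset a z) * s x y * t (add_mset a z) y)))
     = (\<Sum>(x, z)\<in>splits m. sg (fst a * d) * (?\<sigma> x z * s x y * dw a t z y))"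
    by (intro sum.cong refl) (simp add: splits_def case_prod_unfold del: count_add_mset)
   moreover have "(\<Sum>(x, z)\<in>splits (add_mset a m). real (count z a) * (?\<sigma> {#a#} m * (?\<sigma> x z * s x y * t z y)))
     = (\<Sum>(x, z)\<in>splits m. real (count (add_mset a z) a) * (?\<sigma> {#a#} m * (?\<sigma> x (add_mset a z) * s x y * t (add_mset a z) y)))"
    by (rule sum_splits_right) (simp add: not_in_iff)
   ultimately show ?thesis
    unfolding series_mult_splits[OF m] sum_distrib_left by (simp add: case_prod_unfold)
  qed
  have "dw a (series_mult p s t) m y =
   (\<Sum>(x, z)\<in>splits (add_mset a m). real (count m a + 1) * (?\<sigma> {#a#} m * (?\<sigma> x z * s x y * t z y)))"
   unfolding dw_def series_mult_splits[OF True] sum_distrib_left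
   by (auto simp: mult.assoc intro!: sum.cong)
  also have "\<dots> = (\<Sum>(x, z)\<in>splits (add_mset a m).
    real (count x a) * (?\<sigma> {#a#} m * (?\<sigma> x z * s x y * t z y)) +
    real (count z a) * (?\<sigma> {#a#} m * (?\<sigma> x z * s x y * t z y)))"
  proof (rule sum.cong, simp, clarify)
   fix x z assume "(x, z) : splits (add_mset a m)"
   then have "count m a + 1 = count x a + count z a"
    unfolding splits_def by (metis (mono_tags, lifting) Suc_eq_plus1 case_prodD count_add_mset count_union mem_Collect_eq)
   then show "real (count m a + 1) * (?\<sigma> {#a#} m * (?\<sigma> x z * s x y * t z y)) =
     real (count x a) * (?\<sigma> {#a#} m * (?\<sigma> x z * s x y * t z y)) +
     real (count z a) * (?\<sigma> {#a#} m * (?\<sigma> x z * s x y * t z y))"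
    by (simp only: of_nat_add distrib_right)
  qed
  finally show ?thesis unfolding 1[symmetric] 2[symmetric]
   by (simp add: sum.distrib case_prod_unfold)
 next
  case False
  then have lhs: "dw a (series_mult p s t) m y = 0" by (simp add: dw_def series_mult_def)
  show ?thesis
  \<comment> \<open>Terms on the right can survive only if a is an odd generator already present in
    m; then the square of w_a is 0 and they cancel in pairs.\<close>
  proof (cases "a : gens p & odd (fst a) & a \<in># m")
   case no: False
   have "add_mset a x \<notin> monomials p" if "x \<subseteq># m" for x
   proof
    assume ax: "add_mset a x : monomials p"
    then have a: "a : gens p" by (rule monomials_addD_gen)
    then have "even (fst a) \<or> a \<notin># m" using no by auto
    then have "add_mset a m : monomials p" using a m
     by (auto simp: monomials_def not_in_iff)
    with False show False ..
   qed
   then have "dw a s x y = 0" "dw a t x y = 0" if "x \<subseteq># m" for x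
    using that series_onD(2)[OF s] series_onD(2)[OF t] by (simp_all add: dw_def)
   then have "series_mult p (dw a s) t m y = 0" "series_mult p s (dw a t) m y = 0"
    unfolding series_mult_splits[OF m] by (auto intro!: sum.neutral simp: splits_def)
   with lhs show ?thesis by simp
  next
   case yes: True
   then obtain m0 where m0: "m = add_mset a m0" by (metis insert_DiffM)
   have am0: "a \<notin># m0" using monomials_addD_odd m yes m0 by auto
   have s0: "s (add_mset a x) y = 0" "t (add_mset a x) y = 0" if "a \<in># x" for x
   proof -
    have "add_mset a x \<notin> monomials p" using that yes monomials_addD_odd by blast
    then show "s (add_mset a x) y = 0" "t (add_mset a x) y = 0"
     using series_onD(2)[OF s] series_onD(2)[OF t] by auto
   qed
   have "series_mult p (dw a s) t m y =
     (\<Sum>(x, z)\<in>splits m0. ?\<sigma> x (add_mset a z) * dw a s x y * t (add_mset a z) y)"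
    unfolding series_mult_splits[OF m] unfolding m0
   proof (rule sum_splits_right)
    fix x z assume "x + z = add_mset a m0" "a \<notin># z"
    then have "a \<in># x" by (metis union_iff union_single_eq_member)
    then show "?\<sigma> x z * dw a s x y * t z y = 0" by (simp add: dw_def s0)
   qed
   moreover have "series_mult p s (dw a t) m y =
     (\<Sum>(x, z)\<in>splits m0. ?\<sigma> (add_mset a x) z * s (add_mset a x) y * dw a t z y)"
    unfolding series_mult_splits[OF m] unfolding m0
   proof (rule sum_splits_left)
    fix x z assume "x + z = add_mset a m0" "a \<notin># x"
    then have "a \<in># z" by (metis union_iff union_single_eq_member)
    then show "?\<sigma> x z * s x y * dw a t z y = 0" by (simp add: dw_def s0)
   qed
   \<comment> \<open>Both terms contain the coefficients of s at \<open>add_mset a x\<close> and of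
     t at \<open>add_mset a z\<close>, once with w_a removed on the left and once on the right.
     Passing x, whose degree is d minus the odd degree of a, makes their signs opposite.\<close>
   moreover have "?\<sigma> x (add_mset a z) * dw a s x y * t (add_mset a z) y +
     sg (fst a * d) * (?\<sigma> (add_mset a x) z * s (add_mset a x) y * dw a t z y) = 0" if "x + z = m0" for x z
   proof (cases "mono_degree (add_mset a x) = d")
    case False
    then show ?thesis using hom[OF False] by (simp add: dw_def)
   next
    case True
    have ax: "a \<notin># x" "a \<notin># z" using am0 that by auto
    have sw: "?\<sigma> x {#a#} * ?\<sigma> {#a#} x = - sg (fst a * d)"
     using multisign_swap[OF _ ax(1)] yes True by auto
    have "?\<sigma> x (add_mset a z) * dw a s x y * t (add_mset a z) y =
      (?\<sigma> x {#a#} * ?\<sigma> {#a#} x) * (?\<sigma> x z * s (add_mset a x) y * t (add_mset a z) y)"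
     using ax by (simp add: dw_def not_in_iff multisign_add_right[of x a z] algebra_simps)
    moreover have "?\<sigma> (add_mset a x) z * s (add_mset a x) y * dw a t z y =
      (?\<sigma> {#a#} z * ?\<sigma> {#a#} z) * (?\<sigma> x z * s (add_mset a x) y * t (add_mset a z) y)"
     using ax by (simp add: dw_def not_in_iff multisign_add_left[of a x] algebra_simps)
    ultimately show ?thesis unfolding sw multisign_square by simp
   qed
   moreover define r where "r = sg (fst a * d)"
   ultimately have "series_mult p (dw a s) t m y + r * series_mult p s (dw a t) m y =
    (\<Sum>(x, z)\<in>splits m0. ?\<sigma> x (add_mset a z) * dw a s x y * t (add_mset a z) y +
     r * (?\<sigma> (add_mset a x) z * s (add_mset a x) y * dw a t z y))"
    "!!x z. x + z = m0 ==> ?\<sigma> x (add_mset a z) * dw a s x y * t (add_mset a z) y +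
     r * (?\<sigma> (add_mset a x) z * s (add_mset a x) y * dw a t z y) = 0"
    unfolding r_def[symmetric] by (simp_all add: sum_distrib_left case_prod_unfold sum.distrib)
   then have "series_mult p (dw a s) t m y + r * series_mult p s (dw a t) m y = 0"
    by (auto simp: splits_def intro!: sum.neutral)
   then show ?thesis unfolding lhs r_def by simp
  qed
 qed
qed

section \<open>Products with functions and with single generators\<close>

lemma series_mult_cong:
 assumes "!!x. x \<subseteq># m ==> s x y = s' x y" "!!x. x \<subseteq># m ==> t x y = t' x y"
 shows "series_mult p s t m y = series_mult p s' t' m y"
 using assms by (auto simp: series_mult_def diff_subset_eq_self intro!: sum.cong)

text \<open>If m has fewer than i + j elements, every split has a left part shorter than i or a
  right part shorter than j.\<close>

lemma series_mult_order:
 assumes "!!x. size x < i ==> s x y = 0" "!!x. size x < j ==> t x y = 0" "size m < i + j"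
 shows "series_mult p s t m y = 0"
proof (cases "m : monomials p")
 case True
 have "s x y = 0 \<or> t z y = 0" if "x + z = m" for x z
  using assms that by (metis add_mono_thms_linordered_semiring(1) linorder_not_less size_union)
 then show ?thesis unfolding series_mult_splits[OF True]
  by (auto intro!: sum.neutral simp: splits_def)
qed (simp add: series_mult_def)

lemma series_mult_fun:
 assumes "y : U" "t : series_on p U"
 shows "series_mult p (fun_series U f) t m y = f y * t m y"
proof (cases "m : monomials p")
 case True
 have "series_mult p (fun_series U f) t m y =
   (\<Sum>(x, z)\<in>{({#}, m)}. multisign x z * fun_series U f x y * t z y)"
  unfolding series_mult_splits[OF True]
  by (rule sum.mono_neutral_right[OF finite_splits]) (auto simp: splits_def fun_series_def split: if_splits)
 then show ?thesis using assms by (simp add: fun_series_def)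
qed (use assms series_onD in \<open>auto simp: series_mult_def\<close>)

abbreviation wser :: "(nat => real) set => gen => series" where
 "wser U a \<equiv> linear_series U (%b. if b = a then 1 else 0)"

lemma wser_eq: "wser U a m y = (if m = {#a#} & y : U then 1 else 0)"
proof (cases "size m = 1")
 case True
 then obtain b where "m = {#b#}" using size_1_singleton_mset by blast
 then show ?thesis by (simp add: linear_series_def)
qed (auto simp: linear_series_def)

lemma series_mult_wser:
 assumes "y : U" "m : monomials p"
 shows "series_mult p (wser U a) t m y =
  (if a \<in># m then multisign {#a#} (m - {#a#}) * t (m - {#a#}) y else 0)"
proof (cases "a \<in># m")
 case True
 have "series_mult p (wser U a) t m y =
   (\<Sum>(x, z)\<in>{({#a#}, m - {#a#})}. multisign x z * wser U a x y * t z y)"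
  unfolding series_mult_splits[OF assms(2)]
  by (rule sum.mono_neutral_right[OF finite_splits]) (use True in \<open>auto simp: splits_def wser_eq split: if_splits\<close>)
 then show ?thesis using assms True by (simp add: wser_eq)
next
 case False
 then show ?thesis unfolding series_mult_splits[OF assms(2)]
  by (auto intro!: sum.neutral simp: splits_def wser_eq)
qed

text \<open>A series without constant term is \<open>\<Sum>\<^sub>a w\<^sub>a g\<^sub>a\<close>: each monomial is assigned to one of its generators.\<close>

definition quot_gen :: "gen => series => series" where
 "quot_gen a g = (%m y. if (SOME b. b \<in># add_mset a m) = a
   then multisign {#a#} m * g (add_mset a m) y else 0)"

text \<open>The chosen generator depends on the monomial alone, so precisely one summand is left at
  a nonempty m, and its two signs cancel.\<close>

lemma sum_wser_quot_gen:
 assumes "finite (gens p)" "y : U" "m : monomials p"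
 shows "(\<Sum>a\<in>gens p. series_mult p (wser U a) (quot_gen a g) m y) = (if m = {#} then 0 else g m y)"
proof (cases "m = {#}")
 case True
 then show ?thesis using assms by (simp add: series_mult_wser)
next
 case False
 define c where "c = (SOME b. b \<in># m)"
 have c: "c \<in># m" unfolding c_def using False by (rule someI_ex[OF multiset_nonemptyE]) auto
 then have cg: "c : gens p" using assms(3) by (auto simp: monomials_def)
 have "series_mult p (wser U a) (quot_gen a g) m y = (if a = c then g m y else 0)" for a
 proof (cases "a \<in># m")
  case True
  then have "add_mset a (m - {#a#}) = m" by simp
  then have "quot_gen a g (m - {#a#}) y = (if a = c then multisign {#a#} (m - {#a#}) * g m y else 0)"
   by (auto simp: quot_gen_def c_def simp del: set_mset_add_mset_insert)
  then show ?thesis using True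
   by (simp add: series_mult_wser[OF assms(2,3)] multisign_square')
 next
  case False
  then show ?thesis using c by (auto simp: series_mult_wser[OF assms(2,3)])
 qed
 then show ?thesis using False cg assms(1) by simp
qed

section \<open>Closure properties of the series with smooth coefficients\<close>

lemma fun_series_on:
 assumes "eopn (p 0) U" "smooth_fun_on (p 0) U f"
 shows "fun_series U f : series_on p U"
proof -
 have "smooth_fun_on (p 0) U (fun_series U f m)" for m
 proof (cases "m = {#}")
  case True
  show ?thesis by (rule smooth_cong_imp[OF assms(1) _ assms(2)]) (simp add: fun_series_def True)
 next
  case False
  then show ?thesis using smooth_const[OF assms(1)] by (simp add: fun_series_def)
 qed
 then show ?thesis by (auto simp: series_on_def fun_series_def)
qed

lemma linear_series_on:
 assumes "eopn (p 0) U" "!!b. b \<notin> gens p ==> v b = 0"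
 shows "linear_series U v : series_on p U"
proof -
 have "smooth_fun_on (p 0) U (linear_series U v m)" for m
  by (rule smooth_cong_imp[OF assms(1) _ smooth_const[OF assms(1), of "if size m = 1 then v (the_elem (set_mset m)) else 0"]])
   (auto simp: linear_series_def)
 moreover have "v (the_elem (set_mset m)) = 0" if sm: "size m = 1" and nm: "m \<notin> monomials p" for m
 proof -
  obtain b where "m = {#b#}" using size_1_singleton_mset[OF sm] ..
  then show ?thesis using nm assms(2)[of b] single_monomial[of b p] by (cases "b : gens p") simp_all
 qed
 ultimately show ?thesis by (auto simp: series_on_def linear_series_def)
qed

lemma dt_on:
 assumes "eopn (p 0) U" "s : series_on p U" "i < p 0"
 shows "dt i U s : series_on p U"
proof -
 have "smooth_fun_on (p 0) U (dt i U s m)" for m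
  by (rule smooth_cong_imp[OF assms(1) _ smooth_partial_deriv[OF series_onD(1)[OF assms(2), of m] assms(3)]])
   (simp add: dt_def)
 moreover have "dt i U s m y = 0" if "m \<notin> monomials p" for m y
 proof -
  have "s m = (%x. 0)" using series_onD(2)[OF assms(2) that] by blast
  then show ?thesis by (simp add: dt_def partial_deriv_def)
 qed
 ultimately show ?thesis by (rule series_onI) (simp_all add: dt_def)
qed

lemma smooth_cmult:
 "eopn n U ==> smooth_fun_on n U f ==> smooth_fun_on n U (%x. c * f x)"
 by (intro smooth_mult smooth_const)

lemma dw_on:
 assumes "eopn (p 0) U" "s : series_on p U"
 shows "dw a s : series_on p U"
proof -
 have "add_mset a m \<notin> monomials p" if "m \<notin> monomials p" for m
  using that monomials_addD by blast
 then show ?thesis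
  using series_onD[OF assms(2)] smooth_cmult[OF assms(1)]
  by (auto simp: series_on_def dw_def)
qed

lemma quot_gen_on:
 assumes "eopn (p 0) U" "s : series_on p U"
 shows "quot_gen a s : series_on p U"
proof -
 have "add_mset a m \<notin> monomials p" if "m \<notin> monomials p" for m
  using that monomials_addD by blast
 then have z: "quot_gen a s m y = 0" if "m \<notin> monomials p" for m y
  using that series_onD(2)[OF assms(2)] by (simp add: quot_gen_def)
 show ?thesis
 proof (rule series_onI[OF _ z])
  fix m show "smooth_fun_on (p 0) U (quot_gen a s m)"
   using series_onD(1)[OF assms(2)] smooth_cmult[OF assms(1)] smooth_const[OF assms(1)]
   unfolding quot_gen_def
   by (cases "(SOME b. b \<in># add_mset a m) = a") (simp_all only: if_True if_False refl)
 qed (use series_onD(3)[OF assms(2)] in \<open>auto simp: quot_gen_def\<close>)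
qed

section \<open>Homogeneous components of series and the degrees of monomials\<close>

definition comp_ser :: "int => series => series" where
 "comp_ser k s = (%m y. if mono_degree m = k then s m y else 0)"

lemma comp_ser_on:
 assumes "eopn (p 0) U" "s : series_on p U"
 shows "comp_ser k s : series_on p U"
proof (rule series_onI)
 fix m show "smooth_fun_on (p 0) U (comp_ser k s m)"
  using series_onD[OF assms(2)] smooth_const[OF assms(1)]
  by (cases "mono_degree m = k") (simp_all add: comp_ser_def)
qed (use series_onD[OF assms(2)] in \<open>auto simp: comp_ser_def\<close>)

text \<open>Each generator contributes at most the sum of the absolute degrees of all generators,
  which is finite. This lets the homogeneous components of a series stabilise order by
  order.\<close>

lemma mono_degree_bound:
 assumes "finite (gens p)"
 shows "\<exists>N. \<forall>m\<in>monomials p. size m < n --> \<bar>mono_degree m\<bar> \<le> N"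
proof -
 define B where "B = (\<Sum>a\<in>gens p. \<bar>fst a\<bar>)"
 have B: "\<bar>fst a\<bar> \<le> B" if "a : gens p" for a
  unfolding B_def using that assms by (intro member_le_sum) auto
 have "\<bar>mono_degree m\<bar> \<le> int (size m) * B" if "set_mset m \<subseteq> gens p" for m
  using that
 proof (induction m)
  case (add a m)
  then have "\<bar>mono_degree m\<bar> \<le> int (size m) * B" "\<bar>fst a\<bar> \<le> B" using B by auto
  then show ?case by (simp add: algebra_simps)
 qed simp
 moreover have "B \<ge> 0" by (simp add: B_def sum_nonneg)
 ultimately have "\<bar>mono_degree m\<bar> \<le> int n * B" if "m : monomials p" "size m < n" for m
  using that by (smt (verit) mem_Collect_eq monomials_def mult_right_mono of_nat_less_iff)
 then show ?thesis by blast
qed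

lemma partial_deriv_sum_mult:
 assumes s: "s : series_on p U" and t: "t : series_on p U" and "eopn (p 0) U"
  and y: "y : U" and i: "i < p 0"
 shows "dt i U (series_mult p s t) m y = series_mult p (dt i U s) t m y + series_mult p s (dt i U t) m y"
proof (cases "m : monomials p")
 case False
 then have "series_mult p s t m = (%x. 0)" by (simp add: series_mult_def)
 with False show ?thesis by (simp add: dt_def series_mult_def partial_deriv_def)
next
 case m: True
 have d: "((%r. multisign x z * s x (y(i := r)) * t z (y(i := r))) has_real_derivative
   multisign x z * dt i U s x y * t z y + multisign x z * s x y * dt i U t z y) (at (y i))" for x z
  using DERIV_mult[OF DERIV_cmult[OF smooth_has_partial_deriv[OF series_onD(1)[OF s] y i], of "multisign x z" x]
    smooth_has_partial_deriv[OF series_onD(1)[OF t] y i, of z]] y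
  by (simp only: fun_upd_triv dt_def if_True) (simp only: ac_simps)
 have "partial_deriv i (series_mult p s t m) y =
   (\<Sum>(x, z)\<in>splits m. multisign x z * dt i U s x y * t z y + multisign x z * s x y * dt i U t z y)"
 proof (rule partial_deriv_eqI)
  show "((%r. series_mult p s t m (y(i := r))) has_real_derivative
   (\<Sum>(x, z)\<in>splits m. multisign x z * dt i U s x y * t z y + multisign x z * s x y * dt i U t z y)) (at (y i))"
   unfolding series_mult_splits[OF m] case_prod_unfold by (rule DERIV_sum) (rule d)
 qed
 then have "dt i U (series_mult p s t) m y =
   (\<Sum>(x, z)\<in>splits m. multisign x z * dt i U s x y * t z y + multisign x z * s x y * dt i U t z y)"
  using y by (simp add: dt_def[of i U "series_mult p s t"])
 then show ?thesis
  unfolding series_mult_splits[OF m] by (simp add: case_prod_unfold sum.distrib)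
qed

text \<open>One index set for the coordinates of degree 0 and the generators, so that
  \<open>dd\<close> treats both kinds of partial derivative together; the derivation with index
  \<iota> has degree \<open>- dg \<iota>\<close>.\<close>

type_synonym idx = "nat + gen"

definition idx :: "(int => nat) => idx set" where
 "idx p = Inl ` {..<p 0} \<union> Inr ` gens p"

definition dg :: "idx => int" where
 "dg ii = case_sum (%i. 0) fst ii"

definition coser :: "(nat => real) set => idx => series" where
 "coser U ii = case_sum (%i. fun_series U (%y. y i)) (%a. wser U a) ii"

definition dd :: "idx => (nat => real) set => series => series" where
 "dd ii U s = case_sum (%i. dt i U s) (%a. dw a s) ii"

lemma idx_cases:
 assumes "ii : idx p"
 obtains i where "ii = Inl i" "i < p 0" | a where "ii = Inr a" "a : gens p"
 using assms by (auto simp: idx_def)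

lemma dg_simps [simp]: "dg (Inl i) = 0" "dg (Inr a) = fst a"
 by (simp_all add: dg_def)

lemma finite_idx: "finite (gens p) ==> finite (idx p)"
 by (simp add: idx_def)

lemma coser_on:
 assumes "eopn (p 0) U" "ii : idx p"
 shows "coser U ii : series_on p U"
 using assms by (auto elim!: idx_cases simp: coser_def intro!: fun_series_on linear_series_on smooth_coord)

lemma coser_degree: "mono_degree m ~= dg ii ==> coser U ii m = (%y. 0)"
 by (cases ii) (auto simp: coser_def fun_series_def wser_eq fun_eq_iff)

lemma dd_on:
 assumes "eopn (p 0) U" "s : series_on p U" "ii : idx p"
 shows "dd ii U s : series_on p U"
 using assms by (auto elim!: idx_cases simp: dd_def intro!: dt_on dw_on)

lemma dd_leibniz:
 assumes "s : series_on p U" "t : series_on p U" "eopn (p 0) U" "y : U" "ii : idx p"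
  and hom: "!!m. mono_degree m ~= d ==> s m = (%x. 0)"
 shows "dd ii U (series_mult p s t) m y =
   series_mult p (dd ii U s) t m y + sg (dg ii * d) * series_mult p s (dd ii U t) m y"
 using assms(5)
proof (cases rule: idx_cases)
 case (1 i)
 then show ?thesis using partial_deriv_sum_mult[OF assms(1-4)] by (simp add: dd_def)
next
 case (2 a)
 have "!!m. mono_degree m ~= d ==> s m y = 0" using hom by simp
 from dw_leibniz[OF assms(1,2) this] show ?thesis using 2 by (simp add: dd_def)
qed

lemma dd_add:
 assumes "s : series_on p U" "t : series_on p U" "y : U" "ii : idx p"
 shows "dd ii U (%m y. s m y + t m y) m y = dd ii U s m y + dd ii U t m y"
 using assms(4)
proof (cases rule: idx_cases)
 case (1 i)
 have "partial_deriv i (%y. s m y + t m y) y = partial_deriv i (s m) y + partial_deriv i (t m) y"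
  by (intro partial_deriv_eqI DERIV_add smooth_has_partial_deriv[OF series_onD(1)[OF assms(1)] assms(3) 1(2)]
    smooth_has_partial_deriv[OF series_onD(1)[OF assms(2)] assms(3) 1(2)])
 then show ?thesis using 1 assms by (simp add: dd_def dt_def)
qed (simp add: dd_def dw_def algebra_simps)

lemma dd_smult:
 assumes "s : series_on p U" "y : U" "ii : idx p"
 shows "dd ii U (%m y. r * s m y) m y = r * dd ii U s m y"
 using assms(3)
proof (cases rule: idx_cases)
 case (1 i)
 have "partial_deriv i (%y. r * s m y) y = r * partial_deriv i (s m) y"
  by (intro partial_deriv_eqI DERIV_cmult smooth_has_partial_deriv[OF series_onD(1)[OF assms(1)] assms(2) 1(2)])
 then show ?thesis using 1 assms by (simp add: dd_def dt_def)
qed (simp add: dd_def dw_def algebra_simps)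

text \<open>Partial derivatives are local on open sets, so cutting a series off outside
  \<open>W\<close> commutes with them.\<close>

lemma dd_res:
 assumes "eopn (p 0) W" "W \<subseteq> U" "ii : idx p"
 shows "dd ii W (%m y. if y : W then s m y else 0) = (%m y. if y : W then dd ii U s m y else 0)"
 using assms(3)
proof (cases rule: idx_cases)
 case (1 i)
 have "partial_deriv i (%y. if y : W then s m y else 0) y = partial_deriv i (s m) y" if "y : W" for m y
  by (rule partial_deriv_cong[OF assms(1)]) (use 1 that in auto)
 then show ?thesis using 1 assms(2) by (auto simp: dd_def dt_def fun_eq_iff)
qed (auto simp: dd_def dw_def fun_eq_iff)

lemma dd_degree:
 assumes "!!m. mono_degree m ~= d ==> s m = (%x. 0)" "mono_degree m ~= d - dg ii"
 shows "dd ii U s m = (%x. 0)"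
proof (cases ii)
 case (Inl i)
 then have "s m = (%x. 0)" using assms by simp
 then show ?thesis using Inl by (simp add: dd_def dt_def partial_deriv_def fun_eq_iff)
next
 case (Inr a)
 then have "s (add_mset a m) = (%x. 0)" using assms by (intro assms(1)) auto
 then show ?thesis using Inr by (simp add: dd_def dw_def)
qed

lemma dd_coser:
 assumes "eopn (p 0) U" "y : U" "ii : idx p"
 shows "dd ii U (coser U \<kappa>) m y = (if ii = \<kappa> then fun_series U (%x. 1) m y else 0)"
 using assms(3)
proof (cases rule: idx_cases)
 case (1 i)
 have c: "partial_deriv i (%y. if y : U then c y else 0) y = D"
  if "((%s. c (y(i := s))) has_real_derivative D) (at (y i))" for c D
  by (subst partial_deriv_cong[OF assms(1) _ assms(2) 1(2), of _ c]) (auto intro: partial_deriv_eqI that)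
 show ?thesis
 proof (cases \<kappa>)
  case (Inl j)
  have "coser U \<kappa> m = (%y. if y : U then if m = {#} then y j else 0 else 0)"
   using Inl by (auto simp: coser_def fun_series_def fun_eq_iff)
  moreover have "((%s. if m = {#} then (y(i := s)) j else 0) has_real_derivative
    (if m = {#} & i = j then 1 else 0)) (at (y i))"
   by (cases "i = j"; cases "m = {#}") (auto intro!: derivative_eq_intros)
  note c[OF this]
  ultimately show ?thesis using 1 Inl assms(2) by (simp add: dd_def dt_def) (simp add: fun_series_def)
 next
  case (Inr b)
  have "wser U b m = (%y. if y : U then if m = {#b#} then 1 else 0 else 0)"
   by (auto simp: wser_eq fun_eq_iff)
  moreover have "((%s. if m = {#b#} then 1 else 0 :: real) has_real_derivative 0) (at (y i))" by simp
  note c[OF this]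
  ultimately show ?thesis using 1 Inr assms(2) by (simp add: dd_def coser_def dt_def)
 qed
next
 case (2 a)
 show ?thesis
 proof (cases \<kappa>)
  case (Inl j)
  then show ?thesis using 2 by (simp add: dd_def coser_def dw_def fun_series_def)
 next
  case (Inr b)
  then show ?thesis using 2 assms(2)
   by (auto simp: dd_def coser_def dw_def wser_eq fun_series_def)
 qed
qed

lemma series_mult_add_right:
 "series_mult p s (%m y. t m y + t' m y) m y = series_mult p s t m y + series_mult p s t' m y"
 by (simp add: series_mult_def algebra_simps sum.distrib)

lemma series_mult_cmul_right:
 "series_mult p s (%m y. r * t m y) m y = r * series_mult p s t m y"
 by (simp add: series_mult_def algebra_simps sum_distrib_left)

section \<open>Graded derivations\<close>

lemma supercomm_algebraD:
 assumes "supercomm_algebra A"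
 shows "ring A" "module real_ring A" "formal_grading A"
  "a : hpart A k ==> r \<odot>\<^bsub>A\<^esub> a : hpart A k"
  "\<one>\<^bsub>A\<^esub> : hpart A 0"
  "a : hpart A k ==> b : hpart A l ==> a \<otimes>\<^bsub>A\<^esub> b : hpart A (k + l)"
  "a : hpart A k ==> b : hpart A l ==> a \<otimes>\<^bsub>A\<^esub> b = signed A (k * l) (b \<otimes>\<^bsub>A\<^esub> a)"
 using assms unfolding supercomm_algebra_def by blast+

lemma supercomm_smult_closed:
 assumes "supercomm_algebra A" "a : carrier A"
 shows "r \<odot>\<^bsub>A\<^esub> a : carrier A"
 using module.smult_closed[OF supercomm_algebraD(2)[OF assms(1)], of r a] assms(2)
 by (simp add: real_ring_def)

lemma formal_grading_subgroup:
 assumes "formal_grading A"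
 shows "additive_subgroup (hpart A k) A"
 using assms unfolding formal_grading_def by blast

lemma hpart_carrier:
 assumes "formal_grading A" "a : hpart A k"
 shows "a : carrier A"
 using additive_subgroup.a_subset[OF formal_grading_subgroup[OF assms(1)]] assms(2) by blast


lemma signed_closed:
 assumes "ring A" "x : carrier A"
 shows "signed A n x : carrier A"
proof -
 interpret ring A by fact
 show ?thesis using assms(2) by (simp add: signed_def)
qed

lemma signed_mult:
 assumes "ring A" "x : carrier A" "y : carrier A"
 shows "signed A n x \<otimes>\<^bsub>A\<^esub> y = signed A n (x \<otimes>\<^bsub>A\<^esub> y)" "x \<otimes>\<^bsub>A\<^esub> signed A n y = signed A n (x \<otimes>\<^bsub>A\<^esub> y)"
proof -
 interpret ring A by fact
 show "signed A n x \<otimes>\<^bsub>A\<^esub> y = signed A n (x \<otimes>\<^bsub>A\<^esub> y)" "x \<otimes>\<^bsub>A\<^esub> signed A n y = signed A n (x \<otimes>\<^bsub>A\<^esub> y)"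
  using assms(2,3) by (simp_all add: signed_def l_minus r_minus)
qed

lemma signed_signed:
 assumes "ring A" "x : carrier A"
 shows "signed A n (signed A k x) = signed A (n + k) x"
proof -
 interpret ring A by fact
 show ?thesis using assms(2) by (simp add: signed_def)
qed

lemma signed_add:
 assumes "ring A" "x : carrier A" "y : carrier A"
 shows "signed A n (x \<oplus>\<^bsub>A\<^esub> y) = signed A n x \<oplus>\<^bsub>A\<^esub> signed A n y"
proof -
 interpret ring A by fact
 show ?thesis using assms(2,3) by (simp add: signed_def minus_add)
qed

text \<open>Commuting a past f supplies the sign (-1)^(j m) by which the Leibniz rules for the
  degrees l and j + l differ.\<close>

lemma derivation_cmul:
 assumes A: "supercomm_algebra A" and D: "derivation A l D" and a: "a : hpart A j"
 shows "derivation A (j + l) (%f. a \<otimes>\<^bsub>A\<^esub> D f)"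
proof -
 interpret ring A by (rule supercomm_algebraD(1)[OF A])
 note hc = hpart_carrier[OF supercomm_algebraD(3)[OF A]]
 have ac: "a : carrier A" using a by (rule hc)
 have Dc: "D f : carrier A" if "f : carrier A" for f using D that by (simp add: derivation_def)
 have sm: "a \<otimes>\<^bsub>A\<^esub> (r \<odot>\<^bsub>A\<^esub> f) = r \<odot>\<^bsub>A\<^esub> (a \<otimes>\<^bsub>A\<^esub> f)" if "f : carrier A" for r f
  using A ac that unfolding supercomm_algebra_def by blast
 have leib: "a \<otimes>\<^bsub>A\<^esub> D (f \<otimes>\<^bsub>A\<^esub> g) = (a \<otimes>\<^bsub>A\<^esub> D f \<otimes>\<^bsub>A\<^esub> g) \<oplus>\<^bsub>A\<^esub> signed A ((j + l) * m) (f \<otimes>\<^bsub>A\<^esub> (a \<otimes>\<^bsub>A\<^esub> D g))"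
  if f: "f : hpart A m" and g: "g : carrier A" for m f g
 proof -
  have fc: "f : carrier A" using f by (rule hc)
  have "a \<otimes>\<^bsub>A\<^esub> signed A (l * m) (f \<otimes>\<^bsub>A\<^esub> D g) = signed A (l * m) ((a \<otimes>\<^bsub>A\<^esub> f) \<otimes>\<^bsub>A\<^esub> D g)"
   using ac fc Dc[OF g] by (simp add: signed_mult[OF ring_axioms] m_assoc)
  also have "a \<otimes>\<^bsub>A\<^esub> f = signed A (j * m) (f \<otimes>\<^bsub>A\<^esub> a)" using supercomm_algebraD(7)[OF A a f] .
  also have "signed A (l * m) (signed A (j * m) (f \<otimes>\<^bsub>A\<^esub> a) \<otimes>\<^bsub>A\<^esub> D g) =
    signed A ((j + l) * m) (f \<otimes>\<^bsub>A\<^esub> (a \<otimes>\<^bsub>A\<^esub> D g))"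
   using ac fc Dc[OF g]
   by (simp add: signed_mult[OF ring_axioms] signed_signed[OF ring_axioms] m_assoc algebra_simps)
  finally have 1: "a \<otimes>\<^bsub>A\<^esub> signed A (l * m) (f \<otimes>\<^bsub>A\<^esub> D g) = signed A ((j + l) * m) (f \<otimes>\<^bsub>A\<^esub> (a \<otimes>\<^bsub>A\<^esub> D g))" .
  have "D (f \<otimes>\<^bsub>A\<^esub> g) = (D f \<otimes>\<^bsub>A\<^esub> g) \<oplus>\<^bsub>A\<^esub> signed A (l * m) (f \<otimes>\<^bsub>A\<^esub> D g)"
   using D f g by (simp add: derivation_def)
  then show ?thesis using 1 ac fc g Dc[OF g] Dc[OF fc]
   by (simp add: r_distr signed_closed[OF ring_axioms] m_assoc)
 qed
 have deg: "a \<otimes>\<^bsub>A\<^esub> D f : hpart A (m + (j + l))" if "f : hpart A m" for m f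
 proof -
  have "D f : hpart A (m + l)" using D that by (simp add: derivation_def)
  from supercomm_algebraD(6)[OF A a this] show ?thesis by (simp add: algebra_simps)
 qed
 show ?thesis
  using D ac Dc sm leib deg by (simp add: derivation_def r_distr)
qed

lemma derivation_add:
 assumes A: "supercomm_algebra A" and D: "derivation A l D" and E: "derivation A l E"
 shows "derivation A l (%f. D f \<oplus>\<^bsub>A\<^esub> E f)"
proof -
 interpret ring A by (rule supercomm_algebraD(1)[OF A])
 interpret mo: module real_ring A by (rule supercomm_algebraD(2)[OF A])
 note hc = hpart_carrier[OF supercomm_algebraD(3)[OF A]]
 have c: "D f : carrier A" "E f : carrier A" if "f : carrier A" for f
  using D E that by (simp_all add: derivation_def)
 have sm: "r \<odot>\<^bsub>A\<^esub> (x \<oplus>\<^bsub>A\<^esub> y) = r \<odot>\<^bsub>A\<^esub> x \<oplus>\<^bsub>A\<^esub> r \<odot>\<^bsub>A\<^esub> y" if "x : carrier A" "y : carrier A" for r x y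
  using mo.smult_r_distr[of r x y] that by (simp add: real_ring_def)
 have leib: "D (f \<otimes>\<^bsub>A\<^esub> g) \<oplus>\<^bsub>A\<^esub> E (f \<otimes>\<^bsub>A\<^esub> g) = ((D f \<oplus>\<^bsub>A\<^esub> E f) \<otimes>\<^bsub>A\<^esub> g) \<oplus>\<^bsub>A\<^esub> signed A (l * m) (f \<otimes>\<^bsub>A\<^esub> (D g \<oplus>\<^bsub>A\<^esub> E g))"
  if f: "f : hpart A m" and g: "g : carrier A" for m f g
 proof -
  have fc: "f : carrier A" using f by (rule hc)
  have "D (f \<otimes>\<^bsub>A\<^esub> g) = (D f \<otimes>\<^bsub>A\<^esub> g) \<oplus>\<^bsub>A\<^esub> signed A (l * m) (f \<otimes>\<^bsub>A\<^esub> D g)"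
   "E (f \<otimes>\<^bsub>A\<^esub> g) = (E f \<otimes>\<^bsub>A\<^esub> g) \<oplus>\<^bsub>A\<^esub> signed A (l * m) (f \<otimes>\<^bsub>A\<^esub> E g)"
   using D E f g by (simp_all add: derivation_def)
  then show ?thesis using fc g c
   by (simp add: l_distr r_distr signed_add[OF ring_axioms] signed_closed[OF ring_axioms] a_ac)
 qed
 have deg: "D f \<oplus>\<^bsub>A\<^esub> E f : hpart A (m + l)" if "f : hpart A m" for m f
  using D E that additive_subgroup.a_closed[OF formal_grading_subgroup[OF supercomm_algebraD(3)[OF A]]]
  by (simp add: derivation_def)
 have ad: "D (f \<oplus>\<^bsub>A\<^esub> g) \<oplus>\<^bsub>A\<^esub> E (f \<oplus>\<^bsub>A\<^esub> g) = (D f \<oplus>\<^bsub>A\<^esub> E f) \<oplus>\<^bsub>A\<^esub> (D g \<oplus>\<^bsub>A\<^esub> E g)"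
  if "f : carrier A" "g : carrier A" for f g
  using D E c that by (simp add: derivation_def a_ac)
 show ?thesis
  using D E c sm leib deg ad by (simp add: derivation_def)
qed

lemma derivation_zero:
 assumes A: "supercomm_algebra A"
 shows "derivation A l (%f. \<zero>\<^bsub>A\<^esub>)"
proof -
 interpret ring A by (rule supercomm_algebraD(1)[OF A])
 interpret mo: module real_ring A by (rule supercomm_algebraD(2)[OF A])
 have "r \<odot>\<^bsub>A\<^esub> \<zero>\<^bsub>A\<^esub> = \<zero>\<^bsub>A\<^esub>" for r using mo.smult_r_null[of r] by (simp add: real_ring_def)
 moreover have "\<zero>\<^bsub>A\<^esub> : hpart A k" for k
  by (rule additive_subgroup.zero_closed[OF formal_grading_subgroup[OF supercomm_algebraD(3)[OF A]]])
 ultimately show ?thesis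
  using hpart_carrier[OF supercomm_algebraD(3)[OF A]] by (auto simp: derivation_def signed_def)
qed

text \<open>\<open>derivation\<close> consults the map on the carrier only, whereas sheaf
  endomorphisms are normalised outside it.\<close>

lemma derivation_cong:
 assumes A: "supercomm_algebra A" and "derivation A k D" and eq: "!!f. f : carrier A ==> D f = E f"
 shows "derivation A k E"
proof -
 interpret ring A by (rule supercomm_algebraD(1)[OF A])
 note hc = hpart_carrier[OF supercomm_algebraD(3)[OF A]] supercomm_smult_closed[OF A]
 show ?thesis using assms(2) hc unfolding derivation_def
  by (simp add: eq[symmetric])
qed

lemma derivation_finsum:
 assumes A: "supercomm_algebra A" and "finite I" "!!i. i : I ==> derivation A k (D i)"
 shows "derivation A k (%f. \<Oplus>\<^bsub>A\<^esub>i\<in>I. D i f)"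
 using assms(2,3)
proof (induction I)
 case empty
 interpret ring A by (rule supercomm_algebraD(1)[OF A])
 show ?case using derivation_zero[OF A] by simp
next
 case (insert i I)
 interpret ring A by (rule supercomm_algebraD(1)[OF A])
 have "derivation A k (%f. D i f \<oplus>\<^bsub>A\<^esub> (\<Oplus>\<^bsub>A\<^esub>i\<in>I. D i f))"
  using insert by (intro derivation_add[OF A]) auto
 moreover have "D i f \<oplus>\<^bsub>A\<^esub> (\<Oplus>\<^bsub>A\<^esub>i\<in>I. D i f) = (\<Oplus>\<^bsub>A\<^esub>i\<in>insert i I. D i f)" if "f : carrier A" for f
  using insert that by (subst finsum_insert) (auto simp: derivation_def)
 ultimately show ?case by (rule derivation_cong[OF A])
qed

text \<open>The Leibniz rule for the product of 1 with itself, without sign because 1 has degree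
  0.\<close>

lemma derivation_one:
 assumes A: "supercomm_algebra A" and D: "derivation A k D"
 shows "D \<one>\<^bsub>A\<^esub> = \<zero>\<^bsub>A\<^esub>"
proof -
 interpret ring A by (rule supercomm_algebraD(1)[OF A])
 have c: "D \<one>\<^bsub>A\<^esub> : carrier A" using D by (simp add: derivation_def)
 have "D (\<one>\<^bsub>A\<^esub> \<otimes>\<^bsub>A\<^esub> \<one>\<^bsub>A\<^esub>) = (D \<one>\<^bsub>A\<^esub> \<otimes>\<^bsub>A\<^esub> \<one>\<^bsub>A\<^esub>) \<oplus>\<^bsub>A\<^esub> signed A (k * 0) (\<one>\<^bsub>A\<^esub> \<otimes>\<^bsub>A\<^esub> D \<one>\<^bsub>A\<^esub>)"
  using D supercomm_algebraD(5)[OF A] unfolding derivation_def by blast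
 then have "D \<one>\<^bsub>A\<^esub> = D \<one>\<^bsub>A\<^esub> \<oplus>\<^bsub>A\<^esub> D \<one>\<^bsub>A\<^esub>" using c by (simp add: signed_def)
 then show ?thesis using c by (metis add.r_cancel_one')
qed

lemma derivation_finsum_arg:
 assumes A: "supercomm_algebra A" and D: "derivation A k D" and "finite I" "F : I \<rightarrow> carrier A"
 shows "D (\<Oplus>\<^bsub>A\<^esub>i\<in>I. F i) = (\<Oplus>\<^bsub>A\<^esub>i\<in>I. D (F i))"
proof -
 interpret ring A by (rule supercomm_algebraD(1)[OF A])
 interpret mo: module real_ring A by (rule supercomm_algebraD(2)[OF A])
 have Dc: "D f : carrier A" if "f : carrier A" for f using D that by (simp add: derivation_def)
 have Da: "D (f \<oplus>\<^bsub>A\<^esub> g) = D f \<oplus>\<^bsub>A\<^esub> D g" if "f : carrier A" "g : carrier A" for f g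
  using D that by (simp add: derivation_def)
 have D0: "D \<zero>\<^bsub>A\<^esub> = \<zero>\<^bsub>A\<^esub>" using Da[of "\<zero>\<^bsub>A\<^esub>" "\<zero>\<^bsub>A\<^esub>"] Dc[of "\<zero>\<^bsub>A\<^esub>"] by (metis add.r_cancel_one' l_zero zero_closed)
 from assms(3,4) show ?thesis
 proof (induction I)
  case (insert i I)
  then have c: "F i : carrier A" "(\<Oplus>\<^bsub>A\<^esub>i\<in>I. F i) : carrier A" by auto
  have "D (\<Oplus>\<^bsub>A\<^esub>i\<in>insert i I. F i) = D (F i) \<oplus>\<^bsub>A\<^esub> D (\<Oplus>\<^bsub>A\<^esub>i\<in>I. F i)"
   using insert c by (subst finsum_insert) (auto simp: Da)
  also have "\<dots> = D (F i) \<oplus>\<^bsub>A\<^esub> (\<Oplus>\<^bsub>A\<^esub>i\<in>I. D (F i))" using insert by auto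
  also have "\<dots> = (\<Oplus>\<^bsub>A\<^esub>i\<in>insert i I. D (F i))"
   using insert Dc by (subst finsum_insert) (auto simp: Pi_iff)
  finally show ?case .
 qed (simp add: D0)
qed

lemma presheafD:
 assumes "is_presheaf S"
 shows "!!U W s. opn S U ==> opn S W ==> W \<subseteq> U ==> s : sects S U ==>
   res S U W s : sects S W"
  and "!!U W s t. opn S U ==> opn S W ==> W \<subseteq> U ==> s : sects S U ==>
   t : sects S U ==> res S U W (s \<oplus>\<^bsub>sec S U\<^esub> t) = res S U W s \<oplus>\<^bsub>sec S W\<^esub> res S U W t"
  and "!!U W s k. opn S U ==> opn S W ==> W \<subseteq> U ==> s : hpart (sec S U) k ==>
   res S U W s : hpart (sec S W) k"
  and "!!U s. opn S U ==> s : sects S U ==> res S U U s = s"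
  and "!!U W X s. opn S U ==> opn S W ==> opn S X ==> X \<subseteq> W ==> W \<subseteq> U ==>
   s : sects S U ==> res S W X (res S U W s) = res S U X s"
 using assms unfolding is_presheaf_def by simp_all

section \<open>Coordinate charts\<close>

definition opens_in :: "('x, 'r, 'a) gpresheaf => 'x set => 'x set => bool" where
 "opens_in S V U \<longleftrightarrow> opn S U & U \<subseteq> V"

text \<open>\<open>Ps U\<close> reads off the coefficients of a section over \<open>U\<close> as functions on \<open>h ` U\<close>.\<close>

locale chart =
 fixes S :: "('x, real, 'a) gpresheaf" and V :: "'x set" and p :: "int => nat"
  and h :: "'x => nat => real" and Ps :: "'x set => 'a => series"
 assumes presheaf: "is_presheaf S" and V_open: "opn S V" and fin: "finite (gens p)"
  and inj: "inj_on h V"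
  and pre_open: "eopn (p 0) B ==> opn S {x : V. h x : B}"
  and img_open: "opens_in S V U ==> eopn (p 0) (h ` U)"
  and alg: "opens_in S V U ==> supercomm_algebra (sec S U)"
  and res_hom: "opens_in S V U ==> opens_in S V W ==> W \<subseteq> U ==> res S U W : ring_hom (sec S U) (sec S W)"
  and res_smult: "opens_in S V U ==> opens_in S V W ==> W \<subseteq> U ==> f : sects S U ==>
    res S U W (r \<odot>\<^bsub>sec S U\<^esub> f) = r \<odot>\<^bsub>sec S W\<^esub> res S U W f"
  and Psi_bij: "opens_in S V U ==> bij_betw (Ps U) (sects S U) (series_on p (h ` U))"
  and Psi_add: "opens_in S V U ==> f : sects S U ==> g : sects S U ==>
    Ps U (f \<oplus>\<^bsub>sec S U\<^esub> g) = (%m y. Ps U f m y + Ps U g m y)"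
  and Psi_mult: "opens_in S V U ==> f : sects S U ==> g : sects S U ==>
    Ps U (f \<otimes>\<^bsub>sec S U\<^esub> g) = series_mult p (Ps U f) (Ps U g)"
  and Psi_smult: "opens_in S V U ==> f : sects S U ==> Ps U (r \<odot>\<^bsub>sec S U\<^esub> f) = (%m y. r * Ps U f m y)"
  and Psi_one: "opens_in S V U ==> Ps U \<one>\<^bsub>sec S U\<^esub> = fun_series (h ` U) (%x. 1)"
  and Psi_res: "opens_in S V U ==> opens_in S V W ==> W \<subseteq> U ==> f : sects S U ==>
    Ps W (res S U W f) = (%m y. if y : h ` W then Ps U f m y else 0)"
  and Psi_hpart: "opens_in S V U ==> f : sects S U ==>
    f : hpart (sec S U) k \<longleftrightarrow> (\<forall>m. mono_degree m ~= k --> Ps U f m = (%x. 0))"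
begin

abbreviation dom :: "'x set => bool" where "dom \<equiv> opens_in S V"
abbreviation "OS U \<equiv> sec S U"
lemmas dom_def = opens_in_def[of S V]

lemma domD: "dom U ==> opn S U" "dom U ==> U \<subseteq> V"
 by (simp_all add: dom_def)

lemma dom_subset: "dom U ==> opn S W ==> W \<subseteq> U ==> dom W"
 by (auto simp: dom_def)

lemma dom_V: "dom V" by (simp add: dom_def V_open)

lemma ringO: "dom U ==> ring (OS U)"
 using alg supercomm_algebraD(1) by blast

lemma res_closed: "dom U ==> dom W ==> W \<subseteq> U ==> f : sects S U ==> res S U W f : sects S W"
 using res_hom ring_hom_closed by metis

lemma res_id: "dom U ==> f : sects S U ==> res S U U f = f"
 unfolding dom_def by (rule presheafD(4)[OF presheaf]) simp_all

lemma res_hpart: "dom U ==> dom W ==> W \<subseteq> U ==> f : hpart (OS U) k ==> res S U W f : hpart (OS W) k"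
 unfolding dom_def by (rule presheafD(3)[OF presheaf]) simp_all

lemma Psi_on: "dom U ==> f : sects S U ==> Ps U f : series_on p (h ` U)"
 using Psi_bij by (auto simp: bij_betw_def)

lemma hpartD: "dom U ==> f : hpart (OS U) k ==> f : sects S U"
 using hpart_carrier[OF supercomm_algebraD(3)[OF alg]] .

lemma eqI:
 assumes "dom U" "f : sects S U" "g : sects S U"
  and "!!m y. m : monomials p ==> y : h ` U ==> Ps U f m y = Ps U g m y"
 shows "f = g"
proof -
 have "Ps U f m y = Ps U g m y" for m y
  using assms(4) series_onD(2,3)[OF Psi_on[OF assms(1,2)]] series_onD(2,3)[OF Psi_on[OF assms(1,3)]]
  by metis
 then have "Ps U f = Ps U g" by (intro ext)
 then show ?thesis using Psi_bij assms(1-3) by (auto simp: bij_betw_def dest: inj_onD)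
qed

lemma Psi_zero: assumes "dom U" shows "Ps U \<zero>\<^bsub>OS U\<^esub> = (%m y. 0)"
proof -
 interpret ring "OS U" by (rule ringO[OF assms])
 have "Ps U \<zero>\<^bsub>OS U\<^esub> = (%m y. Ps U \<zero>\<^bsub>OS U\<^esub> m y + Ps U \<zero>\<^bsub>OS U\<^esub> m y)"
  using Psi_add[OF assms zero_closed zero_closed] by simp
 then show ?thesis by (simp add: fun_eq_iff)
qed

lemma Psi_uminus:
 assumes "dom U" "f : sects S U"
 shows "Ps U (\<ominus>\<^bsub>OS U\<^esub> f) = (%m y. - Ps U f m y)"
proof -
 interpret ring "OS U" by (rule ringO[OF assms(1)])
 have "(%m y. Ps U (\<ominus>\<^bsub>OS U\<^esub> f) m y + Ps U f m y) = (%m y. 0)"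
  using Psi_add[OF assms(1) a_inv_closed[OF assms(2)] assms(2)] Psi_zero[OF assms(1)] assms(2)
  by (simp add: l_neg)
 then show ?thesis by (simp add: fun_eq_iff add_eq_0_iff2)
qed

lemma Psi_minus:
 assumes "dom U" "f : sects S U" "g : sects S U"
 shows "Ps U (f \<ominus>\<^bsub>OS U\<^esub> g) = (%m y. Ps U f m y - Ps U g m y)"
proof -
 interpret ring "OS U" by (rule ringO[OF assms(1)])
 show ?thesis using assms by (simp add: a_minus_def Psi_add Psi_uminus)
qed

lemma Psi_signed:
 assumes "dom U" "f : sects S U"
 shows "Ps U (signed (OS U) n f) = (%m y. sg n * Ps U f m y)"
 using assms by (simp add: signed_def Psi_uminus)

lemma Psi_finsum:
 assumes "dom U" "finite I" "F : I \<rightarrow> sects S U"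
 shows "Ps U (\<Oplus>\<^bsub>OS U\<^esub>i\<in>I. F i) = (%m y. \<Sum>i\<in>I. Ps U (F i) m y)"
proof -
 interpret ring "OS U" by (rule ringO[OF assms(1)])
 from assms(2,3) show ?thesis
  by (induction I) (auto simp: Psi_zero[OF assms(1)] Psi_add[OF assms(1)])
qed

section \<open>Coordinate sections and partial derivatives on a chart\<close>

definition sect :: "'x set => series => 'a" where
 "sect U s = inv_into (sects S U) (Ps U) s"

lemma sect_closed: "dom U ==> s : series_on p (h ` U) ==> sect U s : sects S U"
 using Psi_bij[of U] inv_into_into[of s "Ps U" "sects S U"]
 by (simp add: dom_def sect_def bij_betw_def)

lemma Psi_sect: "dom U ==> s : series_on p (h ` U) ==> Ps U (sect U s) = s"
 using Psi_bij[of U] f_inv_into_f[of s "Ps U" "sects S U"]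
 by (simp add: dom_def sect_def bij_betw_def)

definition co :: "'x set => idx => 'a" where
 "co U ii = sect U (coser (h ` U) ii)"

definition pd :: "idx => 'x set => 'a => 'a" where
 "pd ii U f = sect U (dd ii (h ` U) (Ps U f))"

lemma co_closed: "dom U ==> ii : idx p ==> co U ii : sects S U"
 unfolding co_def by (intro sect_closed coser_on img_open)

lemma Psi_co: "dom U ==> ii : idx p ==> Ps U (co U ii) = coser (h ` U) ii"
 unfolding co_def by (intro Psi_sect coser_on img_open)

lemma co_hpart: "dom U ==> ii : idx p ==> co U ii : hpart (OS U) (dg ii)"
 by (simp add: Psi_hpart co_closed Psi_co coser_degree)

lemma co_res:
 assumes "dom U" "dom W" "W \<subseteq> U" "ii : idx p"
 shows "res S U W (co U ii) = co W ii"
proof (rule eqI[OF assms(2)])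
 have "h ` W \<subseteq> h ` U" using assms by blast
 fix m y assume "y : h ` W"
 then show "Ps W (res S U W (co U ii)) m y = Ps W (co W ii) m y"
  using assms \<open>h ` W \<subseteq> h ` U\<close> by (cases ii) (auto simp: Psi_res co_closed Psi_co coser_def fun_series_def wser_eq)
qed (use assms in \<open>auto intro: res_closed co_closed\<close>)

lemma pd_closed: "dom U ==> ii : idx p ==> f : sects S U ==> pd ii U f : sects S U"
 unfolding pd_def by (intro sect_closed dd_on img_open Psi_on)

lemma Psi_pd: "dom U ==> ii : idx p ==> f : sects S U ==> Ps U (pd ii U f) = dd ii (h ` U) (Ps U f)"
 unfolding pd_def by (intro Psi_sect dd_on img_open Psi_on)

lemma pd_res:
 assumes "dom U" "dom W" "W \<subseteq> U" "ii : idx p" "f : sects S U"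
 shows "pd ii W (res S U W f) = res S U W (pd ii U f)"
proof (rule eqI[OF assms(2)])
 have sub: "h ` W \<subseteq> h ` U" using assms by blast
 fix m y
 show "Ps W (pd ii W (res S U W f)) m y = Ps W (res S U W (pd ii U f)) m y"
  using assms by (simp add: Psi_res pd_closed Psi_pd res_closed dd_res[OF img_open[OF assms(2)] sub assms(4)])
qed (use assms in \<open>auto intro: res_closed pd_closed\<close>)

lemma pd_derivation:
 assumes U: "dom U" and i: "ii : idx p"
 shows "derivation (OS U) (- dg ii) (pd ii U)"
 unfolding derivation_def
proof (intro conjI ballI allI)
 interpret ring "OS U" by (rule ringO[OF U])
 note c = pd_closed[OF U i] and Pp = Psi_pd[OF U i] and sc = supercomm_smult_closed[OF alg[OF U]]
 fix f assume f: "f : sects S U"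
 show "pd ii U f : sects S U" by (rule c[OF f])
 show "pd ii U (f \<oplus>\<^bsub>OS U\<^esub> g) = pd ii U f \<oplus>\<^bsub>OS U\<^esub> pd ii U g" if g: "g : sects S U" for g
  by (rule eqI[OF U]) (use f g c U i in \<open>simp_all add: Pp Psi_add dd_add[OF Psi_on[OF U f] Psi_on[OF U g]]\<close>)
 show "pd ii U (r \<odot>\<^bsub>OS U\<^esub> f) = r \<odot>\<^bsub>OS U\<^esub> pd ii U f" for r
  by (rule eqI[OF U]) (use f sc c U i in \<open>simp_all add: Pp Psi_smult dd_smult[OF Psi_on[OF U f]]\<close>)
next
 interpret ring "OS U" by (rule ringO[OF U])
 note c = pd_closed[OF U i] and Pp = Psi_pd[OF U i]
 fix d f assume fd: "f : hpart (OS U) d"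
 have f: "f : sects S U" by (rule hpartD[OF U fd])
 have hom: "mono_degree m ~= d ==> Ps U f m = (%x. 0)" for m using fd Psi_hpart[OF U f] by blast
 show "pd ii U f : hpart (OS U) (d + - dg ii)"
  unfolding Psi_hpart[OF U c[OF f]] Pp[OF f] using dd_degree[OF hom] by simp
 fix g assume g: "g : sects S U"
 show "pd ii U (f \<otimes>\<^bsub>OS U\<^esub> g) = (pd ii U f \<otimes>\<^bsub>OS U\<^esub> g) \<oplus>\<^bsub>OS U\<^esub> signed (OS U) (- dg ii * d) (f \<otimes>\<^bsub>OS U\<^esub> pd ii U g)"
 proof (rule eqI[OF U])
  fix m y assume y: "y : h ` U"
  show "Ps U (pd ii U (f \<otimes>\<^bsub>OS U\<^esub> g)) m y =
    Ps U ((pd ii U f \<otimes>\<^bsub>OS U\<^esub> g) \<oplus>\<^bsub>OS U\<^esub> signed (OS U) (- dg ii * d) (f \<otimes>\<^bsub>OS U\<^esub> pd ii U g)) m y"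
   using f g c[OF f] c[OF g]
   by (simp add: Pp Psi_mult[OF U] Psi_add[OF U] Psi_signed[OF U] signed_closed[OF ring_axioms]
     dd_leibniz[OF Psi_on[OF U f] Psi_on[OF U g] img_open[OF U] y i hom])
 qed (use f g c signed_closed[OF ring_axioms] in auto)
qed

lemma pd_co:
 assumes "dom U" "ii : idx p" "\<kappa> : idx p"
 shows "pd ii U (co U \<kappa>) = (if ii = \<kappa> then \<one>\<^bsub>OS U\<^esub> else \<zero>\<^bsub>OS U\<^esub>)"
proof -
 interpret ring "OS U" by (rule ringO[OF assms(1)])
 show ?thesis
  by (rule eqI[OF assms(1)]) (use assms in \<open>auto simp: pd_closed co_closed Psi_pd Psi_co Psi_one Psi_zero
    dd_coser[where p = p, OF img_open[OF assms(1)]]\<close>)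
qed

text \<open>The linear combination of the partial derivatives with coefficients c. It is
  \<open>undefined\<close> off its domain because \<open>sheaf_endo\<close> prescribes this, which
  makes equal derivations equal functions.\<close>

definition LC :: "'x set => (idx => 'a) => 'x set => 'a => 'a" where
 "LC V0 c = (%U f. if opn S U & U \<subseteq> V0 & f : sects S U
   then \<Oplus>\<^bsub>OS U\<^esub>ii\<in>idx p. res S V0 U (c ii) \<otimes>\<^bsub>OS U\<^esub> pd ii U f else undefined)"

lemma LC_eq:
 "dom V0 ==> dom U ==> U \<subseteq> V0 ==> f : sects S U ==>
  LC V0 c U f = (\<Oplus>\<^bsub>OS U\<^esub>ii\<in>idx p. res S V0 U (c ii) \<otimes>\<^bsub>OS U\<^esub> pd ii U f)"
 by (simp add: LC_def dom_def)

lemma LC_term_closed: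
 assumes "dom V0" "dom U" "U \<subseteq> V0" "f : sects S U" "!!ii. ii : idx p ==> c ii : sects S V0"
 shows "(%ii. res S V0 U (c ii) \<otimes>\<^bsub>OS U\<^esub> pd ii U f) : idx p \<rightarrow> sects S U"
proof -
 interpret ring "OS U" by (rule ringO[OF assms(2)])
 show ?thesis using assms by (auto intro!: m_closed res_closed pd_closed)
qed

lemma LC_closed:
 assumes "dom V0" "dom U" "U \<subseteq> V0" "f : sects S U" "!!ii. ii : idx p ==> c ii : sects S V0"
 shows "LC V0 c U f : sects S U"
proof -
 interpret ring "OS U" by (rule ringO[OF assms(2)])
 show ?thesis unfolding LC_eq[OF assms(1-4)] by (rule finsum_closed[OF LC_term_closed[OF assms]])
qed

text \<open>The restriction of the coefficients disappears: the coefficients of a product at y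
  depend on those of its factors at y alone.\<close>

lemma Psi_LC:
 assumes "dom V0" "dom U" "U \<subseteq> V0" "f : sects S U" "!!ii. ii : idx p ==> c ii : sects S V0" "y : h ` U"
 shows "Ps U (LC V0 c U f) m y = (\<Sum>ii\<in>idx p. series_mult p (Ps V0 (c ii)) (Ps U (pd ii U f)) m y)"
proof -
 have "Ps U (LC V0 c U f) m y = (\<Sum>ii\<in>idx p. series_mult p (Ps U (res S V0 U (c ii))) (Ps U (pd ii U f)) m y)"
  unfolding LC_eq[OF assms(1-4)]
  by (subst Psi_finsum[OF assms(2) finite_idx[OF fin] LC_term_closed[OF assms(1-5)]])
   (use assms in \<open>auto intro!: sum.cong simp: Psi_mult res_closed pd_closed\<close>)
 also have "\<dots> = (\<Sum>ii\<in>idx p. series_mult p (Ps V0 (c ii)) (Ps U (pd ii U f)) m y)"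
  by (intro sum.cong refl series_mult_cong) (use assms in \<open>auto simp: Psi_res\<close>)
 finally show ?thesis .
qed

lemma LC_res:
 assumes "dom V0" "dom U" "U \<subseteq> V0" "dom W" "W \<subseteq> U" "f : sects S U" "!!ii. ii : idx p ==> c ii : sects S V0"
 shows "LC V0 c W (res S U W f) = res S U W (LC V0 c U f)"
proof (rule eqI[OF assms(4)])
 have WV: "W \<subseteq> V0" using assms by blast
 note rc = res_closed[OF assms(2,4,5,6)]
 show "LC V0 c W (res S U W f) : sects S W" "res S U W (LC V0 c U f) : sects S W"
  using LC_closed[OF assms(1,4) WV rc assms(7)] res_closed[OF assms(2,4,5) LC_closed[OF assms(1-3,6,7)]] by auto
 fix m y assume y: "y : h ` W"
 then have yU: "y : h ` U" using assms by blast
 show "Ps W (LC V0 c W (res S U W f)) m y = Ps W (res S U W (LC V0 c U f)) m y"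
  using y yU assms LC_closed[OF assms(1-3,6,7)] rc WV
  by (simp add: Psi_LC Psi_res pd_res pd_closed cong: sum.cong)
   (intro sum.cong refl series_mult_cong, auto simp: Psi_res pd_closed)
qed

lemma LC_derivation:
 assumes "dom V0" "dom U" "U \<subseteq> V0" "!!ii. ii : idx p ==> c ii : hpart (OS V0) (k + dg ii)"
 shows "derivation (OS U) k (LC V0 c U)"
proof -
 interpret ring "OS U" by (rule ringO[OF assms(2)])
 have "derivation (OS U) k (%f. \<Oplus>\<^bsub>OS U\<^esub>ii\<in>idx p. res S V0 U (c ii) \<otimes>\<^bsub>OS U\<^esub> pd ii U f)"
 proof (rule derivation_finsum[OF alg[OF assms(2)] finite_idx[OF fin]])
  fix ii assume i: "ii : idx p"
  from derivation_cmul[OF alg[OF assms(2)] pd_derivation[OF assms(2) i] res_hpart[OF assms(1,2,3) assms(4)[OF i]]]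
  show "derivation (OS U) k (%f. res S V0 U (c ii) \<otimes>\<^bsub>OS U\<^esub> pd ii U f)" by simp
 qed
 then show ?thesis
  by (rule derivation_cong[OF alg[OF assms(2)]]) (simp add: LC_eq[OF assms(1-3)])
qed

lemma LC_co:
 assumes "dom V0" "!!ii. ii : idx p ==> c ii : sects S V0" "\<kappa> : idx p"
 shows "LC V0 c V0 (co V0 \<kappa>) = c \<kappa>"
proof -
 interpret ring "OS V0" by (rule ringO[OF assms(1)])
 have "LC V0 c V0 (co V0 \<kappa>) = (\<Oplus>\<^bsub>OS V0\<^esub>ii\<in>idx p. if \<kappa> = ii then c ii else \<zero>\<^bsub>OS V0\<^esub>)"
  unfolding LC_eq[OF assms(1,1) subset_refl co_closed[OF assms(1,3)]]
  by (rule finsum_cong') (use assms in \<open>auto simp: res_id pd_co\<close>)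
 also have "\<dots> = c \<kappa>" by (rule finsum_singleton) (use assms finite_idx[OF fin] in auto)
 finally show ?thesis .
qed

text \<open>Inhomogeneous coefficients are allowed, so this cannot be deduced from
  \<open>LC_derivation\<close>; the laws are compared coefficient by coefficient.\<close>

lemma LC_sheaf_endo:
 assumes "dom V0" "!!ii. ii : idx p ==> c ii : sects S V0"
 shows "LC V0 c : sheaf_endo S V0"
 unfolding sheaf_endo_def
proof (intro CollectI conjI allI impI ballI)
 fix U f assume "\<not> (opn S U & U \<subseteq> V0 & f : sects S U)"
 then show "LC V0 c U f = undefined" by (auto simp: LC_def)
next
 fix U assume "opn S U & U \<subseteq> V0"
 then have U: "dom U" "U \<subseteq> V0" using dom_subset[OF assms(1)] by auto
 interpret ring "OS U" by (rule ringO[OF U(1)])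
 note cl = LC_closed[OF assms(1) U _ assms(2)]
 note ev = Psi_LC[OF assms(1) U _ assms(2)]
 note pdd = pd_derivation[OF U(1), unfolded derivation_def]
 note sc = supercomm_smult_closed[OF alg[OF U(1)]]
 fix f assume f: "f : sects S U"
 show "LC V0 c U f : sects S U" by (rule cl[OF f])
 show "LC V0 c U (f \<oplus>\<^bsub>OS U\<^esub> g) = LC V0 c U f \<oplus>\<^bsub>OS U\<^esub> LC V0 c U g" if g: "g : sects S U" for g
 proof (rule eqI[OF U(1)])
  fix m y assume y: "y : h ` U"
  have "pd ii U (f \<oplus>\<^bsub>OS U\<^esub> g) = pd ii U f \<oplus>\<^bsub>OS U\<^esub> pd ii U g" if "ii : idx p" for ii
   using pdd[OF that] f g by blast
  then show "Ps U (LC V0 c U (f \<oplus>\<^bsub>OS U\<^esub> g)) m y = Ps U (LC V0 c U f \<oplus>\<^bsub>OS U\<^esub> LC V0 c U g) m y"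
   using f g y cl U
   by (simp add: ev Psi_add pd_closed cong: sum.cong)
    (simp add: series_mult_add_right sum.distrib)
 qed (use f g cl in auto)
 show "LC V0 c U (r \<odot>\<^bsub>OS U\<^esub> f) = r \<odot>\<^bsub>OS U\<^esub> LC V0 c U f" for r
 proof (rule eqI[OF U(1)])
  fix m y assume y: "y : h ` U"
  have "pd ii U (r \<odot>\<^bsub>OS U\<^esub> f) = r \<odot>\<^bsub>OS U\<^esub> pd ii U f" if "ii : idx p" for ii
   using pdd[OF that] f by blast
  then show "Ps U (LC V0 c U (r \<odot>\<^bsub>OS U\<^esub> f)) m y = Ps U (r \<odot>\<^bsub>OS U\<^esub> LC V0 c U f) m y"
   using f y cl U sc
   by (simp add: ev Psi_smult pd_closed cong: sum.cong)
    (simp add: series_mult_cmul_right sum_distrib_left)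
 qed (use f cl sc in auto)
 fix W assume "opn S W & W \<subseteq> U"
 then have W: "dom W" "W \<subseteq> U" using dom_subset[OF U(1)] by auto
 show "LC V0 c W (res S U W f) = res S U W (LC V0 c U f)"
  by (rule LC_res[OF assms(1) U W f assms(2)])
qed

lemma LC_derivations:
 assumes "dom V0" "!!ii. ii : idx p ==> c ii : hpart (OS V0) (k + dg ii)"
 shows "LC V0 c : derivations S V0 k"
 unfolding derivations_def
proof (intro CollectI conjI allI impI)
 show "LC V0 c : sheaf_endo S V0"
  by (rule LC_sheaf_endo[OF assms(1)]) (use assms hpartD in auto)
 fix U assume "opn S U & U \<subseteq> V0"
 then show "derivation (OS U) k (LC V0 c U)"
  using LC_derivation[OF assms(1) _ _ assms(2)] dom_subset[OF assms(1)] by simp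
qed

end

lemma sheaf_endoD:
 assumes "X : sheaf_endo S V"
 shows "!!U f. opn S U ==> U \<subseteq> V ==> f : sects S U ==> X U f : sects S U"
  and "!!U f g. opn S U ==> U \<subseteq> V ==> f : sects S U ==> g : sects S U ==>
   X U (f \<oplus>\<^bsub>sec S U\<^esub> g) = X U f \<oplus>\<^bsub>sec S U\<^esub> X U g"
  and "!!U f r. opn S U ==> U \<subseteq> V ==> f : sects S U ==>
   X U (r \<odot>\<^bsub>sec S U\<^esub> f) = r \<odot>\<^bsub>sec S U\<^esub> X U f"
  and "!!U W f. opn S U ==> U \<subseteq> V ==> opn S W ==> W \<subseteq> U ==> f : sects S U ==>
   X W (res S U W f) = res S U W (X U f)"
  and "!!U f. \<not> (opn S U & U \<subseteq> V & f : sects S U) ==> X U f = undefined"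
 using assms unfolding sheaf_endo_def by simp_all

lemma sheaf_endoI:
 assumes "!!U f. \<not> (opn S U & U \<subseteq> V & f : sects S U) ==> X U f = undefined"
  and "!!U f. opn S U ==> U \<subseteq> V ==> f : sects S U ==> X U f : sects S U"
  and "!!U f g. opn S U ==> U \<subseteq> V ==> f : sects S U ==> g : sects S U ==>
   X U (f \<oplus>\<^bsub>sec S U\<^esub> g) = X U f \<oplus>\<^bsub>sec S U\<^esub> X U g"
  and "!!U f r. opn S U ==> U \<subseteq> V ==> f : sects S U ==>
   X U (r \<odot>\<^bsub>sec S U\<^esub> f) = r \<odot>\<^bsub>sec S U\<^esub> X U f"
  and "!!U W f. opn S U ==> U \<subseteq> V ==> opn S W ==> W \<subseteq> U ==> f : sects S U ==>
   X W (res S U W f) = res S U W (X U f)"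
 shows "X : sheaf_endo S V"
 unfolding sheaf_endo_def
 by (intro CollectI conjI allI impI ballI) (use assms in \<open>simp_all\<close>)

lemma sheaf_endo_eqI:
 assumes "X : sheaf_endo S V" "Y : sheaf_endo S V"
  and "!!U f. opn S U ==> U \<subseteq> V ==> f : sects S U ==> X U f = Y U f"
 shows "X = Y"
proof (intro ext)
 fix U f
 show "X U f = Y U f"
  using assms(3)[of U f] sheaf_endoD(5)[OF assms(1), of U f] sheaf_endoD(5)[OF assms(2), of U f]
  by (cases "opn S U & U \<subseteq> V & f : sects S U") auto
qed

lemma derivationsD:
 assumes "X : derivations S V k"
 shows "X : sheaf_endo S V"
  and "!!U. opn S U ==> U \<subseteq> V ==> derivation (sec S U) k (X U)"
 using assms unfolding derivations_def by simp_all

lemma derivationsI: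
 assumes "X : sheaf_endo S V"
  and "!!U. opn S U ==> U \<subseteq> V ==> derivation (sec S U) k (X U)"
 shows "X : derivations S V k"
 using assms unfolding derivations_def by simp_all

lemma derivationD:
 assumes "derivation A k D"
 shows "!!f. f : carrier A ==> D f : carrier A"
  "!!f g. f : carrier A ==> g : carrier A ==> D (f \<oplus>\<^bsub>A\<^esub> g) = D f \<oplus>\<^bsub>A\<^esub> D g"
  "!!f r. f : carrier A ==> D (r \<odot>\<^bsub>A\<^esub> f) = r \<odot>\<^bsub>A\<^esub> D f"
  "!!m f. f : hpart A m ==> D f : hpart A (m + k)"
  "!!m f g. f : hpart A m ==> g : carrier A ==>
    D (f \<otimes>\<^bsub>A\<^esub> g) = (D f \<otimes>\<^bsub>A\<^esub> g) \<oplus>\<^bsub>A\<^esub> signed A (k * m) (f \<otimes>\<^bsub>A\<^esub> D g)"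
 using assms unfolding derivation_def by simp_all

subsection \<open>Derivations are determined by the coordinates\<close>

context chart
begin

lemma dom_endoD:
 assumes "X : sheaf_endo S V0" "dom V0" "dom U" "U \<subseteq> V0" "f : sects S U"
 shows "X U f : sects S U" "dom W ==> W \<subseteq> U ==> X W (res S U W f) = res S U W (X U f)"
 using sheaf_endoD(1,4)[OF assms(1)] assms(2-5) by (auto simp: dom_def)

lemma dom_derivation: "D : derivations S V0 k ==> dom U ==> U \<subseteq> V0 ==> derivation (OS U) k (D U)"
 using derivationsD(2) domD(1) by blast

text \<open>D is applied to F = c + \<Sum> (x_i - y_i) G_i. Constants are killed, and the summands
  with a derivative of G_i carry the factor x_i - y_i, which vanishes at y.\<close>

lemma derivation_coef_fun:
 assumes D: "D : derivations S V0 k" and V0: "dom V0" and W: "dom W" "W \<subseteq> V0" and hW: "h ` W = box_at (p 0) y e"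
  and y: "y : h ` W" and G: "!!i. i < p 0 ==> smooth_fun_on (p 0) (h ` W) (G i)"
  and F: "F : sects S W" "!!m z. z : h ` W ==>
   Ps W F m z = (if m = {#} then c + (\<Sum>i<p 0. (z i - y i) * G i z) else 0)"
 shows "Ps W (D W F) m y = (\<Sum>i<p 0. series_mult p (Ps W (D W (co W (Inl i)))) (fun_series (h ` W) (G i)) m y)"
proof -
 interpret ring "OS W" by (rule ringO[OF W(1)])
 note A = alg[OF W(1)]
 note dD = dom_derivation[OF D W]
 note sc = supercomm_smult_closed[OF A]
 \<comment> \<open>The section x_i - y_i. It has degree 0, so no sign occurs when D passes
   it.\<close>
 define T where "T i = co W (Inl i) \<oplus>\<^bsub>OS W\<^esub> (- y i) \<odot>\<^bsub>OS W\<^esub> \<one>\<^bsub>OS W\<^esub>" for i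
 define \<Gamma> where "\<Gamma> i = sect W (fun_series (h ` W) (G i))" for i
 have ix: "Inl i : idx p" if "i < p 0" for i using that by (simp add: idx_def)
 have Tc: "T i : sects S W" if "i < p 0" for i
  using co_closed[OF W(1) ix[OF that]] sc by (simp add: T_def)
 have fo: "fun_series (h ` W) (G i) : series_on p (h ` W)" if "i < p 0" for i
  by (rule fun_series_on[where p = p, OF img_open[OF W(1)] G[OF that]])
 have \<Gamma>c: "\<Gamma> i : sects S W" "Ps W (\<Gamma> i) = fun_series (h ` W) (G i)" if "i < p 0" for i
  using fo[OF that] by (simp_all add: \<Gamma>_def sect_closed[OF W(1)] Psi_sect[OF W(1)])
 have PT: "Ps W (T i) = fun_series (h ` W) (%x. x i - y i)" if "i < p 0" for i
  using that co_closed[OF W(1) ix] sc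
  by (auto simp: T_def Psi_add[OF W(1)] Psi_smult[OF W(1)] Psi_co[OF W(1)] ix Psi_one[OF W(1)]
    coser_def fun_series_def fun_eq_iff)
 have Th: "T i : hpart (OS W) 0" if "i < p 0" for i
  unfolding Psi_hpart[OF W(1) Tc[OF that]] PT[OF that] by (auto simp: fun_series_def fun_eq_iff)
 have TG: "(%i. T i \<otimes>\<^bsub>OS W\<^esub> \<Gamma> i) : {..<p 0} \<rightarrow> sects S W" using Tc \<Gamma>c by auto
 have Fdec: "F = c \<odot>\<^bsub>OS W\<^esub> \<one>\<^bsub>OS W\<^esub> \<oplus>\<^bsub>OS W\<^esub> (\<Oplus>\<^bsub>OS W\<^esub>i\<in>{..<p 0}. T i \<otimes>\<^bsub>OS W\<^esub> \<Gamma> i)"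
 proof (rule eqI[OF W(1) F(1)])
  show "c \<odot>\<^bsub>OS W\<^esub> \<one>\<^bsub>OS W\<^esub> \<oplus>\<^bsub>OS W\<^esub> (\<Oplus>\<^bsub>OS W\<^esub>i\<in>{..<p 0}. T i \<otimes>\<^bsub>OS W\<^esub> \<Gamma> i) : sects S W"
   using sc TG by (intro a_closed finsum_closed) auto
  fix m z assume z: "z : h ` W"
  have "Ps W (T i \<otimes>\<^bsub>OS W\<^esub> \<Gamma> i) m z = (if m = {#} then (z i - y i) * G i z else 0)" if "i < p 0" for i
   using that Tc \<Gamma>c z by (simp add: Psi_mult[OF W(1)] PT series_mult_fun[OF z fo[OF that]]) (simp add: fun_series_def)
  then show "Ps W F m z = Ps W (c \<odot>\<^bsub>OS W\<^esub> \<one>\<^bsub>OS W\<^esub> \<oplus>\<^bsub>OS W\<^esub> (\<Oplus>\<^bsub>OS W\<^esub>i\<in>{..<p 0}. T i \<otimes>\<^bsub>OS W\<^esub> \<Gamma> i)) m z"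
   using sc TG z by (simp add: F(2) Psi_add[OF W(1)] finsum_closed Psi_smult[OF W(1)] Psi_one[OF W(1)] Psi_finsum[OF W(1)])
    (auto simp: fun_series_def)
 qed
 have DT: "D W (T i) = D W (co W (Inl i))" if "i < p 0" for i
 proof -
  have "D W (T i) = D W (co W (Inl i)) \<oplus>\<^bsub>OS W\<^esub> (- y i) \<odot>\<^bsub>OS W\<^esub> D W \<one>\<^bsub>OS W\<^esub>"
   using co_closed[OF W(1) ix[OF that]] sc by (simp add: T_def derivationD(2,3)[OF dD])
  then show ?thesis
   unfolding derivation_one[OF A dD]
   using co_closed[OF W(1) ix[OF that]] derivationD(1)[OF dD] derivationD(3)[OF derivation_zero[OF A], of "\<one>\<^bsub>OS W\<^esub>"]
   by simp
 qed
 have "D W F = c \<odot>\<^bsub>OS W\<^esub> D W \<one>\<^bsub>OS W\<^esub> \<oplus>\<^bsub>OS W\<^esub> (\<Oplus>\<^bsub>OS W\<^esub>i\<in>{..<p 0}. D W (T i \<otimes>\<^bsub>OS W\<^esub> \<Gamma> i))"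
  unfolding Fdec using sc TG
  by (simp add: derivationD(2,3)[OF dD] finsum_closed derivation_finsum_arg[OF A dD])
 also have "c \<odot>\<^bsub>OS W\<^esub> D W \<one>\<^bsub>OS W\<^esub> = \<zero>\<^bsub>OS W\<^esub>"
  unfolding derivation_one[OF A dD] using derivationD(3)[OF derivation_zero[OF A], of "\<one>\<^bsub>OS W\<^esub>"] by simp
 finally have DF: "D W F = \<zero>\<^bsub>OS W\<^esub> \<oplus>\<^bsub>OS W\<^esub> (\<Oplus>\<^bsub>OS W\<^esub>i\<in>{..<p 0}. D W (T i \<otimes>\<^bsub>OS W\<^esub> \<Gamma> i))" .
 have c1: "(%i. D W (T i \<otimes>\<^bsub>OS W\<^esub> \<Gamma> i)) : {..<p 0} \<rightarrow> sects S W"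
  using TG derivationD(1)[OF dD] by auto
 have c2: "D W (co W (Inl i)) : sects S W" "D W (\<Gamma> i) : sects S W" if "i < p 0" for i
  using co_closed[OF W(1) ix[OF that]] \<Gamma>c[OF that] derivationD(1)[OF dD] by auto
 have "Ps W (D W (T i \<otimes>\<^bsub>OS W\<^esub> \<Gamma> i)) m y = series_mult p (Ps W (D W (co W (Inl i)))) (fun_series (h ` W) (G i)) m y"
  if i: "i < p 0" for i
 proof -
  have "D W (T i \<otimes>\<^bsub>OS W\<^esub> \<Gamma> i) = (D W (co W (Inl i)) \<otimes>\<^bsub>OS W\<^esub> \<Gamma> i) \<oplus>\<^bsub>OS W\<^esub> signed (OS W) (k * 0) (T i \<otimes>\<^bsub>OS W\<^esub> D W (\<Gamma> i))"
   using derivationD(5)[OF dD Th[OF i] \<Gamma>c(1)[OF i]] DT[OF i] by simp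
  then show ?thesis
   using Tc[OF i] \<Gamma>c[OF i] c2[OF i] signed_closed[OF ring_axioms]
   by (simp add: Psi_add[OF W(1)] Psi_signed[OF W(1)] Psi_mult[OF W(1)] PT[OF i]
     series_mult_fun[OF y Psi_on[OF W(1) c2(2)[OF i]]])
 qed
 then show ?thesis
  unfolding DF using c1 by (simp add: Psi_finsum[OF W(1)] finsum_closed)
qed

text \<open>D is applied to f = F0 + \<Sum> w_a Q_a. In the last terms D(Q_a) is multiplied by w_a
  and hence enters only with monomials smaller than m; this drives the induction in
  \<open>derivations_eqI\<close>.\<close>

lemma derivation_coef_series:
 assumes D: "D : derivations S V0 k" and V0: "dom V0" and U: "dom U" "U \<subseteq> V0"
  and y: "y : h ` U" and f: "f : sects S U"
 shows "Ps U (D U f) m y = Ps U (D U (sect U (fun_series (h ` U) (Ps U f {#})))) m y +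
  (\<Sum>a\<in>gens p. series_mult p (Ps U (D U (co U (Inr a)))) (quot_gen a (Ps U f)) m y +
    sg (k * fst a) * series_mult p (wser (h ` U) a) (Ps U (D U (sect U (quot_gen a (Ps U f))))) m y)"
proof -
 interpret ring "OS U" by (rule ringO[OF U(1)])
 note A = alg[OF U(1)]
 note dD = dom_derivation[OF D U]
 have ix: "Inr a : idx p" if "a : gens p" for a using that by (simp add: idx_def)
 define F0 where "F0 = sect U (fun_series (h ` U) (Ps U f {#}))"
 define Q where "Q a = sect U (quot_gen a (Ps U f))" for a
 have f0: "fun_series (h ` U) (Ps U f {#}) : series_on p (h ` U)"
  using series_onD(1)[OF Psi_on[OF U(1) f]] by (intro fun_series_on img_open[OF U(1)])
 have F0: "F0 : sects S U" "Ps U F0 = fun_series (h ` U) (Ps U f {#})"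
  using f0 by (simp_all add: F0_def sect_closed[OF U(1)] Psi_sect[OF U(1)])
 have Q: "Q a : sects S U" "Ps U (Q a) = quot_gen a (Ps U f)" for a
  using quot_gen_on[OF img_open[OF U(1)] Psi_on[OF U(1) f]]
  by (simp_all add: Q_def sect_closed[OF U(1)] Psi_sect[OF U(1)])
 note cc = co_closed[OF U(1) ix]
 have cQ: "(%a. co U (Inr a) \<otimes>\<^bsub>OS U\<^esub> Q a) : gens p \<rightarrow> sects S U" using cc Q by auto
 have fdec: "f = F0 \<oplus>\<^bsub>OS U\<^esub> (\<Oplus>\<^bsub>OS U\<^esub>a\<in>gens p. co U (Inr a) \<otimes>\<^bsub>OS U\<^esub> Q a)"
 proof (rule eqI[OF U(1) f])
  show "F0 \<oplus>\<^bsub>OS U\<^esub> (\<Oplus>\<^bsub>OS U\<^esub>a\<in>gens p. co U (Inr a) \<otimes>\<^bsub>OS U\<^esub> Q a) : sects S U"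
   using F0 cQ by (intro a_closed finsum_closed)
  fix m z assume m: "m : monomials p" and z: "z : h ` U"
  have "(\<Sum>a\<in>gens p. Ps U (co U (Inr a) \<otimes>\<^bsub>OS U\<^esub> Q a) m z) =
    (\<Sum>a\<in>gens p. series_mult p (wser (h ` U) a) (quot_gen a (Ps U f)) m z)"
   by (rule sum.cong) (use cc Q ix in \<open>auto simp: Psi_mult[OF U(1)] Psi_co[OF U(1)] coser_def\<close>)
  then show "Ps U f m z = Ps U (F0 \<oplus>\<^bsub>OS U\<^esub> (\<Oplus>\<^bsub>OS U\<^esub>a\<in>gens p. co U (Inr a) \<otimes>\<^bsub>OS U\<^esub> Q a)) m z"
   using F0 cQ fin z by (simp add: Psi_add[OF U(1)] finsum_closed Psi_finsum[OF U(1)] sum_wser_quot_gen[OF fin z m])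
    (simp add: fun_series_def)
 qed
 have "D U f = D U F0 \<oplus>\<^bsub>OS U\<^esub> (\<Oplus>\<^bsub>OS U\<^esub>a\<in>gens p. D U (co U (Inr a) \<otimes>\<^bsub>OS U\<^esub> Q a))"
  using F0 cQ fin
  by (subst fdec) (simp add: derivationD(2)[OF dD] finsum_closed derivation_finsum_arg[OF A dD])
 moreover have "Ps U (D U (co U (Inr a) \<otimes>\<^bsub>OS U\<^esub> Q a)) m y =
   series_mult p (Ps U (D U (co U (Inr a)))) (quot_gen a (Ps U f)) m y +
    sg (k * fst a) * series_mult p (wser (h ` U) a) (Ps U (D U (Q a))) m y" if a: "a : gens p" for a
 proof -
  have "co U (Inr a) : hpart (OS U) (fst a)" using co_hpart[OF U(1) ix[OF a]] by simp
  from derivationD(5)[OF dD this Q(1)]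
  show ?thesis using cc[OF a] Q derivationD(1)[OF dD] signed_closed[OF ring_axioms]
   by (simp add: Psi_add[OF U(1)] Psi_signed[OF U(1)] Psi_mult[OF U(1)] Psi_co[OF U(1) ix[OF a]] coser_def)
 qed
 moreover have "(%a. D U (co U (Inr a) \<otimes>\<^bsub>OS U\<^esub> Q a)) : gens p \<rightarrow> sects S U"
  using cQ derivationD(1)[OF dD] by auto
 ultimately show ?thesis
  using F0 derivationD(1)[OF dD] fin
  by (simp add: Psi_add[OF U(1)] finsum_closed Psi_finsum[OF U(1)] F0_def[symmetric] Q_def[symmetric])
qed

text \<open>The preimage of the box is formed in V, where it is known to be open; injectivity of h
  places it inside U.\<close>

lemma box_chart:
 assumes "dom U" "y : h ` U"
 obtains e W where "e > 0" "dom W" "W \<subseteq> U" "h ` W = box_at (p 0) y e" "y : h ` W"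
proof -
 obtain e where e: "e > 0" "box_at (p 0) y e \<subseteq> h ` U"
  using open_contains_box[OF img_open[OF assms(1)] assms(2)] by blast
 define W where "W = {x : V. h x : box_at (p 0) y e}"
 have WU: "W \<subseteq> U"
 proof
  fix x assume x: "x : W"
  then obtain x' where x': "x' : U" "h x = h x'" using e(2) by (auto simp: W_def)
  then have "x = x'" using inj_onD[OF inj] x domD(2)[OF assms(1)] by (auto simp: W_def)
  with x' show "x : U" by simp
 qed
 have "h ` W = box_at (p 0) y e"
  using e(2) domD(2)[OF assms(1)] by (auto simp: W_def)
 moreover have "dom W" using pre_open[OF openin_box_at] by (auto simp: dom_def W_def)
 moreover have "y : box_at (p 0) y e"
  using box_at_center[OF _ e(1)] open_subset_eucl[OF img_open[OF assms(1)]] assms(2) by blast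
 ultimately show ?thesis using that[OF e(1) _ WU] by simp
qed

theorem derivations_eqI:
 assumes V0: "dom V0" and D: "D : derivations S V0 k" and D': "D' : derivations S V0 k"
  and co: "!!ii. ii : idx p ==> D V0 (co V0 ii) = D' V0 (co V0 ii)"
 shows "D = D'"
proof (rule sheaf_endo_eqI[OF derivationsD(1)[OF D] derivationsD(1)[OF D']])
 have coW: "D W (co W ii) = D' W (co W ii)" if W: "dom W" "W \<subseteq> V0" and i: "ii : idx p" for W ii
  using dom_endoD(2)[OF derivationsD(1)[OF D] V0 V0 subset_refl co_closed[OF V0 i] W]
   dom_endoD(2)[OF derivationsD(1)[OF D'] V0 V0 subset_refl co_closed[OF V0 i] W]
  by (simp add: co_res[OF V0 W i] co[OF i])
 fix U f assume U': "opn S U" "U \<subseteq> V0" and f: "f : sects S U"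
 have U: "dom U" by (rule dom_subset[OF V0 U'])
 \<comment> \<open>For a function of the degree-zero coordinates all coefficients of the result at y
   are found at once, from a Hadamard expansion on a box around y.\<close>
 have funs: "Ps U (D U F) m y = Ps U (D' U F) m y"
  if y: "y : h ` U" and g: "smooth_fun_on (p 0) (h ` U) g" and F: "F = sect U (fun_series (h ` U) g)" for F g m y
 proof -
  obtain e W where e: "e > 0" and W: "dom W" "W \<subseteq> U" and hW: "h ` W = box_at (p 0) y e" and yW: "y : h ` W"
   using box_chart[OF U y] by blast
  have WV0: "W \<subseteq> V0" using W U' by blast
  have yE: "y : eucl (p 0)" using open_subset_eucl[OF img_open[OF U]] y by blast
  have sub: "h ` W \<subseteq> h ` U" using W by blast
  have fo: "fun_series (h ` U) g : series_on p (h ` U)" by (rule fun_series_on[where p = p, OF img_open[OF U] g])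
  have Fc: "F : sects S U" and PF: "Ps U F = fun_series (h ` U) g"
   using fo by (simp_all add: F sect_closed[OF U] Psi_sect[OF U])
  have "smooth_fun_on (p 0) (box_at (p 0) y e) g"
   using smooth_subset[OF img_open[OF U] img_open[OF W(1)] sub g] hW by simp
  then obtain G where G: "!!i. i < p 0 ==> smooth_fun_on (p 0) (h ` W) (G i)"
   "!!x. x : h ` W ==> g x = g y + (\<Sum>i<p 0. (x i - y i) * G i x)"
   unfolding hW by (rule hadamard[OF _ yE]) blast+
  have PW: "Ps W (res S U W F) m z = (if m = {#} then g y + (\<Sum>i<p 0. (z i - y i) * G i z) else 0)"
   if "z : h ` W" for m z
   using that sub G(2)[OF that] by (simp add: Psi_res[OF U W Fc] PF) (auto simp: fun_series_def)
  \<comment> \<open>The coefficients at y are the same over U and over W, so the formula on the box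
    applies. It contains E through its values on the coordinates alone.\<close>
  have eq: "Ps U (E U F) m y =
    (\<Sum>i<p 0. series_mult p (Ps W (E W (co W (Inl i)))) (fun_series (h ` W) (G i)) m y)"
   if E: "E : derivations S V0 k" for E
  proof -
   have "Ps U (E U F) m y = Ps W (E W (res S U W F)) m y"
    using yW dom_endoD[OF derivationsD(1)[OF E] V0 U U'(2) Fc] W by (simp add: Psi_res[OF U W])
   then show ?thesis
    using derivation_coef_fun[OF E V0 W(1) WV0 hW yW G(1) res_closed[OF U W Fc] PW] by simp
  qed
  show ?thesis unfolding eq[OF D] eq[OF D']
   by (intro sum.cong refl) (simp add: coW[OF W(1) WV0] idx_def)
 qed
 \<comment> \<open>Induction on a bound for the size of m with f universally quantified, because the
   step passes from f to its cofactors.\<close>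
 have "\<forall>f\<in>sects S U. \<forall>m y. m : monomials p --> y : h ` U --> size m < n --> Ps U (D U f) m y = Ps U (D' U f) m y" for n
 proof (induction n)
  case (Suc n)
  show ?case
  proof (intro ballI allI impI)
   fix f m y assume f: "f : sects S U" and m: "m : monomials p" and y: "y : h ` U" and sz: "size m < Suc n"
   \<comment> \<open>Multiplication by w_a reads the other factor at m without a, where the
     induction hypothesis applies.\<close>
   have t: "series_mult p (wser (h ` U) a) (Ps U (D U q)) m y = series_mult p (wser (h ` U) a) (Ps U (D' U q)) m y"
    if "q : sects S U" for a q
   proof (cases "a \<in># m")
    case True
    then have "size (m - {#a#}) < n" "m - {#a#} : monomials p"
     using sz monomials_subset[OF m diff_subset_eq_self] by (auto simp: size_Suc_Diff1[symmetric])
    then show ?thesis using Suc.IH that y by (simp add: series_mult_wser[OF y m])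
   qed (simp add: series_mult_wser[OF y m])
   have sm: "smooth_fun_on (p 0) (h ` U) (Ps U f {#})" using series_onD(1)[OF Psi_on[OF U f]] .
   have q: "sect U (quot_gen a (Ps U f)) : sects S U" for a
    by (rule sect_closed[OF U quot_gen_on[OF img_open[OF U] Psi_on[OF U f]]])
   show "Ps U (D U f) m y = Ps U (D' U f) m y"
    unfolding derivation_coef_series[OF D V0 U U'(2) y f] derivation_coef_series[OF D' V0 U U'(2) y f]
     funs[OF y sm refl]
    by (intro arg_cong2[where f = "(+)"] sum.cong refl)
     (use t[OF q] coW[OF U U'(2)] in \<open>auto simp: idx_def\<close>)
  qed
 qed simp
 then have "Ps U (D U f) m y = Ps U (D' U f) m y" if "m : monomials p" "y : h ` U" for m y
  using f that by blast
 then show "D U f = D' U f"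
  by (intro eqI[OF U] dom_endoD(1)[OF derivationsD(1)[OF D] V0 U U'(2) f]
    dom_endoD(1)[OF derivationsD(1)[OF D'] V0 U U'(2) f])
qed

theorem derivations_LC:
 assumes V0: "dom V0" and D: "D : derivations S V0 k"
 shows "D = LC V0 (%ii. D V0 (co V0 ii))"
proof (rule derivations_eqI[OF V0 D])
 have hp: "D V0 (co V0 ii) : hpart (OS V0) (k + dg ii)" if "ii : idx p" for ii
  using derivationD(4)[OF dom_derivation[OF D V0 subset_refl] co_hpart[OF V0 that]] by (simp add: add.commute)
 show "LC V0 (%ii. D V0 (co V0 ii)) : derivations S V0 k"
  by (rule LC_derivations[OF V0 hp])
 fix ii assume "ii : idx p"
 then show "D V0 (co V0 ii) = LC V0 (%ii. D V0 (co V0 ii)) V0 (co V0 ii)"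
  using LC_co[OF V0, of "%ii. D V0 (co V0 ii)"] hpartD[OF V0 hp] by simp
qed

end

section \<open>Germs\<close>

lemma germ_mem: "(W, t) : germ S x U s \<longleftrightarrow> opn S W & x : W & t : sects S W \<and>
  (\<exists>N. opn S N & x : N & N \<subseteq> U \<inter> W & res S U N s = res S W N t)"
 by (simp add: germ_def)

lemma germ_self: "opn S U ==> x : U ==> s : sects S U ==> (U, s) : germ S x U s"
 unfolding germ_mem by (intro conjI exI[of _ U]) auto

text \<open>Both agreements hold on the intersection of the two neighbourhoods, which makes germs
  equivalence classes.\<close>

lemma germ_trans:
 assumes P: "is_presheaf S" and U: "opn S U" "s : sects S U"
  and W: "opn S W" "t : sects S W"
  and N: "opn S N" "x : N" "N \<subseteq> U \<inter> W" "res S U N s = res S W N t"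
 shows "germ S x U s \<subseteq> germ S x W t"
proof clarify
 fix X u assume "(X, u) : germ S x U s"
 then obtain N' where X: "opn S X" "x : X" "u : sects S X"
  and N': "opn S N'" "x : N'" "N' \<subseteq> U \<inter> X" "res S U N' s = res S X N' u"
  unfolding germ_mem by blast
 let ?K = "N \<inter> N'"
 have K: "opn S ?K" using N(1) N'(1) by (rule openin_Int)
 have "res S W ?K t = res S N ?K (res S W N t)"
  using presheafD(5)[OF P W(1) N(1) K _ _ W(2)] N by simp
 also have "\<dots> = res S U ?K s"
  using presheafD(5)[OF P U(1) N(1) K _ _ U(2)] N by simp
 also have "\<dots> = res S N' ?K (res S U N' s)"
  using presheafD(5)[OF P U(1) N'(1) K _ _ U(2)] N' by simp
 also have "\<dots> = res S X ?K u"
  using presheafD(5)[OF P X(1) N'(1) K _ _ X(3)] N' by simp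
 finally show "(X, u) : germ S x W t"
  unfolding germ_mem using X K N N' by (intro conjI exI[of _ ?K]) auto
qed

lemma germ_eq_iff:
 assumes P: "is_presheaf S" and U: "opn S U" "x : U" "s : sects S U"
  and W: "opn S W" "x : W" "t : sects S W"
 shows "germ S x U s = germ S x W t \<longleftrightarrow>
  (\<exists>N. opn S N & x : N & N \<subseteq> U \<inter> W & res S U N s = res S W N t)"
proof
 assume "germ S x U s = germ S x W t"
 then have "(W, t) : germ S x U s" using germ_self[OF W] by simp
 then show "\<exists>N. opn S N & x : N & N \<subseteq> U \<inter> W & res S U N s = res S W N t"
  unfolding germ_mem by blast
next
 assume "\<exists>N. opn S N & x : N & N \<subseteq> U \<inter> W & res S U N s = res S W N t"
 then obtain N where "opn S N" "x : N" "N \<subseteq> U \<inter> W" "res S U N s = res S W N t" by blast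
 then show "germ S x U s = germ S x W t"
  using germ_trans[OF P U(1,3) W(1,3)] germ_trans[OF P W(1,3) U(1,3)] by (intro equalityI) auto
qed

lemma germ_res:
 assumes P: "is_presheaf S" and U: "opn S U" "s : sects S U"
  and W: "opn S W" "W \<subseteq> U" "x : W"
 shows "germ S x U s = germ S x W (res S U W s)"
proof -
 have "res S W W (res S U W s) = res S U W s"
  using presheafD(5)[OF P U(1) W(1) W(1) subset_refl W(2) U(2)] .
 moreover have "res S U W s : sects S W" using presheafD(1)[OF P U(1) W(1,2) U(2)] .
 moreover have "x : U" using W by blast
 ultimately show ?thesis
  by (subst germ_eq_iff[OF P U(1) _ U(2) W(1,3)]) (use W in auto)
qed

text \<open>All that is known about the representative which \<open>SOME\<close> selects in the
  operations on stalks.\<close>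

lemma germ_rep:
 assumes "opn S U" "x : U" "s : sects S U"
 obtains W t N where "(SOME r. r : germ S x U s) = (W, t)" "opn S W" "x : W" "t : sects S W"
  "opn S N" "x : N" "N \<subseteq> U \<inter> W" "res S U N s = res S W N t"
proof -
 have "(SOME r. r : germ S x U s) : germ S x U s" using germ_self[OF assms] by (rule someI)
 moreover obtain W t where "(SOME r. r : germ S x U s) = (W, t)" by force
 ultimately show ?thesis using that unfolding germ_def by auto
qed

text \<open>Independence of representatives: near x the selected ones agree with s and t, and f
  commutes with restriction.\<close>

lemma germ_op_germ:
 assumes P: "is_presheaf S"
  and fc: "!!U s t. opn S U ==> x : U ==> s : sects S U ==> t : sects S U ==> f U s t : sects S U"
  and fr: "!!U W s t. opn S U ==> opn S W ==> x : W ==> W \<subseteq> U ==> s : sects S U ==> t : sects S U ==>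
   res S U W (f U s t) = f W (res S U W s) (res S U W t)"
  and U: "opn S U" "x : U" "s : sects S U" "t : sects S U"
 shows "germ_op S x f (germ S x U s) (germ S x U t) = germ S x U (f U s t)"
proof -
 obtain W s' N where s': "(SOME r. r : germ S x U s) = (W, s')" "opn S W" "x : W" "s' : sects S W"
  "opn S N" "x : N" "N \<subseteq> U \<inter> W" "res S U N s = res S W N s'"
  using germ_rep[OF U(1,2,3)] by metis
 obtain W' t' N' where t': "(SOME r. r : germ S x U t) = (W', t')" "opn S W'" "x : W'" "t' : sects S W'"
  "opn S N'" "x : N'" "N' \<subseteq> U \<inter> W'" "res S U N' t = res S W' N' t'"
  using germ_rep[OF U(1,2,4)] by metis
 let ?I = "W \<inter> W'" and ?K = "N \<inter> N'"
 have I: "opn S ?I" "x : ?I" using s' t' by auto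
 have K: "opn S ?K" "x : ?K" "?K \<subseteq> U \<inter> ?I" using s' t' by auto
 have c: "res S W ?I s' : sects S ?I" "res S W' ?I t' : sects S ?I"
  using presheafD(1)[OF P s'(2) I(1) _ s'(4)] presheafD(1)[OF P t'(2) I(1) _ t'(4)] by auto
 have 1: "res S ?I ?K (res S W ?I s') = res S U ?K s"
 proof -
  have "res S ?I ?K (res S W ?I s') = res S W ?K s'"
   by (rule presheafD(5)[OF P s'(2) I(1) K(1) _ _ s'(4)]) (use s' t' in auto)
  also have "\<dots> = res S N ?K (res S W N s')"
   by (rule presheafD(5)[OF P s'(2) s'(5) K(1) _ _ s'(4), symmetric]) (use s' in auto)
  also have "\<dots> = res S U ?K s" unfolding s'(8)[symmetric]
   by (rule presheafD(5)[OF P U(1) s'(5) K(1) _ _ U(3)]) (use s' in auto)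
  finally show ?thesis .
 qed
 have 2: "res S ?I ?K (res S W' ?I t') = res S U ?K t"
 proof -
  have "res S ?I ?K (res S W' ?I t') = res S W' ?K t'"
   by (rule presheafD(5)[OF P t'(2) I(1) K(1) _ _ t'(4)]) (use s' t' in auto)
  also have "\<dots> = res S N' ?K (res S W' N' t')"
   by (rule presheafD(5)[OF P t'(2) t'(5) K(1) _ _ t'(4), symmetric]) (use t' in auto)
  also have "\<dots> = res S U ?K t" unfolding t'(8)[symmetric]
   by (rule presheafD(5)[OF P U(1) t'(5) K(1) _ _ U(4)]) (use t' in auto)
  finally show ?thesis .
 qed
 have "germ S x ?I (f ?I (res S W ?I s') (res S W' ?I t')) = germ S x U (f U s t)"
 proof (subst germ_eq_iff[OF P I fc[OF I c] U(1,2) fc[OF U]], intro exI conjI)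
  show "res S ?I ?K (f ?I (res S W ?I s') (res S W' ?I t')) = res S U ?K (f U s t)"
   using fr[OF I(1) K(1,2) _ c] fr[OF U(1) K(1,2) _ U(3,4)] K(3) 1 2 by simp
 qed (use K in auto)
 then show ?thesis by (simp add: germ_op_def s'(1) t'(1))
qed

lemma stalk_simps:
 "carrier (stalk S x) = {germ S x V s | V s. opn S V & x : V & s : sects S V}"
 "add (stalk S x) = germ_op S x (%V. add (sec S V))"
 "mult (stalk S x) = germ_op S x (%V. mult (sec S V))"
 "hpart (stalk S x) k = {germ S x V s | V s. opn S V & x : V & s : hpart (sec S V) k}"
 by (simp_all add: stalk_def)

lemma algebra_sheafD:
 assumes "algebra_sheaf S"
 shows "is_sheaf S" "is_presheaf S" "!!U. opn S U ==> supercomm_algebra (sec S U)"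
  "!!U W. opn S U ==> opn S W ==> W \<subseteq> U ==> res S U W : ring_hom (sec S U) (sec S W)"
  "!!U W f r. opn S U ==> opn S W ==> W \<subseteq> U ==> f : sects S U ==>
   res S U W (r \<odot>\<^bsub>sec S U\<^esub> f) = r \<odot>\<^bsub>sec S W\<^esub> res S U W f"
proof -
 show "is_sheaf S" "!!U. opn S U ==> supercomm_algebra (sec S U)"
  "!!U W. opn S U ==> opn S W ==> W \<subseteq> U ==> res S U W : ring_hom (sec S U) (sec S W)"
  "!!U W f r. opn S U ==> opn S W ==> W \<subseteq> U ==> f : sects S U ==>
   res S U W (r \<odot>\<^bsub>sec S U\<^esub> f) = r \<odot>\<^bsub>sec S W\<^esub> res S U W f"
  using assms unfolding algebra_sheaf_def by simp_all
 then show "is_presheaf S" unfolding is_sheaf_def by simp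
qed

lemma stalk_add:
 assumes S: "algebra_sheaf S" and U: "opn S U" "x : U" "s : sects S U" "t : sects S U"
 shows "germ S x U s \<oplus>\<^bsub>stalk S x\<^esub> germ S x U t = germ S x U (s \<oplus>\<^bsub>sec S U\<^esub> t)"
 unfolding stalk_simps
proof (rule germ_op_germ[OF algebra_sheafD(2)[OF S] _ _ U])
 fix U s t assume *: "opn S U" "s : sects S U" "t : sects S U"
 interpret ring "sec S U" by (rule supercomm_algebraD(1)[OF algebra_sheafD(3)[OF S *(1)]])
 show "s \<oplus>\<^bsub>sec S U\<^esub> t : sects S U" using * by simp
 fix W assume "opn S W" "W \<subseteq> U"
 then show "res S U W (s \<oplus>\<^bsub>sec S U\<^esub> t) = res S U W s \<oplus>\<^bsub>sec S W\<^esub> res S U W t"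
  using presheafD(2)[OF algebra_sheafD(2)[OF S]] * by blast
qed

lemma stalk_mult:
 assumes S: "algebra_sheaf S" and U: "opn S U" "x : U" "s : sects S U" "t : sects S U"
 shows "germ S x U s \<otimes>\<^bsub>stalk S x\<^esub> germ S x U t = germ S x U (s \<otimes>\<^bsub>sec S U\<^esub> t)"
 unfolding stalk_simps
proof (rule germ_op_germ[OF algebra_sheafD(2)[OF S] _ _ U])
 fix U s t assume *: "opn S U" "s : sects S U" "t : sects S U"
 interpret ring "sec S U" by (rule supercomm_algebraD(1)[OF algebra_sheafD(3)[OF S *(1)]])
 show "s \<otimes>\<^bsub>sec S U\<^esub> t : sects S U" using * by simp
 fix W assume "opn S W" "W \<subseteq> U"
 then show "res S U W (s \<otimes>\<^bsub>sec S U\<^esub> t) = res S U W s \<otimes>\<^bsub>sec S W\<^esub> res S U W t"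
  using ring_hom_mult[OF algebra_sheafD(4)[OF S]] * by blast
qed

section \<open>Vector fields on a chart\<close>

locale mfd_chart = chart S V p h Ps for S :: "('x, real, 'a) gpresheaf" and V p h Ps +
 assumes S_alg: "algebra_sheaf S" and stalk_ring: "!!x. x : V ==> ring (stalk S x)"
begin

section \<open>The order filtration on stalks and the powers of the ideal \<open>J x\<close>\<close>

definition ordge :: "'x set => nat => 'a => bool" where
 "ordge U n f \<longleftrightarrow> (\<forall>m y. size m < n --> Ps U f m y = 0)"

definition ordI :: "'x => nat => ('x set \<times> 'a) set set" where
 "ordI x n = {germ S x N g | N g. dom N & x : N & g : sects S N & ordge N n g}"

abbreviation "J x \<equiv> nonzero_degree_ideal (stalk S x)"
abbreviation "Jpow x n \<equiv> ideal_power (stalk S x) (J x) n"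

lemma stalk_cases:
 assumes "A : carrier (stalk S x)" "x : V"
 obtains N g where "dom N" "x : N" "g : sects S N" "A = germ S x N g"
proof -
 obtain U s where U: "opn S U" "x : U" "s : sects S U" "A = germ S x U s"
  using assms(1) by (auto simp: stalk_simps)
 have UV: "opn S (U \<inter> V)" "U \<inter> V \<subseteq> U" "x : U \<inter> V" using U V_open assms(2) by auto
 show ?thesis
  using that[of "U \<inter> V" "res S U (U \<inter> V) s"] UV U germ_res[OF presheaf U(1,3) UV]
   presheafD(1)[OF presheaf U(1) UV(1,2) U(3)] by (auto simp: dom_def)
qed

lemma germ_dom_res:
 assumes "dom U" "f : sects S U" "dom W" "W \<subseteq> U" "x : W"
 shows "germ S x U f = germ S x W (res S U W f)"
 using germ_res[OF presheaf] assms domD(1) by blast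

lemma germ_in_stalk: "dom U ==> x : U ==> f : sects S U ==> germ S x U f : carrier (stalk S x)"
 by (auto simp: stalk_simps dom_def)

lemma dom_Int: "dom U ==> dom W ==> dom (U \<inter> W)"
 by (auto simp: dom_def)

lemma ordge_res: "dom U ==> dom W ==> W \<subseteq> U ==> f : sects S U ==> ordge U n f ==> ordge W n (res S U W f)"
 by (simp add: ordge_def Psi_res)

text \<open>The coefficients at \<open>h x\<close> depend on the germ only, so they may be computed
  from the representative of order n.\<close>

lemma ordI_coef:
 assumes "germ S x U f : ordI x n" "dom U" "x : U" "f : sects S U" "size m < n"
 shows "Ps U f m (h x) = 0"
proof -
 obtain N g where N: "dom N" "x : N" "g : sects S N" "ordge N n g" "germ S x U f = germ S x N g"
  using assms(1) by (auto simp: ordI_def)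
 then obtain K where K: "opn S K" "x : K" "K \<subseteq> U \<inter> N" "res S U K f = res S N K g"
  using germ_eq_iff[OF presheaf domD(1)[OF assms(2)] assms(3,4) domD(1)[OF N(1)] N(2,3)] by auto
 have dK: "dom K" using dom_subset[OF assms(2) K(1)] K(3) by blast
 have "Ps U f m (h x) = Ps K (res S U K f) m (h x)"
  using K(2,3) by (subst Psi_res[OF assms(2) dK _ assms(4)]) auto
 also have "\<dots> = Ps N g m (h x)" using K by (simp add: Psi_res[OF N(1) dK _ N(3)])
 also have "\<dots> = 0" using N(4) assms(5) by (simp add: ordge_def)
 finally show ?thesis .
qed

lemma ordI_pair:
 assumes "A : ordI x n" "B : ordI x k"
 obtains N f g where "dom N" "x : N" "f : sects S N" "ordge N n f" "A = germ S x N f"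
  "g : sects S N" "ordge N k g" "B = germ S x N g"
proof -
 obtain N f where N: "dom N" "x : N" "f : sects S N" "ordge N n f" "A = germ S x N f"
  using assms(1) by (auto simp: ordI_def)
 obtain N' g where N': "dom N'" "x : N'" "g : sects S N'" "ordge N' k g" "B = germ S x N' g"
  using assms(2) by (auto simp: ordI_def)
 let ?K = "N \<inter> N'"
 have K: "dom ?K" "x : ?K" "?K \<subseteq> N" "?K \<subseteq> N'" using N N' dom_Int by auto
 show ?thesis
  using that[OF K(1,2) res_closed[OF N(1) K(1,3) N(3)] ordge_res[OF N(1) K(1,3) N(3,4)] _
    res_closed[OF N'(1) K(1,4) N'(3)] ordge_res[OF N'(1) K(1,4) N'(3,4)]]
   germ_dom_res[OF N(1,3) K(1,3,2)] germ_dom_res[OF N'(1,3) K(1,4,2)] N(5) N'(5) by simp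
qed

lemma ordI_add:
 assumes "A : ordI x n" "B : ordI x n"
 shows "A \<oplus>\<^bsub>stalk S x\<^esub> B : ordI x n"
proof -
 obtain N f g where N: "dom N" "x : N" "f : sects S N" "ordge N n f" "A = germ S x N f"
  "g : sects S N" "ordge N n g" "B = germ S x N g" using ordI_pair[OF assms] .
 interpret ring "OS N" by (rule ringO[OF N(1)])
 show ?thesis unfolding N(5,8) stalk_add[OF S_alg domD(1)[OF N(1)] N(2,3,6)] ordI_def
  using N by (intro CollectI exI[of _ N] exI[of _ "f \<oplus>\<^bsub>OS N\<^esub> g"]) (simp add: ordge_def Psi_add)
qed

lemma ordI_mult:
 assumes "A : ordI x n" "B : ordI x k"
 shows "A \<otimes>\<^bsub>stalk S x\<^esub> B : ordI x (n + k)"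
proof -
 obtain N f g where N: "dom N" "x : N" "f : sects S N" "ordge N n f" "A = germ S x N f"
  "g : sects S N" "ordge N k g" "B = germ S x N g" using ordI_pair[OF assms] .
 interpret ring "OS N" by (rule ringO[OF N(1)])
 have "ordge N (n + k) (f \<otimes>\<^bsub>OS N\<^esub> g)"
  using N(4,7) by (auto simp: ordge_def Psi_mult[OF N(1,3,6)] intro!: series_mult_order[where i = n and j = k])
 then show ?thesis unfolding N(5,8) stalk_mult[OF S_alg domD(1)[OF N(1)] N(2,3,6)] ordI_def
  using N by (intro CollectI exI[of _ N] exI[of _ "f \<otimes>\<^bsub>OS N\<^esub> g"]) simp
qed

lemma ordI_0: "x : V ==> ordI x 0 = carrier (stalk S x)"
 by (auto simp: ordI_def ordge_def intro: germ_in_stalk elim!: stalk_cases)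

lemma ordI_carrier: "ordI x n \<subseteq> carrier (stalk S x)"
 by (auto simp: ordI_def intro: germ_in_stalk)

text \<open>The zero of the stalk is defined as a germ over the whole space; here it is recognised
  by A + A = A in the additive group.\<close>

lemma germ_zero:
 assumes "dom U" "x : U"
 shows "germ S x U \<zero>\<^bsub>OS U\<^esub> = \<zero>\<^bsub>stalk S x\<^esub>"
proof -
 interpret ring "OS U" by (rule ringO[OF assms(1)])
 interpret st: ring "stalk S x" using stalk_ring assms domD(2) by blast
 have "germ S x U \<zero>\<^bsub>OS U\<^esub> \<oplus>\<^bsub>stalk S x\<^esub> germ S x U \<zero>\<^bsub>OS U\<^esub> = germ S x U \<zero>\<^bsub>OS U\<^esub>"
  using stalk_add[OF S_alg domD(1)[OF assms(1)] assms(2) zero_closed zero_closed] by simp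
 then show ?thesis using germ_in_stalk[OF assms zero_closed] by simp
qed

lemma ordI_ideal:
 assumes "x : V"
 shows "ideal (ordI x n) (stalk S x)"
proof -
 interpret st: ring "stalk S x" by (rule stalk_ring[OF assms])
 show ?thesis
 proof (rule idealI[OF st.ring_axioms])
  show "subgroup (ordI x n) (add_monoid (stalk S x))"
  proof (rule st.add.subgroupI)
   show "ordI x n \<subseteq> carrier (stalk S x)" by (rule ordI_carrier)
   have "germ S x V \<zero>\<^bsub>OS V\<^esub> : ordI x n"
    using assms dom_V ring.ring_simprules(2)[OF ringO[OF dom_V]]
    by (auto simp: ordI_def ordge_def Psi_zero intro!: exI[of _ V] exI[of _ "\<zero>\<^bsub>OS V\<^esub>"])
   then show "ordI x n ~= {}" by blast
  next
   fix A assume "A : ordI x n"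
   then obtain N g where N: "dom N" "x : N" "g : sects S N" "ordge N n g" "A = germ S x N g"
    by (auto simp: ordI_def)
   interpret ring "OS N" by (rule ringO[OF N(1)])
   have "germ S x N (\<ominus>\<^bsub>OS N\<^esub> g) \<oplus>\<^bsub>stalk S x\<^esub> A = \<zero>\<^bsub>stalk S x\<^esub>"
    using N stalk_add[OF S_alg domD(1)[OF N(1)] N(2) a_inv_closed[OF N(3)] N(3)]
    by (simp add: l_neg germ_zero)
   then have "\<ominus>\<^bsub>stalk S x\<^esub> A = germ S x N (\<ominus>\<^bsub>OS N\<^esub> g)"
    using N by (intro st.minus_equality) (auto intro: germ_in_stalk)
   moreover have "germ S x N (\<ominus>\<^bsub>OS N\<^esub> g) : ordI x n"
    using N by (auto simp: ordI_def ordge_def Psi_uminus intro!: exI[of _ N] exI[of _ "\<ominus>\<^bsub>OS N\<^esub> g"])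
   ultimately show "\<ominus>\<^bsub>stalk S x\<^esub> A : ordI x n" by simp
  next
   fix A B assume "A : ordI x n" "B : ordI x n"
   then show "A \<oplus>\<^bsub>stalk S x\<^esub> B : ordI x n" by (rule ordI_add)
  qed
  fix A B assume A: "A : ordI x n" and B: "B : carrier (stalk S x)"
  show "B \<otimes>\<^bsub>stalk S x\<^esub> A : ordI x n" "A \<otimes>\<^bsub>stalk S x\<^esub> B : ordI x n"
   using ordI_mult[OF _ A, of B 0] ordI_mult[OF A, of B 0] B ordI_0[OF assms] by auto
 qed
qed

lemma hpart_stalk_J:
 assumes "x : V" "k ~= 0"
 shows "hpart (stalk S x) k \<subseteq> J x"
 using assms by (auto simp: nonzero_degree_ideal_def genideal_def)

lemma J_ideal:
 assumes "x : V"
 shows "ideal (J x) (stalk S x)"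
proof -
 interpret st: ring "stalk S x" by (rule stalk_ring[OF assms])
 have "(\<Union>k\<in>-{0}. hpart (stalk S x) k) \<subseteq> carrier (stalk S x)"
  using hpart_carrier[OF supercomm_algebraD(3)[OF algebra_sheafD(3)[OF S_alg]]]
  by (fastforce simp: stalk_simps)
 then show ?thesis unfolding nonzero_degree_ideal_def by (rule st.genideal_ideal)
qed

lemma Jpow_ideal:
 assumes "x : V"
 shows "ideal (Jpow x n) (stalk S x)"
proof (induction n)
 interpret st: ring "stalk S x" by (rule stalk_ring[OF assms])
 case 0 show ?case by (simp add: st.oneideal)
next
 interpret st: ring "stalk S x" by (rule stalk_ring[OF assms])
 case (Suc n) then show ?case using st.ideal_prod_is_ideal[OF J_ideal[OF assms]] by simp
qed

text \<open>The empty monomial has degree 0, hence series of nonzero degree have no constant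
  term.\<close>

lemma J_ordI:
 assumes "x : V"
 shows "J x \<subseteq> ordI x 1"
proof -
 have "germ S x U s : ordI x 1" if U: "opn S U" "x : U" "s : hpart (OS U) k" "k ~= 0" for U s k
 proof -
  have sc: "s : sects S U"
   using hpart_carrier[OF supercomm_algebraD(3)[OF algebra_sheafD(3)[OF S_alg U(1)]] U(3)] .
  let ?N = "U \<inter> V"
  have N: "opn S ?N" "?N \<subseteq> U" "x : ?N" using U V_open assms by auto
  have dN: "dom ?N" using N by (simp add: dom_def)
  have r: "res S U ?N s : hpart (OS ?N) k" using presheafD(3)[OF presheaf U(1) N(1,2) U(3)] .
  have rc: "res S U ?N s : sects S ?N" by (rule hpartD[OF dN r])
  have "ordge ?N 1 (res S U ?N s)"
   using r U(4) unfolding ordge_def Psi_hpart[OF dN rc] by auto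
  then show ?thesis unfolding germ_res[OF presheaf U(1) sc N] ordI_def using N dN rc by blast
 qed
 then have "(\<Union>k\<in>-{0}. hpart (stalk S x) k) \<subseteq> ordI x 1" by (auto simp: stalk_simps)
 then show ?thesis unfolding nonzero_degree_ideal_def genideal_def
  using ordI_ideal[OF assms] by blast
qed

lemma Jpow_ordI:
 assumes "x : V"
 shows "Jpow x n \<subseteq> ordI x n"
proof (induction n)
 case (Suc n)
 have "A : ordI x (Suc n)" if "A : ideal_prod (stalk S x) (J x) (Jpow x n)" for A
  using that
 proof (induction rule: ideal_prod.induct)
  case (prod i j)
  then show ?case using ordI_mult[of i x 1 j n] J_ordI[OF assms] Suc by auto
 qed (rule ordI_add)
 then show ?case by auto
qed (simp add: ordI_0[OF assms])

text \<open>Converse to \<open>Jpow_ordI\<close>. A series of order n + 1 is a sum of terms w_a Q_a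
  with Q_a of order n and w_a in the ideal; the sum is finite because \<open>gens p\<close>
  is.\<close>

lemma ordge_Jpow:
 assumes "dom U" "x : U"
 shows "f : sects S U ==> ordge U n f ==> germ S x U f : Jpow x n"
proof (induction n arbitrary: f)
 case 0
 then show ?case using germ_in_stalk[OF assms] by simp
next
 case (Suc n)
 have xV: "x : V" using assms domD by blast
 interpret ring "OS U" by (rule ringO[OF assms(1)])
 interpret st: ring "stalk S x" by (rule stalk_ring[OF xV])
 interpret Jp: ideal "Jpow x (Suc n)" "stalk S x" by (rule Jpow_ideal[OF xV])
 define Q where "Q a = sect U (quot_gen a (Ps U f))" for a
 have Q: "Q a : sects S U" "Ps U (Q a) = quot_gen a (Ps U f)" for a
  using quot_gen_on[OF img_open[OF assms(1)] Psi_on[OF assms(1) Suc.prems(1)]]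
  by (simp_all add: Q_def sect_closed[OF assms(1)] Psi_sect[OF assms(1)])
 have oQ: "ordge U n (Q a)" for a
  using Suc.prems(2) by (auto simp: ordge_def Q quot_gen_def)
 have ix: "Inr a : idx p" if "a : gens p" for a using that by (simp add: idx_def)
 note cc = co_closed[OF assms(1) ix]
 have cQ: "(%a. co U (Inr a) \<otimes>\<^bsub>OS U\<^esub> Q a) : gens p \<rightarrow> sects S U" using cc Q by auto
 have f: "f = (\<Oplus>\<^bsub>OS U\<^esub>a\<in>gens p. co U (Inr a) \<otimes>\<^bsub>OS U\<^esub> Q a)"
 proof (rule eqI[OF assms(1) Suc.prems(1) finsum_closed[OF cQ]])
  fix m z assume m: "m : monomials p" and z: "z : h ` U"
  have "(\<Sum>a\<in>gens p. Ps U (co U (Inr a) \<otimes>\<^bsub>OS U\<^esub> Q a) m z) =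
    (\<Sum>a\<in>gens p. series_mult p (wser (h ` U) a) (quot_gen a (Ps U f)) m z)"
   by (rule sum.cong) (use cc Q ix in \<open>auto simp: Psi_mult[OF assms(1)] Psi_co[OF assms(1)] coser_def\<close>)
  then show "Ps U f m z = Ps U (\<Oplus>\<^bsub>OS U\<^esub>a\<in>gens p. co U (Inr a) \<otimes>\<^bsub>OS U\<^esub> Q a) m z"
   using cQ fin Suc.prems(2) by (simp add: Psi_finsum[OF assms(1)] sum_wser_quot_gen[OF fin z m] ordge_def)
 qed
 have one: "germ S x U (co U (Inr a) \<otimes>\<^bsub>OS U\<^esub> Q a) : Jpow x (Suc n)" if a: "a : gens p" for a
 proof -
  have "fst a ~= 0" using a by (auto simp: gens_def)
  moreover have "germ S x U (co U (Inr a)) : hpart (stalk S x) (fst a)"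
   using co_hpart[OF assms(1) ix[OF a]] assms domD(1) by (auto simp: stalk_simps)
  ultimately have "germ S x U (co U (Inr a)) : J x" using hpart_stalk_J[OF xV] by blast
  moreover have "germ S x U (Q a) : Jpow x n" by (rule Suc.IH[OF Q(1) oQ])
  ultimately have "germ S x U (co U (Inr a)) \<otimes>\<^bsub>stalk S x\<^esub> germ S x U (Q a) : Jpow x (Suc n)"
   unfolding ideal_power.simps(2) by (rule ideal_prod.prod)
  then show ?thesis
   unfolding stalk_mult[OF S_alg domD(1)[OF assms(1)] assms(2) cc[OF a] Q(1)] .
 qed
 have "germ S x U (\<Oplus>\<^bsub>OS U\<^esub>a\<in>G. co U (Inr a) \<otimes>\<^bsub>OS U\<^esub> Q a) : Jpow x (Suc n)"
  if "finite G" "G \<subseteq> gens p" for G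
  using that
 proof (induction G)
  case empty
  show ?case using germ_zero[OF assms] Jp.zero_closed by simp
 next
  case (insert a G)
  have c: "(%a. co U (Inr a) \<otimes>\<^bsub>OS U\<^esub> Q a) : G \<rightarrow> sects S U" "co U (Inr a) \<otimes>\<^bsub>OS U\<^esub> Q a : sects S U"
   using cQ insert by auto
  have "(\<Oplus>\<^bsub>OS U\<^esub>a\<in>insert a G. co U (Inr a) \<otimes>\<^bsub>OS U\<^esub> Q a) =
    (co U (Inr a) \<otimes>\<^bsub>OS U\<^esub> Q a) \<oplus>\<^bsub>OS U\<^esub> (\<Oplus>\<^bsub>OS U\<^esub>a\<in>G. co U (Inr a) \<otimes>\<^bsub>OS U\<^esub> Q a)"
   using insert c by (intro finsum_insert)
  then show ?case
   using stalk_add[OF S_alg domD(1)[OF assms(1)] assms(2) c(2) finsum_closed[OF c(1)], symmetric]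
    Jp.a_closed[OF one insert.IH] insert by simp
 qed
 from this[OF fin subset_refl] show ?case using f by simp
qed

end

section \<open>Convergence of formal sums and the components of a vector field\<close>

definition vf_comp ::
 "('x, real, 'a) gpresheaf => 'x set => ('x set => 'a => 'a) => (int => 'x set => 'a => 'a) => bool" where
 "vf_comp M V X D \<longleftrightarrow> (\<forall>k. D k : derivations M V k) \<and>
   (\<forall>U. opn M U & U \<subseteq> V -->
    (\<forall>f\<in>sects M U. formal_sum M U (%k. D k U f) (X U f)))"

lemma vector_fields_iff: "X : vector_fields M V \<longleftrightarrow> X : sheaf_endo M V & (\<exists>D. vf_comp M V X D)"
 by (simp add: vector_fields_def vf_comp_def)

lemma vf_compD:
 assumes "vf_comp M V X D"
 shows "!!k. D k : derivations M V k"
  "!!U f. opn M U ==> U \<subseteq> V ==> f : sects M U ==> formal_sum M U (%k. D k U f) (X U f)"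
 using assms by (simp_all add: vf_comp_def)

lemma series_mult_sum_left:
 "series_mult p (%m y. \<Sum>k\<in>K. s k m y) t m y = (\<Sum>k\<in>K. series_mult p (s k) t m y)"
proof -
 have "(\<Sum>m'\<in>{m'. m' \<subseteq># m}. mono_sign m' (m - m') * (\<Sum>k\<in>K. s k m' y) * t (m - m') y) =
   (\<Sum>k\<in>K. \<Sum>m'\<in>{m'. m' \<subseteq># m}. mono_sign m' (m - m') * s k m' y * t (m - m') y)"
  by (subst sum.swap) (simp add: sum_distrib_left sum_distrib_right)
 then show ?thesis by (simp add: series_mult_def)
qed

context mfd_chart
begin

text \<open>Elements of the n-th power of the ideal have no coefficients below order n at x, so
  large finite sums reproduce those of f exactly.\<close>

lemma formal_sum_coef:
 assumes "dom U" "formal_sum S U F f" "f : sects S U" "!!k. F k : sects S U" "x : U"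
 shows "\<exists>K0. finite K0 & (\<forall>K. finite K & K0 \<subseteq> K -->
  (\<forall>m. size m < n --> Ps U f m (h x) = (\<Sum>k\<in>K. Ps U (F k) m (h x))))"
proof -
 interpret ring "OS U" by (rule ringO[OF assms(1)])
 have xV: "x : V" using assms(1,5) domD by blast
 obtain K0 where K0: "finite K0 & (\<forall>K. finite K & K0 \<subseteq> K -->
   germ S x U (f \<ominus>\<^bsub>OS U\<^esub> finsum (OS U) F K) : Jpow x n)"
  using assms(2)[unfolded formal_sum_def, THEN bspec, OF assms(5), THEN spec, of n] by (rule exE)
 have "Ps U f m (h x) = (\<Sum>k\<in>K. Ps U (F k) m (h x))" if K: "finite K" "K0 \<subseteq> K" and m: "size m < n" for K m
 proof -
  have c: "finsum (OS U) F K : sects S U" using assms(4) by (intro finsum_closed) auto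
  have "germ S x U (f \<ominus>\<^bsub>OS U\<^esub> finsum (OS U) F K) : ordI x n"
   using K0 K by (intro subsetD[OF Jpow_ordI[OF xV]]) simp
  from ordI_coef[OF this assms(1,5) _ m] show ?thesis
   using c assms(3,4) K(1) by (simp add: Psi_minus[OF assms(1)] Psi_finsum[OF assms(1)])
 qed
 then show ?thesis using K0 by (intro exI[of _ K0]) simp
qed

text \<open>Here the finite index set has to work at all points of U, as membership in
  \<open>Jpow x n\<close> is obtained from a bound on the order over the whole of U.\<close>

lemma formal_sumI:
 assumes "dom U" "f : sects S U" "!!k. F k : sects S U"
  and "!!n. \<exists>K0. finite K0 & (\<forall>K. finite K & K0 \<subseteq> K -->
   (\<forall>m y. size m < n --> m : monomials p --> y : h ` U --> Ps U f m y = (\<Sum>k\<in>K. Ps U (F k) m y)))"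
 shows "formal_sum S U F f"
 unfolding formal_sum_def
proof (intro ballI allI)
 interpret ring "OS U" by (rule ringO[OF assms(1)])
 fix x n assume x: "x : U"
 obtain K0 where K0: "finite K0 & (\<forall>K. finite K & K0 \<subseteq> K -->
   (\<forall>m y. size m < n --> m : monomials p --> y : h ` U --> Ps U f m y = (\<Sum>k\<in>K. Ps U (F k) m y)))"
  using assms(4)[of n] by (rule exE)
 have "germ S x U (f \<ominus>\<^bsub>OS U\<^esub> finsum (OS U) F K) : Jpow x n" if K: "finite K" "K0 \<subseteq> K" for K
 proof (rule ordge_Jpow[OF assms(1) x])
  have c: "finsum (OS U) F K : sects S U" using assms(3) by (intro finsum_closed) auto
  then show fc: "f \<ominus>\<^bsub>OS U\<^esub> finsum (OS U) F K : sects S U" using assms(2) by simp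
  show "ordge U n (f \<ominus>\<^bsub>OS U\<^esub> finsum (OS U) F K)"
   unfolding ordge_def
  proof (intro allI impI)
   fix m :: "gen multiset" and y assume m: "size m < n"
   show "Ps U (f \<ominus>\<^bsub>OS U\<^esub> finsum (OS U) F K) m y = 0"
   proof (cases "m : monomials p & y : h ` U")
    case True
    then have "Ps U f m y = (\<Sum>k\<in>K. Ps U (F k) m y)" using K0 K m by simp
    then show ?thesis using c assms(2,3) K(1)
     by (simp add: Psi_minus[OF assms(1)] Psi_finsum[OF assms(1)])
   next
    case False
    then show ?thesis using series_onD(2,3)[OF Psi_on[OF assms(1) fc]] by blast
   qed
  qed
 qed
 then show "\<exists>K0. finite K0 & (\<forall>K. finite K & K0 \<subseteq> K --> germ S x U (f \<ominus>\<^bsub>OS U\<^esub> finsum (OS U) F K) : Jpow x n)"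
  using K0 by (intro exI[of _ K0]) simp
qed

definition hcomp :: "'x set => int => 'a => 'a" where
 "hcomp U k f = sect U (comp_ser k (Ps U f))"

lemma hcomp_closed: "dom U ==> f : sects S U ==> hcomp U k f : sects S U"
 unfolding hcomp_def by (intro sect_closed comp_ser_on img_open Psi_on)

lemma Psi_hcomp: "dom U ==> f : sects S U ==> Ps U (hcomp U k f) = comp_ser k (Ps U f)"
 unfolding hcomp_def by (intro Psi_sect comp_ser_on img_open Psi_on)

lemma hcomp_hpart: "dom U ==> f : sects S U ==> hcomp U k f : hpart (OS U) k"
 by (simp add: Psi_hpart hcomp_closed Psi_hcomp comp_ser_def)

lemma vf_endo_closed:
 "X : sheaf_endo S V0 ==> dom V0 ==> ii : idx p ==> X V0 (co V0 ii) : sects S V0"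
 using dom_endoD(1) co_closed by blast

text \<open>At a monomial m only the component of degree \<open>mono_degree m - dg ii\<close>
  contributes to the value of X on the coordinate, so the components can be read off from that
  value.\<close>

lemma vf_comp_coef:
 assumes V0: "dom V0" and X: "X : sheaf_endo S V0" and D: "vf_comp S V0 X D" and i: "ii : idx p"
 shows "D k V0 (co V0 ii) = hcomp V0 (k + dg ii) (X V0 (co V0 ii))"
proof (rule eqI[OF V0])
 note Dd = vf_compD(1)[OF D]
 note cc = co_closed[OF V0 i]
 have Dc: "D l V0 (co V0 ii) : hpart (OS V0) (l + dg ii)" for l
  using derivationD(4)[OF dom_derivation[OF Dd V0 subset_refl] co_hpart[OF V0 i]] by (simp add: add.commute)
 have Dcc: "D l V0 (co V0 ii) : sects S V0" for l by (rule hpartD[OF V0 Dc])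
 have Xc: "X V0 (co V0 ii) : sects S V0" by (rule vf_endo_closed[OF X V0 i])
 show "D k V0 (co V0 ii) : sects S V0" by (rule Dcc)
 show "hcomp V0 (k + dg ii) (X V0 (co V0 ii)) : sects S V0" by (rule hcomp_closed[OF V0 Xc])
 fix m y assume "y : h ` V0"
 then obtain x where x: "x : V0" "y = h x" by blast
 have z: "Ps V0 (D l V0 (co V0 ii)) m y = 0" if "mono_degree m ~= l + dg ii" for l
  using Dc[of l] that unfolding Psi_hpart[OF V0 Dcc] by metis
 obtain K0 where K0': "finite K0 & (\<forall>K. finite K & K0 \<subseteq> K --> (\<forall>m'. size m' < Suc (size m) -->
   Ps V0 (X V0 (co V0 ii)) m' y = (\<Sum>l\<in>K. Ps V0 (D l V0 (co V0 ii)) m' y)))"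
  using formal_sum_coef[OF V0 vf_compD(2)[OF D domD(1)[OF V0] subset_refl cc] Xc Dcc x(1), of "Suc (size m)"]
  unfolding x(2)[symmetric] by (rule exE)
 then have K0: "finite K0" "!!K. finite K ==> K0 \<subseteq> K ==>
   Ps V0 (X V0 (co V0 ii)) m y = (\<Sum>l\<in>K. Ps V0 (D l V0 (co V0 ii)) m y)"
  by simp_all
 show "Ps V0 (D k V0 (co V0 ii)) m y = Ps V0 (hcomp V0 (k + dg ii) (X V0 (co V0 ii))) m y"
 proof (cases "mono_degree m = k + dg ii")
  case True
  \<comment> \<open>Enlarging the finite sum by k ensures that the contributing component is
    present.\<close>
  have "Ps V0 (X V0 (co V0 ii)) m y = (\<Sum>l\<in>insert k K0. Ps V0 (D l V0 (co V0 ii)) m y)"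
   using K0(2)[of "insert k K0"] K0(1) by auto
  also have "\<dots> = Ps V0 (D k V0 (co V0 ii)) m y"
   using K0(1) True z by (subst sum.remove[of _ k]) (auto intro!: sum.neutral)
  finally show ?thesis using True by (simp add: Psi_hcomp[OF V0 Xc] comp_ser_def)
 next
  case False
  then show ?thesis using z by (simp add: Psi_hcomp[OF V0 Xc] comp_ser_def)
 qed
qed

text \<open>The right-hand side does not mention D, so the components of a vector field on a chart
  are unique.\<close>

lemma vf_comp_LC:
 assumes V0: "dom V0" and X: "X : sheaf_endo S V0" and D: "vf_comp S V0 X D"
 shows "D k = LC V0 (%ii. hcomp V0 (k + dg ii) (X V0 (co V0 ii)))"
proof -
 have "D k = LC V0 (%ii. D k V0 (co V0 ii))" by (rule derivations_LC[OF V0 vf_compD(1)[OF D]])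
 also have "\<dots> = LC V0 (%ii. hcomp V0 (k + dg ii) (X V0 (co V0 ii)))"
  (is "LC V0 ?c = LC V0 ?d")
 proof (rule sheaf_endo_eqI)
  have c: "?c ii = ?d ii" if "ii : idx p" for ii by (rule vf_comp_coef[OF V0 X D that])
  have dc: "?d ii : sects S V0" if "ii : idx p" for ii by (rule hcomp_closed[OF V0 vf_endo_closed[OF X V0 that]])
  show "LC V0 ?c : sheaf_endo S V0" "LC V0 ?d : sheaf_endo S V0"
   using dc c by (auto intro!: LC_sheaf_endo[OF V0])
  fix U f assume U: "opn S U" "U \<subseteq> V0" "f : sects S U"
  have dU: "dom U" by (rule dom_subset[OF V0 U(1,2)])
  interpret ring "OS U" by (rule ringO[OF dU])
  show "LC V0 ?c U f = LC V0 ?d U f"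
   unfolding LC_eq[OF V0 dU U(2,3)]
   by (rule finsum_cong') (use c LC_term_closed[OF V0 dU U(2,3) dc] in auto)
 qed
 finally show ?thesis .
qed

text \<open>For a single coefficient finitely many homogeneous components matter, both in X f and in
  the values of X on the finitely many coordinates. Each component is expanded by
  \<open>derivations_LC\<close>, and a finite sum of these expansions gives the claim.\<close>

theorem vector_fields_LC:
 assumes V0: "dom V0" and X: "X : vector_fields S V0"
 shows "X = LC V0 (%ii. X V0 (co V0 ii))"
proof (rule sheaf_endo_eqI)
 obtain D where Xe: "X : sheaf_endo S V0" and D: "vf_comp S V0 X D" using X by (auto simp: vector_fields_iff)
 show "X : sheaf_endo S V0" by (rule Xe)
 note Xc = vf_endo_closed[OF Xe V0]
 show "LC V0 (%ii. X V0 (co V0 ii)) : sheaf_endo S V0" by (rule LC_sheaf_endo[OF V0 Xc])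
 fix U f assume U: "opn S U" "U \<subseteq> V0" "f : sects S U"
 have dU: "dom U" by (rule dom_subset[OF V0 U(1,2)])
 note Dd = vf_compD(1)[OF D]
 have Dc: "D k V0 (co V0 ii) : sects S V0" if "ii : idx p" for k ii
  by (rule vf_endo_closed[OF derivationsD(1)[OF Dd] V0 that])
 have DUc: "D k U f : sects S U" for k
  using dom_endoD(1)[OF derivationsD(1)[OF Dd] V0 dU U(2,3)] .
 show "X U f = LC V0 (%ii. X V0 (co V0 ii)) U f"
 proof (rule eqI[OF dU])
  show XUc: "X U f : sects S U" by (rule dom_endoD(1)[OF Xe V0 dU U(2,3)])
  show "LC V0 (%ii. X V0 (co V0 ii)) U f : sects S U"
   by (rule LC_closed[OF V0 dU U(2,3) Xc])
  fix m :: "gen multiset" and y assume y: "y : h ` U"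
  then obtain x where x: "x : U" "y = h x" by blast
  have xV0: "x : V0" using x U by blast
  obtain K0 where K0': "finite K0 & (\<forall>K. finite K & K0 \<subseteq> K -->
    (\<forall>m'. size m' < Suc (size m) --> Ps U (X U f) m' y = (\<Sum>k\<in>K. Ps U (D k U f) m' y)))"
   using formal_sum_coef[OF dU vf_compD(2)[OF D U] XUc DUc x(1), of "Suc (size m)"] unfolding x(2)[symmetric] by (rule exE)
  then have K0: "finite K0" "!!K. finite K ==> K0 \<subseteq> K ==> Ps U (X U f) m y = (\<Sum>k\<in>K. Ps U (D k U f) m y)"
   by simp_all
  have "\<exists>K0. finite K0 & (\<forall>K. finite K & K0 \<subseteq> K --> (\<forall>m'. size m' < Suc (size m) -->
    Ps V0 (X V0 (co V0 ii)) m' y = (\<Sum>k\<in>K. Ps V0 (D k V0 (co V0 ii)) m' y)))" if "ii : idx p" for ii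
   using formal_sum_coef[OF V0 vf_compD(2)[OF D domD(1)[OF V0] subset_refl co_closed[OF V0 that]] Xc[OF that] Dc[OF that] xV0, of "Suc (size m)"]
    x(2) by simp
  then have "\<forall>ii\<in>idx p. \<exists>K0. finite K0 & (\<forall>K. finite K & K0 \<subseteq> K --> (\<forall>m'. size m' < Suc (size m) -->
    Ps V0 (X V0 (co V0 ii)) m' y = (\<Sum>k\<in>K. Ps V0 (D k V0 (co V0 ii)) m' y)))" by (rule ballI)
  from bchoice[OF this] obtain K1 where K1': "\<forall>ii\<in>idx p. finite (K1 ii) & (\<forall>K. finite K & K1 ii \<subseteq> K --> (\<forall>m'. size m' < Suc (size m) -->
    Ps V0 (X V0 (co V0 ii)) m' y = (\<Sum>k\<in>K. Ps V0 (D k V0 (co V0 ii)) m' y)))" by (rule exE)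
  then have K1: "!!ii. ii : idx p ==> finite (K1 ii)"
   "!!ii K m'. ii : idx p ==> finite K ==> K1 ii \<subseteq> K ==> size m' < Suc (size m) ==>
     Ps V0 (X V0 (co V0 ii)) m' y = (\<Sum>k\<in>K. Ps V0 (D k V0 (co V0 ii)) m' y)"
   by simp_all
  \<comment> \<open>One finite set of degrees that suffices for X f and for the values on all
    coordinates.\<close>
  define K where "K = K0 \<union> (\<Union>ii\<in>idx p. K1 ii)"
  have K: "finite K" "K0 \<subseteq> K" "!!ii. ii : idx p ==> K1 ii \<subseteq> K"
   using K0(1) K1(1) finite_idx[OF fin] by (auto simp: K_def)
  have "Ps U (D k U f) m y = (\<Sum>ii\<in>idx p. series_mult p (Ps V0 (D k V0 (co V0 ii))) (Ps U (pd ii U f)) m y)" for k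
  proof -
   have "Ps U (D k U f) m y = Ps U (LC V0 (%ii. D k V0 (co V0 ii)) U f) m y"
    by (rule arg_cong[of _ _ "%Z. Ps U (Z U f) m y", OF derivations_LC[OF V0 Dd]])
   also have "\<dots> = (\<Sum>ii\<in>idx p. series_mult p (Ps V0 (D k V0 (co V0 ii))) (Ps U (pd ii U f)) m y)"
    by (rule Psi_LC[OF V0 dU U(2,3) _ y]) (rule Dc)
   finally show ?thesis .
  qed
  then have "Ps U (X U f) m y =
    (\<Sum>k\<in>K. \<Sum>ii\<in>idx p. series_mult p (Ps V0 (D k V0 (co V0 ii))) (Ps U (pd ii U f)) m y)"
   using K0(2)[OF K(1,2)] by simp
  also have "\<dots> = (\<Sum>ii\<in>idx p. series_mult p (%m y. \<Sum>k\<in>K. Ps V0 (D k V0 (co V0 ii)) m y) (Ps U (pd ii U f)) m y)"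
   by (subst sum.swap) (simp add: series_mult_sum_left)
  also have "\<dots> = (\<Sum>ii\<in>idx p. series_mult p (Ps V0 (X V0 (co V0 ii))) (Ps U (pd ii U f)) m y)"
  \<comment> \<open>The product at m involves the coefficients at all submultisets of m, hence the
    bound \<open>Suc (size m)\<close> above.\<close>
  proof (intro sum.cong refl series_mult_cong)
   fix ii m' assume i: "ii : idx p" and m': "m' \<subseteq># m"
   have "size m' < Suc (size m)" using size_mset_mono[OF m'] by simp
   from K1(2)[OF i K(1) K(3)[OF i] this]
   show "(\<Sum>k\<in>K. Ps V0 (D k V0 (co V0 ii)) m' y) = Ps V0 (X V0 (co V0 ii)) m' y" by simp
  qed
  also have "\<dots> = Ps U (LC V0 (%ii. X V0 (co V0 ii)) U f) m y"
   using Psi_LC[OF V0 dU U(2,3) Xc y] by simp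
  finally show "Ps U (X U f) m y = Ps U (LC V0 (%ii. X V0 (co V0 ii)) U f) m y" .
 qed
qed

text \<open>\<open>hcomp V0 (k + dg ii)\<close> picks the part of the coefficient that makes its
  term homogeneous of degree k. The sum over k converges because the degrees of monomials of bounded
  size are bounded.\<close>

lemma LC_vf_comp:
 assumes V0: "dom V0" and c: "!!ii. ii : idx p ==> c ii : sects S V0"
 shows "vf_comp S V0 (LC V0 c) (%k. LC V0 (%ii. hcomp V0 (k + dg ii) (c ii)))"
 unfolding vf_comp_def
proof (intro conjI allI impI ballI)
 show "LC V0 (%ii. hcomp V0 (k + dg ii) (c ii)) : derivations S V0 k" for k
  by (rule LC_derivations[OF V0 hcomp_hpart[OF V0 c]])
 fix U f assume "opn S U & U \<subseteq> V0" and f: "f : sects S U"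
 then have U: "dom U" "U \<subseteq> V0" using dom_subset[OF V0] by auto
 note hc = hcomp_closed[OF V0 c]
 show "formal_sum S U (%k. LC V0 (%ii. hcomp V0 (k + dg ii) (c ii)) U f) (LC V0 c U f)"
 proof (rule formal_sumI[OF U(1) LC_closed[OF V0 U f c] LC_closed[OF V0 U f hc]])
  fix n
  obtain N where N: "!!m. m : monomials p ==> size m < n ==> \<bar>mono_degree m\<bar> \<le> N"
   using mono_degree_bound[OF fin, of n] by blast
  \<comment> \<open>A monomial m' of size below n in the coefficient with index \<iota> belongs to
    the component of degree \<open>mono_degree m' - dg \<iota>\<close>, whose absolute value is at
    most N + B.\<close>
  define B where "B = (\<Sum>ii\<in>idx p. \<bar>dg ii\<bar>)"
  have B: "\<bar>dg ii\<bar> \<le> B" if "ii : idx p" for ii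
   unfolding B_def using that finite_idx[OF fin] by (intro member_le_sum) auto
  have "Ps U (LC V0 c U f) m y = (\<Sum>k\<in>K. Ps U (LC V0 (%ii. hcomp V0 (k + dg ii) (c ii)) U f) m y)"
   if K: "finite K" "{-(N + B)..N + B} \<subseteq> K" and m: "size m < n" and y: "y : h ` U" for K m y
  proof -
   have "(\<Sum>k\<in>K. Ps U (LC V0 (%ii. hcomp V0 (k + dg ii) (c ii)) U f) m y) =
    (\<Sum>k\<in>K. \<Sum>ii\<in>idx p. series_mult p (comp_ser (k + dg ii) (Ps V0 (c ii))) (Ps U (pd ii U f)) m y)"
    by (simp add: Psi_LC[OF V0 U f hc y] Psi_hcomp[OF V0 c] cong: sum.cong)
   also have "\<dots> = (\<Sum>ii\<in>idx p. series_mult p (%m y. \<Sum>k\<in>K. comp_ser (k + dg ii) (Ps V0 (c ii)) m y) (Ps U (pd ii U f)) m y)"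
    by (subst sum.swap) (simp add: series_mult_sum_left)
   also have "\<dots> = (\<Sum>ii\<in>idx p. series_mult p (Ps V0 (c ii)) (Ps U (pd ii U f)) m y)"
   proof (intro sum.cong refl series_mult_cong)
    fix ii m' assume i: "ii : idx p" and m': "m' \<subseteq># m"
    show "(\<Sum>k\<in>K. comp_ser (k + dg ii) (Ps V0 (c ii)) m' y) = Ps V0 (c ii) m' y"
    proof (cases "m' : monomials p")
     case True
     have "size m' < n" using size_mset_mono[OF m'] m by simp
     then have k: "mono_degree m' - dg ii : K" using N[OF True] B[OF i] K(2) by force
     have "(\<Sum>k\<in>K. comp_ser (k + dg ii) (Ps V0 (c ii)) m' y) =
       (\<Sum>k\<in>K. if k = mono_degree m' - dg ii then Ps V0 (c ii) m' y else 0)"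
      by (intro sum.cong) (auto simp: comp_ser_def)
     then show ?thesis using k K(1) by simp
    next
     case False
     then have "Ps V0 (c ii) m' y = 0" by (rule series_onD(2)[OF Psi_on[OF V0 c[OF i]]])
     then show ?thesis by (auto simp: comp_ser_def intro!: sum.neutral)
    qed
   qed
   finally show ?thesis by (simp add: Psi_LC[OF V0 U f c y])
  qed
  then show "\<exists>K0. finite K0 & (\<forall>K. finite K & K0 \<subseteq> K -->
    (\<forall>m y. size m < n --> m : monomials p --> y : h ` U -->
     Ps U (LC V0 c U f) m y = (\<Sum>k\<in>K. Ps U (LC V0 (%ii. hcomp V0 (k + dg ii) (c ii)) U f) m y)))"
   by (intro exI[of _ "{-(N + B)..N + B}"]) simp
 qed
qed

lemma LC_vector_field:
 "dom V0 ==> (!!ii. ii : idx p ==> c ii : sects S V0) ==> LC V0 c : vector_fields S V0"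
 unfolding vector_fields_iff using LC_sheaf_endo LC_vf_comp by blast

end

section \<open>Gluing\<close>

lemma sheafD:
 assumes "is_sheaf S"
 shows "is_presheaf S"
  "!!\<V> s. (!!V. V : \<V> ==> opn S V) ==> (!!V. V : \<V> ==> s V : sects S V) ==>
    (!!V W. V : \<V> ==> W : \<V> ==> res S V (V \<inter> W) (s V) = res S W (V \<inter> W) (s W)) ==>
    \<exists>!t. t : sects S (\<Union>\<V>) & (\<forall>V\<in>\<V>. res S (\<Union>\<V>) V t = s V)"
  "!!\<V> t k. (!!V. V : \<V> ==> opn S V) ==> t : sects S (\<Union>\<V>) ==>
    (!!V. V : \<V> ==> res S (\<Union>\<V>) V t : hpart (sec S V) k) ==> t : hpart (sec S (\<Union>\<V>)) k"
proof -
 show "is_presheaf S" using assms by (simp add: is_sheaf_def)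
 note A = assms[unfolded is_sheaf_def, THEN conjunct2, THEN conjunct1]
  and B = assms[unfolded is_sheaf_def, THEN conjunct2, THEN conjunct2]
 show "\<exists>!t. t : sects S (\<Union>\<V>) & (\<forall>V\<in>\<V>. res S (\<Union>\<V>) V t = s V)"
  if "!!V. V : \<V> ==> opn S V" "!!V. V : \<V> ==> s V : sects S V"
   "!!V W. V : \<V> ==> W : \<V> ==> res S V (V \<inter> W) (s V) = res S W (V \<inter> W) (s W)" for \<V> s
  by (rule mp[OF spec[OF spec[OF A]]]) (intro conjI ballI that)
 show "t : hpart (sec S (\<Union>\<V>)) k" if "!!V. V : \<V> ==> opn S V" "t : sects S (\<Union>\<V>)"
    "!!V. V : \<V> ==> res S (\<Union>\<V>) V t : hpart (sec S V) k" for \<V> t k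
  by (rule mp[OF spec[OF spec[OF spec[OF B]]]]) (intro conjI ballI that)
qed

text \<open>Uniqueness of gluing for the cover by all open sets on which s and t agree.\<close>

lemma sheaf_eqI:
 assumes S: "is_sheaf S" and U: "opn S U" and s: "s : sects S U" and t: "t : sects S U"
  and loc: "!!x. x : U ==> \<exists>N. opn S N & x : N & N \<subseteq> U & res S U N s = res S U N t"
 shows "s = t"
proof -
 note P = sheafD(1)[OF S]
 define \<V> where "\<V> = {N. opn S N & N \<subseteq> U & res S U N s = res S U N t}"
 have un: "\<Union>\<V> = U" using loc by (auto simp: \<V>_def)
 have "\<exists>!r. r : sects S (\<Union>\<V>) & (\<forall>V\<in>\<V>. res S (\<Union>\<V>) V r = res S U V s)"
 proof (rule sheafD(2)[OF S])
  fix V W assume V: "V : \<V>" and W: "W : \<V>"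
  show "opn S V" using V by (simp add: \<V>_def)
  show "res S U V s : sects S V"
   by (rule presheafD(1)[OF P U _ _ s]) (use V in \<open>simp_all add: \<V>_def\<close>)
  have VW: "opn S V" "opn S W" "V \<subseteq> U" "W \<subseteq> U" using V W by (simp_all add: \<V>_def)
  show "res S V (V \<inter> W) (res S U V s) = res S W (V \<inter> W) (res S U W s)"
   using presheafD(5)[OF P U VW(1) openin_Int[OF VW(1,2)] _ VW(3) s]
    presheafD(5)[OF P U VW(2) openin_Int[OF VW(1,2)] _ VW(4) s] by simp
 qed
 then show ?thesis unfolding un using s t by (auto simp: \<V>_def)
qed

text \<open>\<open>is_sheaf\<close> indexes local sections by their open sets, while an indexed
  family may repeat a set; agreement on the overlap makes the choice of an index immaterial.\<close>

lemma sheaf_glue: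
 assumes S: "is_sheaf S" and U: "U = (\<Union>i\<in>I. N i)"
  and N: "!!i. i : I ==> opn S (N i)" and s: "!!i. i : I ==> s i : sects S (N i)"
  and agree: "!!i j. i : I ==> j : I ==> res S (N i) (N i \<inter> N j) (s i) = res S (N j) (N i \<inter> N j) (s j)"
 obtains t where "t : sects S U" "!!i. i : I ==> res S U (N i) t = s i"
proof -
 note P = sheafD(1)[OF S]
 define c where "c W = (SOME i. i : I & N i = W)" for W
 have c: "c (N i) : I" "N (c (N i)) = N i" if "i : I" for i
  using someI[of "%j. j : I & N j = N i" i] that by (auto simp: c_def)
 have sc: "s (c (N i)) = s i" if i: "i : I" for i
 proof -
  have "res S (N i) (N i) (s (c (N i))) = res S (N i) (N i) (s i)"
   using agree[OF c(1)[OF i] i] c(2)[OF i] by simp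
  moreover have "s (c (N i)) : sects S (N i)" using s[OF c(1)[OF i]] c(2)[OF i] by simp
  ultimately show ?thesis using presheafD(4)[OF P N[OF i]] s[OF i] by simp
 qed
 have un: "\<Union>(N ` I) = U" using U by simp
 have "\<exists>!t. t : carrier (sec S (\<Union>(N ` I))) & (\<forall>V\<in>N ` I. res S (\<Union>(N ` I)) V t = s (c V))"
 proof (rule sheafD(2)[OF S])
  fix V W assume "V : N ` I" "W : N ` I"
  then obtain i j where ij: "i : I" "j : I" "V = N i" "W = N j" by blast
  show "opn S V" "s (c V) : sects S V" using ij N s sc by auto
  show "res S V (V \<inter> W) (s (c V)) = res S W (V \<inter> W) (s (c W))"
   using agree[OF ij(1,2)] sc ij by simp
 qed
 then obtain t where "t : sects S U" "\<forall>V\<in>N ` I. res S U V t = s (c V)" unfolding un by blast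
 then show ?thesis using that sc by auto
qed

lemma sheaf_hpartI:
 assumes S: "is_sheaf S" and U: "opn S U" and t: "t : sects S U"
  and loc: "!!x. x : U ==> \<exists>N. opn S N & x : N & N \<subseteq> U & res S U N t : hpart (sec S N) k"
 shows "t : hpart (sec S U) k"
proof -
 define \<V> where "\<V> = {N. opn S N & N \<subseteq> U & res S U N t : hpart (sec S N) k}"
 have un: "\<Union>\<V> = U" using loc by (auto simp: \<V>_def)
 have "t : hpart (sec S (\<Union>\<V>)) k"
  by (rule sheafD(3)[OF S]) (use t in \<open>auto simp: un\<close>, auto simp: \<V>_def)
 then show ?thesis by (simp add: un)
qed

section \<open>Restriction maps, and gluing of sheaf endomorphisms\<close>

lemma res_hom_facts:
 assumes S: "algebra_sheaf S" and U: "opn S U" and W: "opn S W" "W \<subseteq> U"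
 shows "!!f. f : sects S U ==> res S U W f : sects S W"
  and "!!f g. f : sects S U ==> g : sects S U ==>
   res S U W (f \<oplus>\<^bsub>sec S U\<^esub> g) = res S U W f \<oplus>\<^bsub>sec S W\<^esub> res S U W g"
  and "!!f g. f : sects S U ==> g : sects S U ==>
   res S U W (f \<otimes>\<^bsub>sec S U\<^esub> g) = res S U W f \<otimes>\<^bsub>sec S W\<^esub> res S U W g"
  and "res S U W \<one>\<^bsub>sec S U\<^esub> = \<one>\<^bsub>sec S W\<^esub>"
  and "res S U W \<zero>\<^bsub>sec S U\<^esub> = \<zero>\<^bsub>sec S W\<^esub>"
  and "!!f. f : sects S U ==> res S U W (\<ominus>\<^bsub>sec S U\<^esub> f) = \<ominus>\<^bsub>sec S W\<^esub> res S U W f"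
  and "!!f n. f : sects S U ==> res S U W (signed (sec S U) n f) = signed (sec S W) n (res S U W f)"
  and "!!F I. finite I ==> F : I \<rightarrow> sects S U ==>
   res S U W (\<Oplus>\<^bsub>sec S U\<^esub>i\<in>I. F i) = (\<Oplus>\<^bsub>sec S W\<^esub>i\<in>I. res S U W (F i))"
proof -
 interpret ring_hom_ring "sec S U" "sec S W" "res S U W"
  by (rule ring_hom_ringI2)
   (use algebra_sheafD(4)[OF S U W] supercomm_algebraD(1)[OF algebra_sheafD(3)[OF S]] U W in auto)
 show "!!f. f : sects S U ==> res S U W f : sects S W"
  "!!f g. f : sects S U ==> g : sects S U ==>
   res S U W (f \<oplus>\<^bsub>sec S U\<^esub> g) = res S U W f \<oplus>\<^bsub>sec S W\<^esub> res S U W g"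
  "!!f g. f : sects S U ==> g : sects S U ==>
   res S U W (f \<otimes>\<^bsub>sec S U\<^esub> g) = res S U W f \<otimes>\<^bsub>sec S W\<^esub> res S U W g"
  "res S U W \<one>\<^bsub>sec S U\<^esub> = \<one>\<^bsub>sec S W\<^esub>" "res S U W \<zero>\<^bsub>sec S U\<^esub> = \<zero>\<^bsub>sec S W\<^esub>"
  and inv: "!!f. f : sects S U ==> res S U W (\<ominus>\<^bsub>sec S U\<^esub> f) = \<ominus>\<^bsub>sec S W\<^esub> res S U W f"
  by simp_all
 show "!!f n. f : sects S U ==> res S U W (signed (sec S U) n f) = signed (sec S W) n (res S U W f)"
  using inv by (simp add: signed_def)
 show "res S U W (\<Oplus>\<^bsub>sec S U\<^esub>i\<in>I. F i) = (\<Oplus>\<^bsub>sec S W\<^esub>i\<in>I. res S U W (F i))"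
  if "finite I" "F : I \<rightarrow> sects S U" for F I
  using that
 proof (induction I)
  case (insert i I)
  then have "(%i. res S U W (F i)) : I \<rightarrow> sects S W" "res S U W (F i) : sects S W"
   using hom_closed by (auto simp: Pi_iff)
  with insert show ?case by (simp add: R.finsum_insert S.finsum_insert)
 qed simp
qed

text \<open>The common shape of the restriction maps and of the operations of
  \<open>tangent_sheaf\<close>: a family cut down to the open subsets of N and normalised
  elsewhere.\<close>

definition rst :: "('x, real, 'a) gpresheaf => 'x set => ('x set => 'a => 'a) => 'x set => 'a => 'a" where
 "rst S N X = (%U f. if opn S U & U \<subseteq> N & f : sects S U then X U f else undefined)"

lemma rst_endo:
 assumes S: "algebra_sheaf S" and X: "X : sheaf_endo S U" and N: "N \<subseteq> U"
 shows "rst S N X : sheaf_endo S N"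
proof (rule sheaf_endoI)
 fix W f assume W: "opn S W" "W \<subseteq> N" and f: "f : sects S W"
 interpret ring "sec S W" by (rule supercomm_algebraD(1)[OF algebra_sheafD(3)[OF S W(1)]])
 have WU: "W \<subseteq> U" using W N by blast
 show "rst S N X W f : sects S W" using sheaf_endoD(1)[OF X W(1) WU f] W f by (simp add: rst_def)
 show "rst S N X W (f \<oplus>\<^bsub>sec S W\<^esub> g) = rst S N X W f \<oplus>\<^bsub>sec S W\<^esub> rst S N X W g" if "g : sects S W" for g
  using sheaf_endoD(2)[OF X W(1) WU f that] W f that by (simp add: rst_def)
 show "rst S N X W (r \<odot>\<^bsub>sec S W\<^esub> f) = r \<odot>\<^bsub>sec S W\<^esub> rst S N X W f" for r
  using sheaf_endoD(3)[OF X W(1) WU f] W f supercomm_smult_closed[OF algebra_sheafD(3)[OF S W(1)] f]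
  by (simp add: rst_def)
 show "rst S N X W' (res S W W' f) = res S W W' (rst S N X W f)" if "opn S W'" "W' \<subseteq> W" for W'
  using sheaf_endoD(4)[OF X W(1) WU that f] W f that res_hom_facts(1)[OF S W(1) that f] order_trans[OF that(2) W(2)]
  by (simp add: rst_def)
qed (auto simp: rst_def)

lemma rst_derivations:
 assumes S: "algebra_sheaf S" and X: "X : derivations S U k" and N: "N \<subseteq> U"
 shows "rst S N X : derivations S N k"
proof (rule derivationsI[OF rst_endo[OF S derivationsD(1)[OF X] N]])
 fix W assume W: "opn S W" "W \<subseteq> N"
 then show "derivation (sec S W) k (rst S N X W)"
  using derivation_cong[OF algebra_sheafD(3)[OF S W(1)] derivationsD(2)[OF X W(1)], of "rst S N X W"] N
  by (auto simp: rst_def)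
qed

lemma rst_vf_comp:
 assumes S: "algebra_sheaf S" and X: "vf_comp S U X D" and N: "N \<subseteq> U"
 shows "vf_comp S N (rst S N X) (%k. rst S N (D k))"
 unfolding vf_comp_def
proof (intro conjI allI impI ballI)
 show "rst S N (D k) : derivations S N k" for k
  by (rule rst_derivations[OF S vf_compD(1)[OF X] N])
 fix W f assume "opn S W & W \<subseteq> N" and "f : sects S W"
 then show "formal_sum S W (%k. rst S N (D k) W f) (rst S N X W f)"
  using vf_compD(2)[OF X, of W f] N by (auto simp: rst_def)
qed

lemma rst_vector_fields:
 assumes S: "algebra_sheaf S" and X: "X : vector_fields S U" and N: "N \<subseteq> U"
 shows "rst S N X : vector_fields S N"
 using X rst_endo[OF S _ N] rst_vf_comp[OF S _ N] unfolding vector_fields_iff by blast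

lemma rst_eq: "opn S W ==> W \<subseteq> N ==> f : sects S W ==> rst S N X W f = X W f"
 by (simp add: rst_def)

text \<open>The value on f over W is glued from the \<open>Y i\<close> applied to the restrictions
  of f. \<open>G W f t\<close> says that t is such a value; since it determines t, the laws for X
  are proved by checking that both sides of an equation are such values.\<close>

lemma endo_glue:
 assumes S: "algebra_sheaf S" and U: "U = (\<Union>i\<in>I. N i)" and N: "!!i. i : I ==> opn S (N i)"
  and Y: "!!i. i : I ==> Y i : sheaf_endo S (N i)"
  and agree: "!!i j W f. i : I ==> j : I ==> opn S W ==> W \<subseteq> N i \<inter> N j ==> f : sects S W ==>
   Y i W f = Y j W f"
 obtains X where "X : sheaf_endo S U"
  "!!i W f. i : I ==> opn S W ==> W \<subseteq> N i ==> f : sects S W ==> X W f = Y i W f"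
proof -
 note sh = algebra_sheafD(1)[OF S] and P = algebra_sheafD(2)[OF S]
 define G where "G W f t \<longleftrightarrow> t : sects S W \<and>
   (\<forall>i\<in>I. res S W (W \<inter> N i) t = Y i (W \<inter> N i) (res S W (W \<inter> N i) f))" for W f t
 define X where "X W f = (if opn S W & W \<subseteq> U & f : sects S W then SOME t. G W f t else undefined)" for W f
 have op: "opn S (W \<inter> N i)" if "opn S W" "i : I" for W i using that N by auto
 have Gex: "\<exists>t. G W f t" if W: "opn S W" "W \<subseteq> U" and f: "f : sects S W" for W f
 proof -
  have fr: "res S W (W \<inter> N i) f : sects S (W \<inter> N i)" if "i : I" for i
   using presheafD(1)[OF P W(1) op[OF W(1) that] _ f] by simp
  obtain t where "t : sects S W" "!!i. i : I ==> res S W (W \<inter> N i) t = Y i (W \<inter> N i) (res S W (W \<inter> N i) f)"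
  proof (rule sheaf_glue[OF sh, where U = W and I = I and N = "%i. W \<inter> N i"
     and s = "%i. Y i (W \<inter> N i) (res S W (W \<inter> N i) f)"])
   show "W = (\<Union>i\<in>I. W \<inter> N i)" using W U by blast
   fix i assume i: "i : I"
   show "opn S (W \<inter> N i)" by (rule op[OF W(1) i])
   show "Y i (W \<inter> N i) (res S W (W \<inter> N i) f) : sects S (W \<inter> N i)"
    using sheaf_endoD(1)[OF Y[OF i] op[OF W(1) i] _ fr[OF i]] by simp
   fix j assume j: "j : I"
   let ?K = "(W \<inter> N i) \<inter> (W \<inter> N j)"
   have K: "opn S ?K" using op[OF W(1) i] op[OF W(1) j] by (rule openin_Int)
   have "res S (W \<inter> N i) ?K (Y i (W \<inter> N i) (res S W (W \<inter> N i) f)) = Y i ?K (res S W ?K f)"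
    using sheaf_endoD(4)[OF Y[OF i] op[OF W(1) i] Int_lower2 K Int_lower1 fr[OF i]]
     presheafD(5)[OF P W(1) op[OF W(1) i] K Int_lower1 Int_lower1 f] by simp
   also have "\<dots> = Y j ?K (res S W ?K f)"
    by (rule agree[OF i j K]) (use presheafD(1)[OF P W(1) K _ f] in auto)
   also have "\<dots> = res S (W \<inter> N j) ?K (Y j (W \<inter> N j) (res S W (W \<inter> N j) f))"
    using sheaf_endoD(4)[OF Y[OF j] op[OF W(1) j] Int_lower2 K Int_lower2 fr[OF j]]
     presheafD(5)[OF P W(1) op[OF W(1) j] K Int_lower2 Int_lower1 f] by simp
   finally show "res S (W \<inter> N i) ?K (Y i (W \<inter> N i) (res S W (W \<inter> N i) f)) =
     res S (W \<inter> N j) ?K (Y j (W \<inter> N j) (res S W (W \<inter> N j) f))" .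
  qed blast
  then show ?thesis unfolding G_def by blast
 qed
 have G: "G W f (X W f)" if "opn S W" "W \<subseteq> U" "f : sects S W" for W f
  using someI_ex[OF Gex[OF that]] that by (simp add: X_def)
 have Guniq: "t = t'" if W: "opn S W" "W \<subseteq> U" and "G W f t" "G W f t'" for W f t t'
 proof (rule sheaf_eqI[OF sh W(1)])
  show "t : sects S W" "t' : sects S W" using that by (auto simp: G_def)
  fix x assume "x : W"
  then obtain i where "i : I" "x : W \<inter> N i" using W U by blast
  then show "\<exists>K. opn S K & x : K & K \<subseteq> W & res S W K t = res S W K t'"
   using that op[OF W(1)] by (intro exI[of _ "W \<inter> N i"]) (auto simp: G_def)
 qed
 have X1: "X W f = t" if "opn S W" "W \<subseteq> U" "f : sects S W" "G W f t" for W f t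
  using Guniq[OF that(1,2) G[OF that(1-3)] that(4)] .
 have "X : sheaf_endo S U"
 proof (rule sheaf_endoI)
  fix W f assume W: "opn S W" "W \<subseteq> U" and f: "f : sects S W"
  interpret ring "sec S W" by (rule supercomm_algebraD(1)[OF algebra_sheafD(3)[OF S W(1)]])
  note sc = supercomm_smult_closed[OF algebra_sheafD(3)[OF S]]
  note Gf = G[OF W f, unfolded G_def]
  show "X W f : sects S W" using Gf by blast
  have fr: "res S W (W \<inter> N i) f : sects S (W \<inter> N i)" if "i : I" "f : sects S W" for i f
   using presheafD(1)[OF P W(1) op[OF W(1) that(1)] _ that(2)] by simp
  show "X W (f \<oplus>\<^bsub>sec S W\<^esub> g) = X W f \<oplus>\<^bsub>sec S W\<^esub> X W g" if g: "g : sects S W" for g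
  proof (rule X1[OF W])
   show "G W (f \<oplus>\<^bsub>sec S W\<^esub> g) (X W f \<oplus>\<^bsub>sec S W\<^esub> X W g)"
    unfolding G_def
   proof (intro conjI ballI)
    fix i assume i: "i : I"
    show "res S W (W \<inter> N i) (X W f \<oplus>\<^bsub>sec S W\<^esub> X W g) = Y i (W \<inter> N i) (res S W (W \<inter> N i) (f \<oplus>\<^bsub>sec S W\<^esub> g))"
     using Gf G[OF W g, unfolded G_def] i f g fr[OF i] sheaf_endoD(2)[OF Y[OF i] op[OF W(1) i]]
     by (simp add: res_hom_facts(2)[OF S W(1) op[OF W(1) i]])
   qed (use Gf G[OF W g, unfolded G_def] in simp)
  qed (use f g in simp)
  show "X W (r \<odot>\<^bsub>sec S W\<^esub> f) = r \<odot>\<^bsub>sec S W\<^esub> X W f" for r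
  proof (rule X1[OF W])
   show "G W (r \<odot>\<^bsub>sec S W\<^esub> f) (r \<odot>\<^bsub>sec S W\<^esub> X W f)"
    unfolding G_def
   proof (intro conjI ballI)
    fix i assume i: "i : I"
    show "res S W (W \<inter> N i) (r \<odot>\<^bsub>sec S W\<^esub> X W f) = Y i (W \<inter> N i) (res S W (W \<inter> N i) (r \<odot>\<^bsub>sec S W\<^esub> f))"
     using Gf i f fr[OF i] sheaf_endoD(3)[OF Y[OF i] op[OF W(1) i]]
     by (simp add: algebra_sheafD(5)[OF S W(1) op[OF W(1) i]])
   qed (use Gf sc[OF W(1)] in simp)
  qed (use f sc[OF W(1)] in simp)
  fix W' assume W': "opn S W'" "W' \<subseteq> W"
  then have W'U: "W' \<subseteq> U" using W by blast
  show "X W' (res S W W' f) = res S W W' (X W f)"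
  proof (rule X1[OF W'(1) W'U presheafD(1)[OF P W(1) W' f]])
   show "G W' (res S W W' f) (res S W W' (X W f))"
    unfolding G_def
   proof (intro conjI ballI)
    show "res S W W' (X W f) : sects S W'" using presheafD(1)[OF P W(1) W'] Gf by blast
    fix i assume i: "i : I"
    have "res S W' (W' \<inter> N i) (res S W W' (X W f)) = res S W (W' \<inter> N i) (X W f)"
     using presheafD(5)[OF P W(1) W'(1) op[OF W'(1) i] _ W'(2)] Gf by simp
    also have "\<dots> = res S (W \<inter> N i) (W' \<inter> N i) (res S W (W \<inter> N i) (X W f))"
     using presheafD(5)[OF P W(1) op[OF W(1) i] op[OF W'(1) i]] Gf W' by (metis Int_lower1 Int_mono order_refl)
    also have "\<dots> = Y i (W' \<inter> N i) (res S (W \<inter> N i) (W' \<inter> N i) (res S W (W \<inter> N i) f))"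
     using Gf i sheaf_endoD(4)[OF Y[OF i] op[OF W(1) i] Int_lower2 op[OF W'(1) i] Int_mono[OF W'(2) subset_refl] fr[OF i f]]
     by simp
    also have "res S (W \<inter> N i) (W' \<inter> N i) (res S W (W \<inter> N i) f) = res S W (W' \<inter> N i) f"
     by (rule presheafD(5)[OF P W(1) op[OF W(1) i] op[OF W'(1) i] Int_mono[OF W'(2) subset_refl] Int_lower1 f])
    also have "\<dots> = res S W' (W' \<inter> N i) (res S W W' f)"
     using presheafD(5)[OF P W(1) W'(1) op[OF W'(1) i] _ W'(2) f] by simp
    finally show "res S W' (W' \<inter> N i) (res S W W' (X W f)) = Y i (W' \<inter> N i) (res S W' (W' \<inter> N i) (res S W W' f))" .
   qed
  qed
 qed (auto simp: X_def)
 moreover have "X W f = Y i W f" if i: "i : I" and W: "opn S W" "W \<subseteq> N i" and f: "f : sects S W" for i W f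
 proof -
  have WU: "W \<subseteq> U" using W i U by blast
  have "W \<inter> N i = W" using W by blast
  moreover have "res S W (W \<inter> N i) (X W f) = Y i (W \<inter> N i) (res S W (W \<inter> N i) f)"
   using G[OF W(1) WU f] i by (simp add: G_def)
  ultimately show ?thesis
   using presheafD(4)[OF P W(1)] f G[OF W(1) WU f] by (simp add: G_def)
 qed
 ultimately show ?thesis using that by blast
qed

lemma derivations_local:
 assumes S: "algebra_sheaf S" and X: "X : sheaf_endo S U"
  and loc: "!!x. x : U ==> \<exists>N. opn S N & x : N & N \<subseteq> U & rst S N X : derivations S N k"
 shows "X : derivations S U k"
proof (rule derivationsI[OF X])
 note sh = algebra_sheafD(1)[OF S] and P = algebra_sheafD(2)[OF S]
 fix W assume W: "opn S W" "W \<subseteq> U"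
 note A = algebra_sheafD(3)[OF S W(1)]
 interpret ring "sec S W" by (rule supercomm_algebraD(1)[OF A])
 note Xd = sheaf_endoD[OF X]
 have ex: "\<exists>K. opn S K & x : K & K \<subseteq> W & derivation (sec S K) k (X K)" if x: "x : W" for x
 proof -
  obtain N where N: "opn S N" "x : N" "N \<subseteq> U" "rst S N X : derivations S N k" using loc x W by blast
  let ?K = "W \<inter> N"
  have K: "opn S ?K" using W N by auto
  have "derivation (sec S ?K) k (rst S N X ?K)" by (rule derivationsD(2)[OF N(4) K]) simp
  then have "derivation (sec S ?K) k (X ?K)"
   by (rule derivation_cong[OF algebra_sheafD(3)[OF S K]]) (simp add: rst_def K)
  then show ?thesis using K x N by (intro exI[of _ ?K]) auto
 qed
 have hp: "X W f : hpart (sec S W) (m + k)" if f: "f : hpart (sec S W) m" for f m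
 proof (rule sheaf_hpartI[OF sh W(1)])
  have fc: "f : sects S W" by (rule hpart_carrier[OF supercomm_algebraD(3)[OF A] f])
  then show "X W f : sects S W" by (rule Xd(1)[OF W])
  fix x assume "x : W"
  then obtain K where K: "opn S K" "x : K" "K \<subseteq> W" "derivation (sec S K) k (X K)" using ex by blast
  have "X K (res S W K f) : hpart (sec S K) (m + k)"
   using derivationD(4)[OF K(4) presheafD(3)[OF P W(1) K(1,3) f]] .
  then show "\<exists>K. opn S K & x : K & K \<subseteq> W & res S W K (X W f) : hpart (sec S K) (m + k)"
   using Xd(4)[OF W K(1,3) fc] K by auto
 qed
 have leib: "X W (f \<otimes>\<^bsub>sec S W\<^esub> g) = (X W f \<otimes>\<^bsub>sec S W\<^esub> g) \<oplus>\<^bsub>sec S W\<^esub> signed (sec S W) (k * m) (f \<otimes>\<^bsub>sec S W\<^esub> X W g)"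
  if f: "f : hpart (sec S W) m" and g: "g : sects S W" for f g m
 proof (rule sheaf_eqI[OF sh W(1)])
  have fc: "f : sects S W" by (rule hpart_carrier[OF supercomm_algebraD(3)[OF A] f])
  note c = Xd(1)[OF W fc] Xd(1)[OF W g] Xd(1)[OF W m_closed[OF fc g]]
  show "X W (f \<otimes>\<^bsub>sec S W\<^esub> g) : sects S W" by (rule c)
  show "(X W f \<otimes>\<^bsub>sec S W\<^esub> g) \<oplus>\<^bsub>sec S W\<^esub> signed (sec S W) (k * m) (f \<otimes>\<^bsub>sec S W\<^esub> X W g) : sects S W"
   using c fc g signed_closed[OF ring_axioms] by simp
  fix x assume "x : W"
  then obtain K where K: "opn S K" "x : K" "K \<subseteq> W" "derivation (sec S K) k (X K)" using ex by blast
  note r = res_hom_facts[OF S W(1) K(1,3)]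
  have "res S W K (X W (f \<otimes>\<^bsub>sec S W\<^esub> g)) = X K (res S W K f \<otimes>\<^bsub>sec S K\<^esub> res S W K g)"
   using Xd(4)[OF W K(1,3) m_closed[OF fc g]] r(3)[OF fc g] by simp
  also have "\<dots> = (X K (res S W K f) \<otimes>\<^bsub>sec S K\<^esub> res S W K g) \<oplus>\<^bsub>sec S K\<^esub>
    signed (sec S K) (k * m) (res S W K f \<otimes>\<^bsub>sec S K\<^esub> X K (res S W K g))"
   by (rule derivationD(5)[OF K(4) presheafD(3)[OF P W(1) K(1,3) f] r(1)[OF g]])
  also have "\<dots> = res S W K ((X W f \<otimes>\<^bsub>sec S W\<^esub> g) \<oplus>\<^bsub>sec S W\<^esub> signed (sec S W) (k * m) (f \<otimes>\<^bsub>sec S W\<^esub> X W g))"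
   using c fc g signed_closed[OF ring_axioms] Xd(4)[OF W K(1,3)] by (simp add: r(2,3,7))
  finally show "\<exists>K. opn S K & x : K & K \<subseteq> W & res S W K (X W (f \<otimes>\<^bsub>sec S W\<^esub> g)) =
    res S W K ((X W f \<otimes>\<^bsub>sec S W\<^esub> g) \<oplus>\<^bsub>sec S W\<^esub> signed (sec S W) (k * m) (f \<otimes>\<^bsub>sec S W\<^esub> X W g))"
   using K by blast
 qed
 show "derivation (sec S W) k (X W)"
  unfolding derivation_def using Xd(1,2,3)[OF W] hp leib by simp
qed

text \<open>Convergence is a condition on germs, and finite sums commute with restriction.\<close>

lemma formal_sum_local:
 assumes S: "algebra_sheaf S" and U: "opn S U" and f: "f : sects S U" and F: "!!k. F k : sects S U"
  and loc: "!!x. x : U ==> \<exists>N. opn S N & x : N & N \<subseteq> U & formal_sum S N (%k. res S U N (F k)) (res S U N f)"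
 shows "formal_sum S U F f"
 unfolding formal_sum_def
proof (intro ballI allI)
 interpret ring "sec S U" by (rule supercomm_algebraD(1)[OF algebra_sheafD(3)[OF S U]])
 fix x n assume "x : U"
 then obtain N where N: "opn S N" "x : N" "N \<subseteq> U" "formal_sum S N (%k. res S U N (F k)) (res S U N f)"
  using loc by blast
 note r = res_hom_facts[OF S U N(1,3)]
 have "germ S x N (res S U N f \<ominus>\<^bsub>sec S N\<^esub> finsum (sec S N) (%k. res S U N (F k)) K) =
   germ S x U (f \<ominus>\<^bsub>sec S U\<^esub> finsum (sec S U) F K)" if "finite K" for K
 proof -
  have c: "finsum (sec S U) F K : sects S U" using F by (intro finsum_closed) auto
  have "germ S x U (f \<ominus>\<^bsub>sec S U\<^esub> finsum (sec S U) F K) = germ S x N (res S U N (f \<ominus>\<^bsub>sec S U\<^esub> finsum (sec S U) F K))"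
   by (rule germ_res[OF algebra_sheafD(2)[OF S] U _ N(1,3,2)]) (use c f in simp)
  then show ?thesis using c f F that by (simp add: a_minus_def r(2,6,8))
 qed
 then show "\<exists>K0. finite K0 & (\<forall>K. finite K & K0 \<subseteq> K --> germ S x U (f \<ominus>\<^bsub>sec S U\<^esub> finsum (sec S U) F K)
   : ideal_power (stalk S x) (nonzero_degree_ideal (stalk S x)) n)"
  using N(2,4) unfolding formal_sum_def by metis
qed

section \<open>Trivialisations are charts\<close>

lemma graded_domain_simps:
 "base (graded_domain p) = Euclidean_space (p 0)"
 "sects (graded_domain p) U = series_on p U"
 "mult (sec (graded_domain p) U) = series_mult p"
 "one (sec (graded_domain p) U) = fun_series U (%x. 1)"
 "add (sec (graded_domain p) U) = (%s t m x. s m x + t m x)"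
 "smult (sec (graded_domain p) U) = (%r s m x. r * s m x)"
 "hpart (sec (graded_domain p) U) k = {s : series_on p U. \<forall>m. mono_degree m ~= k --> s m = (%x. 0)}"
 "res (graded_domain p) U V = (%s m x. if x : V then s m x else 0)"
 by (simp_all add: graded_domain_def)

lemma restrict_sheaf_simps [simp]:
 "base (restrict_sheaf S V) = subtopology (base S) V" "sec (restrict_sheaf S V) = sec S"
 "res (restrict_sheaf S V) = res S"
 by (simp_all add: restrict_sheaf_def)

lemma openin_restrict:
 "openin X V ==> openin (subtopology X V) U \<longleftrightarrow> openin X U & U \<subseteq> V"
 by (rule openin_open_subtopology)

lemma finite_gens:
 assumes "finite {j. p j ~= 0}"
 shows "finite (gens p)"
proof -
 have "gens p \<subseteq> (SIGMA j:{j. p j ~= 0}. {..<p j})" by (auto simp: gens_def)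
 then show ?thesis by (rule finite_subset) (use assms in auto)
qed

lemma graded_manifoldD:
 assumes "graded_manifold p M"
 shows "algebra_sheaf M" "!!x. x : topspace (base M) ==> ring (stalk M x)"
  "!!x. x : topspace (base M) ==> \<exists>V V' h H. x : V & trivialisation p M V V' h H"
proof -
 have lr: "graded_locally_ringed_space M" using assms by (simp add: graded_manifold_def)
 then show "algebra_sheaf M" by (simp add: graded_locally_ringed_space_def)
 show "!!x. x : topspace (base M) ==> \<exists>V V' h H. x : V & trivialisation p M V V' h H"
  using assms unfolding graded_manifold_def by blast
 \<comment> \<open>The stalk is a ring because it has a maximal homogeneous ideal and
   \<open>ideal\<close> includes the ring axioms.\<close>
 fix x assume "x : topspace (base M)"
 then obtain I where "max_hom_ideal (stalk M x) I"
  using lr unfolding graded_locally_ringed_space_def by blast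
 then have "ideal I (stalk M x)" by (simp add: max_hom_ideal_def homogeneous_ideal_def)
 then show "ring (stalk M x)" by (rule ideal.axioms(2))
qed

lemma graded_morphismD:
 assumes "graded_morphism X Y h H"
 shows "continuous_map (base X) (base Y) h"
  "!!V. opn Y V ==> H V : ring_hom (sec Y V) (sec X (preim X h V))"
  "!!V r f. opn Y V ==> f : sects Y V ==> H V (r \<odot>\<^bsub>sec Y V\<^esub> f) = r \<odot>\<^bsub>sec X (preim X h V)\<^esub> H V f"
  "!!V k f. opn Y V ==> f : hpart (sec Y V) k ==> H V f : hpart (sec X (preim X h V)) k"
  "!!V W f. opn Y V ==> opn Y W ==> W \<subseteq> V ==> f : sects Y V ==>
   H W (res Y V W f) = res X (preim X h V) (preim X h W) (H V f)"
 using assms unfolding graded_morphism_def by simp_all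

text \<open>Coefficients are read off by the pullback K along the inverse isomorphism. That H is
  inverse to it is exported as well, since the embedding of the smooth functions and the coordinates
  are given by H.\<close>

lemma trivialisation_chart:
 assumes gm: "graded_manifold p M" and finp: "finite {j. p j ~= 0}" and triv: "trivialisation p M V V' h H"
 obtains Ps where "mfd_chart M V p h Ps" "h ` V = V'"
  "!!U s. opn M U ==> U \<subseteq> V ==> s : series_on p (h ` U) ==>
   H (h ` U) s : sects M U & Ps U (H (h ` U) s) = s"
proof -
 let ?X = "restrict_sheaf M V" and ?Y = "restrict_sheaf (graded_domain p) V'"
 have V: "opn M V" and V': "eopn (p 0) V'"
  and iso: "graded_iso ?X ?Y h H" using triv by (simp_all add: trivialisation_def)
 note A = graded_manifoldD(1)[OF gm]
 note P = algebra_sheafD(2)[OF A]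
 have hH: "graded_morphism ?X ?Y h H" using iso unfolding graded_iso_def by (rule conjunct1)
 obtain k K where kK': "graded_morphism ?Y ?X k K \<and>
    (\<forall>x\<in>topspace (base ?X). k (h x) = x) \<and>
    (\<forall>y\<in>topspace (base ?Y). h (k y) = y) \<and>
    (\<forall>U. opn ?X U --> (\<forall>f\<in>sects ?X U. H (preim ?Y k U) (K U f) = f)) \<and>
    (\<forall>V. opn ?Y V --> (\<forall>g\<in>sects ?Y V. K (preim ?X h V) (H V g) = g))"
  using iso[unfolded graded_iso_def, THEN conjunct2] by (elim exE)
 note kK = kK'[THEN conjunct1] and kh = kK'[THEN conjunct2, THEN conjunct1]
  and hk = kK'[THEN conjunct2, THEN conjunct2, THEN conjunct1]
  and HK = kK'[THEN conjunct2, THEN conjunct2, THEN conjunct2, THEN conjunct1]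
  and KH = kK'[THEN conjunct2, THEN conjunct2, THEN conjunct2, THEN conjunct2]
 have opX: "opn ?X U \<longleftrightarrow> opn M U & U \<subseteq> V" for U
  by (simp add: openin_restrict[OF V])
 have opY: "opn ?Y U \<longleftrightarrow> eopn (p 0) U & U \<subseteq> V'" for U
  by (simp add: graded_domain_simps openin_restrict[OF V'])
 have tX: "topspace (base ?X) = V" using openin_subset[OF V] by auto
 have tY: "topspace (base ?Y) = V'" using openin_subset[OF V'] by (auto simp: graded_domain_simps)
 have hV: "h x : V'" if "x : V" for x
  using continuous_map_funspace[OF graded_morphismD(1)[OF hH]] that tX tY by auto
 have kV: "k y : V" if "y : V'" for y
  using continuous_map_funspace[OF graded_morphismD(1)[OF kK]] that tX tY by auto
 have kh': "k (h x) = x" if "x : V" for x using kh that tX by simp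
 have hk': "h (k y) = y" if "y : V'" for y using hk that tY by simp
 have inj: "inj_on h V" by (rule inj_on_inverseI[of _ k]) (rule kh')
 have img: "h ` V = V'" using hV kV hk' by force
 \<comment> \<open>Preimages under k are images under h; this brings the pullbacks into the form
   that \<open>chart\<close> expects.\<close>
 have pk: "preim ?Y k U = h ` U" if "U \<subseteq> V" for U
 proof -
  have "preim ?Y k U = {y : V'. k y : U}" by (simp only: preim_def tY)
  also have "\<dots> = h ` U" using hV kh' hk' that by force
  finally show ?thesis .
 qed
 have ph: "preim ?X h (h ` U) = U" if "U \<subseteq> V" for U
 proof -
  have "preim ?X h (h ` U) = {x : V. h x : h ` U}" by (simp only: preim_def tX)
  also have "\<dots> = U" using that inj_onD[OF inj] by blast
  finally show ?thesis .
 qed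
 have io: "eopn (p 0) (h ` U)" "h ` U \<subseteq> V'" if U: "opn M U" "U \<subseteq> V" for U
 proof -
  have "opn ?Y {y : topspace (base ?Y). k y : U}"
   by (rule openin_continuous_map_preimage[OF graded_morphismD(1)[OF kK]]) (simp only: opX U)
  then have "opn ?Y (h ` U)" using pk[OF U(2)] by (simp only: preim_def)
  then show "eopn (p 0) (h ` U)" "h ` U \<subseteq> V'" by (simp_all only: opY)
 qed
 have Kr: "K U : ring_hom (sec M U) (sec (graded_domain p) (h ` U))" if "opn M U" "U \<subseteq> V" for U
  using graded_morphismD(2)[OF kK, unfolded opX, OF conjI[OF that]] pk[OF that(2)] by simp
 have Hr: "H (h ` U) : ring_hom (sec (graded_domain p) (h ` U)) (sec M U)" if "opn M U" "U \<subseteq> V" for U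
  using graded_morphismD(2)[OF hH, unfolded opY, OF conjI[OF io[OF that]]] ph[OF that(2)] by simp
 have HK': "H (h ` U) (K U f) = f" if "opn M U" "U \<subseteq> V" "f : sects M U" for U f
  using HK[unfolded opX, THEN spec, of U, THEN mp, OF conjI[OF that(1,2)], THEN bspec, of f] that(3)
  unfolding pk[OF that(2)] by simp
 have KH': "K U (H (h ` U) s) = s" if "opn M U" "U \<subseteq> V" "s : series_on p (h ` U)" for U s
  using KH[unfolded opY, THEN spec, of "h ` U", THEN mp, OF conjI[OF io[OF that(1,2)]], THEN bspec, of s] that(3)
  unfolding ph[OF that(2)] by (simp add: graded_domain_simps)
 have Kc: "K U f : series_on p (h ` U)" if "opn M U" "U \<subseteq> V" "f : sects M U" for U f
  using ring_hom_closed[OF Kr[OF that(1,2)] that(3)] by (simp add: graded_domain_simps)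
 have Hc: "H (h ` U) s : sects M U" if "opn M U" "U \<subseteq> V" "s : series_on p (h ` U)" for U s
  using ring_hom_closed[OF Hr[OF that(1,2)]] that(3) by (simp add: graded_domain_simps)
 have "chart M V p h K"
 proof
  show "is_presheaf M" by (rule P)
  show "opn M V" by (rule V)
  show "finite (gens p)" by (rule finite_gens[OF finp])
  show "inj_on h V" by (rule inj)
  fix W assume W: "eopn (p 0) W"
  have "opn ?Y (W \<inter> V')" unfolding opY using W V' by auto
  from openin_continuous_map_preimage[OF graded_morphismD(1)[OF hH] this]
  have "opn M {x : V. h x : W \<inter> V'}" unfolding tX opX by simp
  moreover have "{x : V. h x : W \<inter> V'} = {x : V. h x : W}" using hV by auto
  ultimately show "opn M {x : V. h x : W}" by simp
 next
  fix U assume "opens_in M V U"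
  then have U: "opn M U" "U \<subseteq> V" by (simp_all add: opens_in_def)
  show "eopn (p 0) (h ` U)" by (rule io[OF U])
  show "supercomm_algebra (sec M U)" by (rule algebra_sheafD(3)[OF A U(1)])
  show "bij_betw (K U) (sects M U) (series_on p (h ` U))"
   by (rule bij_betw_byWitness[of _ "H (h ` U)"]) (use HK'[OF U] KH'[OF U] Kc[OF U] Hc[OF U] in auto)
  show "K U \<one>\<^bsub>sec M U\<^esub> = fun_series (h ` U) (%x. 1)"
   using ring_hom_one[OF Kr[OF U]] by (simp add: graded_domain_simps)
  fix f assume f: "f : sects M U"
  show "K U (f \<oplus>\<^bsub>sec M U\<^esub> g) = (%m y. K U f m y + K U g m y)" if "g : sects M U" for g
   using ring_hom_add[OF Kr[OF U] f that] by (simp add: graded_domain_simps)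
  show "K U (f \<otimes>\<^bsub>sec M U\<^esub> g) = series_mult p (K U f) (K U g)" if "g : sects M U" for g
   using ring_hom_mult[OF Kr[OF U] f that] by (simp add: graded_domain_simps)
  show "K U (r \<odot>\<^bsub>sec M U\<^esub> f) = (%m y. r * K U f m y)" for r
   using graded_morphismD(3)[OF kK, unfolded opX, OF conjI[OF U], of f r] f pk[OF U(2)] by (simp add: graded_domain_simps)
  show "f : hpart (sec M U) d \<longleftrightarrow> (\<forall>m. mono_degree m ~= d --> K U f m = (%x. 0))" for d
  proof
   assume "f : hpart (sec M U) d"
   then have "K U f : hpart (sec ?Y (preim ?Y k U)) d"
    using graded_morphismD(4)[OF kK, unfolded opX, OF conjI[OF U]] by simp
   then show "\<forall>m. mono_degree m ~= d --> K U f m = (%x. 0)" by (simp add: graded_domain_simps)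
  next
   assume "\<forall>m. mono_degree m ~= d --> K U f m = (%x. 0)"
   then have "K U f : hpart (sec ?Y (h ` U)) d" using Kc[OF U f] by (simp add: graded_domain_simps)
   then have "H (h ` U) (K U f) : hpart (sec ?X (preim ?X h (h ` U))) d"
    using graded_morphismD(4)[OF hH, unfolded opY, OF conjI[OF io[OF U]]] by blast
   then show "f : hpart (sec M U) d" using HK'[OF U f] ph[OF U(2)] by simp
  qed
 next
  fix U W assume "opens_in M V U" "opens_in M V W" "W \<subseteq> U"
  then have UW: "opn M U" "opn M W" "W \<subseteq> U" "U \<subseteq> V" by (simp_all add: opens_in_def)
  show "res M U W : ring_hom (sec M U) (sec M W)" by (rule algebra_sheafD(4)[OF A UW(1-3)])
  have WV: "W \<subseteq> V" using UW by blast
  fix f assume f: "f : sects M U"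
  show "res M U W (r \<odot>\<^bsub>sec M U\<^esub> f) = r \<odot>\<^bsub>sec M W\<^esub> res M U W f" for r
   by (rule algebra_sheafD(5)[OF A UW(1-3) f])
  show "K W (res M U W f) = (%m y. if y : h ` W then K U f m y else 0)"
   using graded_morphismD(5)[OF kK, unfolded opX, OF conjI[OF UW(1,4)] conjI[OF UW(2) WV] UW(3), of f] f pk[OF UW(4)] pk[OF WV]
   by (simp add: graded_domain_simps)
 qed
 then have "mfd_chart M V p h K"
 proof (rule mfd_chart.intro[OF _ mfd_chart_axioms.intro])
  show "algebra_sheaf M" by (rule A)
  fix x assume "x : V"
  then show "ring (stalk M x)" using graded_manifoldD(2)[OF gm] openin_subset[OF V] by blast
 qed
 then show ?thesis using that[of K] img Hc KH' by blast
qed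

section \<open>The tangent sheaf of a graded manifold\<close>

lemma tangent_simps:
 "base (tangent_sheaf M) = base M"
 "sects (tangent_sheaf M) V = vector_fields M V"
 "ring.zero (sec (tangent_sheaf M) V) = rst M V (%U f. \<zero>\<^bsub>sec M U\<^esub>)"
 "add (sec (tangent_sheaf M) V) = (%X Y. rst M V (%U f. X U f \<oplus>\<^bsub>sec M U\<^esub> Y U f))"
 "smult (sec (tangent_sheaf M) V) = (%g X. rst M V (%U f. res M V U g \<otimes>\<^bsub>sec M U\<^esub> X U f))"
 "hpart (sec (tangent_sheaf M) V) = derivations M V"
 "res (tangent_sheaf M) V V' = rst M V'"
 by (simp_all add: tangent_sheaf_def rst_def Let_def fun_eq_iff)

lemma supercomm_smult_facts:
 assumes A: "supercomm_algebra A" and "x : carrier A" "y : carrier A"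
 shows "r \<odot>\<^bsub>A\<^esub> (x \<oplus>\<^bsub>A\<^esub> y) = r \<odot>\<^bsub>A\<^esub> x \<oplus>\<^bsub>A\<^esub> r \<odot>\<^bsub>A\<^esub> y" "r \<odot>\<^bsub>A\<^esub> \<zero>\<^bsub>A\<^esub> = \<zero>\<^bsub>A\<^esub>"
  "x \<otimes>\<^bsub>A\<^esub> (r \<odot>\<^bsub>A\<^esub> y) = r \<odot>\<^bsub>A\<^esub> (x \<otimes>\<^bsub>A\<^esub> y)"
proof -
 interpret mo: module real_ring A by (rule supercomm_algebraD(2)[OF A])
 show "r \<odot>\<^bsub>A\<^esub> (x \<oplus>\<^bsub>A\<^esub> y) = r \<odot>\<^bsub>A\<^esub> x \<oplus>\<^bsub>A\<^esub> r \<odot>\<^bsub>A\<^esub> y"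
  using mo.smult_r_distr[of r x y] assms(2,3) by (simp add: real_ring_def)
 show "r \<odot>\<^bsub>A\<^esub> \<zero>\<^bsub>A\<^esub> = \<zero>\<^bsub>A\<^esub>" using mo.smult_r_null[of r] by (simp add: real_ring_def)
 show "x \<otimes>\<^bsub>A\<^esub> (r \<odot>\<^bsub>A\<^esub> y) = r \<odot>\<^bsub>A\<^esub> (x \<otimes>\<^bsub>A\<^esub> y)"
  using A assms(2,3) unfolding supercomm_algebra_def by blast
qed

section \<open>Pointwise operations on sheaf endomorphisms\<close>

lemma endo_zero:
 assumes S: "algebra_sheaf S"
 shows "rst S V (%U f. \<zero>\<^bsub>sec S U\<^esub>) : sheaf_endo S V"
proof (rule sheaf_endoI)
 fix U f assume U: "opn S U" "U \<subseteq> V" and f: "f : sects S U"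
 note A = algebra_sheafD(3)[OF S U(1)]
 interpret ring "sec S U" by (rule supercomm_algebraD(1)[OF A])
 show "rst S V (%U f. \<zero>\<^bsub>sec S U\<^esub>) U f : sects S U" using U f by (simp add: rst_def)
 show "rst S V (%U f. \<zero>\<^bsub>sec S U\<^esub>) U (f \<oplus>\<^bsub>sec S U\<^esub> g) =
   rst S V (%U f. \<zero>\<^bsub>sec S U\<^esub>) U f \<oplus>\<^bsub>sec S U\<^esub> rst S V (%U f. \<zero>\<^bsub>sec S U\<^esub>) U g" if "g : sects S U" for g
  using U f that by (simp add: rst_def)
 show "rst S V (%U f. \<zero>\<^bsub>sec S U\<^esub>) U (r \<odot>\<^bsub>sec S U\<^esub> f) = r \<odot>\<^bsub>sec S U\<^esub> rst S V (%U f. \<zero>\<^bsub>sec S U\<^esub>) U f" for r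
  using U f supercomm_smult_closed[OF A f] supercomm_smult_facts(2)[OF A f f] by (simp add: rst_def)
 fix W assume W: "opn S W" "W \<subseteq> U"
 then show "rst S V (%U f. \<zero>\<^bsub>sec S U\<^esub>) W (res S U W f) = res S U W (rst S V (%U f. \<zero>\<^bsub>sec S U\<^esub>) U f)"
  using U f res_hom_facts(1,5)[OF S U(1) W] order_trans[OF W(2) U(2)] by (simp add: rst_def)
qed (auto simp: rst_def)

lemma endo_add:
 assumes S: "algebra_sheaf S" and X: "X : sheaf_endo S V" and Y: "Y : sheaf_endo S V"
 shows "rst S V (%U f. X U f \<oplus>\<^bsub>sec S U\<^esub> Y U f) : sheaf_endo S V"
proof (rule sheaf_endoI)
 fix U f assume U: "opn S U" "U \<subseteq> V" and f: "f : sects S U"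
 note A = algebra_sheafD(3)[OF S U(1)]
 interpret ring "sec S U" by (rule supercomm_algebraD(1)[OF A])
 note d = sheaf_endoD[OF X] sheaf_endoD[OF Y]
 show "rst S V (%U f. X U f \<oplus>\<^bsub>sec S U\<^esub> Y U f) U f : sects S U" using U f d by (simp add: rst_def)
 show "rst S V (%U f. X U f \<oplus>\<^bsub>sec S U\<^esub> Y U f) U (f \<oplus>\<^bsub>sec S U\<^esub> g) =
   rst S V (%U f. X U f \<oplus>\<^bsub>sec S U\<^esub> Y U f) U f \<oplus>\<^bsub>sec S U\<^esub> rst S V (%U f. X U f \<oplus>\<^bsub>sec S U\<^esub> Y U f) U g" if "g : sects S U" for g
  using U f that by (simp add: rst_def d(1-2,6-7) a_ac)
 show "rst S V (%U f. X U f \<oplus>\<^bsub>sec S U\<^esub> Y U f) U (r \<odot>\<^bsub>sec S U\<^esub> f) = r \<odot>\<^bsub>sec S U\<^esub> rst S V (%U f. X U f \<oplus>\<^bsub>sec S U\<^esub> Y U f) U f" for r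
  using U f supercomm_smult_closed[OF A f] supercomm_smult_facts(1)[OF A]
  by (simp add: rst_def d(1,3,6,8))
 fix W assume W: "opn S W" "W \<subseteq> U"
 then show "rst S V (%U f. X U f \<oplus>\<^bsub>sec S U\<^esub> Y U f) W (res S U W f) = res S U W (rst S V (%U f. X U f \<oplus>\<^bsub>sec S U\<^esub> Y U f) U f)"
  using U f res_hom_facts(1,2)[OF S U(1) W] order_trans[OF W(2) U(2)] by (simp add: rst_def d(1,4,6,9))
qed (auto simp: rst_def)

lemma endo_smult:
 assumes S: "algebra_sheaf S" and V: "opn S V" and X: "X : sheaf_endo S V" and a: "a : sects S V"
 shows "rst S V (%U f. res S V U a \<otimes>\<^bsub>sec S U\<^esub> X U f) : sheaf_endo S V"
proof (rule sheaf_endoI)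
 fix U f assume U: "opn S U" "U \<subseteq> V" and f: "f : sects S U"
 note A = algebra_sheafD(3)[OF S U(1)]
 interpret ring "sec S U" by (rule supercomm_algebraD(1)[OF A])
 note d = sheaf_endoD[OF X]
 have ra: "res S V U a : sects S U" by (rule res_hom_facts(1)[OF S V U a])
 show "rst S V (%U f. res S V U a \<otimes>\<^bsub>sec S U\<^esub> X U f) U f : sects S U" using U f d ra by (simp add: rst_def)
 show "rst S V (%U f. res S V U a \<otimes>\<^bsub>sec S U\<^esub> X U f) U (f \<oplus>\<^bsub>sec S U\<^esub> g) =
   rst S V (%U f. res S V U a \<otimes>\<^bsub>sec S U\<^esub> X U f) U f \<oplus>\<^bsub>sec S U\<^esub> rst S V (%U f. res S V U a \<otimes>\<^bsub>sec S U\<^esub> X U f) U g" if "g : sects S U" for g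
  using U f that ra by (simp add: rst_def d(1-2) r_distr)
 show "rst S V (%U f. res S V U a \<otimes>\<^bsub>sec S U\<^esub> X U f) U (r \<odot>\<^bsub>sec S U\<^esub> f) = r \<odot>\<^bsub>sec S U\<^esub> rst S V (%U f. res S V U a \<otimes>\<^bsub>sec S U\<^esub> X U f) U f" for r
  using U f supercomm_smult_closed[OF A f] supercomm_smult_facts(3)[OF A ra]
  by (simp add: rst_def d(1,3))
 fix W assume W: "opn S W" "W \<subseteq> U"
 then show "rst S V (%U f. res S V U a \<otimes>\<^bsub>sec S U\<^esub> X U f) W (res S U W f) = res S U W (rst S V (%U f. res S V U a \<otimes>\<^bsub>sec S U\<^esub> X U f) U f)"
  using U f ra res_hom_facts(1,3)[OF S U(1) W] order_trans[OF W(2) U(2)]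
   presheafD(5)[OF algebra_sheafD(2)[OF S] V U(1) W U(2) a] by (simp add: rst_def d(1,4))
qed (auto simp: rst_def)

locale gmanifold =
 fixes M :: "('x, real, 'a) gpresheaf" and p :: "int => nat"
 assumes gm: "graded_manifold p M" and finp: "finite {j. p j ~= 0}"
begin

lemma alg_sheaf: "algebra_sheaf M" by (rule graded_manifoldD(1)[OF gm])
lemma shf: "is_sheaf M" by (rule algebra_sheafD(1)[OF alg_sheaf])
lemma pre: "is_presheaf M" by (rule algebra_sheafD(2)[OF alg_sheaf])
lemma sca: "opn M U ==> supercomm_algebra (sec M U)" by (rule algebra_sheafD(3)[OF alg_sheaf])
lemma rng: "opn M U ==> ring (sec M U)" by (rule supercomm_algebraD(1)[OF sca])

lemma chart_at:
 assumes "opn M U" "x : U"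
 obtains V h Ps where "mfd_chart M V p h Ps" "x : V" "opn M V"
proof -
 have "x : topspace (base M)" using assms openin_subset by blast
 then obtain V V' h H where t: "x : V" "trivialisation p M V V' h H" using graded_manifoldD(3)[OF gm] by blast
 obtain Ps where "mfd_chart M V p h Ps" using trivialisation_chart[OF gm finp t(2)] by blast
 then show ?thesis using that t by (simp add: trivialisation_def)
qed

text \<open>Equality is tested locally by the sheaf property, and on a chart
  \<open>vf_comp_LC\<close> expresses the components by X alone.\<close>

lemma vf_comp_unique:
 assumes X: "X : sheaf_endo M U" and U: "opn M U" and D: "vf_comp M U X D" and D': "vf_comp M U X D'"
 shows "D k = D' k"
proof (rule sheaf_endo_eqI[OF derivationsD(1)[OF vf_compD(1)[OF D]] derivationsD(1)[OF vf_compD(1)[OF D']]])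
 note e = derivationsD(1)[OF vf_compD(1)[OF D]] and e' = derivationsD(1)[OF vf_compD(1)[OF D']]
 fix W f assume W: "opn M W" "W \<subseteq> U" and f: "f : sects M W"
 show "D k W f = D' k W f"
 proof (rule sheaf_eqI[OF shf W(1) sheaf_endoD(1)[OF e W f] sheaf_endoD(1)[OF e' W f]])
  fix x assume x: "x : W"
  obtain V h Ps where c: "mfd_chart M V p h Ps" "x : V" "opn M V" using chart_at[OF W(1) x] .
  interpret mfd_chart M V p h Ps by (rule c(1))
  let ?N = "W \<inter> V"
  have N: "opn M ?N" "?N \<subseteq> U" "?N \<subseteq> W" using W c by auto
  have dN: "dom ?N" using N by (simp add: dom_def)
  have "rst M ?N (D k) = rst M ?N (D' k)"
   using vf_comp_LC[OF dN rst_endo[OF alg_sheaf X N(2)] rst_vf_comp[OF alg_sheaf D N(2)], of k]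
    vf_comp_LC[OF dN rst_endo[OF alg_sheaf X N(2)] rst_vf_comp[OF alg_sheaf D' N(2)], of k] by simp
  then have "D k ?N (res M W ?N f) = D' k ?N (res M W ?N f)"
   using rst_eq[OF N(1) subset_refl presheafD(1)[OF pre W(1) N(1,3) f]] by metis
  then show "\<exists>N. opn M N & x : N & N \<subseteq> W & res M W N (D k W f) = res M W N (D' k W f)"
   using N c x sheaf_endoD(4)[OF e W N(1,3) f] sheaf_endoD(4)[OF e' W N(1,3) f]
   by (intro exI[of _ ?N]) auto
 qed
qed

lemma rst_rst: "N \<subseteq> N' ==> rst M N (rst M N' X) = rst M N X"
 by (auto simp: rst_def fun_eq_iff)

text \<open>The local components are unique, hence agree on overlaps and glue to derivations;
  convergence is tested on germs.\<close>

lemma vector_fields_local: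
 assumes U: "opn M U" and X: "X : sheaf_endo M U"
  and loc: "!!x. x : U ==> \<exists>N. opn M N & x : N & N \<subseteq> U & rst M N X : vector_fields M N"
 shows "X : vector_fields M U"
proof -
 have "\<forall>x\<in>U. \<exists>ND. opn M (fst ND) & x : fst ND & fst ND \<subseteq> U & vf_comp M (fst ND) (rst M (fst ND) X) (snd ND)"
  using loc unfolding vector_fields_iff by fastforce
 from bchoice[OF this] obtain ND where ND: "\<forall>x\<in>U. opn M (fst (ND x)) & x : fst (ND x) & fst (ND x) \<subseteq> U \<and>
   vf_comp M (fst (ND x)) (rst M (fst (ND x)) X) (snd (ND x))" by (rule exE)
 define N where "N x = fst (ND x)" for x
 define D where "D x = snd (ND x)" for x
 have N: "opn M (N x)" "x : N x" "N x \<subseteq> U" and D: "vf_comp M (N x) (rst M (N x) X) (D x)" if "x : U" for x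
  using ND that by (simp_all add: N_def D_def)
 have UN: "U = (\<Union>x\<in>U. N x)" using N by blast
 have ag: "D x k W f = D y k W f" if x: "x : U" and y: "y : U" and W: "opn M W" "W \<subseteq> N x \<inter> N y" and f: "f : sects M W"
  for x y W f k
 proof -
  have WU: "W \<subseteq> N x" "W \<subseteq> N y" "W \<subseteq> U" using W N[OF x] by auto
  have "rst M W (D x k) = rst M W (D y k)"
   using vf_comp_unique[OF rst_endo[OF alg_sheaf X WU(3)] W(1)]
    rst_vf_comp[OF alg_sheaf D[OF x] WU(1)] rst_vf_comp[OF alg_sheaf D[OF y] WU(2)] WU
   by (simp add: rst_rst)
  then show ?thesis using rst_eq[OF W(1) subset_refl f] by metis
 qed
 have "\<exists>E. E : sheaf_endo M U & (\<forall>x\<in>U. \<forall>W f. opn M W --> W \<subseteq> N x --> f : sects M W --> E W f = D x k W f)" for k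
  by (rule endo_glue[OF alg_sheaf UN N(1) derivationsD(1)[OF vf_compD(1)[OF D]] ag]) blast+
 then have "\<forall>k. \<exists>E. E : sheaf_endo M U & (\<forall>x\<in>U. \<forall>W f. opn M W --> W \<subseteq> N x --> f : sects M W --> E W f = D x k W f)"
  by (rule allI)
 from choice[OF this] obtain E where E': "\<forall>k. E k : sheaf_endo M U & (\<forall>x\<in>U. \<forall>W f. opn M W --> W \<subseteq> N x --> f : sects M W --> E k W f = D x k W f)"
  by (rule exE)
 then have E: "E k : sheaf_endo M U" and ED: "x : U ==> opn M W ==> W \<subseteq> N x ==> f : sects M W ==> E k W f = D x k W f"
  for k x W f by simp_all
 have Ed: "E k : derivations M U k" for k
 proof (rule derivations_local[OF alg_sheaf E])
  fix x assume x: "x : U"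
  have "rst M (N x) (E k) = D x k"
   by (rule sheaf_endo_eqI[OF rst_endo[OF alg_sheaf E N(3)[OF x]] derivationsD(1)[OF vf_compD(1)[OF D[OF x]]]])
    (simp add: rst_eq ED[OF x])
  then show "\<exists>N. opn M N & x : N & N \<subseteq> U & rst M N (E k) : derivations M N k"
   using N[OF x] vf_compD(1)[OF D[OF x], of k] by (intro exI[of _ "N x"]) simp
 qed
 have "vf_comp M U X E"
  unfolding vf_comp_def
 proof (intro conjI allI impI ballI Ed)
  fix W f assume "opn M W & W \<subseteq> U" and f: "f : sects M W"
  then have W: "opn M W" "W \<subseteq> U" by auto
  show "formal_sum M W (%k. E k W f) (X W f)"
  proof (rule formal_sum_local[OF alg_sheaf W(1) sheaf_endoD(1)[OF X W f] sheaf_endoD(1)[OF E W f]])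
   fix x assume x: "x : W"
   then have xU: "x : U" using W by blast
   let ?K = "W \<inter> N x"
   have K: "opn M ?K" "x : ?K" "?K \<subseteq> W" "?K \<subseteq> N x" using W N[OF xU] x by auto
   have fr: "res M W ?K f : sects M ?K" by (rule presheafD(1)[OF pre W(1) K(1,3) f])
   have "formal_sum M ?K (%k. D x k ?K (res M W ?K f)) (rst M (N x) X ?K (res M W ?K f))"
    by (rule vf_compD(2)[OF D[OF xU] K(1,4) fr])
   then have "formal_sum M ?K (%k. res M W ?K (E k W f)) (res M W ?K (X W f))"
    using sheaf_endoD(4)[OF E W K(1,3) f] sheaf_endoD(4)[OF X W K(1,3) f] ED[OF xU K(1,4) fr] rst_eq[OF K(1,4) fr]
    by simp
   then show "\<exists>N. opn M N & x : N & N \<subseteq> W & formal_sum M N (%k. res M W N (E k W f)) (res M W N (X W f))"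
    using K by blast
  qed
 qed
 then show ?thesis using X by (auto simp: vector_fields_iff)
qed

lemma vf_endo: "X : vector_fields M U ==> X : sheaf_endo M U"
 by (simp add: vector_fields_iff)

lemma vector_fieldsI_chart:
 assumes U: "opn M U" and X: "X : sheaf_endo M U"
  and loc: "!!V h Ps N. mfd_chart M V p h Ps ==> opn M N ==> N \<subseteq> U ==> N \<subseteq> V ==> rst M N X : vector_fields M N"
 shows "X : vector_fields M U"
proof (rule vector_fields_local[OF U X])
 fix x assume x: "x : U"
 obtain V h Ps where c: "mfd_chart M V p h Ps" "x : V" "opn M V" using chart_at[OF U x] .
 show "\<exists>N. opn M N & x : N & N \<subseteq> U & rst M N X : vector_fields M N"
  using loc[OF c(1), of "U \<inter> V"] U c x by (intro exI[of _ "U \<inter> V"]) auto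
qed

text \<open>For an inhomogeneous g the components of the product are themselves infinite sums. On a
  chart the product is again a combination \<open>LC\<close>, with coefficients multiplied by g, and
  \<open>LC_vector_field\<close> supplies the components.\<close>

lemma tsmult_vf:
 assumes U: "opn M U" and X: "X : vector_fields M U" and g: "g : sects M U"
 shows "rst M U (%W f. res M U W g \<otimes>\<^bsub>sec M W\<^esub> X W f) : vector_fields M U"
proof (rule vector_fieldsI_chart[OF U endo_smult[OF alg_sheaf U vf_endo[OF X] g]])
 let ?Z = "rst M U (%W f. res M U W g \<otimes>\<^bsub>sec M W\<^esub> X W f)"
 fix V h Ps N assume "mfd_chart M V p h Ps" and N: "opn M N" "N \<subseteq> U" "N \<subseteq> V"
 then interpret mfd_chart M V p h Ps by simp
 have dN: "dom N" using N by (simp add: dom_def)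
 interpret ring "OS N" by (rule ringO[OF dN])
 note Xr = rst_vector_fields[OF alg_sheaf X N(2)]
 define a where "a ii = rst M N X N (co N ii)" for ii
 define b where "b = res M U N g"
 have bc: "b : sects M N" unfolding b_def by (rule presheafD(1)[OF pre U N(1,2) g])
 have ac: "a ii : sects M N" if "ii : idx p" for ii
  unfolding a_def using vf_endo_closed[OF vf_endo[OF Xr] dN that] .
 then have abc: "b \<otimes>\<^bsub>OS N\<^esub> a ii : sects M N" if "ii : idx p" for ii using that bc by simp
 have "rst M N ?Z = LC N (%ii. b \<otimes>\<^bsub>OS N\<^esub> a ii)"
 proof (rule sheaf_endo_eqI[OF rst_endo[OF alg_sheaf endo_smult[OF alg_sheaf U vf_endo[OF X] g] N(2)] LC_sheaf_endo[OF dN abc]])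
  fix W f assume W: "opn M W" "W \<subseteq> N" and f: "f : sects M W"
  have dW: "dom W" by (rule dom_subset[OF dN W])
  interpret W: ring "OS W" by (rule ringO[OF dW])
  note r = res_hom_facts[OF alg_sheaf N(1) W]
  have rb: "res M U W g = res M N W b"
   unfolding b_def by (rule presheafD(5)[OF pre U N(1) W(1,2) N(2) g, symmetric])
  have tc: "(%ii. res M N W (a ii) \<otimes>\<^bsub>OS W\<^esub> pd ii W f) : idx p \<rightarrow> sects M W"
   by (rule LC_term_closed[OF dN dW W(2) f ac])
  have Xe: "X W f = LC N a W f"
   using vector_fields_LC[OF dN Xr] rst_eq[OF W f, of X] unfolding a_def[symmetric] by simp
  have "rst M N ?Z W f = res M N W b \<otimes>\<^bsub>OS W\<^esub> LC N a W f"
   using W f order_trans[OF W(2) N(2)] by (simp add: rst_eq rb Xe)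
  also have "\<dots> = (\<Oplus>\<^bsub>OS W\<^esub>ii\<in>idx p. res M N W b \<otimes>\<^bsub>OS W\<^esub> (res M N W (a ii) \<otimes>\<^bsub>OS W\<^esub> pd ii W f))"
   unfolding LC_eq[OF dN dW W(2) f] by (rule W.finsum_rdistr[OF finite_idx[OF fin] r(1)[OF bc] tc])
  also have "\<dots> = LC N (%ii. b \<otimes>\<^bsub>OS N\<^esub> a ii) W f"
   unfolding LC_eq[OF dN dW W(2) f]
   by (rule W.finsum_cong') (use LC_term_closed[OF dN dW W(2) f abc] ac bc r(1,3) pd_closed[OF dW _ f] in \<open>auto simp: W.m_assoc\<close>)
  finally show "rst M N ?Z W f = LC N (%ii. b \<otimes>\<^bsub>OS N\<^esub> a ii) W f" .
 qed
 then show "rst M N ?Z : vector_fields M N"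
  using LC_vector_field[OF dN, of "%ii. b \<otimes>\<^bsub>OS N\<^esub> a ii", OF abc] by simp
qed

end

lemma rst_cong:
 assumes "!!W f. opn M W ==> W \<subseteq> U ==> f : sects M W ==> X W f = Y W f"
 shows "rst M U X = rst M U Y"
 using assms by (auto simp: rst_def fun_eq_iff)

lemma rst_id:
 assumes "X : sheaf_endo M U"
 shows "rst M U X = X"
proof (intro ext)
 fix W f
 show "rst M U X W f = X W f"
 proof (cases "opn M W & W \<subseteq> U & f : sects M W")
  case True
  then show ?thesis by (simp add: rst_def)
 next
  case False
  then show ?thesis using sheaf_endoD(5)[OF assms False] by (simp add: rst_def)
 qed
qed

lemma endo_eq_rstI:
 assumes "X : sheaf_endo M U"
  and "!!W f. opn M W ==> W \<subseteq> U ==> f : sects M W ==> Y W f = X W f"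
 shows "rst M U Y = X"
proof -
 have "rst M U Y = rst M U X" by (rule rst_cong) (rule assms(2))
 then show ?thesis using rst_id[OF assms(1)] by simp
qed

lemma rst_derivationI:
 assumes S: "algebra_sheaf S" and X: "rst S V X : sheaf_endo S V"
  and D: "!!U. opn S U ==> U \<subseteq> V ==> derivation (sec S U) k (X U)"
 shows "rst S V X : derivations S V k"
proof (rule derivationsI[OF X])
 fix U assume U: "opn S U" "U \<subseteq> V"
 show "derivation (sec S U) k (rst S V X U)"
  by (rule derivation_cong[OF algebra_sheafD(3)[OF S U(1)] D[OF U]]) (simp add: rst_eq U)
qed

lemma derivations_zero:
 assumes S: "algebra_sheaf S"
 shows "rst S V (%U f. \<zero>\<^bsub>sec S U\<^esub>) : derivations S V k"
 by (rule rst_derivationI[OF S endo_zero[OF S]]) (rule derivation_zero[OF algebra_sheafD(3)[OF S]])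

lemma derivations_add:
 assumes S: "algebra_sheaf S" and X: "X : derivations S V k" and Y: "Y : derivations S V k"
 shows "rst S V (%U f. X U f \<oplus>\<^bsub>sec S U\<^esub> Y U f) : derivations S V k"
 by (rule rst_derivationI[OF S endo_add[OF S derivationsD(1)[OF X] derivationsD(1)[OF Y]]])
  (intro derivation_add[OF algebra_sheafD(3)[OF S]] derivationsD(2)[OF X] derivationsD(2)[OF Y])

lemma derivations_smult:
 assumes S: "algebra_sheaf S" and V: "opn S V" and X: "X : derivations S V k" and a: "a : hpart (sec S V) j"
 shows "rst S V (%U f. res S V U a \<otimes>\<^bsub>sec S U\<^esub> X U f) : derivations S V (j + k)"
proof (rule rst_derivationI[OF S endo_smult[OF S V derivationsD(1)[OF X]]])
 show "a : sects S V" by (rule hpart_carrier[OF supercomm_algebraD(3)[OF algebra_sheafD(3)[OF S V]] a])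
 fix U assume U: "opn S U" "U \<subseteq> V"
 show "derivation (sec S U) (j + k) (%f. res S V U a \<otimes>\<^bsub>sec S U\<^esub> X U f)"
  by (rule derivation_cmul[OF algebra_sheafD(3)[OF S U(1)] derivationsD(2)[OF X U]
     presheafD(3)[OF algebra_sheafD(2)[OF S] V U a]])
qed

text \<open>Serves both the graded and the ordinary tangent sheaf. The inverse is the multiple by
  -1, which is why closure is demanded in that form.\<close>

lemma endo_abelian_group:
 assumes S: "algebra_sheaf S" and U: "opn S U" and C: "carrier G \<subseteq> sheaf_endo S U"
  and zero: "ring.zero G = rst S U (%W f. \<zero>\<^bsub>sec S W\<^esub>)" and add: "ring.add G = (%X Y. rst S U (%W f. X W f \<oplus>\<^bsub>sec S W\<^esub> Y W f))"
  and closed: "\<zero>\<^bsub>G\<^esub> : carrier G" "!!X Y. X : carrier G ==> Y : carrier G ==> X \<oplus>\<^bsub>G\<^esub> Y : carrier G"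
  and inv: "!!X. X : carrier G ==> rst S U (%W f. res S U W (\<ominus>\<^bsub>sec S U\<^esub> \<one>\<^bsub>sec S U\<^esub>) \<otimes>\<^bsub>sec S W\<^esub> X W f) : carrier G"
 shows "abelian_group G"
proof (rule abelian_groupI[OF closed(2,1)])
 note rng = supercomm_algebraD(1)[OF algebra_sheafD(3)[OF S]]
 have Xc: "X W f : sects S W" if "X : carrier G" "opn S W" "W \<subseteq> U" "f : sects S W" for X W f
  by (rule sheaf_endoD(1)[OF subsetD[OF C that(1)] that(2-4)])
 fix X assume X: "X : carrier G"
 show "\<zero>\<^bsub>G\<^esub> \<oplus>\<^bsub>G\<^esub> X = X"
  unfolding add zero
 proof (rule endo_eq_rstI)
  show "X : sheaf_endo S U" using C X by blast
  fix W f assume W: "opn S W" "W \<subseteq> U" and f: "f : sects S W"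
  interpret ring "sec S W" by (rule rng[OF W(1)])
  show "rst S U (%W f. \<zero>\<^bsub>sec S W\<^esub>) W f \<oplus>\<^bsub>sec S W\<^esub> X W f = X W f" using Xc[OF X W f] by (simp add: rst_eq[OF W f])
 qed
 show "\<exists>Y\<in>carrier G. Y \<oplus>\<^bsub>G\<^esub> X = \<zero>\<^bsub>G\<^esub>"
 proof (intro bexI[OF _ inv[OF X]], unfold add zero, rule rst_cong)
  fix W f assume W: "opn S W" "W \<subseteq> U" and f: "f : sects S W"
  interpret ring "sec S W" by (rule rng[OF W(1)])
  interpret U: ring "sec S U" by (rule rng[OF U])
  show "rst S U (%W f. res S U W (\<ominus>\<^bsub>sec S U\<^esub> \<one>\<^bsub>sec S U\<^esub>) \<otimes>\<^bsub>sec S W\<^esub> X W f) W f \<oplus>\<^bsub>sec S W\<^esub> X W f = \<zero>\<^bsub>sec S W\<^esub>"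
   using Xc[OF X W f] by (simp add: rst_eq[OF W f] res_hom_facts(4,6)[OF S U W] l_minus l_neg)
 qed
 fix Y assume Y: "Y : carrier G"
 show "X \<oplus>\<^bsub>G\<^esub> Y = Y \<oplus>\<^bsub>G\<^esub> X"
  unfolding add
 proof (rule rst_cong)
  fix W f assume W: "opn S W" "W \<subseteq> U" and f: "f : sects S W"
  interpret ring "sec S W" by (rule rng[OF W(1)])
  show "X W f \<oplus>\<^bsub>sec S W\<^esub> Y W f = Y W f \<oplus>\<^bsub>sec S W\<^esub> X W f" using Xc[OF X W f] Xc[OF Y W f] by (rule a_comm)
 qed
 fix Z assume Z: "Z : carrier G"
 show "X \<oplus>\<^bsub>G\<^esub> Y \<oplus>\<^bsub>G\<^esub> Z = X \<oplus>\<^bsub>G\<^esub> (Y \<oplus>\<^bsub>G\<^esub> Z)"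
  unfolding add
 proof (rule rst_cong)
  fix W f assume W: "opn S W" "W \<subseteq> U" and f: "f : sects S W"
  interpret ring "sec S W" by (rule rng[OF W(1)])
  show "rst S U (%W f. X W f \<oplus>\<^bsub>sec S W\<^esub> Y W f) W f \<oplus>\<^bsub>sec S W\<^esub> Z W f =
   X W f \<oplus>\<^bsub>sec S W\<^esub> rst S U (%W f. Y W f \<oplus>\<^bsub>sec S W\<^esub> Z W f) W f"
   using Xc[OF X W f] Xc[OF Y W f] Xc[OF Z W f] by (simp add: rst_eq[OF W f] a_assoc)
 qed
qed

section \<open>The grading of the tangent sheaf\<close>

context gmanifold
begin

text \<open>The error terms add up, and on a chart the powers of the ideal are known to be closed
  under addition.\<close>

lemma formal_sum_add:
 assumes U: "opn M U" and f: "f : sects M U" and g: "g : sects M U"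
  and F: "!!k. F k : sects M U" and G: "!!k. G k : sects M U"
  and sf: "formal_sum M U F f" and sg: "formal_sum M U G g"
 shows "formal_sum M U (%k. F k \<oplus>\<^bsub>sec M U\<^esub> G k) (f \<oplus>\<^bsub>sec M U\<^esub> g)"
 unfolding formal_sum_def
proof (intro ballI allI)
 interpret ring "sec M U" by (rule rng[OF U])
 fix x n assume x: "x : U"
 obtain V h Ps where c: "mfd_chart M V p h Ps" "x : V" "opn M V" using chart_at[OF U x] .
 interpret mfd_chart M V p h Ps by (rule c(1))
 note Jp = ideal.axioms(1)[OF Jpow_ideal[OF c(2), of n]]
 obtain K1 where K1: "finite K1 & (\<forall>K. finite K & K1 \<subseteq> K --> germ M x U (f \<ominus>\<^bsub>sec M U\<^esub> finsum (sec M U) F K) : Jpow x n)"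
  using sf[unfolded formal_sum_def, THEN bspec, OF x, THEN spec, of n] by (rule exE)
 obtain K2 where K2: "finite K2 & (\<forall>K. finite K & K2 \<subseteq> K --> germ M x U (g \<ominus>\<^bsub>sec M U\<^esub> finsum (sec M U) G K) : Jpow x n)"
  using sg[unfolded formal_sum_def, THEN bspec, OF x, THEN spec, of n] by (rule exE)
 have "germ M x U ((f \<oplus>\<^bsub>sec M U\<^esub> g) \<ominus>\<^bsub>sec M U\<^esub> finsum (sec M U) (%k. F k \<oplus>\<^bsub>sec M U\<^esub> G k) K) : Jpow x n"
  if K: "finite K" "K1 \<union> K2 \<subseteq> K" for K
 proof -
  have c: "finsum (sec M U) F K : sects M U" "finsum (sec M U) G K : sects M U"
   using F G by (auto intro!: finsum_closed)
  have "finsum (sec M U) (%k. F k \<oplus>\<^bsub>sec M U\<^esub> G k) K = finsum (sec M U) F K \<oplus>\<^bsub>sec M U\<^esub> finsum (sec M U) G K"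
   using F G by (intro finsum_addf) auto
  then have "(f \<oplus>\<^bsub>sec M U\<^esub> g) \<ominus>\<^bsub>sec M U\<^esub> finsum (sec M U) (%k. F k \<oplus>\<^bsub>sec M U\<^esub> G k) K =
    (f \<ominus>\<^bsub>sec M U\<^esub> finsum (sec M U) F K) \<oplus>\<^bsub>sec M U\<^esub> (g \<ominus>\<^bsub>sec M U\<^esub> finsum (sec M U) G K)"
   using c f g by (simp add: a_minus_def minus_add a_ac)
  moreover have "germ M x U (f \<ominus>\<^bsub>sec M U\<^esub> finsum (sec M U) F K) \<oplus>\<^bsub>stalk M x\<^esub> germ M x U (g \<ominus>\<^bsub>sec M U\<^esub> finsum (sec M U) G K) : Jpow x n"
   using K1 K2 K by (intro additive_subgroup.a_closed[OF Jp]) simp_all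
  ultimately show ?thesis
   using stalk_add[OF alg_sheaf U x, of "f \<ominus>\<^bsub>sec M U\<^esub> finsum (sec M U) F K" "g \<ominus>\<^bsub>sec M U\<^esub> finsum (sec M U) G K"]
    c f g by simp
 qed
 then show "\<exists>K0. finite K0 & (\<forall>K. finite K & K0 \<subseteq> K -->
   germ M x U ((f \<oplus>\<^bsub>sec M U\<^esub> g) \<ominus>\<^bsub>sec M U\<^esub> finsum (sec M U) (%k. F k \<oplus>\<^bsub>sec M U\<^esub> G k) K) : Jpow x n)"
  using K1 K2 by (intro exI[of _ "K1 \<union> K2"]) simp
qed

lemma vf_comp_add:
 assumes X: "X : sheaf_endo M U" and Y: "Y : sheaf_endo M U" and D: "vf_comp M U X D" and E: "vf_comp M U Y E"
 shows "vf_comp M U (rst M U (%W f. X W f \<oplus>\<^bsub>sec M W\<^esub> Y W f)) (%k. rst M U (%W f. D k W f \<oplus>\<^bsub>sec M W\<^esub> E k W f))"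
 unfolding vf_comp_def
proof (intro conjI allI impI ballI)
 show "rst M U (%W f. D k W f \<oplus>\<^bsub>sec M W\<^esub> E k W f) : derivations M U k" for k
  by (rule derivations_add[OF alg_sheaf vf_compD(1)[OF D] vf_compD(1)[OF E]])
 fix W f assume "opn M W & W \<subseteq> U" and f: "f : sects M W"
 then have W: "opn M W" "W \<subseteq> U" by auto
 show "formal_sum M W (%k. rst M U (%W f. D k W f \<oplus>\<^bsub>sec M W\<^esub> E k W f) W f) (rst M U (%W f. X W f \<oplus>\<^bsub>sec M W\<^esub> Y W f) W f)"
  unfolding rst_eq[OF W f]
  by (rule formal_sum_add[OF W(1) sheaf_endoD(1)[OF X W f] sheaf_endoD(1)[OF Y W f]
     sheaf_endoD(1)[OF derivationsD(1)[OF vf_compD(1)[OF D]] W f]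
     sheaf_endoD(1)[OF derivationsD(1)[OF vf_compD(1)[OF E]] W f]
     vf_compD(2)[OF D W f] vf_compD(2)[OF E W f]])
qed

abbreviation "tz U \<equiv> rst M U (%W f. \<zero>\<^bsub>sec M W\<^esub>)"

text \<open>The finite sums are constant once they contain the index k.\<close>

lemma vf_comp_single:
 assumes X: "X : derivations M U k" and U: "opn M U"
 shows "vf_comp M U X (%l. if l = k then X else tz U)"
 unfolding vf_comp_def
proof (intro conjI allI impI ballI)
 show "(if l = k then X else tz U) : derivations M U l" for l
  using X derivations_zero[OF alg_sheaf] by simp
 fix W f assume "opn M W & W \<subseteq> U" and f: "f : sects M W"
 then have W: "opn M W" "W \<subseteq> U" by auto
 note Xe = derivationsD(1)[OF X]
 interpret Wr: ring "sec M W" by (rule rng[OF W(1)])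
 have Xc: "X W f : sects M W" by (rule sheaf_endoD(1)[OF Xe W f])
 have eq: "(if l = k then X else tz U) W f = (if l = k then X W f else \<zero>\<^bsub>sec M W\<^esub>)" for l
  using W f by (simp add: rst_eq)
 show "formal_sum M W (%l. (if l = k then X else tz U) W f) (X W f)"
  unfolding eq
 proof (rule formal_sum_local[OF alg_sheaf W(1) Xc])
  show "(if l = k then X W f else \<zero>\<^bsub>sec M W\<^esub>) : sects M W" for l using Xc by simp
  fix x assume x: "x : W"
  obtain V h Ps where c: "mfd_chart M V p h Ps" "x : V" "opn M V" using chart_at[OF W(1) x] .
  interpret mfd_chart M V p h Ps by (rule c(1))
  let ?N = "W \<inter> V"
  have N: "opn M ?N" "?N \<subseteq> W" "x : ?N" using W c x by auto
  have dN: "dom ?N" using N by (simp add: dom_def)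
  interpret Nr: ring "sec M ?N" by (rule rng[OF N(1)])
  note r = res_hom_facts[OF alg_sheaf W(1) N(1,2)]
  have "formal_sum M ?N (%l. res M W ?N (if l = k then X W f else \<zero>\<^bsub>sec M W\<^esub>)) (res M W ?N (X W f))"
  proof (rule formal_sumI[OF dN r(1)[OF Xc]])
   show "res M W ?N (if l = k then X W f else \<zero>\<^bsub>sec M W\<^esub>) : sects M ?N" for l using Xc r(1) by simp
   fix n
   have "Ps ?N (res M W ?N (if l = k then X W f else \<zero>\<^bsub>sec M W\<^esub>)) m y = (if l = k then Ps ?N (res M W ?N (X W f)) m y else 0)" for l m y
    using r(5) by (simp add: Psi_zero[OF dN])
   then show "\<exists>K0. finite K0 & (\<forall>K. finite K & K0 \<subseteq> K --> (\<forall>m y. size m < n --> m : monomials p --> y : h ` ?N -->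
     Ps ?N (res M W ?N (X W f)) m y = (\<Sum>l\<in>K. Ps ?N (res M W ?N (if l = k then X W f else \<zero>\<^bsub>sec M W\<^esub>)) m y)))"
    by (intro exI[of _ "{k}"]) simp
  qed
  then show "\<exists>N. opn M N & x : N & N \<subseteq> W \<and>
    formal_sum M N (%l. res M W N (if l = k then X W f else \<zero>\<^bsub>sec M W\<^esub>)) (res M W N (X W f))"
   using N by blast
 qed
qed

lemma derivations_vf: "opn M U ==> X : derivations M U k ==> X : vector_fields M U"
 unfolding vector_fields_iff using vf_comp_single derivationsD(1) by blast

lemma tzero_vf: "opn M U ==> rst M U (%U f. \<zero>\<^bsub>sec M U\<^esub>) : vector_fields M U"
 by (rule derivations_vf[OF _ derivations_zero[OF alg_sheaf]])

lemma tadd_vf: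
 assumes X: "X : vector_fields M U" and Y: "Y : vector_fields M U"
 shows "rst M U (%U f. X U f \<oplus>\<^bsub>sec M U\<^esub> Y U f) : vector_fields M U"
proof -
 obtain D E where "vf_comp M U X D" "vf_comp M U Y E" using X Y by (auto simp: vector_fields_iff)
 from vf_comp_add[OF vf_endo[OF X] vf_endo[OF Y] this]
 show ?thesis using endo_add[OF alg_sheaf vf_endo[OF X] vf_endo[OF Y]] by (auto simp: vector_fields_iff)
qed

abbreviation "TM \<equiv> tangent_sheaf M"

lemma T_abelian_group:
 assumes U: "opn M U"
 shows "abelian_group (sec TM U)"
proof (rule endo_abelian_group[OF alg_sheaf U _ tangent_simps(3,4)], unfold tangent_simps)
 interpret ring "sec M U" by (rule rng[OF U])
 show "rst M U (%W f. res M U W (\<ominus>\<^bsub>sec M U\<^esub> \<one>\<^bsub>sec M U\<^esub>) \<otimes>\<^bsub>sec M W\<^esub> X W f) : vector_fields M U"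
  if "X : vector_fields M U" for X by (rule tsmult_vf[OF U that]) simp
qed (use vf_endo tzero_vf[OF U] tadd_vf in \<open>auto\<close>)

text \<open>The projection to degree k; the choice by \<open>SOME\<close> is harmless because
  components are unique.\<close>

definition parts :: "'x set => int => ('x set => 'a => 'a) => 'x set => 'a => 'a" where
 "parts U k X = (SOME D. vf_comp M U X D) k"

lemma vf_comp_parts:
 assumes "X : vector_fields M U"
 shows "vf_comp M U X (%k. parts U k X)"
proof -
 have "\<exists>D. vf_comp M U X D" using assms by (simp add: vector_fields_iff)
 from someI_ex[OF this] show ?thesis by (simp add: parts_def)
qed

lemma parts_eq:
 assumes "opn M U" "X : vector_fields M U" "vf_comp M U X D"
 shows "parts U k X = D k"
 by (rule vf_comp_unique[OF vf_endo[OF assms(2)] assms(1) vf_comp_parts[OF assms(2)] assms(3)])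

lemma T_formal_grading:
 assumes U: "opn M U"
 shows "formal_grading (sec TM U)"
 unfolding formal_grading_def tangent_simps
proof (intro conjI allI exI[of _ "parts U"] ballI impI)
 interpret T: abelian_group "sec TM U" by (rule T_abelian_group[OF U])
 interpret ring "sec M U" by (rule rng[OF U])
 have m1: "\<ominus>\<^bsub>sec M U\<^esub> \<one>\<^bsub>sec M U\<^esub> : hpart (sec M U) 0"
  by (rule additive_subgroup.a_inv_closed[OF formal_grading_subgroup[OF supercomm_algebraD(3)[OF sca[OF U]]]
     supercomm_algebraD(5)[OF sca[OF U]]])
 show "additive_subgroup (derivations M U k) (sec TM U)" for k
 proof (rule additive_subgroup.intro, rule T.add.subgroupI)
  show "derivations M U k \<subseteq> sects TM U" using derivations_vf[OF U] by (auto simp: tangent_simps)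
  show "derivations M U k ~= {}" using derivations_zero[OF alg_sheaf] by blast
  fix X assume X: "X : derivations M U k"
  note Xe = derivationsD(1)[OF X]
  \<comment> \<open>The negative of X as its multiple by -1, which is again a derivation of degree k
    because -1 has degree 0.\<close>
  define Y where "Y = rst M U (%W f. res M U W (\<ominus>\<^bsub>sec M U\<^esub> \<one>\<^bsub>sec M U\<^esub>) \<otimes>\<^bsub>sec M W\<^esub> X W f)"
  have Y: "Y : derivations M U k" using derivations_smult[OF alg_sheaf U X m1] by (simp add: Y_def)
  have "\<ominus>\<^bsub>sec TM U\<^esub> X = Y"
  proof (rule T.minus_equality)
   show "Y \<oplus>\<^bsub>sec TM U\<^esub> X = \<zero>\<^bsub>sec TM U\<^esub>"
    unfolding tangent_simps
   proof (rule rst_cong)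
    fix W f assume W: "opn M W" "W \<subseteq> U" and f: "f : sects M W"
    interpret ring "sec M W" by (rule rng[OF W(1)])
    show "Y W f \<oplus>\<^bsub>sec M W\<^esub> X W f = \<zero>\<^bsub>sec M W\<^esub>"
     using sheaf_endoD(1)[OF Xe W f] by (simp add: Y_def rst_eq[OF W f] res_hom_facts(4,6)[OF alg_sheaf U W] l_minus l_neg)
   qed
  qed (use X Y derivations_vf[OF U] in \<open>auto simp: tangent_simps\<close>)
  then show "\<ominus>\<^bsub>sec TM U\<^esub> X : derivations M U k" using Y by simp
  fix Z assume "Z : derivations M U k"
  then show "X \<oplus>\<^bsub>sec TM U\<^esub> Z : derivations M U k"
   unfolding tangent_simps by (rule derivations_add[OF alg_sheaf X])
 qed
 show "parts U k X : derivations M U k" if "X : vector_fields M U" for k X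
  using vf_compD(1)[OF vf_comp_parts[OF that]] .
 show "parts U k (rst M U (%W f. X W f \<oplus>\<^bsub>sec M W\<^esub> Y W f)) = rst M U (%W f. parts U k X W f \<oplus>\<^bsub>sec M W\<^esub> parts U k Y W f)"
  if X: "X : vector_fields M U" and Y: "Y : vector_fields M U" for k X Y
  by (rule parts_eq[OF U tadd_vf[OF X Y] vf_comp_add[OF vf_endo[OF X] vf_endo[OF Y] vf_comp_parts[OF X] vf_comp_parts[OF Y]]])
 show "parts U l X = (if l = k then X else tz U)" if "X : derivations M U k" for l k X
  by (rule parts_eq[OF U derivations_vf[OF U that] vf_comp_single[OF that U]])
 \<comment> \<open>A vector field whose components all vanish is a formal sum of zeros, hence has
   vanishing coefficients on every chart.\<close>
 show "X = tz U" if X: "X : vector_fields M U" and z: "\<forall>k. parts U k X = tz U" for X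
 proof (rule sheaf_endo_eqI[OF vf_endo[OF X] endo_zero[OF alg_sheaf]])
  have D: "vf_comp M U X (%k. tz U)" using vf_comp_parts[OF X] z by simp
  fix W f assume W: "opn M W" "W \<subseteq> U" and f: "f : sects M W"
  interpret Wr: ring "sec M W" by (rule rng[OF W(1)])
  have "X W f = \<zero>\<^bsub>sec M W\<^esub>"
  proof (rule sheaf_eqI[OF shf W(1) sheaf_endoD(1)[OF vf_endo[OF X] W f]])
   fix x assume x: "x : W"
   obtain V h Ps where c: "mfd_chart M V p h Ps" "x : V" "opn M V" using chart_at[OF W(1) x] .
   interpret mfd_chart M V p h Ps by (rule c(1))
   let ?N = "W \<inter> V"
   have N: "opn M ?N" "?N \<subseteq> W" "x : ?N" "?N \<subseteq> U" using W c x by auto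
   have dN: "dom ?N" using N by (simp add: dom_def)
   interpret Nr: ring "sec M ?N" by (rule rng[OF N(1)])
   have fr: "res M W ?N f : sects M ?N" by (rule presheafD(1)[OF pre W(1) N(1,2) f])
   have Xc: "X ?N (res M W ?N f) : sects M ?N" by (rule sheaf_endoD(1)[OF vf_endo[OF X] N(1,4) fr])
   have fs: "formal_sum M ?N (%k. \<zero>\<^bsub>sec M ?N\<^esub>) (X ?N (res M W ?N f))"
    using vf_compD(2)[OF D N(1,4) fr] by (simp add: rst_eq[OF N(1,4) fr])
   have "X ?N (res M W ?N f) = \<zero>\<^bsub>sec M ?N\<^esub>"
   proof (rule eqI[OF dN Xc Nr.zero_closed])
    fix m :: "gen multiset" and y assume "y : h ` ?N"
    then obtain z where zy: "z : ?N" "y = h z" by blast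
    obtain K0 :: "int set" where "finite K0 & (\<forall>K. finite K & K0 \<subseteq> K --> (\<forall>m'. size m' < Suc (size m) -->
      Ps ?N (X ?N (res M W ?N f)) m' (h z) = (\<Sum>k\<in>K. Ps ?N \<zero>\<^bsub>sec M ?N\<^esub> m' (h z))))"
     using formal_sum_coef[OF dN fs Xc Nr.zero_closed zy(1), of "Suc (size m)"] by (rule exE)
    then have "Ps ?N (X ?N (res M W ?N f)) m (h z) = (\<Sum>k\<in>K0. Ps ?N \<zero>\<^bsub>sec M ?N\<^esub> m (h z))" by simp
    then show "Ps ?N (X ?N (res M W ?N f)) m y = Ps ?N \<zero>\<^bsub>sec M ?N\<^esub> m y" using zy by (simp add: Psi_zero[OF dN])
   qed
   then show "\<exists>N. opn M N & x : N & N \<subseteq> W & res M W N (X W f) = res M W N \<zero>\<^bsub>sec M W\<^esub>"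
    using N sheaf_endoD(4)[OF vf_endo[OF X] W N(1,2) f] res_hom_facts(5)[OF alg_sheaf W(1) N(1,2)]
    by (intro exI[of _ ?N]) simp
  qed simp
  then show "X W f = tz U W f" by (simp add: rst_eq[OF W f])
 qed
qed

section \<open>The tangent sheaf as a sheaf of graded modules\<close>

lemma T_graded_module:
 assumes U: "opn M U"
 shows "graded_module (sec M U) (sec TM U)"
 unfolding graded_module_def
proof (intro conjI ballI allI T_abelian_group[OF U] T_formal_grading[OF U])
 interpret U: ring "sec M U" by (rule rng[OF U])
 fix X assume "X : sects TM U"
 then have X: "X : vector_fields M U" by (simp add: tangent_simps)
 note Xd = sheaf_endoD[OF vf_endo[OF X]]
 show "\<one>\<^bsub>sec M U\<^esub> \<odot>\<^bsub>sec TM U\<^esub> X = X"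
  unfolding tangent_simps
 proof (rule endo_eq_rstI[OF vf_endo[OF X]])
  fix W f assume W: "opn M W" "W \<subseteq> U" and f: "f : sects M W"
  interpret ring "sec M W" by (rule rng[OF W(1)])
  show "res M U W \<one>\<^bsub>sec M U\<^esub> \<otimes>\<^bsub>sec M W\<^esub> X W f = X W f"
   using Xd(1)[OF W f] by (simp add: res_hom_facts(4)[OF alg_sheaf U W])
 qed
 fix a assume a: "a : sects M U"
 show "a \<odot>\<^bsub>sec TM U\<^esub> X : sects TM U" unfolding tangent_simps by (rule tsmult_vf[OF U X a])
 show "a \<odot>\<^bsub>sec TM U\<^esub> (X \<oplus>\<^bsub>sec TM U\<^esub> Y) = a \<odot>\<^bsub>sec TM U\<^esub> X \<oplus>\<^bsub>sec TM U\<^esub> a \<odot>\<^bsub>sec TM U\<^esub> Y"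
  if "Y : sects TM U" for Y
  unfolding tangent_simps
 proof (rule rst_cong)
  have Y: "Y : vector_fields M U" using that by (simp add: tangent_simps)
  note Yd = sheaf_endoD[OF vf_endo[OF Y]]
  fix W f assume W: "opn M W" "W \<subseteq> U" and f: "f : sects M W"
  interpret ring "sec M W" by (rule rng[OF W(1)])
  show "res M U W a \<otimes>\<^bsub>sec M W\<^esub> rst M U (%W f. X W f \<oplus>\<^bsub>sec M W\<^esub> Y W f) W f =
    rst M U (%W f. res M U W a \<otimes>\<^bsub>sec M W\<^esub> X W f) W f \<oplus>\<^bsub>sec M W\<^esub> rst M U (%W f. res M U W a \<otimes>\<^bsub>sec M W\<^esub> Y W f) W f"
   using Xd(1)[OF W f] Yd(1)[OF W f] res_hom_facts(1)[OF alg_sheaf U W a] by (simp add: rst_eq[OF W f] r_distr)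
 qed
 fix b assume b: "b : sects M U"
 show "(a \<oplus>\<^bsub>sec M U\<^esub> b) \<odot>\<^bsub>sec TM U\<^esub> X = a \<odot>\<^bsub>sec TM U\<^esub> X \<oplus>\<^bsub>sec TM U\<^esub> b \<odot>\<^bsub>sec TM U\<^esub> X"
  unfolding tangent_simps
 proof (rule rst_cong)
  fix W f assume W: "opn M W" "W \<subseteq> U" and f: "f : sects M W"
  interpret ring "sec M W" by (rule rng[OF W(1)])
  note r = res_hom_facts[OF alg_sheaf U W]
  show "res M U W (a \<oplus>\<^bsub>sec M U\<^esub> b) \<otimes>\<^bsub>sec M W\<^esub> X W f =
    rst M U (%W f. res M U W a \<otimes>\<^bsub>sec M W\<^esub> X W f) W f \<oplus>\<^bsub>sec M W\<^esub> rst M U (%W f. res M U W b \<otimes>\<^bsub>sec M W\<^esub> X W f) W f"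
   using Xd(1)[OF W f] r(1)[OF a] r(1)[OF b] by (simp add: rst_eq[OF W f] r(2)[OF a b] l_distr)
 qed
 show "(a \<otimes>\<^bsub>sec M U\<^esub> b) \<odot>\<^bsub>sec TM U\<^esub> X = a \<odot>\<^bsub>sec TM U\<^esub> (b \<odot>\<^bsub>sec TM U\<^esub> X)"
  unfolding tangent_simps
 proof (rule rst_cong)
  fix W f assume W: "opn M W" "W \<subseteq> U" and f: "f : sects M W"
  interpret ring "sec M W" by (rule rng[OF W(1)])
  note r = res_hom_facts[OF alg_sheaf U W]
  show "res M U W (a \<otimes>\<^bsub>sec M U\<^esub> b) \<otimes>\<^bsub>sec M W\<^esub> X W f =
    res M U W a \<otimes>\<^bsub>sec M W\<^esub> rst M U (%W f. res M U W b \<otimes>\<^bsub>sec M W\<^esub> X W f) W f"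
   using Xd(1)[OF W f] r(1)[OF a] r(1)[OF b] by (simp add: rst_eq[OF W f] r(3)[OF a b] m_assoc)
 qed
next
 fix k l a X assume a: "a : hpart (sec M U) k" and X: "X : hpart (sec TM U) l"
 then show "a \<odot>\<^bsub>sec TM U\<^esub> X : hpart (sec TM U) (k + l)"
  unfolding tangent_simps using derivations_smult[OF alg_sheaf U _ a] by blast
qed

text \<open>Vector fields glue as sheaf endomorphisms, and being a vector field or a homogeneous
  derivation is a local property.\<close>

lemma T_is_sheaf: "is_sheaf TM"
 unfolding is_sheaf_def
proof (intro conjI allI impI)
 show "is_presheaf TM"
  unfolding is_presheaf_def tangent_simps
 proof (intro conjI allI impI ballI)
  fix U V assume "opn M U & opn M V & V \<subseteq> U"
  then have UV: "opn M U" "opn M V" "V \<subseteq> U" by auto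
  fix X
  show "rst M V X : derivations M V k" if "X : derivations M U k" for k
   by (rule rst_derivations[OF alg_sheaf that UV(3)])
  assume X: "X : vector_fields M U"
  show "rst M V X : vector_fields M V" by (rule rst_vector_fields[OF alg_sheaf X UV(3)])
  show "rst M V (rst M U (%W f. X W f \<oplus>\<^bsub>sec M W\<^esub> Y W f)) = rst M V (%W f. rst M V X W f \<oplus>\<^bsub>sec M W\<^esub> rst M V Y W f)" for Y
   by (rule rst_cong) (use UV(3) in \<open>simp add: rst_eq order_trans\<close>)
 next
  fix U X assume "X : vector_fields M U"
  then show "rst M U X = X" using rst_id vf_endo by blast
 next
  fix U V W :: "'x set" and X
  assume "opn M U & opn M V & opn M W & W \<subseteq> V & V \<subseteq> U"
  then show "rst M W (rst M V X) = rst M W X" by (simp add: rst_rst)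
 qed
next
 fix \<V> s
 assume asm: "(\<forall>V\<in>\<V>. opn TM V & s V : sects TM V) \<and>
    (\<forall>V\<in>\<V>. \<forall>W\<in>\<V>. res TM V (V \<inter> W) (s V) = res TM W (V \<inter> W) (s W))"
 then have op: "!!V. V : \<V> ==> opn M V" and sv: "!!V. V : \<V> ==> s V : vector_fields M V"
  by (simp_all add: tangent_simps)
 have ag: "!!V W. V : \<V> ==> W : \<V> ==> rst M (V \<inter> W) (s V) = rst M (V \<inter> W) (s W)"
  by (rule asm[THEN conjunct2, unfolded tangent_simps, THEN bspec, THEN bspec])
 have oU: "opn M (\<Union>\<V>)" using op by (rule openin_Union)
 obtain X where X: "X : sheaf_endo M (\<Union>\<V>)"
  "!!V W f. V : \<V> ==> opn M W ==> W \<subseteq> V ==> f : sects M W ==> X W f = s V W f"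
 proof (rule endo_glue[OF alg_sheaf, where I = \<V> and N = "%V. V" and Y = s and U = "\<Union>\<V>"])
  show "\<Union>\<V> = (\<Union>V\<in>\<V>. V)" by simp
  show "opn M V" "s V : sheaf_endo M V" if "V : \<V>" for V using op[OF that] vf_endo[OF sv[OF that]] .
  fix V V' W f assume VW: "V : \<V>" "V' : \<V>" "opn M W" "W \<subseteq> V \<inter> V'" "f : sects M W"
  then show "s V W f = s V' W f" using fun_cong[OF fun_cong[OF ag[OF VW(1,2)], of W], of f] by (simp add: rst_eq)
 qed blast
 have rX: "rst M V X = s V" if "V : \<V>" for V
  by (rule endo_eq_rstI[OF vf_endo[OF sv[OF that]] X(2)[OF that]])
 have Xv: "X : vector_fields M (\<Union>\<V>)"
 proof (rule vector_fields_local[OF oU X(1)])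
  fix x assume "x : \<Union>\<V>"
  then obtain V where "V : \<V>" "x : V" by blast
  then show "\<exists>N. opn M N & x : N & N \<subseteq> \<Union>\<V> & rst M N X : vector_fields M N"
   using rX[of V] sv[of V] op[of V] by (intro exI[of _ V]) auto
 qed
 show "\<exists>!t. t : sects TM (\<Union>\<V>) & (\<forall>V\<in>\<V>. res TM (\<Union>\<V>) V t = s V)"
  unfolding tangent_simps
 proof (intro ex1I[of _ X] conjI ballI Xv rX)
  fix Y assume Y: "Y : vector_fields M (\<Union>\<V>) & (\<forall>V\<in>\<V>. rst M V Y = s V)"
  then have Ye: "Y : sheaf_endo M (\<Union>\<V>)" using vf_endo by blast
  show "Y = X"
  proof (rule sheaf_endo_eqI[OF Ye X(1)])
   fix W f assume W: "opn M W" "W \<subseteq> \<Union>\<V>" and f: "f : sects M W"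
   show "Y W f = X W f"
   proof (rule sheaf_eqI[OF shf W(1) sheaf_endoD(1)[OF Ye W f] sheaf_endoD(1)[OF X(1) W f]])
    fix x assume x: "x : W"
    then obtain V where V: "V : \<V>" "x : V" using W by blast
    let ?N = "W \<inter> V"
    have N: "opn M ?N" "?N \<subseteq> W" "?N \<subseteq> V" using W op[OF V(1)] by auto
    have fr: "res M W ?N f : sects M ?N" by (rule presheafD(1)[OF pre W(1) N(1,2) f])
    have "rst M V Y = rst M V X" using Y rX V by simp
    then have "rst M V Y ?N (res M W ?N f) = rst M V X ?N (res M W ?N f)" by simp
    then have "Y ?N (res M W ?N f) = X ?N (res M W ?N f)" by (simp only: rst_eq[OF N(1,3) fr])
    then show "\<exists>N. opn M N & x : N & N \<subseteq> W & res M W N (Y W f) = res M W N (X W f)"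
     using N x V sheaf_endoD(4)[OF Ye W N(1,2) f] sheaf_endoD(4)[OF X(1) W N(1,2) f]
     by (intro exI[of _ ?N]) simp
   qed
  qed
 qed
next
 fix \<V> X k
 assume asm: "(\<forall>V\<in>\<V>. opn TM V) & X : sects TM (\<Union>\<V>) \<and>
    (\<forall>V\<in>\<V>. res TM (\<Union>\<V>) V X : hpart (sec TM V) k)"
 then have op: "!!V. V : \<V> ==> opn M V" and X: "X : vector_fields M (\<Union>\<V>)"
  and h: "!!V. V : \<V> ==> rst M V X : derivations M V k"
  by (simp_all add: tangent_simps)
 show "X : hpart (sec TM (\<Union>\<V>)) k"
  unfolding tangent_simps
 proof (rule derivations_local[OF alg_sheaf vf_endo[OF X]])
  fix x assume "x : \<Union>\<V>"
  then obtain V where "V : \<V>" "x : V" by blast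
  then show "\<exists>N. opn M N & x : N & N \<subseteq> \<Union>\<V> & rst M N X : derivations M N k"
   using op[of V] h[of V] by (intro exI[of _ V]) auto
 qed
qed

theorem T_module_sheaf: "module_sheaf M TM"
 unfolding module_sheaf_def
proof (intro conjI allI impI ballI T_is_sheaf)
 show "base TM = base M" by (simp add: tangent_simps)
 show "graded_module (sec M U) (sec TM U)" if "opn M U" for U by (rule T_graded_module[OF that])
 fix U V g X assume "opn M U & opn M V & V \<subseteq> U" and g: "g : sects M U"
 then have UV: "opn M U" "opn M V" "V \<subseteq> U" by auto
 show "res TM U V (g \<odot>\<^bsub>sec TM U\<^esub> X) = res M U V g \<odot>\<^bsub>sec TM V\<^esub> res TM U V X"
  unfolding tangent_simps
  by (rule rst_cong) (use UV in \<open>simp add: rst_eq order_trans presheafD(5)[OF pre UV(1,2) _ _ UV(3) g]\<close>)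
qed

end

section \<open>Coordinate frames\<close>

lemma free_module_sheaf_simps:
 "base (free_module_sheaf M ds) = base M"
 "sects (free_module_sheaf M ds) U = (\<Pi>\<^sub>E i\<in>{..<length ds}. sects M U)"
 "ring.zero (sec (free_module_sheaf M ds) U) = (\<lambda>i\<in>{..<length ds}. \<zero>\<^bsub>sec M U\<^esub>)"
 "add (sec (free_module_sheaf M ds) U) = (%u v. \<lambda>i\<in>{..<length ds}. u i \<oplus>\<^bsub>sec M U\<^esub> v i)"
 "smult (sec (free_module_sheaf M ds) U) = (%f u. \<lambda>i\<in>{..<length ds}. f \<otimes>\<^bsub>sec M U\<^esub> u i)"
 "hpart (sec (free_module_sheaf M ds) U) k = (\<Pi>\<^sub>E i\<in>{..<length ds}. hpart (sec M U) (k - ds ! i))"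
 "res (free_module_sheaf M ds) U V = (%u. \<lambda>i\<in>{..<length ds}. res M U V (u i))"
 by (simp_all add: free_module_sheaf_def Let_def)

context chart
begin

lemma LC_cong:
 assumes V0: "dom V0" and c: "!!ii. ii : idx p ==> c ii = d ii" and d: "!!ii. ii : idx p ==> d ii : sects S V0"
 shows "LC V0 c = LC V0 d"
proof (rule sheaf_endo_eqI)
 show "LC V0 c : sheaf_endo S V0" "LC V0 d : sheaf_endo S V0"
  using c d by (auto intro!: LC_sheaf_endo[OF V0])
 fix U f assume U: "opn S U" "U \<subseteq> V0" "f : sects S U"
 have dU: "dom U" by (rule dom_subset[OF V0 U(1,2)])
 interpret ring "OS U" by (rule ringO[OF dU])
 show "LC V0 c U f = LC V0 d U f"
  unfolding LC_eq[OF V0 dU U(2,3)]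
  by (rule finsum_cong') (use c LC_term_closed[OF V0 dU U(2,3) d] in auto)
qed

end

context gmanifold
begin

text \<open>A vector field corresponds to its values on the coordinates, with inverse
  \<open>LC\<close>. The shift \<open>- dg\<close> is the degree of the partial derivative.\<close>

lemma tangent_free:
 assumes c: "mfd_chart M V p h Ps" and xs: "distinct xs" "set xs = idx p"
 shows "module_sheaf_iso (restrict_sheaf M V) (restrict_sheaf TM V)
  (free_module_sheaf (restrict_sheaf M V) (map (%ii. - dg ii) xs))"
proof -
 interpret mfd_chart M V p h Ps by (rule c)
 let ?n = "length xs"
 let ?ds = "map (%ii. - dg ii) xs"
 define \<Theta> where "\<Theta> U X = (\<lambda>i\<in>{..<?n}. X U (co U (xs ! i)))" for U :: "'x set" and X :: "'x set => 'a => 'a"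
 \<comment> \<open>The position of an index in the list xs, as free modules are indexed by
   positions.\<close>
 define ix where "ix ii = (SOME i. i < ?n & xs ! i = ii)" for ii
 define \<Gamma> where "\<Gamma> U u = LC U (%ii. u (ix ii))" for U and u :: "nat => 'a"
 have ix: "ix ii < ?n" "xs ! ix ii = ii" if "ii : idx p" for ii
 proof -
  have "ii : set xs" using that xs(2) by simp
  then have "\<exists>i. i < ?n & xs ! i = ii" by (simp only: in_set_conv_nth)
  from someI_ex[OF this] show "ix ii < ?n" "xs ! ix ii = ii" by (simp_all only: ix_def)
 qed
 have xi: "xs ! i : idx p" if "i < ?n" for i using nth_mem[OF that] by (simp only: xs(2))
 have ixi: "ix (xs ! i) = i" if "i < ?n" for i
  using nth_eq_iff_index_eq[OF xs(1) ix(1)[OF xi[OF that]] that] ix(2)[OF xi[OF that]] by simp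
 have uc: "u (ix ii) : sects M U" if "u : (\<Pi>\<^sub>E i\<in>{..<?n}. sects M U)" "ii : idx p" for u ii U
  using that ix[OF that(2)] by auto
 have \<Theta>\<Gamma>: "\<Theta> U (\<Gamma> U u) = u" if U: "dom U" and u: "u : (\<Pi>\<^sub>E i\<in>{..<?n}. sects M U)" for U u
 proof
  fix i
  show "\<Theta> U (\<Gamma> U u) i = u i"
  proof (cases "i < ?n")
   case True
   then show ?thesis
    using LC_co[OF U, of "%ii. u (ix ii)", OF uc[OF u] xi[OF True]] by (simp add: \<Theta>_def \<Gamma>_def ixi)
  next
   case False
   then show ?thesis using PiE_arb[OF u, of i] by (simp add: \<Theta>_def)
  qed
 qed
 have \<Gamma>\<Theta>: "\<Gamma> U (\<Theta> U X) = X" if U: "dom U" and X: "X : vector_fields M U" for U X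
 proof -
  have "\<Gamma> U (\<Theta> U X) = LC U (%ii. X U (co U ii))"
   unfolding \<Gamma>_def by (rule LC_cong[OF U]) (use ix vf_endo_closed[OF vf_endo[OF X] U] in \<open>simp_all add: \<Theta>_def\<close>)
  then show ?thesis using vector_fields_LC[OF U X] by simp
 qed
 have dI: "dom U" if "opn (restrict_sheaf M V) U" for U
  using that by (simp add: openin_restrict[OF V_open] dom_def)
 show ?thesis
  unfolding module_sheaf_iso_def free_module_sheaf_simps restrict_sheaf_simps tangent_simps length_map
 proof (intro exI[of _ \<Theta>] allI impI conjI ballI)
  fix U assume "openin (subtopology (base M) V) U"
  then have dU: "dom U" using dI by simp
  note U = domD(1)[OF dU]
  show "bij_betw (\<Theta> U) (vector_fields M U) (\<Pi>\<^sub>E i\<in>{..<?n}. sects M U)"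
  proof (rule bij_betw_byWitness[of _ "\<Gamma> U"])
   show "\<forall>X\<in>vector_fields M U. \<Gamma> U (\<Theta> U X) = X" using \<Gamma>\<Theta>[OF dU] by blast
   show "\<forall>u\<in>\<Pi>\<^sub>E i\<in>{..<?n}. sects M U. \<Theta> U (\<Gamma> U u) = u" using \<Theta>\<Gamma>[OF dU] by blast
   show "\<Theta> U ` vector_fields M U \<subseteq> (\<Pi>\<^sub>E i\<in>{..<?n}. sects M U)"
   proof (rule image_subsetI)
    fix X assume X: "X : vector_fields M U"
    show "\<Theta> U X : (\<Pi>\<^sub>E i\<in>{..<?n}. sects M U)"
     unfolding \<Theta>_def by (rule restrict_PiE_iff[THEN iffD2]) (use vf_endo_closed[OF vf_endo[OF X] dU xi] in simp)
   qed
   show "\<Gamma> U ` (\<Pi>\<^sub>E i\<in>{..<?n}. sects M U) \<subseteq> vector_fields M U"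
    unfolding \<Gamma>_def by (rule image_subsetI, rule LC_vector_field[OF dU uc])
  qed
  show "\<Theta> U ` derivations M U k = (\<Pi>\<^sub>E i\<in>{..<?n}. hpart (sec M U) (k - ?ds ! i))" for k
  proof
   show "\<Theta> U ` derivations M U k \<subseteq> (\<Pi>\<^sub>E i\<in>{..<?n}. hpart (sec M U) (k - ?ds ! i))"
   proof clarify
    fix X assume X: "X : derivations M U k"
    have "X U (co U (xs ! i)) : hpart (sec M U) (k - ?ds ! i)" if "i < ?n" for i
     using derivationD(4)[OF dom_derivation[OF X dU subset_refl] co_hpart[OF dU xi[OF that]]] that
     by (simp add: add.commute)
    then show "\<Theta> U X : (\<Pi>\<^sub>E i\<in>{..<?n}. hpart (sec M U) (k - ?ds ! i))"
     unfolding \<Theta>_def by (intro restrict_PiE_iff[THEN iffD2] ballI) simp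
   qed
   show "(\<Pi>\<^sub>E i\<in>{..<?n}. hpart (sec M U) (k - ?ds ! i)) \<subseteq> \<Theta> U ` derivations M U k"
   proof
    fix u assume u: "u : (\<Pi>\<^sub>E i\<in>{..<?n}. hpart (sec M U) (k - ?ds ! i))"
    then have uc': "u : (\<Pi>\<^sub>E i\<in>{..<?n}. sects M U)" using hpartD[OF dU] unfolding PiE_iff by blast
    have "u (ix ii) : hpart (sec M U) (k + dg ii)" if "ii : idx p" for ii
    proof -
     have "u (ix ii) : hpart (sec M U) (k - ?ds ! ix ii)"
      by (rule PiE_mem[OF u]) (simp only: lessThan_iff ix(1)[OF that])
     then show ?thesis by (simp only: nth_map[OF ix(1)[OF that]] ix(2)[OF that] diff_minus_eq_add)
    qed
    then have "\<Gamma> U u : derivations M U k" unfolding \<Gamma>_def by (rule LC_derivations[OF dU])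
    then have "\<Theta> U (\<Gamma> U u) : \<Theta> U ` derivations M U k" by (rule imageI)
    then show "u : \<Theta> U ` derivations M U k" by (simp only: \<Theta>\<Gamma>[OF dU uc'])
   qed
  qed
  fix X assume X: "X : vector_fields M U"
  show "\<Theta> U (rst M U (%W f. X W f \<oplus>\<^bsub>sec M W\<^esub> Y W f)) = (\<lambda>i\<in>{..<?n}. \<Theta> U X i \<oplus>\<^bsub>sec M U\<^esub> \<Theta> U Y i)" for Y
   unfolding \<Theta>_def by (rule restrict_ext) (simp add: rst_eq[OF U subset_refl] co_closed[OF dU xi])
  show "\<Theta> U (rst M U (%W f. res M U W g \<otimes>\<^bsub>sec M W\<^esub> X W f)) = (\<lambda>i\<in>{..<?n}. g \<otimes>\<^bsub>sec M U\<^esub> \<Theta> U X i)"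
   if "g : sects M U" for g
   unfolding \<Theta>_def by (rule restrict_ext) (simp add: rst_eq[OF U subset_refl] co_closed[OF dU xi] res_id[OF dU that])
  fix W assume "openin (subtopology (base M) V) W & W \<subseteq> U"
  then have dW: "dom W" "W \<subseteq> U" using dI by simp_all
  show "\<Theta> W (rst M W X) = (\<lambda>i\<in>{..<?n}. res M U W (\<Theta> U X i))"
   unfolding \<Theta>_def
  proof (rule restrict_ext)
   fix i assume "i : {..<?n}"
   then have i: "i < ?n" by simp
   show "rst M W X W (co W (xs ! i)) = res M U W ((\<lambda>i\<in>{..<?n}. X U (co U (xs ! i))) i)"
    using i co_closed[OF dW(1) xi[OF i]] dom_endoD(2)[OF vf_endo[OF X] dU dU subset_refl co_closed[OF dU xi[OF i]] dW]
    by (simp add: rst_eq[OF domD(1)[OF dW(1)] subset_refl] co_res[OF dU dW xi[OF i]])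
  qed
 qed
qed

lemma idx_list:
 obtains gl :: "gen list" where "distinct gl" "set gl = gens p"
 using finite_distinct_list[OF finite_gens[OF finp]] by blast

lemma idx_list_props:
 assumes "distinct gl" "set gl = gens p"
 defines "xs \<equiv> map Inl [0..<p 0] @ map Inr gl"
 shows "distinct xs" "set xs = idx p" "map (%ii. - dg ii) xs = replicate (p 0) 0 @ map (%a. - fst a) gl"
 using assms(1,2) by (auto simp: xs_def idx_def distinct_map o_def map_replicate_const)

theorem T_locally_free: "locally_free M TM"
 unfolding locally_free_def
proof
 fix x assume x: "x : topspace (base M)"
 obtain V h Ps where c: "mfd_chart M V p h Ps" "x : V" "opn M V"
  using chart_at[OF openin_topspace x] .
 obtain gl where gl: "distinct gl" "set gl = gens p" by (rule idx_list)
 show "\<exists>V ds. opn M V & x : V \<and>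
    module_sheaf_iso (restrict_sheaf M V) (restrict_sheaf TM V) (free_module_sheaf (restrict_sheaf M V) ds)"
  using tangent_free[OF c(1) idx_list_props(1,2)[OF gl]] c by blast
qed

end

section \<open>Isomorphisms of module sheaves\<close>

lemma restrict_is_sheaf:
 assumes S: "is_sheaf S" and V: "opn S V"
 shows "is_sheaf (restrict_sheaf S V)"
 unfolding is_sheaf_def restrict_sheaf_simps openin_restrict[OF V]
proof (intro conjI allI impI)
 note P = sheafD(1)[OF S]
 show "is_presheaf (restrict_sheaf S V)"
  unfolding is_presheaf_def restrict_sheaf_simps openin_restrict[OF V]
  by (intro conjI allI impI ballI) (use presheafD[OF P] in \<open>simp_all\<close>)
 show "\<exists>!t. t : sects S (\<Union>\<V>) & (\<forall>V\<in>\<V>. res S (\<Union>\<V>) V t = s V)"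
  if "(\<forall>W\<in>\<V>. (opn S W & W \<subseteq> V) & s W : sects S W) \<and>
    (\<forall>V\<in>\<V>. \<forall>W\<in>\<V>. res S V (V \<inter> W) (s V) = res S W (V \<inter> W) (s W))" for \<V> s
  by (rule sheafD(2)[OF S]) (use that[THEN conjunct1, THEN bspec] that[THEN conjunct2, THEN bspec, THEN bspec] in \<open>simp_all\<close>)
 show "t : hpart (sec S (\<Union>\<V>)) k"
  if "(\<forall>W\<in>\<V>. opn S W & W \<subseteq> V) & t : sects S (\<Union>\<V>) \<and>
    (\<forall>V\<in>\<V>. res S (\<Union>\<V>) V t : hpart (sec S V) k)" for \<V> t k
  by (rule sheafD(3)[OF S]) (use that in \<open>simp_all\<close>)
qed

text \<open>Gluing takes place in each entry separately.\<close>

lemma free_is_sheaf: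
 assumes S: "is_sheaf S"
 shows "is_sheaf (free_module_sheaf S ds)"
 unfolding is_sheaf_def free_module_sheaf_simps
proof (intro conjI allI impI)
 note P = sheafD(1)[OF S]
 let ?I = "{..<length ds}"
 show "is_presheaf (free_module_sheaf S ds)"
  unfolding is_presheaf_def free_module_sheaf_simps
 proof (intro conjI allI impI ballI)
  fix U W assume "opn S U & opn S W & W \<subseteq> U"
  then have UW: "opn S U" "opn S W" "W \<subseteq> U" by auto
  fix u
  show "(\<lambda>i\<in>?I. res S U W (u i)) : (\<Pi>\<^sub>E i\<in>?I. hpart (sec S W) (k - ds ! i))"
   if "u : (\<Pi>\<^sub>E i\<in>?I. hpart (sec S U) (k - ds ! i))" for k
   using presheafD(3)[OF P UW] that by (intro restrict_PiE_iff[THEN iffD2] ballI) (simp add: PiE_iff)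
  assume u: "u : (\<Pi>\<^sub>E i\<in>?I. sects S U)"
  show "(\<lambda>i\<in>?I. res S U W (u i)) : (\<Pi>\<^sub>E i\<in>?I. sects S W)"
   using presheafD(1)[OF P UW] u by (intro restrict_PiE_iff[THEN iffD2] ballI) (simp add: PiE_iff)
  fix v assume v: "v : (\<Pi>\<^sub>E i\<in>?I. sects S U)"
  show "(\<lambda>i\<in>?I. res S U W ((\<lambda>i\<in>?I. u i \<oplus>\<^bsub>sec S U\<^esub> v i) i)) =
    (\<lambda>i\<in>?I. (\<lambda>i\<in>?I. res S U W (u i)) i \<oplus>\<^bsub>sec S W\<^esub> (\<lambda>i\<in>?I. res S U W (v i)) i)"
   by (rule restrict_ext) (use presheafD(2)[OF P UW] u v in \<open>simp add: PiE_iff\<close>)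
 next
  fix U u assume "opn S U" and u: "u : (\<Pi>\<^sub>E i\<in>?I. sects S U)"
  then have "(\<lambda>i\<in>?I. res S U U (u i)) = (\<lambda>i\<in>?I. u i)"
   by (intro restrict_ext) (simp add: PiE_iff presheafD(4)[OF P])
  then show "(\<lambda>i\<in>?I. res S U U (u i)) = u" using PiE_restrict[OF u] by simp
 next
  fix U W X u assume "opn S U & opn S W & opn S X & X \<subseteq> W & W \<subseteq> U"
   and u: "u : (\<Pi>\<^sub>E i\<in>?I. sects S U)"
  then show "(\<lambda>i\<in>?I. res S W X ((\<lambda>i\<in>?I. res S U W (u i)) i)) = (\<lambda>i\<in>?I. res S U X (u i))"
   by (intro restrict_ext) (simp add: PiE_iff presheafD(5)[OF P])
 qed
 fix \<V>
 show "\<exists>!t. t : (\<Pi>\<^sub>E i\<in>?I. sects S (\<Union>\<V>)) & (\<forall>V\<in>\<V>. (\<lambda>i\<in>?I. res S (\<Union>\<V>) V (t i)) = s V)"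
  if asm: "(\<forall>V\<in>\<V>. opn S V & s V : (\<Pi>\<^sub>E i\<in>?I. sects S V)) \<and>
    (\<forall>V\<in>\<V>. \<forall>W\<in>\<V>. (\<lambda>i\<in>?I. res S V (V \<inter> W) (s V i)) = (\<lambda>i\<in>?I. res S W (V \<inter> W) (s W i)))" for s
 proof -
  have ex: "\<exists>!t. t : sects S (\<Union>\<V>) & (\<forall>V\<in>\<V>. res S (\<Union>\<V>) V t = s V i)" if i: "i : ?I" for i
  proof (rule sheafD(2)[OF S])
   fix V W assume V: "V : \<V>" and W: "W : \<V>"
   show "opn S V" "s V i : sects S V" using asm V i by (auto simp: PiE_iff)
   have "(\<lambda>i\<in>?I. res S V (V \<inter> W) (s V i)) i = (\<lambda>i\<in>?I. res S W (V \<inter> W) (s W i)) i"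
    using asm[THEN conjunct2, THEN bspec, THEN bspec, OF V W] by (rule fun_cong)
   then show "res S V (V \<inter> W) (s V i) = res S W (V \<inter> W) (s W i)" using i by simp
  qed
  define t where "t = (\<lambda>i\<in>?I. THE t. t : sects S (\<Union>\<V>) & (\<forall>V\<in>\<V>. res S (\<Union>\<V>) V t = s V i))"
  have t: "t i : sects S (\<Union>\<V>) & (\<forall>V\<in>\<V>. res S (\<Union>\<V>) V (t i) = s V i)" if "i : ?I" for i
   using theI'[OF ex[OF that]] that by (simp add: t_def)
  show ?thesis
  proof (rule ex1I[of _ t])
   have "(\<lambda>i\<in>?I. res S (\<Union>\<V>) V (t i)) = s V" if V: "V : \<V>" for V
   proof -
    have "(\<lambda>i\<in>?I. res S (\<Union>\<V>) V (t i)) = (\<lambda>i\<in>?I. s V i)" by (rule restrict_ext) (use t V in simp)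
    moreover have "s V : (\<Pi>\<^sub>E i\<in>?I. sects S V)" using asm V by simp
    ultimately show ?thesis using PiE_restrict by simp
   qed
   moreover have "t : (\<Pi>\<^sub>E i\<in>?I. sects S (\<Union>\<V>))"
    using t by (simp add: PiE_iff) (simp add: t_def)
   ultimately show "t : (\<Pi>\<^sub>E i\<in>?I. sects S (\<Union>\<V>)) & (\<forall>V\<in>\<V>. (\<lambda>i\<in>?I. res S (\<Union>\<V>) V (t i)) = s V)" by simp
   fix u assume u: "u : (\<Pi>\<^sub>E i\<in>?I. sects S (\<Union>\<V>)) & (\<forall>V\<in>\<V>. (\<lambda>i\<in>?I. res S (\<Union>\<V>) V (u i)) = s V)"
   show "u = t"
   proof
    fix i
    show "u i = t i"
    proof (cases "i : ?I")
     case True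
     have "u i : sects S (\<Union>\<V>) & (\<forall>V\<in>\<V>. res S (\<Union>\<V>) V (u i) = s V i)"
     proof (intro conjI ballI)
      show "u i : sects S (\<Union>\<V>)" using u True by (simp add: PiE_iff)
      fix V assume "V : \<V>"
      then have "(\<lambda>i\<in>?I. res S (\<Union>\<V>) V (u i)) i = s V i" using u by simp
      then show "res S (\<Union>\<V>) V (u i) = s V i" using True by simp
     qed
     then show ?thesis using ex[OF True] t[OF True] by (blast dest: ex1_implies_ex)
    next
     case False
     then show ?thesis using PiE_arb[OF conjunct1[OF u] False] by (simp add: t_def)
    qed
   qed
  qed
 qed
 show "t : (\<Pi>\<^sub>E i\<in>?I. hpart (sec S (\<Union>\<V>)) (k - ds ! i))"
  if asm: "(\<forall>V\<in>\<V>. opn S V) & t : (\<Pi>\<^sub>E i\<in>?I. sects S (\<Union>\<V>)) \<and>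
    (\<forall>V\<in>\<V>. (\<lambda>i\<in>?I. res S (\<Union>\<V>) V (t i)) : (\<Pi>\<^sub>E i\<in>?I. hpart (sec S V) (k - ds ! i)))" for t k
 proof -
  have "t i : hpart (sec S (\<Union>\<V>)) (k - ds ! i)" if i: "i : ?I" for i
  proof (rule sheafD(3)[OF S])
   show "t i : sects S (\<Union>\<V>)" using asm i by (simp add: PiE_iff)
   fix V assume V: "V : \<V>"
   show "opn S V" using asm V by simp
   have "(\<lambda>i\<in>?I. res S (\<Union>\<V>) V (t i)) i : hpart (sec S V) (k - ds ! i)"
    by (rule PiE_mem[OF _ i]) (use asm V in blast)
   then show "res S (\<Union>\<V>) V (t i) : hpart (sec S V) (k - ds ! i)" using i by simp
  qed
  then show ?thesis using asm by (simp add: PiE_iff)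
 qed
qed

definition iso_map ::
 "('x, 'q, 'a) gpresheaf => ('x, 'a, 'm) gpresheaf => ('x, 'a, 'n) gpresheaf => ('x set => 'm => 'n) => bool" where
 "iso_map M F G \<Theta> \<longleftrightarrow>
   (\<forall>U. opn M U -->
    bij_betw (\<Theta> U) (sects F U) (sects G U) \<and>
    (\<forall>x\<in>sects F U. \<forall>y\<in>sects F U.
      \<Theta> U (x \<oplus>\<^bsub>sec F U\<^esub> y) = \<Theta> U x \<oplus>\<^bsub>sec G U\<^esub> \<Theta> U y) \<and>
    (\<forall>f\<in>sects M U. \<forall>x\<in>sects F U.
      \<Theta> U (f \<odot>\<^bsub>sec F U\<^esub> x) = f \<odot>\<^bsub>sec G U\<^esub> \<Theta> U x) \<and>
    (\<forall>k. \<Theta> U ` hpart (sec F U) k = hpart (sec G U) k) \<and>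
    (\<forall>V. opn M V & V \<subseteq> U -->
      (\<forall>x\<in>sects F U. \<Theta> V (res F U V x) = res G U V (\<Theta> U x))))"

lemma module_sheaf_iso_iff: "module_sheaf_iso M F G \<longleftrightarrow> (\<exists>\<Theta>. iso_map M F G \<Theta>)"
 by (simp add: module_sheaf_iso_def iso_map_def)

lemma iso_mapI:
 assumes "!!U. opn M U ==> bij_betw (\<Theta> U) (sects F U) (sects G U)"
  and "!!U x y. opn M U ==> x : sects F U ==> y : sects F U ==>
   \<Theta> U (x \<oplus>\<^bsub>sec F U\<^esub> y) = \<Theta> U x \<oplus>\<^bsub>sec G U\<^esub> \<Theta> U y"
  and "!!U f x. opn M U ==> f : sects M U ==> x : sects F U ==>
   \<Theta> U (f \<odot>\<^bsub>sec F U\<^esub> x) = f \<odot>\<^bsub>sec G U\<^esub> \<Theta> U x"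
  and "!!U k. opn M U ==> \<Theta> U ` hpart (sec F U) k = hpart (sec G U) k"
  and "!!U V x. opn M U ==> opn M V ==> V \<subseteq> U ==> x : sects F U ==>
   \<Theta> V (res F U V x) = res G U V (\<Theta> U x)"
 shows "iso_map M F G \<Theta>"
 unfolding iso_map_def by (intro allI impI conjI ballI) (use assms in \<open>simp_all\<close>)

lemma iso_mapD:
 assumes "iso_map M F G \<Theta>" "opn M U"
 shows "bij_betw (\<Theta> U) (sects F U) (sects G U)"
  "x : sects F U ==> y : sects F U ==> \<Theta> U (x \<oplus>\<^bsub>sec F U\<^esub> y) = \<Theta> U x \<oplus>\<^bsub>sec G U\<^esub> \<Theta> U y"
  "f : sects M U ==> x : sects F U ==> \<Theta> U (f \<odot>\<^bsub>sec F U\<^esub> x) = f \<odot>\<^bsub>sec G U\<^esub> \<Theta> U x"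
  "\<Theta> U ` hpart (sec F U) k = hpart (sec G U) k"
  "opn M V ==> V \<subseteq> U ==> x : sects F U ==> \<Theta> V (res F U V x) = res G U V (\<Theta> U x)"
proof -
 note * = assms(1)[unfolded iso_map_def, THEN spec, THEN mp, OF assms(2)]
 show "bij_betw (\<Theta> U) (sects F U) (sects G U)" by (rule *[THEN conjunct1])
 show "\<Theta> U (x \<oplus>\<^bsub>sec F U\<^esub> y) = \<Theta> U x \<oplus>\<^bsub>sec G U\<^esub> \<Theta> U y" if "x : sects F U" "y : sects F U"
  by (rule *[THEN conjunct2, THEN conjunct1, THEN bspec, THEN bspec, OF that])
 show "\<Theta> U (f \<odot>\<^bsub>sec F U\<^esub> x) = f \<odot>\<^bsub>sec G U\<^esub> \<Theta> U x" if "f : sects M U" "x : sects F U"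
  by (rule *[THEN conjunct2, THEN conjunct2, THEN conjunct1, THEN bspec, THEN bspec, OF that])
 show "\<Theta> U ` hpart (sec F U) k = hpart (sec G U) k"
  by (rule *[THEN conjunct2, THEN conjunct2, THEN conjunct2, THEN conjunct1, THEN spec])
 show "\<Theta> V (res F U V x) = res G U V (\<Theta> U x)" if "opn M V" "V \<subseteq> U" "x : sects F U"
  by (rule *[THEN conjunct2, THEN conjunct2, THEN conjunct2, THEN conjunct2, THEN spec, THEN mp, OF conjI[OF that(1,2)], THEN bspec, OF that(3)])
qed

lemma module_sheaf_iso_trans:
 assumes FG: "module_sheaf_iso M F G" and GH: "module_sheaf_iso M G H"
 shows "module_sheaf_iso M F H"
proof -
 obtain \<Theta> \<Phi> where T': "iso_map M F G \<Theta>" and P': "iso_map M G H \<Phi>"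
  using assms unfolding module_sheaf_iso_iff by (elim exE)
 note T = iso_mapD[OF T'] and P = iso_mapD[OF P']
 have c: "\<Theta> U x : sects G U" if "opn M U" "x : sects F U" for U x
  using T(1)[OF that(1)] that(2) by (rule bij_betw_apply)
 show ?thesis
 unfolding module_sheaf_iso_iff
 proof (intro exI[of _ "%U. \<Phi> U \<circ> \<Theta> U"] iso_mapI)
  fix U assume U: "opn M U"
  show "bij_betw (\<Phi> U \<circ> \<Theta> U) (sects F U) (sects H U)"
   by (rule bij_betw_trans[OF T(1)[OF U] P(1)[OF U]])
  show "(\<Phi> U \<circ> \<Theta> U) ` hpart (sec F U) k = hpart (sec H U) k" for k
   using T(4)[OF U] P(4)[OF U] by (simp only: image_comp[symmetric])
 qed (simp_all add: T P c)
qed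

lemma sum_in_PiE_append:
 fixes n k :: nat
 shows "u : (\<Pi>\<^sub>E i\<in>{..<n}. A i) ==> v : (\<Pi>\<^sub>E i\<in>{..<k}. B i) ==>
  (\<lambda>i\<in>{..<n + k}. if i < n then u i else v (i - n)) : (\<Pi>\<^sub>E i\<in>{..<n + k}. if i < n then A i else B (i - n))"
 unfolding restrict_PiE_iff
proof
 fix i assume u: "u : (\<Pi>\<^sub>E i\<in>{..<n}. A i)" and v: "v : (\<Pi>\<^sub>E i\<in>{..<k}. B i)" and i: "i : {..<n + k}"
 show "(if i < n then u i else v (i - n)) : (if i < n then A i else B (i - n))"
  using PiE_mem[OF u, of i] PiE_mem[OF v, of "i - n"] i by auto
qed

text \<open>Tuples are cut into their first \<open>length ds\<close> entries and the rest; a and b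
  are the two pieces, and j puts them together.\<close>

lemma direct_sum_iso:
 fixes M :: "('x, 'q, 'b) gpresheaf"
 assumes F: "module_sheaf_iso M (free_module_sheaf M ds) F" and G: "module_sheaf_iso M (free_module_sheaf M es) G"
 shows "module_sheaf_iso M (free_module_sheaf M (ds @ es)) (direct_sum_sheaf F G)"
proof -
 let ?n = "length ds" and ?k = "length es"
 obtain \<Theta> \<Phi> where T': "iso_map M (free_module_sheaf M ds) F \<Theta>" and P': "iso_map M (free_module_sheaf M es) G \<Phi>"
  using assms unfolding module_sheaf_iso_iff by (elim exE)
 note T = iso_mapD[OF T', unfolded free_module_sheaf_simps] and P = iso_mapD[OF P', unfolded free_module_sheaf_simps]
 define a where "a u = (\<lambda>i\<in>{..<?n}. u i)" for u :: "nat => 'b"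
 define b where "b u = (\<lambda>i\<in>{..<?k}. u (?n + i))" for u :: "nat => 'b"
 define j where "j u v = (\<lambda>i\<in>{..<?n + ?k}. if i < ?n then u i else v (i - ?n))" for u v :: "nat => 'b"
 define C where "C A B = (\<Pi>\<^sub>E i\<in>{..<?n + ?k}. if i < ?n then A i else B (i - ?n))" for A B :: "nat => 'b set"
 have ab: "a u : (\<Pi>\<^sub>E i\<in>{..<?n}. A i)" "b u : (\<Pi>\<^sub>E i\<in>{..<?k}. B i)" if u: "u : C A B" for u A B
 proof -
  have "u i : A i" if "i < ?n" for i using PiE_mem[OF u[unfolded C_def], of i] that by simp
  then show "a u : (\<Pi>\<^sub>E i\<in>{..<?n}. A i)" by (simp add: a_def)
  have "u (?n + i) : B i" if "i < ?k" for i using PiE_mem[OF u[unfolded C_def], of "?n + i"] that by simp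
  then show "b u : (\<Pi>\<^sub>E i\<in>{..<?k}. B i)" by (simp add: b_def)
 qed
 have jC: "j u v : C A B" if "u : (\<Pi>\<^sub>E i\<in>{..<?n}. A i)" "v : (\<Pi>\<^sub>E i\<in>{..<?k}. B i)" for u v A B
  unfolding j_def C_def by (rule sum_in_PiE_append[OF that])
 have jab: "j (a u) (b u) = u" if "u : C A B" for u A B
  using that by (auto simp: j_def a_def b_def C_def fun_eq_iff PiE_iff extensional_def)
 have aj: "a (j u v) = u" if "u : (\<Pi>\<^sub>E i\<in>{..<?n}. A i)" for u v A
  using that by (auto simp: j_def a_def fun_eq_iff PiE_iff extensional_def)
 have bj: "b (j u v) = v" if "v : (\<Pi>\<^sub>E i\<in>{..<?k}. A i)" for u v A
  using that by (auto simp: j_def b_def fun_eq_iff PiE_iff extensional_def)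
 have bij: "bij_betw (%u. (a u, b u)) (C A B) ((\<Pi>\<^sub>E i\<in>{..<?n}. A i) \<times> (\<Pi>\<^sub>E i\<in>{..<?k}. B i))" for A B
  by (rule bij_betw_byWitness[of _ "%(u, v). j u v"]) (use ab jC jab aj bj in \<open>simp_all add: image_subset_iff split_paired_Ball_Sigma\<close>)
 have Cc: "(\<Pi>\<^sub>E i\<in>{..<?n + ?k}. sects M U) = C (%_. sects M U) (%_. sects M U)" for U
  by (simp add: C_def)
 have Ch: "(\<Pi>\<^sub>E i\<in>{..<?n + ?k}. hpart (sec M U) (d - (ds @ es) ! i)) =
   C (%i. hpart (sec M U) (d - ds ! i)) (%i. hpart (sec M U) (d - es ! i))" for U d
  unfolding C_def by (rule PiE_cong) (simp add: nth_append)
 show ?thesis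
  unfolding module_sheaf_iso_iff
 proof (intro exI[of _ "%U u. (\<Theta> U (a u), \<Phi> U (b u))"] iso_mapI,
   unfold free_module_sheaf_simps direct_sum_sheaf_def gpresheaf.simps graded.simps partial_object.simps
    monoid.simps ring.simps module.simps length_append)
  fix U assume U: "opn M U"
  have "bij_betw (map_prod (\<Theta> U) (\<Phi> U) \<circ> (%u. (a u, b u))) (\<Pi>\<^sub>E i\<in>{..<?n + ?k}. sects M U)
    (sects F U \<times> sects G U)"
   unfolding Cc by (rule bij_betw_trans[OF bij bij_betw_map_prod[OF T(1)[OF U] P(1)[OF U]]])
  then show "bij_betw (%u. (\<Theta> U (a u), \<Phi> U (b u))) (\<Pi>\<^sub>E i\<in>{..<?n + ?k}. sects M U)
    (sects F U \<times> sects G U)" by (simp add: o_def)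
  have "(%u. (a u, b u)) ` C (%i. hpart (sec M U) (d - ds ! i)) (%i. hpart (sec M U) (d - es ! i)) =
    (\<Pi>\<^sub>E i\<in>{..<?n}. hpart (sec M U) (d - ds ! i)) \<times> (\<Pi>\<^sub>E i\<in>{..<?k}. hpart (sec M U) (d - es ! i))" for d
   using bij by (simp add: bij_betw_def)
  then have "map_prod (\<Theta> U) (\<Phi> U) ` (%u. (a u, b u)) ` C (%i. hpart (sec M U) (d - ds ! i)) (%i. hpart (sec M U) (d - es ! i)) =
    hpart (sec F U) d \<times> hpart (sec G U) d" for d
   using T(4)[OF U] P(4)[OF U] by (simp add: map_prod_surj_on)
  then show "(%u. (\<Theta> U (a u), \<Phi> U (b u))) ` (\<Pi>\<^sub>E i\<in>{..<?n + ?k}. hpart (sec M U) (d - (ds @ es) ! i)) =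
    hpart (sec F U) d \<times> hpart (sec G U) d" for d
   unfolding Ch by (simp add: image_image)
  fix u assume u: "u : (\<Pi>\<^sub>E i\<in>{..<?n + ?k}. sects M U)"
  note abu = ab[OF u[unfolded Cc]]
  show "(\<Theta> U (a (\<lambda>i\<in>{..<?n + ?k}. u i \<oplus>\<^bsub>sec M U\<^esub> v i)), \<Phi> U (b (\<lambda>i\<in>{..<?n + ?k}. u i \<oplus>\<^bsub>sec M U\<^esub> v i))) =
    (case (\<Theta> U (a u), \<Phi> U (b u)) of (x, y) => %(x', y'). (x \<oplus>\<^bsub>sec F U\<^esub> x', y \<oplus>\<^bsub>sec G U\<^esub> y')) (\<Theta> U (a v), \<Phi> U (b v))"
   if v: "v : (\<Pi>\<^sub>E i\<in>{..<?n + ?k}. sects M U)" for v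
  proof -
   have "a (\<lambda>i\<in>{..<?n + ?k}. u i \<oplus>\<^bsub>sec M U\<^esub> v i) = (\<lambda>i\<in>{..<?n}. a u i \<oplus>\<^bsub>sec M U\<^esub> a v i)"
    "b (\<lambda>i\<in>{..<?n + ?k}. u i \<oplus>\<^bsub>sec M U\<^esub> v i) = (\<lambda>i\<in>{..<?k}. b u i \<oplus>\<^bsub>sec M U\<^esub> b v i)"
    by (auto simp: a_def b_def fun_eq_iff)
   then show ?thesis using T(2)[OF U abu(1)] P(2)[OF U abu(2)] ab[OF v[unfolded Cc]] by simp
  qed
  show "(\<Theta> U (a (\<lambda>i\<in>{..<?n + ?k}. f \<otimes>\<^bsub>sec M U\<^esub> u i)), \<Phi> U (b (\<lambda>i\<in>{..<?n + ?k}. f \<otimes>\<^bsub>sec M U\<^esub> u i))) =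
    (case (\<Theta> U (a u), \<Phi> U (b u)) of (x, y) => (f \<odot>\<^bsub>sec F U\<^esub> x, f \<odot>\<^bsub>sec G U\<^esub> y))"
   if f: "f : sects M U" for f
  proof -
   have "a (\<lambda>i\<in>{..<?n + ?k}. f \<otimes>\<^bsub>sec M U\<^esub> u i) = (\<lambda>i\<in>{..<?n}. f \<otimes>\<^bsub>sec M U\<^esub> a u i)"
    "b (\<lambda>i\<in>{..<?n + ?k}. f \<otimes>\<^bsub>sec M U\<^esub> u i) = (\<lambda>i\<in>{..<?k}. f \<otimes>\<^bsub>sec M U\<^esub> b u i)"
    by (auto simp: a_def b_def fun_eq_iff)
   then show ?thesis using T(3)[OF U f abu(1)] P(3)[OF U f abu(2)] by simp
  qed
  fix W assume W: "opn M W" "W \<subseteq> U"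
  have "a (\<lambda>i\<in>{..<?n + ?k}. res M U W (u i)) = (\<lambda>i\<in>{..<?n}. res M U W (a u i))"
   "b (\<lambda>i\<in>{..<?n + ?k}. res M U W (u i)) = (\<lambda>i\<in>{..<?k}. res M U W (b u i))"
   by (auto simp: a_def b_def fun_eq_iff)
  then show "(\<Theta> W (a (\<lambda>i\<in>{..<?n + ?k}. res M U W (u i))), \<Phi> W (b (\<lambda>i\<in>{..<?n + ?k}. res M U W (u i)))) =
    (case (\<Theta> U (a u), \<Phi> U (b u)) of (x, y) => (res F U W x, res G U W y))"
   using T(5)[OF U W abu(1)] P(5)[OF U W abu(2)] by simp
 qed
qed

subsection \<open>Sheafification\<close>

lemma sheafify_simps:
 "base (sheafify M P) = base P"
 "sects (sheafify M P) U = germ_families P (%N. sects P N) U"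
 "add (sec (sheafify M P) U) = (%\<sigma> \<tau>. \<lambda>x\<in>U. \<sigma> x \<oplus>\<^bsub>stalk P x\<^esub> \<tau> x)"
 "smult (sec (sheafify M P) U) = (%f \<sigma>. \<lambda>x\<in>U. germ_smult M P x U f (\<sigma> x))"
 "hpart (sec (sheafify M P) U) k = germ_families P (%N. hpart (sec P N) k) U"
 "res (sheafify M P) U V = (%\<sigma>. restrict \<sigma> V)"
 by (simp_all add: sheafify_def)

text \<open>A presheaf that is isomorphic to a sheaf is not changed by sheafification. The laws of P
  are all transported from F along the isomorphism.\<close>

lemma sheafify_iso:
 assumes bF: "base F = base M" and bP: "base P = base M" and F: "is_sheaf F"
  and iso: "module_sheaf_iso M F P"
  and hF: "!!U k. opn M U ==> hpart (sec F U) k \<subseteq> sects F U"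
  and addF: "!!U x y. opn M U ==> x : sects F U ==> y : sects F U ==> x \<oplus>\<^bsub>sec F U\<^esub> y : sects F U"
  and smF: "!!U f x. opn M U ==> f : sects M U ==> x : sects F U ==> f \<odot>\<^bsub>sec F U\<^esub> x : sects F U"
  and resM: "!!U W f. opn M U ==> opn M W ==> W \<subseteq> U ==> f : sects M U ==> res M U W f : sects M W"
  and resMM: "!!U W X f. opn M U ==> opn M W ==> opn M X ==> X \<subseteq> W ==> W \<subseteq> U ==> f : sects M U ==>
   res M W X (res M U W f) = res M U X f"
  and ressm: "!!U W f x. opn M U ==> opn M W ==> W \<subseteq> U ==> f : sects M U ==> x : sects F U ==>
   res F U W (f \<odot>\<^bsub>sec F U\<^esub> x) = res M U W f \<odot>\<^bsub>sec F W\<^esub> res F U W x"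
 shows "module_sheaf_iso M F (sheafify M P)"
proof -
 obtain \<Phi> where P': "iso_map M F P \<Phi>" using iso unfolding module_sheaf_iso_iff ..
 note bij = iso_mapD(1)[OF P'] and \<Phi>add = iso_mapD(2)[OF P'] and \<Phi>sm = iso_mapD(3)[OF P']
  and \<Phi>h = iso_mapD(4)[OF P'] and \<Phi>res = iso_mapD(5)[OF P']
 note PF = sheafD(1)[OF F]
 note FD = presheafD[OF PF, unfolded bF]
 have \<Phi>c: "\<Phi> U x : sects P U" if "opn M U" "x : sects F U" for U x
  using bij[OF that(1)] that(2) by (rule bij_betw_apply)
 have \<Phi>inj: "x = y" if "opn M U" "x : sects F U" "y : sects F U" "\<Phi> U x = \<Phi> U y" for U x y
  using bij_betw_imp_inj_on[OF bij[OF that(1)]] that by (simp add: inj_on_def)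
 have \<Phi>sur: "\<exists>x\<in>sects F U. s = \<Phi> U x" if "opn M U" "s : sects P U" for U s
  using bij_betw_imp_surj_on[OF bij[OF that(1)]] that(2) by blast
 have pP: "is_presheaf P"
  unfolding is_presheaf_def bP
 proof (intro conjI allI impI ballI)
  fix U V assume "opn M U & opn M V & V \<subseteq> U"
  then have UV: "opn M U" "opn M V" "V \<subseteq> U" by auto
  fix s
  show "res P U V s : hpart (sec P V) k" if "s : hpart (sec P U) k" for k
  proof -
   have "s : \<Phi> U ` hpart (sec F U) k" using that by (simp add: \<Phi>h[OF UV(1)])
   then obtain x where x: "x : hpart (sec F U) k" "s = \<Phi> U x" by blast
   have "x : sects F U" using x hF[OF UV(1)] by blast
   then have "res P U V s = \<Phi> V (res F U V x)" using \<Phi>res[OF UV] x by simp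
   also have "\<dots> : \<Phi> V ` hpart (sec F V) k" using FD(3)[OF UV x(1)] by (rule imageI)
   finally show ?thesis by (simp add: \<Phi>h[OF UV(2)])
  qed
  assume "s : sects P U"
  then obtain x where x: "x : sects F U" "s = \<Phi> U x" using \<Phi>sur[OF UV(1)] by blast
  show "res P U V s : sects P V"
   using \<Phi>res[OF UV x(1)] \<Phi>c[OF UV(2) FD(1)[OF UV x(1)]] x by simp
  fix t assume "t : sects P U"
  then obtain y where y: "y : sects F U" "t = \<Phi> U y" using \<Phi>sur[OF UV(1)] by blast
  show "res P U V (s \<oplus>\<^bsub>sec P U\<^esub> t) = res P U V s \<oplus>\<^bsub>sec P V\<^esub> res P U V t"
   unfolding x(2) y(2) \<Phi>add[OF UV(1) x(1) y(1), symmetric] \<Phi>res[OF UV x(1), symmetric] \<Phi>res[OF UV y(1), symmetric]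
    \<Phi>res[OF UV addF[OF UV(1) x(1) y(1)], symmetric] FD(2)[OF UV x(1) y(1)]
   by (rule \<Phi>add[OF UV(2) FD(1)[OF UV x(1)] FD(1)[OF UV y(1)]])
 next
  fix U s assume U: "opn M U" and "s : sects P U"
  then obtain x where x: "x : sects F U" "s = \<Phi> U x" using \<Phi>sur[OF U] by blast
  then show "res P U U s = s" using \<Phi>res[OF U U subset_refl x(1)] FD(4)[OF U x(1)] by simp
 next
  fix U V W s assume "opn M U & opn M V & opn M W & W \<subseteq> V & V \<subseteq> U"
   and s: "s : sects P U"
  then have UVW: "opn M U" "opn M V" "opn M W" "W \<subseteq> V" "V \<subseteq> U" "W \<subseteq> U" by auto
  obtain x where x: "x : sects F U" "s = \<Phi> U x" using \<Phi>sur[OF UVW(1)] s by blast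
  show "res P V W (res P U V s) = res P U W s"
   unfolding x(2) \<Phi>res[OF UVW(1,2,5) x(1), symmetric] \<Phi>res[OF UVW(1,3,6) x(1), symmetric]
    \<Phi>res[OF UVW(2,3,4) FD(1)[OF UVW(1,2,5) x(1)], symmetric] FD(5)[OF UVW(1,2,3,4,5) x(1)] ..
 qed
 note PD = presheafD[OF pP, unfolded bP]
 have addP: "s \<oplus>\<^bsub>sec P U\<^esub> t : sects P U" if U: "opn M U" and st: "s : sects P U" "t : sects P U" for U s t
 proof -
  obtain x y where "x : sects F U" "s = \<Phi> U x" "y : sects F U" "t = \<Phi> U y" using \<Phi>sur[OF U] st by blast
  then show ?thesis using \<Phi>add[OF U] \<Phi>c[OF U addF[OF U]] by metis
 qed
 have smP: "f \<odot>\<^bsub>sec P U\<^esub> s : sects P U" and rsmP: "!!W. opn M W ==> W \<subseteq> U ==>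
   res P U W (f \<odot>\<^bsub>sec P U\<^esub> s) = res M U W f \<odot>\<^bsub>sec P W\<^esub> res P U W s"
  if U: "opn M U" and f: "f : sects M U" and s: "s : sects P U" for U s f
 proof -
  obtain x where x: "x : sects F U" "s = \<Phi> U x" using \<Phi>sur[OF U s] by blast
  show "f \<odot>\<^bsub>sec P U\<^esub> s : sects P U" using \<Phi>sm[OF U f x(1)] \<Phi>c[OF U smF[OF U f x(1)]] x by simp
  fix W assume W: "opn M W" "W \<subseteq> U"
  show "res P U W (f \<odot>\<^bsub>sec P U\<^esub> s) = res M U W f \<odot>\<^bsub>sec P W\<^esub> res P U W s"
   unfolding x(2) \<Phi>sm[OF U f x(1), symmetric] \<Phi>res[OF U W x(1), symmetric] \<Phi>res[OF U W smF[OF U f x(1)], symmetric]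
    ressm[OF U W f x(1)] by (rule \<Phi>sm[OF W(1) resM[OF U W f] FD(1)[OF U W x(1)]])
 qed
 define \<Gamma> where "\<Gamma> U u = (\<lambda>x\<in>U. germ P x U (\<Phi> U u))" for U u
 \<comment> \<open>Equal germs of P come from sections of F that agree near the point, by
   injectivity of \<Phi>.\<close>
 have locP: "\<exists>K. opn M K & z : K & K \<subseteq> U \<inter> W & res F U K u = res F W K v"
  if U: "opn M U" "z : U" "u : sects F U" and W: "opn M W" "z : W" "v : sects F W"
   and eq: "germ P z U (\<Phi> U u) = germ P z W (\<Phi> W v)" for U W u v z
 proof -
  obtain K where K: "opn M K" "z : K" "K \<subseteq> U \<inter> W" "res P U K (\<Phi> U u) = res P W K (\<Phi> W v)"
   using eq germ_eq_iff[OF pP, unfolded bP, OF U(1,2) \<Phi>c[OF U(1,3)] W(1,2) \<Phi>c[OF W(1,3)]] by auto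
  have KU: "K \<subseteq> U" "K \<subseteq> W" using K by auto
  have "\<Phi> K (res F U K u) = \<Phi> K (res F W K v)"
   using K(4) \<Phi>res[OF U(1) K(1) KU(1) U(3)] \<Phi>res[OF W(1) K(1) KU(2) W(3)] by simp
  then have "res F U K u = res F W K v"
   by (rule \<Phi>inj[OF K(1) FD(1)[OF U(1) K(1) KU(1) U(3)] FD(1)[OF W(1) K(1) KU(2) W(3)]])
  then show ?thesis using K by blast
 qed
 have \<Gamma>inj: "u = v" if U: "opn M U" and uv: "u : sects F U" "v : sects F U" and eq: "\<Gamma> U u = \<Gamma> U v" for U u v
 proof (rule sheaf_eqI[OF F, unfolded bF, OF U uv])
  fix x assume x: "x : U"
  have "\<Gamma> U u x = \<Gamma> U v x" using eq by simp
  then have "germ P x U (\<Phi> U u) = germ P x U (\<Phi> U v)" using x by (simp add: \<Gamma>_def)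
  from locP[OF U x uv(1) U x uv(2) this]
  show "\<exists>N. opn M N & x : N & N \<subseteq> U & res F U N u = res F U N v" by auto
 qed
 have \<Gamma>fam: "\<Gamma> U u : germ_families P C U" if "opn M U" "\<Phi> U u : C U" for U u C
  unfolding germ_families_def bP
 proof (intro CollectI conjI ballI)
  show "\<Gamma> U u : extensional U" by (simp add: \<Gamma>_def)
  fix x assume "x : U"
  then show "\<exists>N s. opn M N & x : N & N \<subseteq> U & s : C N & (\<forall>y\<in>N. \<Gamma> U u y = germ P y N s)"
   using that by (intro exI[of _ U] exI[of _ "\<Phi> U u"]) (simp add: \<Gamma>_def)
 qed
 \<comment> \<open>D stands for the full sections or for a homogeneous part, so that surjectivity is
   shown for both at once.\<close>
 have \<Gamma>sur: "\<exists>u\<in>sects F U. \<sigma> = \<Gamma> U u & (\<forall>x\<in>U. \<exists>N. opn M N & x : N & N \<subseteq> U & res F U N u : D N)"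
  if U: "opn M U" and \<sigma>: "\<sigma> : germ_families P (%N. \<Phi> N ` D N) U" and D: "!!N. opn M N ==> D N \<subseteq> sects F N" for U \<sigma> D
 proof -
  have "\<forall>x\<in>U. \<exists>Nu. opn M (fst Nu) & x : fst Nu & fst Nu \<subseteq> U & snd Nu : D (fst Nu) \<and>
    (\<forall>y\<in>fst Nu. \<sigma> y = germ P y (fst Nu) (\<Phi> (fst Nu) (snd Nu)))"
  proof
   fix x assume "x : U"
   then obtain N s where N: "opn M N" "x : N" "N \<subseteq> U" "s : \<Phi> N ` D N" "\<forall>y\<in>N. \<sigma> y = germ P y N s"
    using \<sigma> unfolding germ_families_def bP by blast
   then obtain u where "u : D N" "s = \<Phi> N u" by blast
   then show "\<exists>Nu. opn M (fst Nu) & x : fst Nu & fst Nu \<subseteq> U & snd Nu : D (fst Nu) \<and>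
    (\<forall>y\<in>fst Nu. \<sigma> y = germ P y (fst Nu) (\<Phi> (fst Nu) (snd Nu)))"
    using N by (intro exI[of _ "(N, u)"]) simp
  qed
  from bchoice[OF this] obtain Nu where Nu: "\<forall>x\<in>U. opn M (fst (Nu x)) & x : fst (Nu x) & fst (Nu x) \<subseteq> U \<and>
    snd (Nu x) : D (fst (Nu x)) & (\<forall>y\<in>fst (Nu x). \<sigma> y = germ P y (fst (Nu x)) (\<Phi> (fst (Nu x)) (snd (Nu x))))"
   by (rule exE)
  define N where "N x = fst (Nu x)" for x
  define w where "w x = snd (Nu x)" for x
  have N: "opn M (N x)" "x : N x" "N x \<subseteq> U" "w x : D (N x)" "!!y. y : N x ==> \<sigma> y = germ P y (N x) (\<Phi> (N x) (w x))"
   if "x : U" for x using Nu that by (simp_all add: N_def w_def)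
  have wc: "w x : sects F (N x)" if "x : U" for x using N(4)[OF that] D[OF N(1)[OF that]] by blast
  have UN: "U = (\<Union>x\<in>U. N x)" using N(2,3) by blast
  obtain u where u: "u : sects F U" "!!x. x : U ==> res F U (N x) u = w x"
  proof (rule sheaf_glue[OF F, unfolded bF, OF UN N(1) wc])
   fix x y assume x: "x : U" and y: "y : U"
   let ?I = "N x \<inter> N y"
   have I: "opn M ?I" using N(1)[OF x] N(1)[OF y] by (rule openin_Int)
   show "res F (N x) ?I (w x) = res F (N y) ?I (w y)"
   proof (rule sheaf_eqI[OF F, unfolded bF, OF I FD(1)[OF N(1)[OF x] I Int_lower1 wc[OF x]] FD(1)[OF N(1)[OF y] I Int_lower2 wc[OF y]]])
    fix z assume z: "z : ?I"
    then have zz: "z : N x" "z : N y" by auto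
    have "germ P z (N x) (\<Phi> (N x) (w x)) = germ P z (N y) (\<Phi> (N y) (w y))"
     using N(5)[OF x zz(1)] N(5)[OF y zz(2)] by simp
    from locP[OF N(1)[OF x] zz(1) wc[OF x] N(1)[OF y] zz(2) wc[OF y] this]
    obtain K where K: "opn M K" "z : K" "K \<subseteq> ?I" "res F (N x) K (w x) = res F (N y) K (w y)" by blast
    then show "\<exists>K. opn M K & z : K & K \<subseteq> ?I & res F ?I K (res F (N x) ?I (w x)) = res F ?I K (res F (N y) ?I (w y))"
     using FD(5)[OF N(1)[OF x] I K(1,3) Int_lower1 wc[OF x]] FD(5)[OF N(1)[OF y] I K(1,3) Int_lower2 wc[OF y]]
     by (intro exI[of _ K]) simp
   qed
  qed (assumption | rule that)+
  have "\<sigma> = \<Gamma> U u"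
  proof
   fix x
   show "\<sigma> x = \<Gamma> U u x"
   proof (cases "x : U")
    case True
    have "germ P x U (\<Phi> U u) = germ P x (N x) (res P U (N x) (\<Phi> U u))"
     using germ_res[OF pP, unfolded bP, OF U \<Phi>c[OF U u(1)] N(1)[OF True] N(3)[OF True] N(2)[OF True]] .
    also have "res P U (N x) (\<Phi> U u) = \<Phi> (N x) (w x)"
     using \<Phi>res[OF U N(1)[OF True] N(3)[OF True] u(1)] u(2)[OF True] by simp
    finally show ?thesis using N(5)[OF True N(2)[OF True]] True by (simp add: \<Gamma>_def)
   next
    case False
    then show ?thesis using \<sigma> by (simp add: germ_families_def \<Gamma>_def extensional_def)
   qed
  qed
  moreover have "\<exists>K. opn M K & x : K & K \<subseteq> U & res F U K u : D K" if "x : U" for x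
   using N[OF that] u(2)[OF that] by (intro exI[of _ "N x"]) simp
  ultimately show ?thesis using u(1) by blast
 qed
 have famc: "germ_families P (%N. sects P N) U = germ_families P (%N. \<Phi> N ` sects F N) U" for U
  using bij_betw_imp_surj_on[OF bij] unfolding germ_families_def bP by (intro Collect_cong conj_cong refl ball_cong ex_cong1) auto
 have famh: "germ_families P (%N. hpart (sec P N) k) U = germ_families P (%N. \<Phi> N ` hpart (sec F N) k) U" for U k
  using \<Phi>h unfolding germ_families_def bP by (intro Collect_cong conj_cong refl ball_cong ex_cong1) auto
 show ?thesis
  unfolding module_sheaf_iso_iff
 proof (intro exI[of _ \<Gamma>] iso_mapI, unfold sheafify_simps)
  fix U assume U: "opn M U"
  show "bij_betw (\<Gamma> U) (sects F U) (germ_families P (%N. sects P N) U)"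
  proof (rule bij_betw_imageI)
   show "inj_on (\<Gamma> U) (sects F U)" using \<Gamma>inj[OF U] by (rule inj_onI)
   show "\<Gamma> U ` sects F U = germ_families P (%N. sects P N) U"
   proof
    show "\<Gamma> U ` sects F U \<subseteq> germ_families P (%N. sects P N) U"
     by (rule image_subsetI, rule \<Gamma>fam[OF U], rule \<Phi>c[OF U])
    show "germ_families P (%N. sects P N) U \<subseteq> \<Gamma> U ` sects F U"
     unfolding famc using \<Gamma>sur[OF U, of _ "%N. sects F N"] by blast
   qed
  qed
  show "\<Gamma> U ` hpart (sec F U) k = germ_families P (%N. hpart (sec P N) k) U" for k
  proof
   show "\<Gamma> U ` hpart (sec F U) k \<subseteq> germ_families P (%N. hpart (sec P N) k) U"
    by (rule image_subsetI, rule \<Gamma>fam[OF U]) (simp add: \<Phi>h[OF U, symmetric])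
   show "germ_families P (%N. hpart (sec P N) k) U \<subseteq> \<Gamma> U ` hpart (sec F U) k"
   proof
    fix \<sigma> assume "\<sigma> : germ_families P (%N. hpart (sec P N) k) U"
    then obtain u where u: "u : sects F U" "\<sigma> = \<Gamma> U u"
     "\<forall>x\<in>U. \<exists>N. opn M N & x : N & N \<subseteq> U & res F U N u : hpart (sec F N) k"
     using \<Gamma>sur[OF U, of \<sigma> "%N. hpart (sec F N) k"] hF unfolding famh by blast
    have "u : hpart (sec F U) k"
     by (rule sheaf_hpartI[OF F, unfolded bF, OF U u(1)]) (use u(3) in blast)
    then show "\<sigma> : \<Gamma> U ` hpart (sec F U) k" using u(2) by blast
   qed
  qed
  fix u assume u: "u : sects F U"
  show "\<Gamma> U (u \<oplus>\<^bsub>sec F U\<^esub> v) = (\<lambda>x\<in>U. \<Gamma> U u x \<oplus>\<^bsub>stalk P x\<^esub> \<Gamma> U v x)" if v: "v : sects F U" for v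
   unfolding \<Gamma>_def
  proof (rule restrict_ext)
   fix x assume x: "x : U"
   have "germ P x U (\<Phi> U u) \<oplus>\<^bsub>stalk P x\<^esub> germ P x U (\<Phi> U v) = germ P x U (\<Phi> U u \<oplus>\<^bsub>sec P U\<^esub> \<Phi> U v)"
    unfolding stalk_simps
    by (rule germ_op_germ[OF pP, unfolded bP]) (use addP PD(2) U x u v \<Phi>c[OF U] in \<open>simp_all\<close>)
   then show "germ P x U (\<Phi> U (u \<oplus>\<^bsub>sec F U\<^esub> v)) = (\<lambda>x\<in>U. germ P x U (\<Phi> U u)) x \<oplus>\<^bsub>stalk P x\<^esub> (\<lambda>x\<in>U. germ P x U (\<Phi> U v)) x"
    using x \<Phi>add[OF U u v] by simp
  qed
  show "\<Gamma> U (f \<odot>\<^bsub>sec F U\<^esub> u) = (\<lambda>x\<in>U. germ_smult M P x U f (\<Gamma> U u x))" if f: "f : sects M U" for f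
   unfolding \<Gamma>_def
  proof (rule restrict_ext)
   fix x assume x: "x : U"
   \<comment> \<open>\<open>germ_smult\<close> acts on a representative chosen by
     \<open>SOME\<close>; it agrees with the given one on N, which suffices.\<close>
   obtain W s N where W: "(SOME r. r : germ P x U (\<Phi> U u)) = (W, s)" "opn M W" "x : W" "s : sects P W"
    "opn M N" "x : N" "N \<subseteq> U \<inter> W" "res P U N (\<Phi> U u) = res P W N s"
    using germ_rep[of P U x "\<Phi> U u", unfolded bP, OF U x \<Phi>c[OF U u]] .
   let ?I = "U \<inter> W"
   have I: "opn M ?I" "x : ?I" using U W x by auto
   have fI: "res M U ?I f : sects M ?I" by (rule resM[OF U I(1) Int_lower1 f])
   have sI: "res P W ?I s : sects P ?I" by (rule PD(1)[OF W(2) I(1) Int_lower2 W(4)])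
   have NU: "N \<subseteq> U" "N \<subseteq> W" using W by auto
   have "germ P x ?I (res M U ?I f \<odot>\<^bsub>sec P ?I\<^esub> res P W ?I s) = germ P x U (f \<odot>\<^bsub>sec P U\<^esub> \<Phi> U u)"
   proof (subst germ_eq_iff[OF pP, unfolded bP, OF I smP[OF I(1) fI sI] U x smP[OF U f \<Phi>c[OF U u]]], intro exI[of _ N] conjI W(5,6))
    show "N \<subseteq> ?I \<inter> U" using W by auto
    show "res P ?I N (res M U ?I f \<odot>\<^bsub>sec P ?I\<^esub> res P W ?I s) = res P U N (f \<odot>\<^bsub>sec P U\<^esub> \<Phi> U u)"
     unfolding rsmP[OF I(1) fI sI W(5,7)] rsmP[OF U f \<Phi>c[OF U u] W(5) NU(1)]
      resMM[OF U I(1) W(5,7) Int_lower1 f] PD(5)[OF W(2) I(1) W(5,7) Int_lower2 W(4)] W(8) ..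
   qed
   then show "germ P x U (\<Phi> U (f \<odot>\<^bsub>sec F U\<^esub> u)) = germ_smult M P x U f ((\<lambda>x\<in>U. germ P x U (\<Phi> U u)) x)"
    using x \<Phi>sm[OF U f u] by (simp add: germ_smult_def W(1))
  qed
  fix W assume W: "opn M W" "W \<subseteq> U"
  show "\<Gamma> W (res F U W u) = restrict (\<Gamma> U u) W"
   unfolding \<Gamma>_def
  proof (rule restrict_ext)
   fix x assume x: "x : W"
   then have "x : U" using W by blast
   then show "germ P x W (\<Phi> W (res F U W u)) = (\<lambda>x\<in>U. germ P x U (\<Phi> U u)) x"
    using germ_res[OF pP, unfolded bP, OF U \<Phi>c[OF U u] W x] \<Phi>res[OF U W u] by simp
  qed
 qed
qed

section \<open>Tensor products with free modules\<close>

text \<open>Closure under differences covers inverses and products, as -h = 0 - h and x + y = x - (0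
  - y).\<close>

lemma generate_frag_induct:
 assumes x: "x : generate (free_Abelian_group S) K" and K: "K \<subseteq> carrier (free_Abelian_group S)"
  and P: "P 0" "!!s. s : K ==> P s" "!!x y. P x ==> P y ==> P (x - y)"
 shows "P x"
 using x
proof (induct rule: generate.induct)
 case (inv h)
 then have "Poly_Mapping.keys h \<subseteq> S" using subsetD[OF K inv] by simp
 then show ?case using P(3)[OF P(1) P(2)[OF inv]] by simp
next
 case (eng x y)
 then show ?case using P(3)[OF eng(2) P(3)[OF P(1) eng(4)]] by simp
qed (use P in simp_all)

lemma frag_diff_closed:
 "x : carrier (free_Abelian_group S) ==> y : carrier (free_Abelian_group S) ==> x - y : carrier (free_Abelian_group S)"
 using keys_diff[of x y] by auto

lemma tensor_relations_carrier:
 assumes "ring A" "abelian_group B" "!!a r. a : carrier A ==> r : R ==> act a r : carrier A"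
  "!!r y. r : R ==> y : carrier B ==> r \<odot>\<^bsub>B\<^esub> y : carrier B"
 shows "tensor_relations A B R act \<subseteq> carrier (free_Abelian_group (carrier A \<times> carrier B))"
proof -
 interpret A: ring A by fact
 interpret B: abelian_group B by fact
 show ?thesis
  unfolding tensor_relations_def
  by (intro subsetI, elim UnE CollectE exE conjE; hypsubst; intro frag_diff_closed; simp add: assms)
qed

text \<open>B is free over R with basis b and coordinate functions c. As R is a bare set, the
  linearity of c is stated after acting on elements of A.\<close>

locale tensor_basis =
 fixes A :: "('q, 'a) graded" and B :: "('r, 'b) graded" and R :: "'r set" and act :: "'a => 'r => 'a"
  and n :: nat and b :: "nat => 'b" and c :: "nat => 'b => 'r" and ds :: "nat => int"
 assumes A: "ring A" and B: "abelian_group B"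
  and act_closed: "a : carrier A ==> r : R ==> act a r : carrier A"
  and act_add: "a : carrier A ==> a' : carrier A ==> r : R ==> act (a \<oplus>\<^bsub>A\<^esub> a') r = act a r \<oplus>\<^bsub>A\<^esub> act a' r"
  and act_mult: "f : carrier A ==> a : carrier A ==> r : R ==> act (f \<otimes>\<^bsub>A\<^esub> a) r = f \<otimes>\<^bsub>A\<^esub> act a r"
  and smult_closed: "r : R ==> y : carrier B ==> r \<odot>\<^bsub>B\<^esub> y : carrier B"
  and b: "i < n ==> b i : carrier B"
  and c: "i < n ==> y : carrier B ==> c i y : R"
  and expand: "y : carrier B ==> y = (\<Oplus>\<^bsub>B\<^esub>i\<in>{..<n}. c i y \<odot>\<^bsub>B\<^esub> b i)"
  and c_add: "i < n ==> a : carrier A ==> y : carrier B ==> z : carrier B ==>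
   act a (c i (y \<oplus>\<^bsub>B\<^esub> z)) = act a (c i y) \<oplus>\<^bsub>A\<^esub> act a (c i z)"
  and c_smult: "i < n ==> a : carrier A ==> r : R ==> y : carrier B ==>
   act a (c i (r \<odot>\<^bsub>B\<^esub> y)) = act (act a r) (c i y)"
  and c_b: "i < n ==> j < n ==> a : carrier A ==> act a (c i (b j)) = (if i = j then a else \<zero>\<^bsub>A\<^esub>)"
  and hA: "additive_subgroup (hpart A k) A" and hB: "hpart B k \<subseteq> carrier B"
  and b_hpart: "i < n ==> b i : hpart B (ds i)"
  and c_hpart: "i < n ==> a : hpart A k ==> y : hpart B l ==> act a (c i y) : hpart A (k + l - ds i)"
begin

abbreviation F where "F \<equiv> free_Abelian_group (carrier A \<times> carrier B)"
abbreviation N where "N \<equiv> tensor_null A B R act"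

sublocale A: ring A by (rule A)
sublocale B: abelian_group B by (rule B)

definition \<sigma> :: "(nat => 'a) => 'a \<times> 'b \<Rightarrow>\<^sub>0 int" where
 "\<sigma> u = (\<Sum>i<n. frag_of (u i, b i))"

text \<open>The i-th coordinate of a tensor: the homomorphism that sends a \<otimes> y to a c_i(y).
  It exists by the universal property of the free group, and \<open>T_N\<close> shows that it kills
  the relations.\<close>

definition T :: "nat => ('a \<times> 'b \<Rightarrow>\<^sub>0 int) => 'a" where
 "T i = (SOME h. h : hom F (add_monoid A) \<and>
   (\<forall>a\<in>carrier A. \<forall>y\<in>carrier B. h (frag_of (a, y)) = act a (c i y)))"

lemma hA_carrier: "a : hpart A k ==> a : carrier A"
 using additive_subgroup.a_subset[OF hA] by blast

lemma N_subgroup: "subgroup N F"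
 unfolding tensor_null_def
 by (intro group.generate_is_subgroup group_free_Abelian_group tensor_relations_carrier A B act_closed smult_closed)

lemma N_closed: "0 : N" "x : N ==> y : N ==> x + y : N" "x : N ==> - x : N" "x : N ==> y : N ==> x - y : N"
proof -
 show 0: "0 : N" using subgroup.one_closed[OF N_subgroup] by simp
 show p: "x + y : N" if "x : N" "y : N" for x y using subgroup.m_closed[OF N_subgroup that] by simp
 show m: "- x : N" if x: "x : N" for x
 proof -
  have "Poly_Mapping.keys x \<subseteq> carrier A \<times> carrier B" using subsetD[OF subgroup.subset[OF N_subgroup] x] by simp
  then show ?thesis using subgroup.m_inv_closed[OF N_subgroup x] by simp
 qed
 show "x - y : N" if "x : N" "y : N" using p[OF that(1) m[OF that(2)]] by simp
qed

lemma N_sum: "(!!i. i : I ==> f i : N) ==> sum f I : N"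
 by (induction I rule: infinite_finite_induct) (auto intro: N_closed)

lemma N_rel:
 assumes "a : carrier A" "y : carrier B"
 shows "a' : carrier A ==> frag_of (a \<oplus>\<^bsub>A\<^esub> a', y) - frag_of (a, y) - frag_of (a', y) : N"
  "z : carrier B ==> frag_of (a, y \<oplus>\<^bsub>B\<^esub> z) - frag_of (a, y) - frag_of (a, z) : N"
  "r : R ==> frag_of (act a r, y) - frag_of (a, r \<odot>\<^bsub>B\<^esub> y) : N"
 unfolding tensor_null_def tensor_relations_def
 by (rule generate.incl, rule UnI1, rule UnI1, use assms in blast)
  (rule generate.incl, rule UnI1, rule UnI2, use assms in blast,
   rule generate.incl, rule UnI2, use assms in blast)

lemma N_induct:
 assumes "x : N" "P 0" "!!x y. P x ==> P y ==> P (x - y)"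
  and "!!a a' y. a : carrier A ==> a' : carrier A ==> y : carrier B ==> P (frag_of (a \<oplus>\<^bsub>A\<^esub> a', y) - frag_of (a, y) - frag_of (a', y))"
  and "!!a y z. a : carrier A ==> y : carrier B ==> z : carrier B ==> P (frag_of (a, y \<oplus>\<^bsub>B\<^esub> z) - frag_of (a, y) - frag_of (a, z))"
  and "!!a r y. a : carrier A ==> r : R ==> y : carrier B ==> P (frag_of (act a r, y) - frag_of (a, r \<odot>\<^bsub>B\<^esub> y))"
 shows "P x"
proof (rule generate_frag_induct[OF assms(1)[unfolded tensor_null_def] tensor_relations_carrier[OF A B act_closed smult_closed] assms(2) _ assms(3)])
 fix s assume "s : tensor_relations A B R act"
 then show "P s" unfolding tensor_relations_def using assms(4-6) by auto
qed

lemma T_hom: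
 assumes i: "i < n"
 shows "T i : hom F (add_monoid A)" "a : carrier A ==> y : carrier B ==> T i (frag_of (a, y)) = act a (c i y)"
proof -
 have "(%(a, y). act a (c i y)) ` (carrier A \<times> carrier B) \<subseteq> carrier (add_monoid A)"
  using act_closed c[OF i] by auto
 from comm_group.free_Abelian_group_universal[OF A.a_comm_group this]
 obtain h where "h : hom F (add_monoid A)"
  "!!x. x : carrier A \<times> carrier B ==> h (frag_of x) = (case x of (a, y) => act a (c i y))" by blast
 then have "\<exists>h. h : hom F (add_monoid A) & (\<forall>a\<in>carrier A. \<forall>y\<in>carrier B. h (frag_of (a, y)) = act a (c i y))"
  by (intro exI[of _ h]) simp
 from someI_ex[OF this]
 have *: "T i : hom F (add_monoid A) & (\<forall>a\<in>carrier A. \<forall>y\<in>carrier B. T i (frag_of (a, y)) = act a (c i y))"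
  unfolding T_def .
 show "T i : hom F (add_monoid A)" "a : carrier A ==> y : carrier B ==> T i (frag_of (a, y)) = act a (c i y)"
  using * by simp_all
qed

lemma T_closed: "i < n ==> x : carrier F ==> T i x : carrier A"
 using T_hom(1)[of i] by (auto simp: hom_def)

lemma T_add: "i < n ==> x : carrier F ==> y : carrier F ==> T i (x + y) = T i x \<oplus>\<^bsub>A\<^esub> T i y"
 using hom_mult[OF T_hom(1), of i x y] by simp

lemma T_zero: "i < n ==> T i 0 = \<zero>\<^bsub>A\<^esub>"
 using T_add[of i 0 0] T_closed[of i 0] A.add.l_cancel_one[of "T i 0" "T i 0"] by simp

lemma T_diff:
 assumes "i < n" "x : carrier F" "y : carrier F"
 shows "T i (x - y) = T i x \<ominus>\<^bsub>A\<^esub> T i y"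
proof -
 have "T i (x - y) \<oplus>\<^bsub>A\<^esub> T i y = T i x" using T_add[OF assms(1) frag_diff_closed[OF assms(2,3)] assms(3)] by simp
 moreover have "T i (x - y) : carrier A" "T i x : carrier A" "T i y : carrier A"
  using assms frag_diff_closed T_closed by blast+
 ultimately show ?thesis by (metis A.minus_eq A.add.inv_solve_right)
qed

lemma frag_F: "a : carrier A ==> y : carrier B ==> frag_of (a, y) : carrier F"
 by simp

lemma \<sigma>_F: "(!!i. i < n ==> u i : carrier A) ==> \<sigma> u : carrier F"
 unfolding \<sigma>_def by (intro sum_closed_free_Abelian_group frag_F b) auto

lemma T_N:
 assumes i: "i < n" and x: "x : N"
 shows "T i x = \<zero>\<^bsub>A\<^esub>"
proof -
 note Tf = T_hom(2)[OF i] and Td = T_diff[OF i] and fd = frag_diff_closed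
 have *: "p \<oplus>\<^bsub>A\<^esub> (q \<oplus>\<^bsub>A\<^esub> (\<ominus>\<^bsub>A\<^esub> p \<oplus>\<^bsub>A\<^esub> \<ominus>\<^bsub>A\<^esub> q)) = \<zero>\<^bsub>A\<^esub>" if "p : carrier A" "q : carrier A" for p q
  using that by algebra
 have **: "0 : carrier F" by simp
 \<comment> \<open>Membership in the carrier is part of the induction because T is known to respect
   differences only there.\<close>
 have "x : carrier F & T i x = \<zero>\<^bsub>A\<^esub>"
  by (rule N_induct[OF x])
   (simp_all del: carrier_free_Abelian_group_iff add: T_zero[OF i] Td fd frag_F Tf act_closed act_add c[OF i] smult_closed
    c_add[OF i] c_smult[OF i] A.minus_eq A.minus_add A.a_ac A.r_neg * **)
 then show ?thesis ..
qed

lemma T_\<sigma>: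
 assumes i: "i < n" and u: "!!i. i < n ==> u i : carrier A"
 shows "T i (\<sigma> u) = u i"
proof -
 have "T i (\<Sum>j\<in>J. frag_of (u j, b j)) = (if i : J then u i else \<zero>\<^bsub>A\<^esub>)" if "finite J" "J \<subseteq> {..<n}" for J
  using that
 proof (induction J)
  case (insert j J)
  have "(\<Sum>j\<in>J. frag_of (u j, b j)) : carrier F"
   using insert(4) by (intro sum_closed_free_Abelian_group frag_F b u) auto
  then show ?case
   using insert i u b by (auto simp: T_add[OF i frag_F] T_hom(2)[OF i] c_b)
 qed (simp add: T_zero i)
 from this[of "{..<n}"] show ?thesis using i by (simp add: \<sigma>_def)
qed

lemma frag_minus_N:
 assumes "a : carrier A" "a' : carrier A" "y : carrier B"
 shows "(frag_of (a, y) - frag_of (a', y)) - frag_of (a \<ominus>\<^bsub>A\<^esub> a', y) : N"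
proof -
 have "a \<ominus>\<^bsub>A\<^esub> a' \<oplus>\<^bsub>A\<^esub> a' = a" using assms by algebra
 with N_rel(1)[of "a \<ominus>\<^bsub>A\<^esub> a'" y a'] show ?thesis using assms by (simp add: algebra_simps)
qed

text \<open>Expand y in the basis and move the scalars across the tensor sign.\<close>

lemma frag_expand_N:
 assumes a: "a : carrier A" and y: "y : carrier B"
 shows "frag_of (a, y) - \<sigma> (%i. act a (c i y)) : N"
proof -
 have cb: "c i y \<odot>\<^bsub>B\<^esub> b i : carrier B" if "i < n" for i by (intro smult_closed c b y that)
 have "frag_of (a, \<Oplus>\<^bsub>B\<^esub>i\<in>J. c i y \<odot>\<^bsub>B\<^esub> b i) - (\<Sum>i\<in>J. frag_of (act a (c i y), b i)) : N"
  if "finite J" "J \<subseteq> {..<n}" for J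
  using that
 proof (induction J)
  case empty
  \<comment> \<open>The relation for 0 + 0 reads a \<otimes> 0 - a \<otimes> 0 - a \<otimes> 0,
    which is -(a \<otimes> 0).\<close>
  show ?case using N_closed(3)[OF N_rel(2)[OF a B.zero_closed B.zero_closed]] by simp
 next
  case (insert j J)
  let ?s = "\<Oplus>\<^bsub>B\<^esub>i\<in>J. c i y \<odot>\<^bsub>B\<^esub> b i"
  have j: "j < n" and s: "?s : carrier B" and f: "(%i. c i y \<odot>\<^bsub>B\<^esub> b i) : J \<rightarrow> carrier B"
   using insert(4) cb by (auto intro!: B.finsum_closed)
  note 1 = N_rel(2)[OF a cb[OF j] s] and 2 = N_rel(3)[OF a b[OF j] c[OF j y]]
  have "frag_of (a, c j y \<odot>\<^bsub>B\<^esub> b j \<oplus>\<^bsub>B\<^esub> ?s) - (frag_of (act a (c j y), b j) + (\<Sum>i\<in>J. frag_of (act a (c i y), b i))) : N"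
   using N_closed(2)[OF N_closed(4)[OF 1 2] insert(3)] insert(4) by (simp add: algebra_simps)
  then show ?case using insert B.finsum_insert[OF insert(1,2) f cb[OF j]] by simp
 qed
 from this[of "{..<n}"] show ?thesis using expand[OF y] by (simp add: \<sigma>_def)
qed

lemma \<sigma>_add_N:
 assumes "!!i. i < n ==> u i : carrier A" "!!i. i < n ==> v i : carrier A"
  and "!!i. i < n ==> w i = u i \<oplus>\<^bsub>A\<^esub> v i"
 shows "\<sigma> w - (\<sigma> u + \<sigma> v) : N"
proof -
 have "(\<Sum>i<n. frag_of (w i, b i) - frag_of (u i, b i) - frag_of (v i, b i)) : N"
  by (rule N_sum) (simp add: assms N_rel(1) b)
 then show ?thesis by (simp add: \<sigma>_def sum_subtractf sum.distrib algebra_simps)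
qed

text \<open>Holds on generators and is stable under differences. With \<open>T_\<sigma>\<close> and
  \<open>T_N\<close> it makes T the inverse of \<sigma> modulo the relations.\<close>

lemma reduce_N:
 assumes "x : carrier F"
 shows "x - \<sigma> (%i. T i x) : N"
proof -
 note F = carrier_free_Abelian_group_iff
 show ?thesis
 proof (rule free_Abelian_group_induct[OF assms[unfolded F]])
  have "(\<Sum>i<n. frag_of (\<zero>\<^bsub>A\<^esub>, b i)) : N"
   by (rule N_sum) (use N_closed(3)[OF N_rel(1)[OF A.zero_closed b A.zero_closed]] in simp)
  moreover have "\<sigma> (%i. T i 0) = (\<Sum>i<n. frag_of (\<zero>\<^bsub>A\<^esub>, b i))" unfolding \<sigma>_def by (intro sum.cong) (simp_all add: T_zero)
  ultimately show "0 - \<sigma> (%i. T i 0) : N" using N_closed(3) by simp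
 next
  fix x assume x: "x : carrier A \<times> carrier B"
  have "\<sigma> (%i. T i (frag_of x)) = \<sigma> (%i. act (fst x) (c i (snd x)))"
   unfolding \<sigma>_def by (intro sum.cong) (use x in \<open>auto simp: T_hom(2)\<close>)
  then show "frag_of x - \<sigma> (%i. T i (frag_of x)) : N"
   using frag_expand_N[of "fst x" "snd x"] x by auto
 next
  fix x y assume k: "Poly_Mapping.keys x \<subseteq> carrier A \<times> carrier B" "Poly_Mapping.keys y \<subseteq> carrier A \<times> carrier B"
   and x: "x - \<sigma> (%i. T i x) : N" and y: "y - \<sigma> (%i. T i y) : N"
  note xy = k[folded F]
  have "(\<Sum>i<n. frag_of (T i x, b i) - frag_of (T i y, b i) - frag_of (T i x \<ominus>\<^bsub>A\<^esub> T i y, b i)) : N"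
   by (rule N_sum) (use xy in \<open>simp add: frag_minus_N b T_closed del: carrier_free_Abelian_group_iff\<close>)
  moreover have "\<sigma> (%i. T i (x - y)) = (\<Sum>i<n. frag_of (T i x \<ominus>\<^bsub>A\<^esub> T i y, b i))"
   unfolding \<sigma>_def by (intro sum.cong) (use xy in \<open>simp_all add: T_diff del: carrier_free_Abelian_group_iff\<close>)
  ultimately have "\<sigma> (%i. T i x) - \<sigma> (%i. T i y) - \<sigma> (%i. T i (x - y)) : N"
   by (simp add: \<sigma>_def sum_subtractf)
  from N_closed(2)[OF N_closed(4)[OF x y] this]
  show "x - y - \<sigma> (%i. T i (x - y)) : N" by (simp add: algebra_simps)
 qed
qed

lemma coset_eq_iff: "N #>\<^bsub>F\<^esub> x = N #>\<^bsub>F\<^esub> y \<longleftrightarrow> x - y : N"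
proof
 assume eq: "N #>\<^bsub>F\<^esub> x = N #>\<^bsub>F\<^esub> y"
 have "0 + x : N #>\<^bsub>F\<^esub> x" using N_closed(1) by (auto simp: r_coset_def)
 then obtain h where "h : N" "0 + x = h + y" unfolding eq by (auto simp: r_coset_def)
 then show "x - y : N" by simp
next
 have sub: "N #>\<^bsub>F\<^esub> x \<subseteq> N #>\<^bsub>F\<^esub> y" if "x - y : N" for x y
 proof
  fix z assume "z : N #>\<^bsub>F\<^esub> x"
  then obtain h where h: "h : N" "z = h + x" by (auto simp: r_coset_def)
  then have "z = (h + (x - y)) + y" by simp
  then show "z : N #>\<^bsub>F\<^esub> y" using N_closed(2)[OF h(1) that] unfolding r_coset_def mult_free_Abelian_group by blast
 qed
 assume "x - y : N"
 moreover from N_closed(3)[OF this] have "y - x : N" by simp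
 ultimately show "N #>\<^bsub>F\<^esub> x = N #>\<^bsub>F\<^esub> y" using sub by blast
qed

abbreviation P where "P \<equiv> tensor A B R act"

lemma tensor_carrier: "carrier P = (%x. N #>\<^bsub>F\<^esub> x) ` carrier F"
 by (auto simp: tensor_def Let_def FactGroup_def RCOSETS_def)

lemma tensor_add:
 "(N #>\<^bsub>F\<^esub> x) \<oplus>\<^bsub>P\<^esub> (N #>\<^bsub>F\<^esub> y) = N #>\<^bsub>F\<^esub> (x + y)"
proof -
 have "(N #>\<^bsub>F\<^esub> x) <#>\<^bsub>F\<^esub> (N #>\<^bsub>F\<^esub> y) = N #>\<^bsub>F\<^esub> (x + y)"
 proof (intro equalityI subsetI)
  fix z assume "z : (N #>\<^bsub>F\<^esub> x) <#>\<^bsub>F\<^esub> (N #>\<^bsub>F\<^esub> y)"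
  then obtain h k where "h : N" "k : N" "z = (h + x) + (k + y)" by (auto simp: r_coset_def set_mult_def)
  then show "z : N #>\<^bsub>F\<^esub> (x + y)"
   using N_closed(2)[of h k] by (auto simp: r_coset_def algebra_simps intro!: bexI[of _ "h + k"])
 next
  fix z assume "z : N #>\<^bsub>F\<^esub> (x + y)"
  then obtain h where "h : N" "z = (h + x) + (0 + y)" by (auto simp: r_coset_def algebra_simps)
  then show "z : (N #>\<^bsub>F\<^esub> x) <#>\<^bsub>F\<^esub> (N #>\<^bsub>F\<^esub> y)" unfolding r_coset_def set_mult_def mult_free_Abelian_group using N_closed(1) by blast
 qed
 then show ?thesis by (simp add: tensor_def Let_def FactGroup_def)
qed

lemma \<sigma>_cong: "(!!i. i < n ==> u i = v i) ==> \<sigma> u = \<sigma> v"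
 by (simp add: \<sigma>_def)

lemma tensor_bij:
 "bij_betw (%u. N #>\<^bsub>F\<^esub> \<sigma> u) (\<Pi>\<^sub>E i\<in>{..<n}. carrier A) (carrier P)"
proof (rule bij_betw_imageI[OF inj_onI])
 fix u v assume u: "u : (\<Pi>\<^sub>E i\<in>{..<n}. carrier A)" and v: "v : (\<Pi>\<^sub>E i\<in>{..<n}. carrier A)" and eq: "N #>\<^bsub>F\<^esub> \<sigma> u = N #>\<^bsub>F\<^esub> \<sigma> v"
 have uv: "u i : carrier A" "v i : carrier A" if "i < n" for i using u v that by (auto simp: PiE_iff)
 have "\<sigma> u - \<sigma> v : N" using eq by (simp add: coset_eq_iff)
 then have "u i \<ominus>\<^bsub>A\<^esub> v i = \<zero>\<^bsub>A\<^esub>" if "i < n" for i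
  using T_N[OF that] T_diff[OF that \<sigma>_F \<sigma>_F, of u v] T_\<sigma>[OF that, of u] T_\<sigma>[OF that, of v] uv by simp
 moreover have "u i = (u i \<ominus>\<^bsub>A\<^esub> v i) \<oplus>\<^bsub>A\<^esub> v i" if "i < n" for i using uv[OF that] by algebra
 ultimately have "u i = v i" if "i < n" for i using uv[OF that] that by simp
 then show "u = v" by (intro PiE_ext[OF u v]) simp
next
 show "(%u. N #>\<^bsub>F\<^esub> \<sigma> u) ` (\<Pi>\<^sub>E i\<in>{..<n}. carrier A) = carrier P"
  unfolding tensor_carrier
 proof (intro equalityI subsetI; elim imageE)
  fix z x assume z: "z = N #>\<^bsub>F\<^esub> x" and x: "x : carrier F"
  have "N #>\<^bsub>F\<^esub> x = N #>\<^bsub>F\<^esub> \<sigma> (\<lambda>i\<in>{..<n}. T i x)"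
   unfolding coset_eq_iff using reduce_N[OF x] \<sigma>_cong[of "\<lambda>i\<in>{..<n}. T i x" "%i. T i x"] by simp
  moreover have "(\<lambda>i\<in>{..<n}. T i x) : (\<Pi>\<^sub>E i\<in>{..<n}. carrier A)" using T_closed[OF _ x] by simp
  ultimately show "z : (%u. N #>\<^bsub>F\<^esub> \<sigma> u) ` (\<Pi>\<^sub>E i\<in>{..<n}. carrier A)" unfolding z by (rule image_eqI)
 next
  fix z u assume "z = N #>\<^bsub>F\<^esub> \<sigma> u" "u : (\<Pi>\<^sub>E i\<in>{..<n}. carrier A)"
  then show "z : (%x. N #>\<^bsub>F\<^esub> x) ` carrier F" using \<sigma>_F[of u] by (auto simp: PiE_iff)
 qed
qed

text \<open>The part of degree k is generated by tensors of homogeneous elements, whose coordinates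
  have degree \<open>k - ds i\<close> by \<open>c_hpart\<close>; so the coordinates detect the
  grading.\<close>

lemma tensor_hpart:
 "(%u. N #>\<^bsub>F\<^esub> \<sigma> u) ` (\<Pi>\<^sub>E i\<in>{..<n}. hpart A (k - ds i)) = hpart P k"
proof -
 let ?G = "{frag_of (a, y) | a y. \<exists>i. a : hpart A i & y : hpart B (k - i)}"
 have G: "?G \<subseteq> carrier F" using hA_carrier hB by (auto simp del: carrier_free_Abelian_group_iff intro!: frag_F)
 have sg: "subgroup (generate F ?G) F" by (rule group.generate_is_subgroup[OF group_free_Abelian_group G])
 have hP: "hpart P k = (%x. N #>\<^bsub>F\<^esub> x) ` generate F ?G" by (simp add: tensor_def Let_def)
 show ?thesis
  unfolding hP
 proof (intro equalityI subsetI; elim imageE)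
  fix z u assume z: "z = N #>\<^bsub>F\<^esub> \<sigma> u" and u: "u : (\<Pi>\<^sub>E i\<in>{..<n}. hpart A (k - ds i))"
  have "(\<Sum>i\<in>J. frag_of (u i, b i)) : generate F ?G" if "finite J" "J \<subseteq> {..<n}" for J
   using that
  proof (induction J)
   case empty
   show ?case using subgroup.one_closed[OF sg] by simp
  next
   case (insert j J)
   have "u j : hpart A (k - ds j)" "b j : hpart B (k - (k - ds j))"
    using insert(4) PiE_mem[OF u, of j] b_hpart[of j] by auto
   then have "frag_of (u j, b j) : generate F ?G" by (intro generate.incl) blast
   then show ?case using subgroup.m_closed[OF sg] insert by simp
  qed
  then have "\<sigma> u : generate F ?G" unfolding \<sigma>_def by simp
  then show "z : (%x. N #>\<^bsub>F\<^esub> x) ` generate F ?G" using z by blast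
 next
  fix z x assume z: "z = N #>\<^bsub>F\<^esub> x" and x: "x : generate F ?G"
  have xF: "x : carrier F" using subgroup.subset[OF sg] x by blast
  have Th: "T i x : hpart A (k - ds i)" if i: "i < n" for i
  proof -
   interpret h: additive_subgroup "hpart A (k - ds i)" A by (rule hA)
   have "x : carrier F & T i x : hpart A (k - ds i)"
   proof (rule generate_frag_induct[OF x G])
    show "0 : carrier F & T i 0 : hpart A (k - ds i)" using h.zero_closed by (simp add: T_zero[OF i])
    show "s : carrier F & T i s : hpart A (k - ds i)" if "s : ?G" for s
    proof -
     obtain a y j where s: "s = frag_of (a, y)" "a : hpart A j" "y : hpart B (k - j)" using \<open>s : ?G\<close> by blast
     have "a : carrier A" "y : carrier B" using s hA_carrier hB by auto
     then show ?thesis using c_hpart[OF i s(2,3)] by (simp add: s(1) T_hom(2)[OF i])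
    qed
    fix x y assume xy: "x : carrier F & T i x : hpart A (k - ds i)" "y : carrier F & T i y : hpart A (k - ds i)"
    have "T i x \<ominus>\<^bsub>A\<^esub> T i y : hpart A (k - ds i)"
     unfolding A.minus_eq using xy by (intro h.a_closed h.a_inv_closed) auto
    then show "x - y : carrier F & T i (x - y) : hpart A (k - ds i)"
     using xy T_diff[OF i] by (intro conjI frag_diff_closed) simp_all
   qed
   then show ?thesis ..
  qed
  have "N #>\<^bsub>F\<^esub> x = N #>\<^bsub>F\<^esub> \<sigma> (\<lambda>i\<in>{..<n}. T i x)"
   unfolding coset_eq_iff using reduce_N[OF xF] \<sigma>_cong[of "\<lambda>i\<in>{..<n}. T i x" "%i. T i x"] by simp
  moreover have "(\<lambda>i\<in>{..<n}. T i x) : (\<Pi>\<^sub>E i\<in>{..<n}. hpart A (k - ds i))" using Th by simp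
  ultimately show "z : (%u. N #>\<^bsub>F\<^esub> \<sigma> u) ` (\<Pi>\<^sub>E i\<in>{..<n}. hpart A (k - ds i))" unfolding z by (rule image_eqI)
 qed
qed

text \<open>Scalar multiplication and restriction of tensors are both defined as the image of a
  coset plus the relations of the target; for an additive map that respects the relations this is
  the coset of the image.\<close>

lemma coset_push:
 assumes L: "!!x y. L (x + y) = L x + L y" and N: "!!x. x : N ==> L x : M" and M: "0 : M" "!!x y. x : M ==> y : M ==> x + y : M"
 shows "(L ` (N #>\<^bsub>F\<^esub> x)) <#>\<^bsub>free_Abelian_group S\<^esub> M = M #>\<^bsub>free_Abelian_group S\<^esub> L x"
proof (intro equalityI subsetI)
 fix z assume "z : (L ` (N #>\<^bsub>F\<^esub> x)) <#>\<^bsub>free_Abelian_group S\<^esub> M"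
 then obtain h k where "h : N" "k : M" "z = L (h + x) + k" by (auto simp: r_coset_def set_mult_def)
 then show "z : M #>\<^bsub>free_Abelian_group S\<^esub> L x"
  using M(2)[OF N, of h k] by (auto simp: r_coset_def L algebra_simps intro!: bexI[of _ "L h + k"])
next
 fix z assume "z : M #>\<^bsub>free_Abelian_group S\<^esub> L x"
 then obtain h where h: "h : M" "z = L (0 + x) + h" by (auto simp: r_coset_def algebra_simps)
 then have "L (0 + x) : L ` (N #>\<^bsub>F\<^esub> x)" using N_closed(1) by (auto simp: r_coset_def)
 then show "z : (L ` (N #>\<^bsub>F\<^esub> x)) <#>\<^bsub>free_Abelian_group S\<^esub> M"
  using h unfolding set_mult_def mult_free_Abelian_group by blast
qed

end

lemma frag_extend_sum_of: "frag_extend g (\<Sum>i\<in>I. frag_of (f i)) = (\<Sum>i\<in>I. g (f i))"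
 by (induction I rule: infinite_finite_induct) (simp_all add: frag_extend_add)

context tensor_basis
begin

lemma tensor_smult:
 assumes f: "f : carrier A" and u: "!!i. i < n ==> u i : carrier A"
 shows "f \<odot>\<^bsub>P\<^esub> (N #>\<^bsub>F\<^esub> \<sigma> u) = N #>\<^bsub>F\<^esub> \<sigma> (%i. f \<otimes>\<^bsub>A\<^esub> u i)"
proof -
 let ?L = "frag_extend (%(a, y). frag_of (f \<otimes>\<^bsub>A\<^esub> a, y))"
 have "?L x : N" if "x : N" for x
  by (rule N_induct[OF that])
   (simp_all add: N_closed frag_extend_diff A.r_distr f act_mult[symmetric] N_rel)
 from coset_push[of ?L N, OF frag_extend_add this N_closed(1,2)]
 show ?thesis by (simp add: tensor_def Let_def \<sigma>_def frag_extend_sum_of)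
qed

end

text \<open>The isomorphism is written with the basis alone, so b has to commute with restriction,
  while no such condition arises for c. The map \<rho> restricts the scalars.\<close>

lemma tensor_presheaf_iso:
 fixes M :: "('x, 'q, 'a) gpresheaf" and B :: "('x, 'r, 'b) gpresheaf"
 assumes tb: "!!U. opn M U ==> tensor_basis (sec M U) (sec B U) (R U) (act U) n (b U) (c U) ds"
  and PM: "is_presheaf M"
  and resB: "!!U W y. opn M U ==> opn M W ==> W \<subseteq> U ==> y : sects B U ==> res B U W y : sects B W"
  and resBadd: "!!U W y z. opn M U ==> opn M W ==> W \<subseteq> U ==> y : sects B U ==> z : sects B U ==>
   res B U W (y \<oplus>\<^bsub>sec B U\<^esub> z) = res B U W y \<oplus>\<^bsub>sec B W\<^esub> res B U W z"
  and resb: "!!U W i. opn M U ==> opn M W ==> W \<subseteq> U ==> i < n ==> res B U W (b U i) = b W i"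
  and \<rho>: "!!U W r. opn M U ==> opn M W ==> W \<subseteq> U ==> r : R U ==> \<rho> U W r : R W"
  and resact: "!!U W r a. opn M U ==> opn M W ==> W \<subseteq> U ==> r : R U ==> a : sects M U ==>
   res M U W (act U a r) = act W (res M U W a) (\<rho> U W r)"
  and ressm: "!!U W r y. opn M U ==> opn M W ==> W \<subseteq> U ==> r : R U ==> y : sects B U ==>
   res B U W (r \<odot>\<^bsub>sec B U\<^esub> y) = \<rho> U W r \<odot>\<^bsub>sec B W\<^esub> res B U W y"
 shows "module_sheaf_iso M (free_module_sheaf M (map ds [0..<n])) (tensor_presheaf M B R act)"
proof -
 define \<Theta> where "\<Theta> U u = tensor_null (sec M U) (sec B U) (R U) (act U)
   #>\<^bsub>free_Abelian_group (sects M U \<times> sects B U)\<^esub> tensor_basis.\<sigma> n (b U) u" for U u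
 show ?thesis
  unfolding module_sheaf_iso_iff
 proof (intro exI[of _ \<Theta>] iso_mapI, unfold free_module_sheaf_simps tensor_presheaf_def gpresheaf.simps length_map length_upt diff_zero)
  fix U assume U: "opn M U"
  interpret tensor_basis "sec M U" "sec B U" "R U" "act U" n "b U" "c U" ds by (rule tb[OF U])
  show "bij_betw (\<Theta> U) (\<Pi>\<^sub>E i\<in>{..<n}. sects M U) (carrier P)"
   unfolding \<Theta>_def by (rule tensor_bij)
  have "(\<Pi>\<^sub>E i\<in>{..<n}. hpart (sec M U) (k - map ds [0..<n] ! i)) = (\<Pi>\<^sub>E i\<in>{..<n}. hpart (sec M U) (k - ds i))" for k
   by (rule PiE_cong) simp
  then show "\<Theta> U ` (\<Pi>\<^sub>E i\<in>{..<n}. hpart (sec M U) (k - map ds [0..<n] ! i)) = hpart P k" for k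
   unfolding \<Theta>_def using tensor_hpart by simp
  fix u assume "u : (\<Pi>\<^sub>E i\<in>{..<n}. sects M U)"
  then have u: "u i : sects M U" if "i < n" for i using that by (auto simp: PiE_iff)
  show "\<Theta> U (\<lambda>i\<in>{..<n}. u i \<oplus>\<^bsub>sec M U\<^esub> v i) = \<Theta> U u \<oplus>\<^bsub>P\<^esub> \<Theta> U v" if "v : (\<Pi>\<^sub>E i\<in>{..<n}. sects M U)" for v
   unfolding \<Theta>_def tensor_add coset_eq_iff by (rule \<sigma>_add_N) (use u that in \<open>auto simp: PiE_iff\<close>)
  show "\<Theta> U (\<lambda>i\<in>{..<n}. f \<otimes>\<^bsub>sec M U\<^esub> u i) = f \<odot>\<^bsub>P\<^esub> \<Theta> U u" if f: "f : sects M U" for f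
   unfolding \<Theta>_def by (subst tensor_smult[OF f], rule u, assumption) (rule arg_cong[of _ _ "%x. N #>\<^bsub>F\<^esub> x"], rule \<sigma>_cong, simp)
  fix W assume W: "opn M W" "W \<subseteq> U"
  interpret W: tensor_basis "sec M W" "sec B W" "R W" "act W" n "b W" "c W" ds by (rule tb[OF W(1)])
  let ?L = "frag_extend (%(a, y). frag_of (res M U W a, res B U W y))"
  have "?L x : W.N" if "x : N" for x
   by (rule N_induct[OF that])
    (simp_all add: W.N_closed frag_extend_diff presheafD(1,2)[OF PM U W] resB[OF U W] resBadd[OF U W] \<rho>[OF U W]
     resact[OF U W] ressm[OF U W] W.N_rel)
  from coset_push[of ?L W.N, OF frag_extend_add this W.N_closed(1,2)]
  have "(?L ` \<Theta> U u) <#>\<^bsub>W.F\<^esub> W.N = W.N #>\<^bsub>W.F\<^esub> ?L (\<sigma> u)" by (simp add: \<Theta>_def)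
  also have "?L (\<sigma> u) = W.\<sigma> (\<lambda>i\<in>{..<n}. res M U W (u i))"
   by (simp add: \<sigma>_def W.\<sigma>_def frag_extend_sum_of resb[OF U W])
  finally show "\<Theta> W (\<lambda>i\<in>{..<n}. res M U W (u i)) = (?L ` \<Theta> U u) <#>\<^bsub>W.F\<^esub> W.N" by (simp add: \<Theta>_def)
 qed
qed

section \<open>The sheaf of smooth functions on a chart\<close>

text \<open>The pasting lemma gives continuity; differentiability is a condition at each point, and
  the partial derivatives are handled by the induction.\<close>

lemma ck_on_local:
 assumes U: "eopn n U"
  and N: "!!x. x : U ==> eopn n (N x) & x : N x & N x \<subseteq> U"
 shows "(!!x. x : U ==> ck_on n k (N x) f) ==> ck_on n k U f"
proof (induction k arbitrary: f)
 have cont: "continuous_map (subtopology (Euclidean_space n) U) euclideanreal f"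
  if c: "!!x. x : U ==> continuous_map (subtopology (Euclidean_space n) (N x)) euclideanreal f" for f
 proof (rule pasting_lemma[where T = N and I = U and f = "%_. f"])
  fix x assume x: "x : U"
  then have "U \<inter> N x = N x" using N by blast
  then show "continuous_map (subtopology (subtopology (Euclidean_space n) U) (N x)) euclideanreal f"
   using c[OF x] by (simp add: subtopology_subtopology)
  show "openin (subtopology (Euclidean_space n) U) (N x)" using N[OF x] by (simp add: openin_open_subtopology[OF U])
 qed (use N in auto)
 { case 0
  then show ?case using cont[of f] by simp
 next
  case (Suc k)
  show ?case
   unfolding ck_on.simps
  proof (intro conjI allI impI ballI)
   show "continuous_map (subtopology (Euclidean_space n) U) euclideanreal f" using Suc.prems by (intro cont) simp
   fix i assume i: "i < n"
   show "ck_on n k U (partial_deriv i f)" using Suc.prems i by (intro Suc.IH) simp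
   fix x assume "x : U"
   then show "(%s. f (x(i := s))) differentiable at (x i)" using Suc.prems[of x] N[of x] i by simp
  qed }
qed

lemma smooth_local:
 assumes U: "eopn n U"
  and N: "!!x. x : U ==> \<exists>N. eopn n N & x : N & N \<subseteq> U & smooth_fun_on n N f"
 shows "smooth_fun_on n U f"
proof -
 have "\<forall>x\<in>U. \<exists>N. eopn n N & x : N & N \<subseteq> U & smooth_fun_on n N f" using N by blast
 from bchoice[OF this] obtain N where
  "\<forall>x\<in>U. eopn n (N x) & x : N x & N x \<subseteq> U & smooth_fun_on n (N x) f" by (rule exE)
 then show ?thesis unfolding smooth_fun_on_def by (intro allI ck_on_local[OF U, of N]) blast+
qed

context chart
begin

section \<open>Smooth functions on a chart as a sheaf of algebras\<close>

abbreviation "CS \<equiv> smooth_sheaf (p 0) S V h"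

definition smf :: "'x set => ('x => real) set" where
 "smf U = {f. smooth_fun_on (p 0) (h ` U) (%y. f (inv_into V h y)) & (\<forall>x. x \<notin> U --> f x = 0)}"

lemma CS_simps:
 "base CS = subtopology (base S) V"
 "sects CS U = smf U" "mult (sec CS U) = (%f g x. f x * g x)" "one (sec CS U) = indicator U"
 "ring.zero (sec CS U) = (%x. 0)" "ring.add (sec CS U) = (%f g x. f x + g x)" "smult (sec CS U) = (%r f x. r * f x)"
 "hpart (sec CS U) k = (if k = 0 then smf U else {%x. 0})" "res CS U W = (%f x. if x : W then f x else 0)"
 by (simp_all add: smooth_sheaf_def smf_def)

lemma openin_CS: "opn CS U \<longleftrightarrow> dom U"
 by (simp add: CS_simps openin_restrict[OF V_open] dom_def)

lemma inv_h: "U \<subseteq> V ==> x : U ==> inv_into V h (h x) = x"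
 using inv_into_f_f[OF inj] by blast

lemma inv_h_in: "U \<subseteq> V ==> y : h ` U ==> inv_into V h y : U"
 using inv_h by auto

lemma smfI:
 assumes U: "dom U" and "smooth_fun_on (p 0) (h ` U) g" and "!!x. x : U ==> f x = g (h x)" "!!x. x \<notin> U ==> f x = 0"
 shows "f : smf U"
proof -
 have "smooth_fun_on (p 0) (h ` U) (%y. f (inv_into V h y))"
  by (rule smooth_cong_imp[OF img_open[OF U] _ assms(2)]) (use assms(3) inv_h[OF domD(2)[OF U]] in auto)
 then show ?thesis using assms(4) by (simp add: smf_def)
qed

lemma smf_facts:
 assumes U: "dom U"
 shows "f : smf U ==> g : smf U ==> (%x. f x + g x) : smf U" "f : smf U ==> g : smf U ==> (%x. f x * g x) : smf U"
  "f : smf U ==> (%x. r * f x) : smf U" "(%x. 0) : smf U" "indicator U : smf U"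
  "f : smf U ==> x \<notin> U ==> f x = 0"
proof -
 show "indicator U : smf U" by (rule smfI[OF U smooth_const[OF img_open[OF U], of 1]]) auto
qed (use img_open[OF U] in \<open>auto simp: smf_def intro: smooth_add smooth_mult smooth_cmult smooth_const\<close>)

lemma smf_res:
 assumes "dom U" "dom W" "W \<subseteq> U" "f : smf U"
 shows "(%x. if x : W then f x else 0) : smf W"
proof (rule smfI[OF assms(2)])
 show "smooth_fun_on (p 0) (h ` W) (%y. f (inv_into V h y))"
  by (rule smooth_subset[OF img_open[OF assms(1)] img_open[OF assms(2)]]) (use assms in \<open>auto simp: smf_def\<close>)
qed (use inv_h[OF domD(2)[OF assms(2)]] in auto)

text \<open>Functions glue pointwise, and smoothness of the result is local by
  \<open>smooth_local\<close>.\<close>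

lemma CS_sheaf: "is_sheaf CS"
 unfolding is_sheaf_def openin_CS CS_simps(2,8,9)
proof (intro conjI allI impI)
 show "is_presheaf CS"
  unfolding is_presheaf_def openin_CS CS_simps(2,6,8,9)
  using smf_res by (auto simp: fun_eq_iff smf_facts(6))
 fix \<V>
 have dU: "dom (\<Union>\<V>)" if "\<forall>W\<in>\<V>. dom W" using that unfolding dom_def by blast
 show "\<exists>!t. t : smf (\<Union>\<V>) & (\<forall>W\<in>\<V>. (%x. if x : W then t x else 0) = s W)"
  if asm: "(\<forall>W\<in>\<V>. dom W & s W : smf W) \<and>
    (\<forall>W\<in>\<V>. \<forall>W'\<in>\<V>. (%x. if x : W \<inter> W' then s W x else 0) = (%x. if x : W \<inter> W' then s W' x else 0))" for s
 proof -
  have sW: "dom W" "s W : smf W" if "W : \<V>" for W using asm that by auto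
  have eq: "s W x = s W' x" if "W : \<V>" "W' : \<V>" "x : W" "x : W'" for W W' x
   using fun_cong[OF asm[THEN conjunct2, THEN bspec, THEN bspec, OF that(1,2)], of x] that by simp
  define t where "t x = (if x : \<Union>\<V> then s (SOME W. W : \<V> & x : W) x else 0)" for x
  have t: "t x = s W x" if W: "W : \<V>" "x : W" for x W
  proof -
   have "(SOME W. W : \<V> & x : W) : \<V> & x : (SOME W. W : \<V> & x : W)" by (rule someI[of _ W]) (use W in simp)
   then show ?thesis using W eq[of "SOME W. W : \<V> & x : W" W x] unfolding t_def by auto
  qed
  have D: "dom (\<Union>\<V>)" using dU sW(1) by blast
  have "smooth_fun_on (p 0) (h ` \<Union>\<V>) (%y. t (inv_into V h y))"
  proof (rule smooth_local[OF img_open[OF D]])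
   fix y assume "y : h ` \<Union>\<V>"
   then obtain W x where W: "W : \<V>" "x : W" "y = h x" by blast
   note WV = domD(2)[OF sW(1)[OF W(1)]]
   have "smooth_fun_on (p 0) (h ` W) (%y. t (inv_into V h y))"
    by (rule smooth_cong_imp[OF img_open[OF sW(1)[OF W(1)]], of "%y. s W (inv_into V h y)"])
     (use sW(2)[OF W(1)] t[OF W(1)] inv_h_in[OF WV] in \<open>auto simp: smf_def\<close>)
   then show "\<exists>N. eopn (p 0) N & y : N & N \<subseteq> h ` \<Union>\<V> & smooth_fun_on (p 0) N (%y. t (inv_into V h y))"
    using W img_open[OF sW(1)[OF W(1)]] by (intro exI[of _ "h ` W"]) auto
  qed
  then have ts: "t : smf (\<Union>\<V>)" by (simp add: smf_def t_def)
  have tr: "(%x. if x : W then t x else 0) = s W" if "W : \<V>" for W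
   by (rule ext) (simp add: t[OF that] smf_facts(6)[OF sW[OF that]])
  show ?thesis
  proof (intro ex1I[of _ t] conjI ballI ts tr)
   fix u assume u: "u : smf (\<Union>\<V>) & (\<forall>W\<in>\<V>. (%x. if x : W then u x else 0) = s W)"
   show "u = t"
   proof
    fix x
    show "u x = t x"
    proof (cases "x : \<Union>\<V>")
     case True
     then obtain W where W: "W : \<V>" "x : W" by blast
     then show ?thesis using fun_cong[OF u[THEN conjunct2, THEN bspec, OF W(1)], of x] t[OF W] by simp
    next
     case False
     then show ?thesis using smf_facts(6)[OF D conjunct1[OF u] False] smf_facts(6)[OF D ts False] by simp
    qed
   qed
  qed
 qed
 show "t : (if k = 0 then smf (\<Union>\<V>) else {%x. 0})"
  if asm: "(\<forall>V\<in>\<V>. dom V) & t : smf (\<Union>\<V>) \<and>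
    (\<forall>V\<in>\<V>. (%x. if x : V then t x else 0) : (if k = 0 then smf V else {%x. 0}))" for t k
 proof (cases "k = 0")
  case False
  have "t x = 0" for x
  proof (cases "x : \<Union>\<V>")
   case True
   then obtain W where W: "W : \<V>" "x : W" by blast
   have "(%x. if x : W then t x else 0) = (%x. 0)" using asm W False by auto
   from fun_cong[OF this, of x] show ?thesis using W by simp
  qed (use asm in \<open>auto simp: smf_def\<close>)
  then show ?thesis using False by auto
 qed (use asm in simp)
qed

lemma CS_ring:
 assumes U: "dom U"
 shows "ring (sec CS U)" "abelian_group (sec CS U)"
proof -
 note f = smf_facts[OF U]
 show a: "abelian_group (sec CS U)"
 proof (rule abelian_groupI, unfold CS_simps)
  show "\<exists>g\<in>smf U. (%x. g x + f x) = (%x. 0)" if "f : smf U" for f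
   using f(3)[OF that, of "-1"] by (intro bexI[of _ "%x. - 1 * f x"]) auto
 qed (use f in \<open>auto simp: fun_eq_iff algebra_simps\<close>)
 show "ring (sec CS U)"
 proof (rule ringI[OF a monoidI], unfold CS_simps)
  show "(%x. indicator U x * g x) = g" "(%x. g x * indicator U x) = g" if "g : smf U" for g
   using f(6)[OF that] by (auto simp: fun_eq_iff indicator_def)
 qed (use f in \<open>auto simp: fun_eq_iff algebra_simps\<close>)
qed

lemma CS_algebra:
 assumes U: "dom U"
 shows "supercomm_algebra (sec CS U)"
 unfolding supercomm_algebra_def
proof (intro conjI allI ballI)
 note f = smf_facts[OF U]
 interpret R: ring "sec CS U" by (rule CS_ring[OF U])
 show "ring (sec CS U)" by (rule CS_ring[OF U])
 show "module real_ring (sec CS U)"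
 proof (rule moduleI[OF _ CS_ring(2)[OF U]], unfold CS_simps)
  have "cring real_ring" unfolding real_ring_def
   by (rule cringI, rule abelian_groupI, simp_all, rule exI[of _ "- x" for x], simp, unfold_locales) (simp_all add: algebra_simps)
  then show "cring real_ring" .
 qed (use f in \<open>auto simp: fun_eq_iff algebra_simps real_ring_def\<close>)
 show "formal_grading (sec CS U)"
  unfolding formal_grading_def CS_simps
 proof (intro conjI allI exI[of _ "%k f. if k = (0::int) then f else (%x. 0)"] ballI impI)
  show "additive_subgroup (if k = 0 then smf U else {%x. 0}) (sec CS U)" for k
  proof (cases "k = 0")
   case True
   have "additive_subgroup (sects CS U) (sec CS U)"
    by (rule additive_subgroup.intro, rule group.subgroup_self[OF R.a_group, simplified])
   then show ?thesis using True by (simp add: CS_simps)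
  next
   case False
   have "additive_subgroup {\<zero>\<^bsub>sec CS U\<^esub>} (sec CS U)"
    by (rule additive_subgroup.intro, rule group.triv_subgroup[OF R.a_group, simplified])
   then show ?thesis using False by (simp add: CS_simps)
  qed
 qed (use f(4) in \<open>auto split: if_splits\<close>)
 fix a b k l assume a: "a : hpart (sec CS U) k" and b: "b : hpart (sec CS U) l"
 then show "a \<otimes>\<^bsub>sec CS U\<^esub> b : hpart (sec CS U) (k + l)"
  using f(2,4) by (auto simp: CS_simps split: if_splits)
 have "signed (sec CS U) n \<zero>\<^bsub>sec CS U\<^esub> = \<zero>\<^bsub>sec CS U\<^esub>" for n by (simp add: signed_def)
 then have "signed (sec CS U) n (%x. 0) = (%x. 0)" for n by (simp add: CS_simps)
 then show "a \<otimes>\<^bsub>sec CS U\<^esub> b = signed (sec CS U) (k * l) (b \<otimes>\<^bsub>sec CS U\<^esub> a)"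
  using a b by (cases "k = 0"; cases "l = 0") (auto simp: CS_simps mult.commute, simp_all add: signed_def)
qed (use smf_facts[OF U] in \<open>auto simp: CS_simps fun_eq_iff split: if_splits\<close>)

lemma CS_res_hom:
 assumes "dom U" "dom W" "W \<subseteq> U"
 shows "res CS U W : ring_hom (sec CS U) (sec CS W)"
 by (rule ring_hom_memI) (use smf_res[OF assms] assms(3) in \<open>auto simp: CS_simps fun_eq_iff indicator_def\<close>)

lemma CS_algebra_sheaf: "algebra_sheaf CS"
 unfolding algebra_sheaf_def openin_CS
proof (intro conjI allI impI ballI CS_sheaf CS_algebra)
 fix U W assume "dom U & dom W & W \<subseteq> U"
 then show "res CS U W : ring_hom (sec CS U) (sec CS W)" by (intro CS_res_hom) auto
qed (auto simp: CS_simps fun_eq_iff)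

text \<open>Without generators the formal series are just functions of the degree-zero coordinates.
  The smooth functions thus form a \<open>chart\<close> themselves, and the results about
  derivations cover the ordinary vector fields.\<close>

definition p\<^sub>0 :: "int => nat" where "p\<^sub>0 = (%j. if j = 0 then p 0 else 0)"

definition Ps\<^sub>0 :: "'x set => ('x => real) => series" where
 "Ps\<^sub>0 U f = fun_series (h ` U) (%y. f (inv_into V h y))"

lemma monomials_p0: "m : monomials p\<^sub>0 \<longleftrightarrow> m = {#}"
proof -
 have "gens p\<^sub>0 = {}" by (auto simp: gens_def p\<^sub>0_def)
 then show ?thesis by (auto simp: monomials_def)
qed

lemma CS_chart: "chart CS V p\<^sub>0 h Ps\<^sub>0"
proof
 have p0: "p\<^sub>0 0 = p 0" by (simp add: p\<^sub>0_def)
 have op: "opn CS U \<longleftrightarrow> dom U" for U by (rule openin_CS)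
 have od: "opens_in CS V U \<longleftrightarrow> dom U" for U using op[of U] by (auto simp: opens_in_def)
 show "is_presheaf CS" by (rule sheafD(1)[OF CS_sheaf])
 show "opn CS V" unfolding op by (rule dom_V)
 have "gens p\<^sub>0 = {}" by (auto simp: gens_def p\<^sub>0_def)
 then show "finite (gens p\<^sub>0)" by simp
 show "inj_on h V" by (rule inj)
 show "opn CS {x : V. h x : W}" if "openin (Euclidean_space (p\<^sub>0 0)) W" for W
  using pre_open[of W] that unfolding op dom_def p0 by auto
 fix U assume "opens_in CS V U"
 then have U: "dom U" by (simp add: od)
 note UV = domD(2)[OF U]
 note iV = inv_h_in[OF UV]
 show "openin (Euclidean_space (p\<^sub>0 0)) (h ` U)" unfolding p0 by (rule img_open[OF U])
 show "supercomm_algebra (sec CS U)" by (rule CS_algebra[OF U])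
 show "Ps\<^sub>0 U \<one>\<^bsub>sec CS U\<^esub> = fun_series (h ` U) (%x. 1)"
  using iV by (auto simp: Ps\<^sub>0_def CS_simps fun_series_def fun_eq_iff)
 have so: "Ps\<^sub>0 U f : series_on p\<^sub>0 (h ` U)" if "f : smf U" for f
  unfolding Ps\<^sub>0_def by (rule fun_series_on) (use that img_open[OF U] in \<open>simp_all add: p0 smf_def\<close>)
 show "bij_betw (Ps\<^sub>0 U) (sects CS U) (series_on p\<^sub>0 (h ` U))"
  unfolding CS_simps
 proof (rule bij_betw_byWitness[of _ "%s x. if x : U then s {#} (h x) else 0"])
  show "\<forall>f\<in>smf U. (%x. if x : U then Ps\<^sub>0 U f {#} (h x) else 0) = f"
   using smf_facts(6)[OF U] inv_h[OF UV] by (auto simp: Ps\<^sub>0_def fun_series_def fun_eq_iff)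
  show "\<forall>s\<in>series_on p\<^sub>0 (h ` U). Ps\<^sub>0 U (%x. if x : U then s {#} (h x) else 0) = s"
  proof (intro ballI ext)
   fix s m y assume s: "s : series_on p\<^sub>0 (h ` U)"
   show "Ps\<^sub>0 U (%x. if x : U then s {#} (h x) else 0) m y = s m y"
    using series_onD(2)[OF s, unfolded monomials_p0, of m y] series_onD(3)[OF s, of y m] inv_h[OF UV]
    by (auto simp: Ps\<^sub>0_def fun_series_def)
  qed
  show "(%s x. if x : U then s {#} (h x) else 0) ` series_on p\<^sub>0 (h ` U) \<subseteq> smf U"
  proof (rule image_subsetI)
   fix s assume s: "s : series_on p\<^sub>0 (h ` U)"
   show "(%x. if x : U then s {#} (h x) else 0) : smf U"
    by (rule smfI[OF U series_onD(1)[OF s, unfolded p0, of "{#}"]]) simp_all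
  qed
 qed (use so in blast)
 show "res CS U W : ring_hom (sec CS U) (sec CS W)" if "opens_in CS V W" "W \<subseteq> U" for W
  using CS_res_hom[OF U _ that(2)] that(1) by (simp add: od)
 fix f assume "f : sects CS U"
 then have f: "f : smf U" by (simp add: CS_simps)
 show "Ps\<^sub>0 U (f \<otimes>\<^bsub>sec CS U\<^esub> g) = series_mult p\<^sub>0 (Ps\<^sub>0 U f) (Ps\<^sub>0 U g)" if "g : sects CS U" for g
 proof (intro ext)
  fix m y
  show "Ps\<^sub>0 U (f \<otimes>\<^bsub>sec CS U\<^esub> g) m y = series_mult p\<^sub>0 (Ps\<^sub>0 U f) (Ps\<^sub>0 U g) m y"
  proof (cases "y : h ` U")
   case True
   have "series_mult p\<^sub>0 (Ps\<^sub>0 U f) (Ps\<^sub>0 U g) m y = f (inv_into V h y) * Ps\<^sub>0 U g m y"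
    unfolding Ps\<^sub>0_def[of U f] by (rule series_mult_fun[OF True so]) (use that in \<open>simp add: CS_simps\<close>)
   then show ?thesis by (simp add: Ps\<^sub>0_def CS_simps fun_series_def)
  qed (simp add: Ps\<^sub>0_def CS_simps fun_series_def series_mult_def)
 qed
 have z1: "(%x. 0) = f" if "Ps\<^sub>0 U f {#} = (%y. 0)"
 proof
  fix x
  show "0 = f x" using fun_cong[OF that, of "h x"] inv_h[OF UV] smf_facts(6)[OF U f, of x]
   by (cases "x : U") (simp_all add: Ps\<^sub>0_def fun_series_def)
 qed
 have z2: "Ps\<^sub>0 U f m = (%y. 0)" if "m ~= {#} \<or> f = (%x. 0)" for m
  using that by (auto simp: Ps\<^sub>0_def fun_series_def)
 show "f : hpart (sec CS U) k \<longleftrightarrow> (\<forall>m. mono_degree m ~= k --> Ps\<^sub>0 U f m = (%x. 0))" for k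
 proof (cases "k = 0")
  case True
  have "Ps\<^sub>0 U f m = (%x. 0)" if "mono_degree m ~= k" for m by (rule z2) (use that True in auto)
  then show ?thesis using f True by (simp add: CS_simps)
 next
  case False
  have "f = (%x. 0)" if a: "\<forall>m. mono_degree m ~= k --> Ps\<^sub>0 U f m = (%x. 0)"
   using z1 a[THEN spec, of "{#}"] False by simp
  moreover have "\<forall>m. mono_degree m ~= k --> Ps\<^sub>0 U f m = (%x. 0)" if "f = (%x. 0)"
   using z2 that by simp
  moreover have "f : hpart (sec CS U) k \<longleftrightarrow> f = (%x. 0)" using False by (simp add: CS_simps)
  ultimately show ?thesis by argo
 qed
 fix W assume "opens_in CS V W" "W \<subseteq> U"
 then have W: "dom W" "W \<subseteq> U" by (simp_all add: od)
 show "Ps\<^sub>0 W (res CS U W f) = (%m y. if y : h ` W then Ps\<^sub>0 U f m y else 0)"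
  using inv_h_in[OF domD(2)[OF W(1)]] W by (auto simp: Ps\<^sub>0_def CS_simps fun_series_def fun_eq_iff)
qed (auto simp: Ps\<^sub>0_def CS_simps fun_series_def fun_eq_iff)

end

section \<open>The splitting of the tangent sheaf\<close>

lemma restrict_algebra_sheaf:
 assumes A: "algebra_sheaf M" and V: "opn M V"
 shows "algebra_sheaf (restrict_sheaf M V)"
 unfolding algebra_sheaf_def restrict_sheaf_simps openin_restrict[OF V]
 using algebra_sheafD(3-5)[OF A] restrict_is_sheaf[OF algebra_sheafD(1)[OF A] V] by simp

lemma tensor_sheaf_iso:
 fixes M :: "('x, real, 'a) gpresheaf"
 assumes A: "algebra_sheaf M"
  and iso: "module_sheaf_iso M (free_module_sheaf M ds) (tensor_presheaf M B R act)"
 shows "module_sheaf_iso M (free_module_sheaf M ds) (tensor_sheaf M B R act)"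
 unfolding tensor_sheaf_def
proof (rule sheafify_iso[OF _ _ free_is_sheaf[OF algebra_sheafD(1)[OF A]] iso], unfold free_module_sheaf_simps)
 show "base (tensor_presheaf M B R act) = base M" by (simp add: tensor_presheaf_def)
 let ?I = "{..<length ds}"
 fix U assume U: "opn M U"
 interpret ring "sec M U" by (rule supercomm_algebraD(1)[OF algebra_sheafD(3)[OF A U]])
 show "(\<Pi>\<^sub>E i\<in>?I. hpart (sec M U) (k - ds ! i)) \<subseteq> (\<Pi>\<^sub>E i\<in>?I. sects M U)" for k
  by (rule PiE_mono) (use hpart_carrier[OF supercomm_algebraD(3)[OF algebra_sheafD(3)[OF A U]]] in blast)
 fix u assume u: "u : (\<Pi>\<^sub>E i\<in>?I. sects M U)"
 show "(\<lambda>i\<in>?I. u i \<oplus>\<^bsub>sec M U\<^esub> v i) : (\<Pi>\<^sub>E i\<in>?I. sects M U)" if "v : (\<Pi>\<^sub>E i\<in>?I. sects M U)" for v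
  using u that by (auto simp: PiE_iff)
 fix f assume f: "f : sects M U"
 show "(\<lambda>i\<in>?I. f \<otimes>\<^bsub>sec M U\<^esub> u i) : (\<Pi>\<^sub>E i\<in>?I. sects M U)" using u f by (auto simp: PiE_iff)
 fix W assume W: "opn M W" "W \<subseteq> U"
 show "(\<lambda>i\<in>?I. res M U W ((\<lambda>i\<in>?I. f \<otimes>\<^bsub>sec M U\<^esub> u i) i)) = (\<lambda>i\<in>?I. res M U W f \<otimes>\<^bsub>sec M W\<^esub> (\<lambda>i\<in>?I. res M U W (u i)) i)"
  by (rule restrict_ext) (use u in \<open>simp add: res_hom_facts(3)[OF A U W f] PiE_iff\<close>)
qed (use presheafD(1,5)[OF algebra_sheafD(2)[OF A]] in \<open>simp_all\<close>)

lemma endo_finsum: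
 assumes S: "algebra_sheaf S" and G: "abelian_group G" and C: "carrier G \<subseteq> sheaf_endo S U"
  and zero: "ring.zero G = rst S U (%W f. \<zero>\<^bsub>sec S W\<^esub>)" and add: "ring.add G = (%X Y. rst S U (%W f. X W f \<oplus>\<^bsub>sec S W\<^esub> Y W f))"
  and W: "opn S W" "W \<subseteq> U" "f : sects S W" and I: "finite I" "X : I \<rightarrow> carrier G"
 shows "(\<Oplus>\<^bsub>G\<^esub>i\<in>I. X i) W f = (\<Oplus>\<^bsub>sec S W\<^esub>i\<in>I. X i W f)"
 using I
proof (induction I)
 interpret G: abelian_group G by fact
 interpret R: ring "sec S W" by (rule supercomm_algebraD(1)[OF algebra_sheafD(3)[OF S W(1)]])
 { case empty
  show ?case by (simp add: zero rst_eq[OF W])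
 next
  case (insert j I)
  have c: "X i W f : sects S W" if "i : insert j I" for i
   by (rule sheaf_endoD(1)[OF subsetD[OF C] W]) (use insert.prems that in blast)
  have "(\<Oplus>\<^bsub>G\<^esub>i\<in>insert j I. X i) = X j \<oplus>\<^bsub>G\<^esub> (\<Oplus>\<^bsub>G\<^esub>i\<in>I. X i)"
   using insert by (intro G.finsum_insert) auto
  then have "(\<Oplus>\<^bsub>G\<^esub>i\<in>insert j I. X i) W f = X j W f \<oplus>\<^bsub>sec S W\<^esub> (\<Oplus>\<^bsub>G\<^esub>i\<in>I. X i) W f"
   by (simp add: add rst_eq[OF W])
  also have "(\<Oplus>\<^bsub>G\<^esub>i\<in>I. X i) W f = (\<Oplus>\<^bsub>sec S W\<^esub>i\<in>I. X i W f)" using insert by auto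
  finally show ?case using R.finsum_insert[OF insert(1,2), of "%i. X i W f"] c by auto }
qed

lemma ordinary_simps:
 "base (ordinary_tangent_sheaf S) = base S"
 "sects (ordinary_tangent_sheaf S) U = derivations S U 0"
 "ring.zero (sec (ordinary_tangent_sheaf S) U) = rst S U (%W f. \<zero>\<^bsub>sec S W\<^esub>)"
 "ring.add (sec (ordinary_tangent_sheaf S) U) = (%X Y. rst S U (%W f. X W f \<oplus>\<^bsub>sec S W\<^esub> Y W f))"
 "smult (sec (ordinary_tangent_sheaf S) U) = (%g X. rst S U (%W f. res S U W g \<otimes>\<^bsub>sec S W\<^esub> X W f))"
 "hpart (sec (ordinary_tangent_sheaf S) U) = derivations S U"
 "res (ordinary_tangent_sheaf S) U W = rst S W"
 by (simp_all add: ordinary_tangent_sheaf_def tangent_simps)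

subsection \<open>The ordinary tangent sheaf\<close>

context mfd_chart
begin

interpretation C0: chart CS V p\<^sub>0 h Ps\<^sub>0 by (rule CS_chart)

lemma C0_dom: "C0.dom U \<longleftrightarrow> dom U"
 using openin_CS[of U] by (auto simp: opens_in_def)

lemma idx_p0: "idx p\<^sub>0 = Inl ` {..<p 0}"
 by (auto simp: idx_def p\<^sub>0_def gens_def)

abbreviation "VB U \<equiv> sec (ordinary_tangent_sheaf CS) U"

text \<open>The vector field \<partial>/\<partial>x_i on U, as the combination \<open>LC\<close>
  with the i-th unit vector of coefficients; \<open>ocoef\<close> below is X(x_i).\<close>

definition ob :: "'x set => nat => 'x set => ('x => real) => 'x => real" where
 "ob U i = C0.LC U (%ii. if ii = Inl i then indicator U else (%x. 0))"

definition ocoef :: "'x set => nat => ('x set => ('x => real) => 'x => real) => 'x => real" where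
 "ocoef U i X = X U (C0.co U (Inl i))"

lemma C0_co: "dom U ==> i < p 0 ==> C0.co U (Inl i) : smf U"
 using C0.co_closed[of U "Inl i"] by (simp add: C0_dom idx_p0 CS_simps)

lemma ob_derivation: "dom U ==> ob U i : derivations CS U 0"
 unfolding ob_def
 by (rule C0.LC_derivations) (use smf_facts(4,5)[of U] in \<open>auto simp: C0_dom idx_p0 CS_simps\<close>)

lemma ocoef_ob:
 assumes "dom U" "i < p 0" "j < p 0"
 shows "ocoef U i (ob U j) = (if i = j then indicator U else (%x. 0))"
 unfolding ocoef_def ob_def
 by (subst C0.LC_co) (use assms smf_facts(4,5)[of U] in \<open>auto simp: C0_dom idx_p0 CS_simps\<close>)

lemma ocoef_closed: "dom U ==> i < p 0 ==> X : derivations CS U 0 ==> ocoef U i X : smf U"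
 unfolding ocoef_def using C0.dom_endoD(1)[OF derivationsD(1), of X U 0 U] C0_co by (simp add: C0_dom CS_simps)

lemma derivations_CS_eqI:
 assumes "dom U" "X : derivations CS U 0" "Y : derivations CS U 0" "!!i. i < p 0 ==> ocoef U i X = ocoef U i Y"
 shows "X = Y"
 by (rule C0.derivations_eqI[OF _ assms(2,3)]) (use assms(1,4) in \<open>auto simp: C0_dom idx_p0 ocoef_def\<close>)

text \<open>All functions have degree 0, and the other parts of the sheaf vanish. Hence the
  homogeneous parts of the ordinary tangent sheaf lie in its carrier, which consists of the
  derivations of degree 0.\<close>

lemma derivations_CS_zero:
 assumes U: "dom U" and X: "X : derivations CS U k" and k: "k ~= 0"
 shows "X = rst CS U (%W f. \<zero>\<^bsub>sec CS W\<^esub>)"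
proof (rule sheaf_endo_eqI[OF derivationsD(1)[OF X] endo_zero[OF CS_algebra_sheaf]])
 fix W f assume W: "opn CS W" "W \<subseteq> U" "f : sects CS W"
 then have "f : hpart (sec CS W) 0" by (simp add: CS_simps)
 from derivationD(4)[OF derivationsD(2)[OF X W(1,2)] this]
 show "X W f = rst CS U (%W f. \<zero>\<^bsub>sec CS W\<^esub>) W f" using k by (simp add: rst_eq[OF W] CS_simps)
qed

lemma VB_smult_closed: "dom U ==> r : smf U ==> X : derivations CS U 0 ==> r \<odot>\<^bsub>VB U\<^esub> X : derivations CS U 0"
 using derivations_smult[OF CS_algebra_sheaf, of U X 0 r 0] unfolding ordinary_simps openin_CS
 by (simp add: CS_simps)

lemma VB_abelian_group:
 assumes U: "dom U"
 shows "abelian_group (VB U)"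
proof (rule endo_abelian_group[OF CS_algebra_sheaf _ _ ordinary_simps(3,4)], unfold ordinary_simps)
 interpret ring "sec CS U" by (rule CS_ring[OF U])
 have m: "\<ominus>\<^bsub>sec CS U\<^esub> \<one>\<^bsub>sec CS U\<^esub> : smf U" using a_inv_closed[OF one_closed] by (simp only: CS_simps)
 show "opn CS U" using U by (simp only: openin_CS)
 show "derivations CS U 0 \<subseteq> sheaf_endo CS U" using derivationsD(1) by blast
 show "rst CS U (%W f. \<zero>\<^bsub>sec CS W\<^esub>) : derivations CS U 0" by (rule derivations_zero[OF CS_algebra_sheaf])
 fix X assume X: "X : derivations CS U 0"
 show "rst CS U (%W f. X W f \<oplus>\<^bsub>sec CS W\<^esub> Y W f) : derivations CS U 0" if "Y : derivations CS U 0" for Y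
  by (rule derivations_add[OF CS_algebra_sheaf X that])
 show "rst CS U (%W f. res CS U W (\<ominus>\<^bsub>sec CS U\<^esub> \<one>\<^bsub>sec CS U\<^esub>) \<otimes>\<^bsub>sec CS W\<^esub> X W f) : derivations CS U 0"
  using VB_smult_closed[OF U m X] unfolding ordinary_simps .
qed

text \<open>Both sides are derivations with the same values on the coordinates.\<close>

lemma ordinary_expand:
 assumes U: "dom U" and X: "X : derivations CS U 0"
 shows "X = (\<Oplus>\<^bsub>VB U\<^esub>i\<in>{..<p 0}. ocoef U i X \<odot>\<^bsub>VB U\<^esub> ob U i)"
proof (rule derivations_CS_eqI[OF U X])
 interpret B: abelian_group "VB U" by (rule VB_abelian_group[OF U])
 have f: "(%i. ocoef U i X \<odot>\<^bsub>VB U\<^esub> ob U i) : {..<p 0} \<rightarrow> carrier (VB U)"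
  using VB_smult_closed[OF U ocoef_closed[OF U _ X] ob_derivation[OF U]] by (simp add: ordinary_simps(2))
 show "(\<Oplus>\<^bsub>VB U\<^esub>i\<in>{..<p 0}. ocoef U i X \<odot>\<^bsub>VB U\<^esub> ob U i) : derivations CS U 0"
  using B.finsum_closed[OF f] by (simp add: ordinary_simps(2))
 fix j assume j: "j < p 0"
 have oU: "opn CS U" using U by (simp only: openin_CS)
 interpret R: ring "sec CS U" by (rule CS_ring[OF U])
 have jc: "C0.co U (Inl j) : sects CS U" using C0_co[OF U j] by (simp add: CS_simps)
 have "(ocoef U i X \<odot>\<^bsub>VB U\<^esub> ob U i) U (C0.co U (Inl j)) = (if j = i then ocoef U j X else \<zero>\<^bsub>sec CS U\<^esub>)" if "i < p 0" for i
  using ocoef_ob[OF U j that] ocoef_closed[OF U that X] smf_facts(6)[OF U ocoef_closed[OF U that X]]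
  by (auto simp: ordinary_simps rst_eq[OF oU subset_refl jc] ocoef_def CS_simps fun_eq_iff indicator_def)
 then have "(\<Oplus>\<^bsub>sec CS U\<^esub>i\<in>{..<p 0}. (ocoef U i X \<odot>\<^bsub>VB U\<^esub> ob U i) U (C0.co U (Inl j))) =
   (\<Oplus>\<^bsub>sec CS U\<^esub>i\<in>{..<p 0}. if j = i then ocoef U j X else \<zero>\<^bsub>sec CS U\<^esub>)"
  using ocoef_closed[OF U j X] by (intro R.finsum_cong') (auto simp: CS_simps smf_facts(4)[OF U])
 also have "\<dots> = ocoef U j X"
  by (rule R.finsum_singleton) (use j ocoef_closed[OF U _ X] in \<open>auto simp: CS_simps\<close>)
 finally show "ocoef U j X = ocoef U j (\<Oplus>\<^bsub>VB U\<^esub>i\<in>{..<p 0}. ocoef U i X \<odot>\<^bsub>VB U\<^esub> ob U i)"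
  unfolding ocoef_def
  by (subst endo_finsum[OF CS_algebra_sheaf VB_abelian_group[OF U] _ ordinary_simps(3,4) oU subset_refl jc _ f[unfolded ocoef_def]])
   (auto simp: ordinary_simps(2) derivationsD(1))
qed

lemma ob_res:
 assumes U: "dom U" and W: "dom W" "W \<subseteq> U" and i: "i < p 0"
 shows "rst CS W (ob U i) = ob W i"
proof (rule derivations_CS_eqI[OF W(1)])
 note D = ob_derivation[OF U, of i]
 show "rst CS W (ob U i) : derivations CS W 0" by (rule rst_derivations[OF CS_algebra_sheaf D W(2)])
 show "ob W i : derivations CS W 0" by (rule ob_derivation[OF W(1)])
 fix j assume j: "j < p 0"
 have "res CS U W (C0.co U (Inl j)) = C0.co W (Inl j)"
  using C0.co_res[of U W "Inl j"] U W j by (simp add: C0_dom idx_p0)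
 moreover have "ob U i W (res CS U W (C0.co U (Inl j))) = res CS U W (ob U i U (C0.co U (Inl j)))"
  using C0.dom_endoD(2)[OF derivationsD(1)[OF D], of U "C0.co U (Inl j)" W] U W C0_co[OF U j] by (simp add: C0_dom CS_simps)
 moreover have "rst CS W (ob U i) W (C0.co W (Inl j)) = ob U i W (C0.co W (Inl j))"
  by (rule rst_eq) (use W C0_co[OF W(1) j] in \<open>simp_all add: openin_CS CS_simps(2)\<close>)
 ultimately have "ocoef W j (rst CS W (ob U i)) = res CS U W (ocoef U j (ob U i))" by (simp add: ocoef_def)
 then show "ocoef W j (rst CS W (ob U i)) = ocoef W j (ob W i)"
  using W by (auto simp: ocoef_ob[OF U j i] ocoef_ob[OF W(1) j i] CS_simps fun_eq_iff indicator_def)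
qed

text \<open>Only the coefficients of \<open>e U f\<close> are prescribed; that e is additive,
  multiplicative and compatible with restriction follows by comparing them.\<close>

lemma ordinary_tensor_iso:
 fixes e :: "'x set => ('x => real) => 'a"
 assumes e: "!!U f. dom U ==> f : smf U ==> e U f : sects S U & Ps U (e U f) = Ps\<^sub>0 U f"
 shows "module_sheaf_iso (restrict_sheaf S V) (free_module_sheaf (restrict_sheaf S V) (map (%i. 0) [0..<p 0]))
  (tensor_sheaf (restrict_sheaf S V) (ordinary_tangent_sheaf CS) (%U. sects CS U) (%U a f. a \<otimes>\<^bsub>OS U\<^esub> e U f))"
proof (rule tensor_sheaf_iso[OF restrict_algebra_sheaf[OF S_alg V_open]],
  rule tensor_presheaf_iso[where b = ob and c = ocoef and \<rho> = "res CS"],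
  unfold restrict_sheaf_simps openin_restrict[OF V_open] dom_def[symmetric] ordinary_simps(2,7))
 have ec: "e U f : sects S U" and Pe: "Ps U (e U f) = fun_series (h ` U) (%y. f (inv_into V h y))" if "dom U" "f : smf U" for U f
  using e[OF that] by (simp_all add: Ps\<^sub>0_def)
 have eadd: "e U (%x. f x + g x) = e U f \<oplus>\<^bsub>OS U\<^esub> e U g" and emult: "e U (%x. f x * g x) = e U f \<otimes>\<^bsub>OS U\<^esub> e U g"
  if U: "dom U" and f: "f : smf U" and g: "g : smf U" for U f g
 proof -
  interpret ring "OS U" by (rule ringO[OF U])
  show "e U (%x. f x + g x) = e U f \<oplus>\<^bsub>OS U\<^esub> e U g"
   by (rule eqI[OF U]) (use smf_facts(1)[OF U f g] f g in \<open>simp_all add: ec[OF U] Pe[OF U] Psi_add[OF U], simp_all add: fun_series_def\<close>)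
  show "e U (%x. f x * g x) = e U f \<otimes>\<^bsub>OS U\<^esub> e U g"
  proof (rule eqI[OF U])
   fix m y assume y: "y : h ` U"
   have "series_mult p (Ps U (e U f)) (Ps U (e U g)) m y = f (inv_into V h y) * Ps U (e U g) m y"
    unfolding Pe[OF U f] by (rule series_mult_fun[OF y Psi_on[OF U ec[OF U g]]])
   then show "Ps U (e U (%x. f x * g x)) m y = Ps U (e U f \<otimes>\<^bsub>OS U\<^esub> e U g) m y"
    using smf_facts(2)[OF U f g] f g by (simp add: ec[OF U] Pe[OF U] Psi_mult[OF U]) (simp add: fun_series_def)
  qed (use smf_facts(2)[OF U f g] f g in \<open>simp_all add: ec[OF U]\<close>)
 qed
 have e0: "e U (%x. 0) = \<zero>\<^bsub>OS U\<^esub>" and e1: "e U (indicator U) = \<one>\<^bsub>OS U\<^esub>" if U: "dom U" for U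
 proof -
  interpret ring "OS U" by (rule ringO[OF U])
  show "e U (%x. 0) = \<zero>\<^bsub>OS U\<^esub>"
   by (rule eqI[OF U]) (use smf_facts(4)[OF U] in \<open>simp_all add: ec[OF U] Pe[OF U] Psi_zero[OF U], simp_all add: fun_series_def\<close>)
  show "e U (indicator U) = \<one>\<^bsub>OS U\<^esub>"
   by (rule eqI[OF U]) (use smf_facts(5)[OF U] inv_h_in[OF domD(2)[OF U]] in \<open>simp_all add: ec[OF U] Pe[OF U] Psi_one[OF U], simp_all add: fun_series_def\<close>)
 qed
 have eh: "e U f : hpart (OS U) 0" if "dom U" "f : smf U" for U f
  using that by (auto simp: Psi_hpart ec Pe fun_series_def fun_eq_iff)
 have CSc: "sects CS U = smf U" for U by (simp add: CS_simps)
 { fix U assume U: "dom U"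
  have oU: "opn CS U" using U by (simp only: openin_CS)
  note co = C0_co[OF U, folded CSc]
  show "tensor_basis (OS U) (VB U) (sects CS U) (%a f. a \<otimes>\<^bsub>OS U\<^esub> e U f) (p 0) (ob U) (ocoef U) (%i. 0)"
   unfolding CSc
  proof (rule tensor_basis.intro, unfold ordinary_simps(2,6))
   interpret ring "OS U" by (rule ringO[OF U])
   show "ring (OS U)" "abelian_group (VB U)" by (rule ring_axioms) (rule VB_abelian_group[OF U])
   show "additive_subgroup (hpart (OS U) k) (OS U)" for k
    by (rule formal_grading_subgroup[OF supercomm_algebraD(3)[OF alg[OF U]]])
   show "derivations CS U k \<subseteq> derivations CS U 0" for k
    using derivations_CS_zero[OF U, of _ k] derivations_zero[OF CS_algebra_sheaf, of U 0] by (cases "k = 0") auto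
   show "X = (\<Oplus>\<^bsub>VB U\<^esub>i\<in>{..<p 0}. ocoef U i X \<odot>\<^bsub>VB U\<^esub> ob U i)" if "X : derivations CS U 0" for X
    by (rule ordinary_expand[OF U that])
   show "ob U i : derivations CS U 0" for i by (rule ob_derivation[OF U])
   show "ob U i : derivations CS U 0" for i by (rule ob_derivation[OF U])
   show "r \<odot>\<^bsub>VB U\<^esub> X : derivations CS U 0" if "r : smf U" "X : derivations CS U 0" for r X
    by (rule VB_smult_closed[OF U that])
   show "ocoef U i X : smf U" if "i < p 0" "X : derivations CS U 0" for i X by (rule ocoef_closed[OF U that])
   show "a \<otimes>\<^bsub>OS U\<^esub> e U (ocoef U i X) : hpart (OS U) (k + l - 0)"
    if i: "i < p 0" and a: "a : hpart (OS U) k" and X: "X : derivations CS U l" for i a k X l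
   proof (cases "l = 0")
    case True
    then show ?thesis using supercomm_algebraD(6)[OF alg[OF U] a eh[OF U ocoef_closed[OF U i]]] X by simp
   next
    case False
    have "ocoef U i X = (%x. 0)"
     unfolding derivations_CS_zero[OF U X False] ocoef_def by (simp add: rst_eq[OF oU subset_refl co[OF i]] CS_simps)
    then show ?thesis
     using hpartD[OF U a] additive_subgroup.zero_closed[OF formal_grading_subgroup[OF supercomm_algebraD(3)[OF alg[OF U]]]]
     by (simp add: e0[OF U])
   qed
   fix a assume a: "a : sects S U"
   show "a \<otimes>\<^bsub>OS U\<^esub> e U r : sects S U" if "r : smf U" for r using a ec[OF U that] by simp
   show "(a \<oplus>\<^bsub>OS U\<^esub> a') \<otimes>\<^bsub>OS U\<^esub> e U r = a \<otimes>\<^bsub>OS U\<^esub> e U r \<oplus>\<^bsub>OS U\<^esub> a' \<otimes>\<^bsub>OS U\<^esub> e U r"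
    if "a' : sects S U" "r : smf U" for a' r using a that ec[OF U] by (simp add: l_distr)
   show "(f \<otimes>\<^bsub>OS U\<^esub> a) \<otimes>\<^bsub>OS U\<^esub> e U r = f \<otimes>\<^bsub>OS U\<^esub> (a \<otimes>\<^bsub>OS U\<^esub> e U r)"
    if "f : sects S U" "r : smf U" for f r using a that ec[OF U] by (simp add: m_assoc)
   show "a \<otimes>\<^bsub>OS U\<^esub> e U (ocoef U i (ob U j)) = (if i = j then a else \<zero>\<^bsub>OS U\<^esub>)" if "i < p 0" "j < p 0" for i j
    using a by (simp add: ocoef_ob[OF U that] e0[OF U] e1[OF U])
   fix i X assume i: "i < p 0" and X: "X : derivations CS U 0"
   show "a \<otimes>\<^bsub>OS U\<^esub> e U (ocoef U i (X \<oplus>\<^bsub>VB U\<^esub> Y)) = a \<otimes>\<^bsub>OS U\<^esub> e U (ocoef U i X) \<oplus>\<^bsub>OS U\<^esub> a \<otimes>\<^bsub>OS U\<^esub> e U (ocoef U i Y)"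
    if Y: "Y : derivations CS U 0" for Y
   proof -
    have "ocoef U i (X \<oplus>\<^bsub>VB U\<^esub> Y) = (%x. ocoef U i X x + ocoef U i Y x)"
     by (simp add: ocoef_def ordinary_simps rst_eq[OF oU subset_refl co[OF i]] CS_simps)
    then show ?thesis using a ocoef_closed[OF U i X] ocoef_closed[OF U i Y] ec[OF U] by (simp add: eadd[OF U] r_distr)
   qed
   show "a \<otimes>\<^bsub>OS U\<^esub> e U (ocoef U i (r \<odot>\<^bsub>VB U\<^esub> X)) = a \<otimes>\<^bsub>OS U\<^esub> e U r \<otimes>\<^bsub>OS U\<^esub> e U (ocoef U i X)" if r: "r : smf U" for r
   proof -
    have "ocoef U i (r \<odot>\<^bsub>VB U\<^esub> X) = (%x. r x * ocoef U i X x)"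
     using smf_facts(6)[OF U r] by (auto simp: ocoef_def ordinary_simps rst_eq[OF oU subset_refl co[OF i]] CS_simps fun_eq_iff)
    then show ?thesis using a r ocoef_closed[OF U i X] ec[OF U] by (simp add: emult[OF U] m_assoc)
   qed
  qed }
 show "is_presheaf (restrict_sheaf S V)" by (rule algebra_sheafD(2)[OF restrict_algebra_sheaf[OF S_alg V_open]])
 fix U W assume UW: "dom U" "dom W" "W \<subseteq> U"
 have oUW: "opn CS U" "opn CS W" using UW by (simp_all only: openin_CS)
 show "rst CS W (ob U i) = ob W i" if "i < p 0" for i by (rule ob_res[OF UW that])
 show "res CS U W r : sects CS W" if "r : sects CS U" for r
  using smf_res[OF UW] that by (simp add: CS_simps)
 show "res S U W (a \<otimes>\<^bsub>OS U\<^esub> e U r) = res S U W a \<otimes>\<^bsub>OS W\<^esub> e W (res CS U W r)"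
  if r: "r : sects CS U" and a: "a : sects S U" for r a
 proof -
  have rs: "r : smf U" "res CS U W r : smf W" using r smf_res[OF UW] by (simp_all add: CS_simps)
  have "res S U W (e U r) = e W (res CS U W r)"
  proof (rule eqI[OF UW(2) res_closed[OF UW ec[OF UW(1) rs(1)]] ec[OF UW(2) rs(2)]])
   fix m y assume y: "y : h ` W"
   then have "y : h ` U" using UW by blast
   then show "Ps W (res S U W (e U r)) m y = Ps W (e W (res CS U W r)) m y"
    using y inv_h_in[OF domD(2)[OF UW(2)] y] by (simp add: Psi_res[OF UW ec[OF UW(1) rs(1)]] Pe[OF UW(1) rs(1)] Pe[OF UW(2) rs(2), unfolded CS_simps(9)] fun_series_def CS_simps(9))
  qed
  then show ?thesis using ring_hom_mult[OF res_hom[OF UW] a ec[OF UW(1) rs(1)]] by simp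
 qed
 fix X assume X: "X : derivations CS U 0"
 show "rst CS W X : derivations CS W 0" by (rule rst_derivations[OF CS_algebra_sheaf X UW(3)])
 show "rst CS W (X \<oplus>\<^bsub>VB U\<^esub> Y) = rst CS W X \<oplus>\<^bsub>VB W\<^esub> rst CS W Y" for Y
  unfolding ordinary_simps by (rule rst_cong) (use UW(3) in \<open>simp add: rst_eq order_trans\<close>)
 show "rst CS W (r \<odot>\<^bsub>VB U\<^esub> X) = res CS U W r \<odot>\<^bsub>VB W\<^esub> rst CS W X" if r: "r : sects CS U" for r
  unfolding ordinary_simps
  by (rule rst_cong) (use UW(3) in \<open>simp add: rst_eq order_trans presheafD(5)[OF algebra_sheafD(2)[OF CS_algebra_sheaf] oUW _ _ UW(3) r]\<close>)
qed

end

subsection \<open>The dual of the space of generators\<close>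

lemma vs_simps:
 "carrier (graded_vs p) = {v. finite {a. v a ~= 0} & {a. v a ~= 0} \<subseteq> gens p}"
 "ring.add (graded_vs p) = (%v w a. v a + w a)" "smult (graded_vs p) = (%r v a. r * v a)"
 "hpart (graded_vs p) j = {v. {a. v a ~= 0} \<subseteq> {a : gens p. fst a = j}}"
 by (simp_all add: graded_vs_def)

abbreviation "Wd p \<equiv> graded_dual (graded_vs p)"

lemma dual_simps:
 "carrier (Wd p) = {\<xi>. (\<forall>v. v \<notin> carrier (graded_vs p) --> \<xi> v = 0) \<and>
   (\<forall>v\<in>carrier (graded_vs p). \<forall>w\<in>carrier (graded_vs p). \<xi> (%a. v a + w a) = \<xi> v + \<xi> w) \<and>
   (\<forall>r. \<forall>v\<in>carrier (graded_vs p). \<xi> (%a. r * v a) = r * \<xi> v) \<and>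
   finite {j. \<exists>v\<in>hpart (graded_vs p) j. \<xi> v ~= 0}}"
 "ring.zero (Wd p) = (%v. 0)" "ring.add (Wd p) = (%\<xi> \<eta> v. \<xi> v + \<eta> v)" "smult (Wd p) = (%r \<xi> v. r * \<xi> v)"
 "hpart (Wd p) k = {\<xi> : carrier (Wd p). \<forall>j. j ~= - k --> (\<forall>v\<in>hpart (graded_vs p) j. \<xi> v = 0)}"
 by (simp_all add: graded_dual_def Let_def vs_simps(2,3))

definition unit_vec :: "gen => gen => real" where
 "unit_vec a = (%b. if b = a then 1 else 0)"

text \<open>The dual basis; functionals in \<open>graded_dual\<close> vanish outside the space,
  whence the case distinction.\<close>

definition dual_vec :: "(int => nat) => gen => (gen => real) => real" where
 "dual_vec p a = (%v. if v : carrier (graded_vs p) then v a else 0)"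

lemma unit_vec_hpart: "a : gens p ==> unit_vec a : hpart (graded_vs p) (fst a)"
 by (auto simp: vs_simps unit_vec_def)

text \<open>With finitely many generators the finiteness of the support is automatic.\<close>

lemma vs_carrier_iff:
 assumes "finite (gens p)"
 shows "v : carrier (graded_vs p) \<longleftrightarrow> (\<forall>a. a \<notin> gens p --> v a = 0)"
proof -
 have "v : carrier (graded_vs p) \<longleftrightarrow> {a. v a ~= 0} \<subseteq> gens p"
  unfolding vs_simps using finite_subset[OF _ assms, of "{a. v a ~= 0}"] by blast
 then show ?thesis by blast
qed

lemma hpart_vs_carrier: "finite (gens p) ==> v : hpart (graded_vs p) j ==> v : carrier (graded_vs p)"
 by (auto simp: vs_carrier_iff vs_simps(4))

lemma vs_closed:
 assumes "finite (gens p)"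
 shows "v : carrier (graded_vs p) ==> w : carrier (graded_vs p) ==> (%a. v a + w a) : carrier (graded_vs p)"
  "v : carrier (graded_vs p) ==> (%a. r * v a) : carrier (graded_vs p)"
 by (simp_all add: vs_carrier_iff[OF assms])

lemma dual_vec_hpart:
 assumes fin: "finite (gens p)"
 shows "dual_vec p a : hpart (Wd p) (- fst a)"
proof -
 have z: "dual_vec p a v = 0" if "v : hpart (graded_vs p) j" "j ~= fst a" for v j
  using that by (auto simp: dual_vec_def vs_simps)
 then have "{j. \<exists>v\<in>hpart (graded_vs p) j. dual_vec p a v ~= 0} \<subseteq> {fst a}" by blast
 from finite_subset[OF this] have f: "finite {j. \<exists>v\<in>hpart (graded_vs p) j. dual_vec p a v ~= 0}" by simp
 have "dual_vec p a : carrier (Wd p)"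
  unfolding dual_simps
  by (intro CollectI conjI allI ballI impI f) (simp_all add: dual_vec_def vs_closed[OF fin])
 then show ?thesis unfolding dual_simps(5) using z by simp
qed

lemma dual_closed:
 assumes fin: "finite (gens p)"
 shows "(%v. 0) : carrier (Wd p)" "\<xi> : carrier (Wd p) ==> \<eta> : carrier (Wd p) ==> (%v. \<xi> v + \<eta> v) : carrier (Wd p)"
  "\<xi> : carrier (Wd p) ==> (%v. r * \<xi> v) : carrier (Wd p)"
proof -
 show "(%v. 0) : carrier (Wd p)" by (simp add: dual_simps)
 assume x: "\<xi> : carrier (Wd p)"
 have "finite {j. \<exists>v\<in>hpart (graded_vs p) j. r * \<xi> v ~= 0}"
  by (rule finite_subset[of _ "{j. \<exists>v\<in>hpart (graded_vs p) j. \<xi> v ~= 0}"]) (use x in \<open>auto simp: dual_simps(1)\<close>)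
 then show "(%v. r * \<xi> v) : carrier (Wd p)" using x by (simp add: dual_simps(1) algebra_simps)
 assume y: "\<eta> : carrier (Wd p)"
 have "finite {j. \<exists>v\<in>hpart (graded_vs p) j. \<xi> v + \<eta> v ~= 0}"
  by (rule finite_subset[of _ "{j. \<exists>v\<in>hpart (graded_vs p) j. \<xi> v ~= 0} \<union> {j. \<exists>v\<in>hpart (graded_vs p) j. \<eta> v ~= 0}"])
   (use x y in \<open>auto simp: dual_simps(1)\<close>)
 then show "(%v. \<xi> v + \<eta> v) : carrier (Wd p)" using x y by (simp add: dual_simps(1) algebra_simps)
qed

lemma dual_abelian_group:
 assumes fin: "finite (gens p)"
 shows "abelian_group (Wd p)"
proof (rule abelian_groupI, unfold dual_simps(2,3))
 show "\<exists>\<eta>\<in>carrier (Wd p). (%v. \<eta> v + \<xi> v) = (%v. 0)" if "\<xi> : carrier (Wd p)" for \<xi>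
  using dual_closed(3)[OF fin that, of "-1"] by (intro bexI[of _ "%v. - 1 * \<xi> v"]) auto
qed (use dual_closed[OF fin] in \<open>auto simp: fun_eq_iff algebra_simps\<close>)

lemma dual_expand:
 assumes fin: "finite (gens p)" and x: "\<xi> : carrier (Wd p)" and v: "v : carrier (graded_vs p)"
 shows "\<xi> v = (\<Sum>a\<in>gens p. \<xi> (unit_vec a) * v a)"
proof -
 have uv: "(%b. v a * unit_vec a b) : carrier (graded_vs p)" "unit_vec a : carrier (graded_vs p)" if "a : gens p" for a
  using hpart_vs_carrier[OF fin unit_vec_hpart[OF that]] vs_closed(2)[OF fin] by blast+
 have lin: "\<xi> (%a. v a + w a) = \<xi> v + \<xi> w" "\<xi> (%a. r * v a) = r * \<xi> v"
  if "v : carrier (graded_vs p)" "w : carrier (graded_vs p)" for v w r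
  using x that by (simp_all add: dual_simps(1))
 have z: "(%b. 0) : carrier (graded_vs p)" by (simp add: vs_simps)
 \<comment> \<open>Linearity is given for two summands within the space, hence the induction over
   subsets of the generators with membership of the partial sums carried along.\<close>
 have "(%b. \<Sum>a\<in>J. v a * unit_vec a b) : carrier (graded_vs p) \<and>
   \<xi> (%b. \<Sum>a\<in>J. v a * unit_vec a b) = (\<Sum>a\<in>J. \<xi> (unit_vec a) * v a)" if "finite J" "J \<subseteq> gens p" for J
  using that
 proof (induction J)
  case empty
  show ?case using lin(2)[OF z z, of 0] z by simp
 next
  case (insert a J)
  then have a: "a : gens p" and J: "(%b. \<Sum>a\<in>J. v a * unit_vec a b) : carrier (graded_vs p)"
   "\<xi> (%b. \<Sum>a\<in>J. v a * unit_vec a b) = (\<Sum>a\<in>J. \<xi> (unit_vec a) * v a)" by auto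
  show ?case
   using insert(1,2) J vs_closed(1)[OF fin uv(1)[OF a] J(1)] lin(1)[OF uv(1)[OF a] J(1)] lin(2)[OF uv(2)[OF a] uv(2)[OF a], of "v a"]
   by (simp add: mult.commute)
 qed
 from this[OF fin subset_refl] have "\<xi> (%b. \<Sum>a\<in>gens p. v a * unit_vec a b) = (\<Sum>a\<in>gens p. \<xi> (unit_vec a) * v a)" ..
 moreover have "(%b. \<Sum>a\<in>gens p. v a * unit_vec a b) = v"
 proof
  fix b
  have "(\<Sum>a\<in>gens p. v a * unit_vec a b) = (\<Sum>a\<in>gens p. if a = b then v a else 0)"
   by (intro sum.cong) (auto simp: unit_vec_def)
  also have "\<dots> = v b" using fin v by (auto simp: sum.delta vs_simps)
  finally show "(\<Sum>a\<in>gens p. v a * unit_vec a b) = v b" .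
 qed
 ultimately show ?thesis by simp
qed

lemma dual_finsum:
 assumes fin: "finite (gens p)" and "finite I" "X : I \<rightarrow> carrier (Wd p)"
 shows "(\<Oplus>\<^bsub>Wd p\<^esub>i\<in>I. X i) = (%v. \<Sum>i\<in>I. X i v)"
proof -
 interpret abelian_group "Wd p" by (rule dual_abelian_group[OF fin])
 from assms(2,3) show ?thesis
 proof (induction I)
  case (insert j I)
  then have "(\<Oplus>\<^bsub>Wd p\<^esub>i\<in>insert j I. X i) = X j \<oplus>\<^bsub>Wd p\<^esub> (\<Oplus>\<^bsub>Wd p\<^esub>i\<in>I. X i)" by (intro finsum_insert) auto
  then show ?case using insert by (simp add: dual_simps(3))
 qed (simp add: dual_simps(2))
qed

context mfd_chart
begin

lemma constant_simps:
 "base (constant_presheaf X A) = X" "sec (constant_presheaf X A) U = A" "res (constant_presheaf X A) U W = (%a. a)"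
 by (simp_all add: constant_presheaf_def)

lemma dual_tensor_iso:
 assumes gl: "distinct gl" "set gl = gens p"
 shows "module_sheaf_iso (restrict_sheaf S V) (free_module_sheaf (restrict_sheaf S V) (map (%i. - fst (gl ! i)) [0..<length gl]))
  (tensor_sheaf (restrict_sheaf S V) (constant_presheaf (subtopology (base S) V) (Wd p)) (%U. UNIV) (%U a r. r \<odot>\<^bsub>OS U\<^esub> a))"
proof (rule tensor_sheaf_iso[OF restrict_algebra_sheaf[OF S_alg V_open]],
  rule tensor_presheaf_iso[where b = "%U i. dual_vec p (gl ! i)" and c = "%U i \<xi>. \<xi> (unit_vec (gl ! i))" and \<rho> = "%U W r. r"],
  unfold restrict_sheaf_simps openin_restrict[OF V_open] dom_def[symmetric] constant_simps)
 have g: "gl ! i : gens p" if "i < length gl" for i using nth_mem[OF that] unfolding gl(2) .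
 note uc = hpart_vs_carrier[OF fin unit_vec_hpart]
 { fix U assume U: "dom U"
  show "tensor_basis (OS U) (Wd p) UNIV (%a r. r \<odot>\<^bsub>OS U\<^esub> a) (length gl) (%i. dual_vec p (gl ! i))
    (%i \<xi>. \<xi> (unit_vec (gl ! i))) (%i. - fst (gl ! i))"
  proof (rule tensor_basis.intro)
   interpret ring "OS U" by (rule ringO[OF U])
   interpret mo: module real_ring "OS U" by (rule supercomm_algebraD(2)[OF alg[OF U]])
   note sc = supercomm_smult_closed[OF alg[OF U]]
   have sm: "(r * s) \<odot>\<^bsub>OS U\<^esub> a = r \<odot>\<^bsub>OS U\<^esub> (s \<odot>\<^bsub>OS U\<^esub> a)" "(r + s) \<odot>\<^bsub>OS U\<^esub> a = r \<odot>\<^bsub>OS U\<^esub> a \<oplus>\<^bsub>OS U\<^esub> s \<odot>\<^bsub>OS U\<^esub> a"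
    "1 \<odot>\<^bsub>OS U\<^esub> a = a" "0 \<odot>\<^bsub>OS U\<^esub> a = \<zero>\<^bsub>OS U\<^esub>" if "a : sects S U" for a r s
    using that mo.smult_assoc1[of r s a] mo.smult_l_distr[of r s a] mo.smult_one[of a] mo.smult_l_null[of a] by (simp_all add: real_ring_def)
   show "ring (OS U)" "abelian_group (Wd p)" by (rule ring_axioms) (rule dual_abelian_group[OF fin])
   show "additive_subgroup (hpart (OS U) k) (OS U)" for k
    by (rule formal_grading_subgroup[OF supercomm_algebraD(3)[OF alg[OF U]]])
   show "hpart (Wd p) k \<subseteq> carrier (Wd p)" for k by (auto simp: dual_simps(5))
   show h: "dual_vec p (gl ! i) : hpart (Wd p) (- fst (gl ! i))" for i by (rule dual_vec_hpart[OF fin])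
   then show "dual_vec p (gl ! i) : carrier (Wd p)" for i unfolding dual_simps(5) by blast
   then have dc: "dual_vec p (gl ! i) : carrier (Wd p)" for i .
   show "r \<odot>\<^bsub>Wd p\<^esub> \<xi> : carrier (Wd p)" if "\<xi> : carrier (Wd p)" for r \<xi>
    unfolding dual_simps(4) by (rule dual_closed(3)[OF fin that])
   then have rc: "r \<odot>\<^bsub>Wd p\<^esub> \<xi> : carrier (Wd p)" if "\<xi> : carrier (Wd p)" for r \<xi> using that .
   show "\<xi> = (\<Oplus>\<^bsub>Wd p\<^esub>i\<in>{..<length gl}. \<xi> (unit_vec (gl ! i)) \<odot>\<^bsub>Wd p\<^esub> dual_vec p (gl ! i))" if x: "\<xi> : carrier (Wd p)" for \<xi>
   proof -
    have "(\<Oplus>\<^bsub>Wd p\<^esub>i\<in>{..<length gl}. \<xi> (unit_vec (gl ! i)) \<odot>\<^bsub>Wd p\<^esub> dual_vec p (gl ! i)) =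
      (%v. \<Sum>i<length gl. \<xi> (unit_vec (gl ! i)) * dual_vec p (gl ! i) v)"
     by (subst dual_finsum[OF fin]) (use rc[OF dc] in \<open>simp_all add: dual_simps(4)\<close>)
    also have "\<dots> = \<xi>"
    proof
     fix v
     show "(\<Sum>i<length gl. \<xi> (unit_vec (gl ! i)) * dual_vec p (gl ! i) v) = \<xi> v"
     proof (cases "v : carrier (graded_vs p)")
      case True
      have "(\<Sum>i<length gl. \<xi> (unit_vec (gl ! i)) * v (gl ! i)) = (\<Sum>a\<in>gens p. \<xi> (unit_vec a) * v a)"
       unfolding gl(2)[symmetric] by (rule sum.reindex_bij_betw) (rule bij_betw_nth[OF gl(1) refl refl])
      then show ?thesis using dual_expand[OF fin x True] True by (simp add: dual_vec_def)
     next
      case False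
      then show ?thesis using x by (simp add: dual_vec_def dual_simps(1))
     qed
    qed
    finally show ?thesis by simp
   qed
   show "\<xi> (unit_vec (gl ! i)) \<odot>\<^bsub>OS U\<^esub> a : hpart (OS U) (k + l - - fst (gl ! i))"
    if i: "i < length gl" and a: "a : hpart (OS U) k" and x: "\<xi> : hpart (Wd p) l" for i a k \<xi> l
   proof (cases "fst (gl ! i) = - l")
    case True
    then show ?thesis using supercomm_algebraD(4)[OF alg[OF U] a] by simp
   next
    case False
    then have "\<xi> (unit_vec (gl ! i)) = 0" using x unit_vec_hpart[OF g[OF i]] unfolding dual_simps(5) by blast
    then show ?thesis
     using sm(4)[OF hpartD[OF U a]] additive_subgroup.zero_closed[OF formal_grading_subgroup[OF supercomm_algebraD(3)[OF alg[OF U]]]]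
     by simp
   qed
   fix a assume a: "a : sects S U"
   show "r \<odot>\<^bsub>OS U\<^esub> a : sects S U" for r by (rule sc[OF a])
   show "r \<odot>\<^bsub>OS U\<^esub> (a \<oplus>\<^bsub>OS U\<^esub> a') = r \<odot>\<^bsub>OS U\<^esub> a \<oplus>\<^bsub>OS U\<^esub> r \<odot>\<^bsub>OS U\<^esub> a'" if "a' : sects S U" for a' r
    using mo.smult_r_distr[of r a a'] a that by (simp add: real_ring_def)
   show "r \<odot>\<^bsub>OS U\<^esub> (f \<otimes>\<^bsub>OS U\<^esub> a) = f \<otimes>\<^bsub>OS U\<^esub> (r \<odot>\<^bsub>OS U\<^esub> a)" if "f : sects S U" for f r
    using alg[OF U] a that unfolding supercomm_algebra_def by metis
   show "dual_vec p (gl ! j) (unit_vec (gl ! i)) \<odot>\<^bsub>OS U\<^esub> a = (if i = j then a else \<zero>\<^bsub>OS U\<^esub>)" if "i < length gl" "j < length gl" for i j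
    using uc[OF g[OF that(1)]] sm(3,4)[OF a] nth_eq_iff_index_eq[OF gl(1) that] by (auto simp: dual_vec_def unit_vec_def)
   fix i \<xi> assume x: "\<xi> : carrier (Wd p)"
   show "(\<xi> \<oplus>\<^bsub>Wd p\<^esub> \<eta>) (unit_vec (gl ! i)) \<odot>\<^bsub>OS U\<^esub> a = \<xi> (unit_vec (gl ! i)) \<odot>\<^bsub>OS U\<^esub> a \<oplus>\<^bsub>OS U\<^esub> \<eta> (unit_vec (gl ! i)) \<odot>\<^bsub>OS U\<^esub> a" for \<eta>
    by (simp add: dual_simps(3) sm(2)[OF a])
   show "(r \<odot>\<^bsub>Wd p\<^esub> \<xi>) (unit_vec (gl ! i)) \<odot>\<^bsub>OS U\<^esub> a = \<xi> (unit_vec (gl ! i)) \<odot>\<^bsub>OS U\<^esub> (r \<odot>\<^bsub>OS U\<^esub> a)" for r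
    using sm(1)[OF a, of "\<xi> (unit_vec (gl ! i))" r] by (simp add: dual_simps(4) mult.commute)
  qed simp_all }
 show "is_presheaf (restrict_sheaf S V)" by (rule algebra_sheafD(2)[OF restrict_algebra_sheaf[OF S_alg V_open]])
qed (use res_smult in simp_all)

text \<open>The hypothesis T and the two tensor products supply free modules on the same list of
  degrees, through which the isomorphism is composed.\<close>

lemma tangent_split:
 assumes T: "!!xs. distinct xs ==> set xs = idx p ==> module_sheaf_iso (restrict_sheaf S V) F
   (free_module_sheaf (restrict_sheaf S V) (map (%ii. - dg ii) xs))"
  and H: "!!U s. opn S U ==> U \<subseteq> V ==> s : series_on p (h ` U) ==>
   H (h ` U) s : sects S U & Ps U (H (h ` U) s) = s"
 shows "module_sheaf_iso (restrict_sheaf S V) F (split_tangent_sheaf p S V h H)"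
proof -
 obtain gl where gl: "distinct gl" "set gl = gens p" using finite_distinct_list[OF fin] by blast
 \<comment> \<open>Degree-zero coordinates first: the list of degrees is then the concatenation of
   those of the two tensor products.\<close>
 define xs :: "idx list" where "xs = map Inl [0..<p 0] @ map Inr gl"
 have xs: "distinct xs" "set xs = idx p"
  using gl by (auto simp: xs_def idx_def distinct_map)
 have "map (%ii. - dg ii) xs = map (%i. 0) [0..<p 0] @ map (%a. - fst a) gl" by (simp add: xs_def o_def)
 also have "map (%a. - fst a) gl = map (%i. - fst (gl ! i)) [0..<length gl]" by (rule nth_equalityI) simp_all
 finally have ds: "map (%ii. - dg ii) xs = map (%i. 0) [0..<p 0] @ map (%i. - fst (gl ! i)) [0..<length gl]" .
 have e: "smooth_embed V h H U f : sects S U & Ps U (smooth_embed V h H U f) = Ps\<^sub>0 U f" if U: "dom U" and f: "f : smf U" for U f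
  unfolding smooth_embed_def Ps\<^sub>0_def
  by (rule H[OF domD[OF U] fun_series_on[where p = p, OF img_open[OF U]]]) (use f in \<open>simp add: smf_def\<close>)
 show ?thesis
  unfolding split_tangent_sheaf_def
  by (rule module_sheaf_iso_trans[OF T[OF xs, unfolded ds] direct_sum_iso[OF ordinary_tensor_iso[of "smooth_embed V h H", OF e] dual_tensor_iso[OF gl]]])
qed

end

section \<open>Coordinates\<close>

lemma series_mult_fun_right:
 assumes "y : U" "s : series_on p U"
 shows "series_mult p s (fun_series U f) m y = s m y * f y"
proof (cases "m : monomials p")
 case True
 have "series_mult p s (fun_series U f) m y =
   (\<Sum>(x, z)\<in>{(m, {#})}. multisign x z * s x y * fun_series U f z y)"
  unfolding series_mult_splits[OF True]
  by (rule sum.mono_neutral_right[OF finite_splits]) (auto simp: splits_def fun_series_def split: if_splits)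
 then show ?thesis using assms by (simp add: fun_series_def)
qed (use assms series_onD in \<open>auto simp: series_mult_def\<close>)

subsection \<open>Frames\<close>

text \<open>The Jacobian matrix of the sections \<open>\<kappa> \<iota>\<close> has entries \<open>J\<close>, which are functions of the degree-zero
  coordinates, and \<open>\<alpha>\<close> is its inverse.\<close>

locale frame = mfd_chart S V p h Ps
 for S :: "('x, real, 'a) gpresheaf" and V :: "'x set" and p :: "int => nat"
  and h :: "'x => nat => real" and Ps :: "'x set => 'a => series" +
 fixes \<kappa> :: "idx => 'a" and J \<alpha> :: "idx => idx => (nat => real) => real"
 assumes \<kappa>: "ii : idx p ==> \<kappa> ii : sects S V"
  and J: "\<nu> : idx p ==> ii : idx p ==> dd \<nu> (h ` V) (Ps V (\<kappa> ii)) = fun_series (h ` V) (J \<nu> ii)"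
  and \<alpha>_smooth: "ii : idx p ==> \<nu> : idx p ==> smooth_fun_on (p 0) (h ` V) (\<alpha> ii \<nu>)"
  and \<alpha>_degree: "dg ii ~= dg \<nu> ==> \<alpha> ii \<nu> = (%y. 0)"
  and \<alpha>J: "ii : idx p ==> ii' : idx p ==> y : h ` V ==> (\<Sum>\<nu>\<in>idx p. \<alpha> ii \<nu> y * J \<nu> ii' y) = (if ii = ii' then 1 else 0)"
  and J\<alpha>: "\<nu> : idx p ==> \<nu>' : idx p ==> y : h ` V ==> (\<Sum>ii\<in>idx p. J \<nu> ii y * \<alpha> ii \<nu>' y) = (if \<nu> = \<nu>' then 1 else 0)"
begin

text \<open>The Jacobian entries are functions without generators, so multiplication by them acts on
  each coefficient separately.\<close>

lemma LC_\<kappa>: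
 assumes c: "!!\<nu>. \<nu> : idx p ==> c \<nu> : sects S V" and i: "ii : idx p" and y: "y : h ` V"
 shows "Ps V (LC V c V (\<kappa> ii)) m y = (\<Sum>\<nu>\<in>idx p. Ps V (c \<nu>) m y * J \<nu> ii y)"
proof -
 have "series_mult p (Ps V (c \<nu>)) (Ps V (pd \<nu> V (\<kappa> ii))) m y = Ps V (c \<nu>) m y * J \<nu> ii y" if "\<nu> : idx p" for \<nu>
  using series_mult_fun_right[OF y Psi_on[OF dom_V c[OF that]]] by (simp add: Psi_pd[OF dom_V that \<kappa>[OF i]] J[OF that i])
 then show ?thesis by (subst Psi_LC[OF dom_V dom_V subset_refl \<kappa>[OF i] c y]) simp_all
qed

text \<open>The values on the sections \<kappa> arise from those on the coordinates by
  multiplication with J; multiplying with \<alpha> recovers the latter, which determine the vector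
  field.\<close>

lemma vector_fields_eqI:
 assumes X: "X : vector_fields S V" and Y: "Y : vector_fields S V" and eq: "!!ii. ii : idx p ==> X V (\<kappa> ii) = Y V (\<kappa> ii)"
 shows "X = Y"
proof -
 have ve: "Z : sheaf_endo S V" if "Z : vector_fields S V" for Z using that by (simp add: vector_fields_iff)
 note Xc = vf_endo_closed[OF ve[OF X] dom_V] and Yc = vf_endo_closed[OF ve[OF Y] dom_V]
 have rec: "Ps V (Z V (co V \<nu>)) m y = (\<Sum>ii\<in>idx p. Ps V (Z V (\<kappa> ii)) m y * \<alpha> ii \<nu> y)"
  if Z: "Z : vector_fields S V" and n: "\<nu> : idx p" and y: "y : h ` V" for Z \<nu> m y
 proof -
  note Zc = vf_endo_closed[OF ve[OF Z] dom_V]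
  have "(\<Sum>ii\<in>idx p. Ps V (Z V (\<kappa> ii)) m y * \<alpha> ii \<nu> y) =
    (\<Sum>ii\<in>idx p. (\<Sum>\<nu>'\<in>idx p. Ps V (Z V (co V \<nu>')) m y * J \<nu>' ii y) * \<alpha> ii \<nu> y)"
  proof (intro sum.cong refl)
   fix ii assume "ii : idx p"
   from LC_\<kappa>[of "%\<nu>. Z V (co V \<nu>)", OF Zc this y]
   show "Ps V (Z V (\<kappa> ii)) m y * \<alpha> ii \<nu> y = (\<Sum>\<nu>'\<in>idx p. Ps V (Z V (co V \<nu>')) m y * J \<nu>' ii y) * \<alpha> ii \<nu> y"
    unfolding vector_fields_LC[OF dom_V Z, symmetric] by simp
  qed
  also have "\<dots> = (\<Sum>\<nu>'\<in>idx p. Ps V (Z V (co V \<nu>')) m y * (\<Sum>ii\<in>idx p. J \<nu>' ii y * \<alpha> ii \<nu> y))"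
   unfolding sum_distrib_right sum_distrib_left mult.assoc by (rule sum.swap)
  also have "\<dots> = (\<Sum>\<nu>'\<in>idx p. if \<nu>' = \<nu> then Ps V (Z V (co V \<nu>')) m y else 0)"
   by (intro sum.cong refl) (simp add: J\<alpha>[OF _ n y])
  also have "\<dots> = Ps V (Z V (co V \<nu>)) m y" using n finite_idx[OF fin] by simp
  finally show ?thesis by simp
 qed
 have "X V (co V \<nu>) = Y V (co V \<nu>)" if n: "\<nu> : idx p" for \<nu>
  by (rule eqI[OF dom_V Xc[OF n] Yc[OF n]]) (simp add: rec[OF X n] rec[OF Y n] eq)
 then have "LC V (%ii. X V (co V ii)) = LC V (%ii. Y V (co V ii))" by (intro LC_cong[OF dom_V] Yc)
 then show ?thesis by (simp only: vector_fields_LC[OF dom_V X, symmetric] vector_fields_LC[OF dom_V Y, symmetric])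
qed

text \<open>The partial derivative along \<open>\<kappa> ii\<close>, with the row \<open>ii\<close>
  of the inverse Jacobian matrix as coefficients.\<close>

definition frame_derivation :: "idx => 'x set => 'a => 'a" where
 "frame_derivation ii = LC V (%\<nu>. sect V (fun_series (h ` V) (\<alpha> ii \<nu>)))"

text \<open>\<open>\<alpha>_degree\<close> makes the combination homogeneous; its values on \<kappa>
  are the entries of the product of \<alpha> and J.\<close>

lemma frame_derivation:
 assumes i: "ii : idx p"
 shows "frame_derivation ii : derivations S V (- dg ii)"
  "ii' : idx p ==> frame_derivation ii V (\<kappa> ii') = (if ii = ii' then \<one>\<^bsub>OS V\<^esub> else \<zero>\<^bsub>OS V\<^esub>)"
proof -
 interpret ring "OS V" by (rule ringO[OF dom_V])
 let ?c = "%\<nu>. sect V (fun_series (h ` V) (\<alpha> ii \<nu>))"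
 have on: "fun_series (h ` V) (\<alpha> ii \<nu>) : series_on p (h ` V)" if "\<nu> : idx p" for \<nu>
  by (rule fun_series_on[where p = p, OF img_open[OF dom_V] \<alpha>_smooth[OF i that]])
 note cc = sect_closed[OF dom_V on] and Pc = Psi_sect[OF dom_V on]
 have "?c \<nu> : hpart (OS V) (- dg ii + dg \<nu>)" if "\<nu> : idx p" for \<nu>
  unfolding Psi_hpart[OF dom_V cc[OF that]] Pc[OF that]
  using \<alpha>_degree[of ii \<nu>] by (auto simp: fun_series_def fun_eq_iff)
 then show D: "frame_derivation ii : derivations S V (- dg ii)"
  unfolding frame_derivation_def by (rule LC_derivations[OF dom_V])
 assume i': "ii' : idx p"
 show "frame_derivation ii V (\<kappa> ii') = (if ii = ii' then \<one>\<^bsub>OS V\<^esub> else \<zero>\<^bsub>OS V\<^esub>)"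
 proof (rule eqI[OF dom_V dom_endoD(1)[OF derivationsD(1)[OF D] dom_V dom_V subset_refl \<kappa>[OF i']]])
  fix m y assume y: "y : h ` V"
  have "Ps V (frame_derivation ii V (\<kappa> ii')) m y = (\<Sum>\<nu>\<in>idx p. fun_series (h ` V) (\<alpha> ii \<nu>) m y * J \<nu> ii' y)"
   unfolding frame_derivation_def by (subst LC_\<kappa>[OF cc i' y]) (simp_all add: Pc)
  also have "\<dots> = (if m = {#} then \<Sum>\<nu>\<in>idx p. \<alpha> ii \<nu> y * J \<nu> ii' y else 0)" using y by (simp add: fun_series_def)
  also have "\<dots> = Ps V (if ii = ii' then \<one>\<^bsub>OS V\<^esub> else \<zero>\<^bsub>OS V\<^esub>) m y"
   using y by (simp add: \<alpha>J[OF i i' y] Psi_one[OF dom_V] Psi_zero[OF dom_V] fun_series_def)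
  finally show "Ps V (frame_derivation ii V (\<kappa> ii')) m y = Ps V (if ii = ii' then \<one>\<^bsub>OS V\<^esub> else \<zero>\<^bsub>OS V\<^esub>) m y" .
 qed simp
qed

end

subsection \<open>Coordinate changes\<close>

text \<open>The chain rule applied to \<open>T \<circ> T\<^sup>-\<^sup>1\<close> and \<open>T\<^sup>-\<^sup>1 \<circ> T\<close> shows that the Jacobian matrices of \<open>T\<close> and
  \<open>T\<^sup>-\<^sup>1\<close> are inverse to each other.\<close>

lemma global_coordinates_inverse:
 fixes n :: nat
 assumes t: "global_coordinates n t"
 obtains \<beta> where "!!i l. i < n ==> l < n ==> smooth_fun_on n (eucl n) (\<beta> i l)"
  "!!i j y. i < n ==> j < n ==> y : eucl n ==> (\<Sum>l<n. \<beta> i l y * partial_deriv l (t j) y) = (if i = j then 1 else 0)"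
  "!!l k y. l < n ==> k < n ==> y : eucl n ==> (\<Sum>i<n. partial_deriv l (t i) y * \<beta> i k y) = (if l = k then 1 else 0)"
proof -
 let ?E = "eucl n"
 define T where "T = (%x i. if i < n then t i x else (0::real))"
 define R where "R = inv_into ?E T"
 have oE: "eopn n ?E" by (rule openin_topspace)
 have ts: "!!i. i < n ==> smooth_fun_on n ?E (t i)" and inj: "inj_on T ?E" and oT: "eopn n (T ` ?E)"
  and Rs: "!!i. i < n ==> smooth_fun_on n (T ` ?E) (%y. R y i)"
  using t unfolding global_coordinates_def Let_def T_def[symmetric] R_def[symmetric] by auto
 have RT: "R (T y) = y" if "y : ?E" for y using inv_into_f_f[OF inj that] by (simp add: R_def)
 have TR: "T (R z) = z" and RE: "R z : ?E" if "z : T ` ?E" for z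
  using f_inv_into_f[OF that] inv_into_into[OF that] by (simp_all add: R_def)
 have Ts: "smooth_fun_on n ?E (%x. T x i)" if "i < n" for i using ts[OF that] that by (simp add: T_def)
 have Tt: "(%x. T x i) = t i" if "i < n" for i using that by (simp add: T_def)
 have coord: "partial_deriv i (%z. z j) x = (if i = j then 1 else 0)" for i j and x :: "nat => real"
  by (rule partial_deriv_eqI) (auto intro!: derivative_eq_intros)
 \<comment> \<open>The Jacobian matrix of the inverse map is evaluated at T y, so that both matrices
   become functions of y.\<close>
 define \<beta> where "\<beta> i l y = partial_deriv i (%z. R z l) (T y)" for i l y
 show ?thesis
 proof (rule that[of \<beta>])
  show "smooth_fun_on n ?E (\<beta> i l)" if "i < n" "l < n" for i l
   unfolding \<beta>_def by (rule smooth_comp[OF oE oT Ts _ smooth_partial_deriv[OF Rs[OF that(2)] that(1)]]) auto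
  show "(\<Sum>l<n. \<beta> i l y * partial_deriv l (t j) y) = (if i = j then 1 else 0)" if ij: "i < n" "j < n" and y: "y : ?E" for i j y
  proof -
   have Ty: "T y : T ` ?E" using y by blast
   have "partial_deriv i (%z. t j (R z)) (T y) = (\<Sum>l<n. partial_deriv i (%x. R x l) (T y) * partial_deriv l (t j) (R (T y)))"
    by (rule partial_deriv_eqI) (rule smooth_comp_partial[OF oT oE Rs RE ts[OF ij(2)] ij(1) Ty])
   moreover have "partial_deriv i (%z. t j (R z)) (T y) = partial_deriv i (%z. z j) (T y)"
   proof (rule partial_deriv_cong[OF oT _ Ty ij(1)])
    fix z assume "z : T ` ?E"
    then show "t j (R z) = z j" using fun_cong[OF TR, of z j] ij(2) by (simp add: T_def)
   qed
   ultimately show ?thesis using RT[OF y] by (simp add: \<beta>_def coord)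
  qed
  show "(\<Sum>i<n. partial_deriv l (t i) y * \<beta> i k y) = (if l = k then 1 else 0)" if lk: "l < n" "k < n" and y: "y : ?E" for l k y
  proof -
   have "partial_deriv l (%x. R (T x) k) y = (\<Sum>i<n. partial_deriv l (%x. T x i) y * partial_deriv i (%z. R z k) (T y))"
    by (rule partial_deriv_eqI, rule smooth_comp_partial[OF oE oT Ts _ Rs[OF lk(2)] lk(1) y]) auto
   moreover have "partial_deriv l (%x. R (T x) k) y = partial_deriv l (%x. x k) y"
    by (rule partial_deriv_cong[OF oE _ y lk(1)]) (simp add: RT)
   moreover have "partial_deriv l (%x. T x i) y = partial_deriv l (t i) y" if "i < n" for i
    by (rule arg_cong[OF Tt[OF that], of "%f. partial_deriv l f y"])
   ultimately show ?thesis by (simp add: \<beta>_def coord)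
  qed
 qed
qed

text \<open>C consists of the coefficients of the unit vectors in the basis w, which gives one of
  the two matrix identities. The other follows from the uniqueness of coefficients.\<close>

lemma graded_basis_inverse:
 assumes w: "graded_basis p w" and fin: "finite (gens p)"
 obtains C where "!!a b. fst a ~= fst b ==> C a b = 0"
  "!!a a'. a : gens p ==> a' : gens p ==> (\<Sum>b\<in>gens p. C a b * w a' b) = (if a = a' then 1 else 0)"
  "!!b b'. b : gens p ==> b' : gens p ==> (\<Sum>a\<in>gens p. w a b * C a b') = (if b = b' then 1 else 0)"
proof -
 have wh: "w a : hpart (graded_vs p) (fst a)" if "a : gens p" for a
  using w[unfolded graded_basis_def, THEN conjunct1, THEN bspec, OF that] by (cases a) simp
 have w0: "w a b = 0" if "a : gens p" "fst a ~= fst b \<or> b \<notin> gens p" for a b using wh[OF that(1)] that(2) by (auto simp: vs_simps)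
 have ex: "\<exists>!c. (\<forall>i\<ge>p j. c i = 0) & v = (%a. \<Sum>i<p j. c i * w (j, i) a)" if "j ~= 0" "v : hpart (graded_vs p) j" for j v
  using w[unfolded graded_basis_def, THEN conjunct2, THEN spec, THEN mp, OF that(1), THEN bspec, OF that(2)] .
 have g0: "fst a ~= 0" if "a : gens p" for a using that by (auto simp: gens_def)
 \<comment> \<open>Rewrites a sum over one degree as a sum over all generators, the form needed for
   matrix products.\<close>
 have slice: "(\<Sum>i<p j. f (j, i)) = (\<Sum>a\<in>gens p. if fst a = j then f a else 0)" if "j ~= 0" for j and f :: "gen => real"
 proof -
  have "(\<Sum>a\<in>gens p. if fst a = j then f a else 0) = (\<Sum>a\<in>{a : gens p. fst a = j}. f a)"
   by (subst sum.inter_filter[OF fin]) simp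
  also have "{a : gens p. fst a = j} = Pair j ` {..<p j}" using that by (auto simp: gens_def)
  finally show ?thesis by (simp add: sum.reindex inj_on_def)
 qed
 have "\<forall>b\<in>gens p. \<exists>c. (\<forall>i\<ge>p (fst b). c i = 0) & unit_vec b = (%a. \<Sum>i<p (fst b). c i * w (fst b, i) a)"
  using ex[OF g0 unit_vec_hpart] by blast
 from bchoice[OF this] obtain c where c: "\<forall>b\<in>gens p. (\<forall>i\<ge>p (fst b). c b i = 0) & unit_vec b = (%a. \<Sum>i<p (fst b). c b i * w (fst b, i) a)"
  by (rule exE)
 define C where "C a b = (if fst a = fst b then c b (snd a) else 0)" for a b
 have Cz: "C a b = 0" if "fst a ~= fst b" for a b using that by (simp add: C_def)
 have wC: "(\<Sum>a\<in>gens p. w a b * C a b') = (if b = b' then 1 else 0)" if b: "b' : gens p" for b b'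
 proof -
  have "(if b = b' then 1 else 0) = unit_vec b' b" by (simp add: unit_vec_def)
  also have "\<dots> = (\<Sum>i<p (fst b'). c b' i * w (fst b', i) b)" using c b by metis
  also have "\<dots> = (\<Sum>i<p (fst b'). (%a. w a b * C a b') (fst b', i))" by (simp add: C_def mult.commute)
  also have "\<dots> = (\<Sum>a\<in>gens p. w a b * C a b')"
   unfolding slice[OF g0[OF b], of "%a. w a b * C a b'"] by (intro sum.cong) (auto simp: Cz)
  finally show ?thesis by simp
 qed
 have Cw: "(\<Sum>b\<in>gens p. C a b * w a' b) = (if a = a' then 1 else 0)" if a: "a : gens p" "a' : gens p" for a a'
 proof (cases "fst a = fst a'")
  case False
  then have "C a b * w a' b = 0" for b using w0[OF a(2), of b] Cz[of a b] by (cases "fst a = fst b") auto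
  then have "(\<Sum>b\<in>gens p. C a b * w a' b) = 0" by (intro sum.neutral ballI)
  then show ?thesis using False by auto
 next
  case True
  let ?j = "fst a'"
  \<comment> \<open>d expands \<open>w a'\<close> through the unit vectors by means of C, and d' is
    the trivial expansion; uniqueness identifies them.\<close>
  define d where "d i = (if i < p ?j then \<Sum>b\<in>gens p. C (?j, i) b * w a' b else 0)" for i
  define d' where "d' i = (if i = snd a' then 1 else 0 :: real)" for i
  have "w a' = (%x. \<Sum>i<p ?j. d i * w (?j, i) x)"
  proof
   fix x
   have "(\<Sum>i<p ?j. d i * w (?j, i) x) = (\<Sum>i<p ?j. (%a. (\<Sum>b\<in>gens p. C a b * w a' b) * w a x) (?j, i))"
    by (simp add: d_def)
   also have "\<dots> = (\<Sum>a\<in>gens p. (\<Sum>b\<in>gens p. C a b * w a' b) * w a x)"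
    unfolding slice[OF g0[OF a(2)], of "%a. (\<Sum>b\<in>gens p. C a b * w a' b) * w a x"]
   proof (intro sum.cong refl)
    fix a'' show "(if fst a'' = ?j then (\<Sum>b\<in>gens p. C a'' b * w a' b) * w a'' x else 0) = (\<Sum>b\<in>gens p. C a'' b * w a' b) * w a'' x"
    proof (cases "fst a'' = ?j")
     case False
     then have "C a'' b * w a' b = 0" for b using w0[OF a(2), of b] Cz[of a'' b] by (cases "fst a'' = fst b") auto
     then have "(\<Sum>b\<in>gens p. C a'' b * w a' b) = 0" by (intro sum.neutral ballI)
     then show ?thesis by simp
    qed simp
   qed
   also have "\<dots> = (\<Sum>b\<in>gens p. w a' b * (\<Sum>a\<in>gens p. w a x * C a b))"
    unfolding sum_distrib_right sum_distrib_left by (subst sum.swap) (simp add: ac_simps)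
   also have "\<dots> = (\<Sum>b\<in>gens p. if b = x then w a' b else 0)" by (intro sum.cong refl) (simp add: wC)
   also have "\<dots> = w a' x" using w0[OF a(2), of x] fin by simp
   finally show "w a' x = (\<Sum>i<p ?j. d i * w (?j, i) x)" by simp
  qed
  then have 1: "(\<forall>i\<ge>p ?j. d i = 0) & w a' = (%x. \<Sum>i<p ?j. d i * w (?j, i) x)" by (simp add: d_def)
  have s: "snd a' < p ?j" using a(2) by (auto simp: gens_def)
  have "(\<Sum>i<p ?j. d' i * w (?j, i) x) = w a' x" for x
   using s by (simp add: d'_def if_distrib[of "%r. r * _"] sum.delta' cong: if_cong)
  then have 2: "(\<forall>i\<ge>p ?j. d' i = 0) & w a' = (%x. \<Sum>i<p ?j. d' i * w (?j, i) x)" using s by (auto simp: d'_def)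
  define Q where "Q c \<longleftrightarrow> (\<forall>i\<ge>p ?j. c i = 0) & w a' = (%x. \<Sum>i<p ?j. c i * w (?j, i) x)" for c
  have "\<exists>!c. Q c" "Q d" "Q d'" unfolding Q_def by (rule ex[OF g0[OF a(2)] wh[OF a(2)]] 1 2)+
  then have "d = d'" by blast
  then have "d (snd a) = d' (snd a)" by simp
  moreover have "snd a < p ?j" using a(1) True by (auto simp: gens_def)
  moreover have "(?j, snd a) = a" using True by (simp add: prod_eq_iff)
  ultimately have "(\<Sum>b\<in>gens p. C a b * w a' b) = d' (snd a)" by (simp add: d_def)
  then show ?thesis using True by (simp add: d'_def prod_eq_iff)
 qed
 show ?thesis by (rule that[of C]) (use Cz Cw wC in auto)
qed

lemma sum_idx: "finite (gens p) ==> (\<Sum>\<nu>\<in>idx p. f \<nu>) = (\<Sum>i<p 0. f (Inl i)) + (\<Sum>a\<in>gens p. f (Inr a))"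
 unfolding idx_def by (subst sum.union_disjoint) (auto simp: sum.reindex)

lemma linear_series_eq:
 "linear_series U v m y = (if size m = 1 & y : U then v (the_elem (set_mset m)) else 0)"
 by (simp add: linear_series_def)

context mfd_chart
begin

lemma coordinate_frame:
 assumes t: "global_coordinates (p 0) t" and w: "graded_basis p w"
  and \<tau>: "!!i. i < p 0 ==> \<tau> i : sects S V & Ps V (\<tau> i) = fun_series (h ` V) (t i)"
  and \<omega>: "!!a. a : gens p ==> \<omega> a : sects S V & Ps V (\<omega> a) = linear_series (h ` V) (w a)"
 obtains J \<alpha> where "frame S V p h Ps (case_sum \<tau> \<omega>) J \<alpha>"
proof -
 note oV = img_open[OF dom_V]
 note VE = open_subset_eucl[OF oV]
 obtain \<beta> where bs: "!!i l. i < p 0 ==> l < p 0 ==> smooth_fun_on (p 0) (eucl (p 0)) (\<beta> i l)"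
  and b1: "!!i j y. i < p 0 ==> j < p 0 ==> y : eucl (p 0) ==> (\<Sum>l<p 0. \<beta> i l y * partial_deriv l (t j) y) = (if i = j then 1 else 0)"
  and b2: "!!l k y. l < p 0 ==> k < p 0 ==> y : eucl (p 0) ==> (\<Sum>i<p 0. partial_deriv l (t i) y * \<beta> i k y) = (if l = k then 1 else 0)"
  by (rule global_coordinates_inverse[OF t]) (rule that)
 obtain C where Cz: "!!a b. fst a ~= fst b ==> C a b = 0"
  and c1: "!!a a'. a : gens p ==> a' : gens p ==> (\<Sum>b\<in>gens p. C a b * w a' b) = (if a = a' then 1 else 0)"
  and c2: "!!b b'. b : gens p ==> b' : gens p ==> (\<Sum>a\<in>gens p. w a b * C a b') = (if b = b' then 1 else 0)"
  by (rule graded_basis_inverse[OF w fin]) (rule that)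
 \<comment> \<open>The matrix is block diagonal: the t_i depend on the degree-zero coordinates
   alone, and the w_a have constant coefficients. The blocks are inverted separately by \<beta> and
   C.\<close>
 define J where "J \<nu> ii = (case \<nu> of Inl l => case_sum (%i. partial_deriv l (t i)) (%a y. 0) ii
   | Inr b => case_sum (%i y. 0) (%a y. w a b) ii)" for \<nu> ii :: idx
 define \<alpha> where "\<alpha> ii \<nu> = (case ii of Inl i => case_sum (%l. \<beta> i l) (%b y. 0) \<nu>
   | Inr a => case_sum (%l y. 0) (%b y. C a b) \<nu>)" for ii \<nu> :: idx
 have "frame S V p h Ps (case_sum \<tau> \<omega>) J \<alpha>"
 proof (rule frame.intro[OF mfd_chart_axioms frame_axioms.intro])
  fix ii assume i: "ii : idx p"
  then show "case_sum \<tau> \<omega> ii : sects S V" using \<tau> \<omega> by (auto elim!: idx_cases)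
  fix \<nu> assume n: "\<nu> : idx p"
  show "dd \<nu> (h ` V) (Ps V (case_sum \<tau> \<omega> ii)) = fun_series (h ` V) (J \<nu> ii)"
  proof (intro ext)
   fix m :: "gen multiset" and y
   have pc: "partial_deriv l (%y. if y : h ` V then f y else 0) y = partial_deriv l f y" if "y : h ` V" "l < p 0" for l f
    by (rule partial_deriv_cong[OF oV _ that]) simp
   have p0: "partial_deriv l (%y. r) y = 0" for l and r :: real by (rule partial_deriv_eqI) simp
   have pl: "partial_deriv l (linear_series (h ` V) v m) y = 0" if "y : h ` V" "l < p 0" for l v m
    by (subst partial_deriv_cong[OF oV _ that, of _ "%y. if size m = 1 then v (the_elem (set_mset m)) else 0"])
     (simp_all add: linear_series_eq p0)
   show "dd \<nu> (h ` V) (Ps V (case_sum \<tau> \<omega> ii)) m y = fun_series (h ` V) (J \<nu> ii) m y"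
    using i n
    by (elim idx_cases; cases "m = {#}")
     (simp_all add: dd_def \<tau> \<omega> J_def dt_def dw_def fun_series_def linear_series_eq pc pl p0)
  qed
  show "smooth_fun_on (p 0) (h ` V) (\<alpha> ii \<nu>)"
   using i n smooth_subset[OF openin_topspace oV VE bs] smooth_const[OF oV]
   by (auto elim!: idx_cases simp: \<alpha>_def)
  fix y assume y: "y : h ` V"
  then have yE: "y : eucl (p 0)" using VE by blast
  show "(\<Sum>\<mu>\<in>idx p. \<alpha> ii \<mu> y * J \<mu> \<nu> y) = (if ii = \<nu> then 1 else 0)"
   using i n by (elim idx_cases) (simp_all add: sum_idx[OF fin] \<alpha>_def J_def b1 yE c1)
  show "(\<Sum>\<mu>\<in>idx p. J ii \<mu> y * \<alpha> \<mu> \<nu> y) = (if ii = \<nu> then 1 else 0)"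
   using i n by (elim idx_cases) (simp_all add: sum_idx[OF fin] \<alpha>_def J_def b2 yE c2)
 next
  fix ii \<nu> assume "dg ii ~= dg \<nu>"
  then show "\<alpha> ii \<nu> = (%y. 0)" using Cz by (cases ii; cases \<nu>) (auto simp: \<alpha>_def)
 qed
 then show ?thesis by (rule that)
qed

end

section \<open>Splitting of vector fields in local coordinates\<close>

context gmanifold
begin

lemma TM_finsum:
 assumes U: "opn M U" and f: "f : sects M U" and I: "finite I" "!!i. i : I ==> X i : vector_fields M U"
 shows "(\<Oplus>\<^bsub>sec TM U\<^esub>i\<in>I. X i) U f = (\<Oplus>\<^bsub>sec M U\<^esub>i\<in>I. X i U f)"
 by (rule endo_finsum[OF alg_sheaf T_abelian_group[OF U] _ tangent_simps(3,4) U subset_refl f I(1)])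
  (use vf_endo I(2) in \<open>auto simp: tangent_simps(2)\<close>)

text \<open>By \<open>vector_fields_eqI\<close> it suffices to compare both sides on the coordinate
  sections, where the defining equations of Dt and Dw leave a single summand.\<close>

lemma coordinate_splitting:
 assumes fr: "frame M V p h Ps (case_sum \<tau> \<omega>) J \<alpha>" and cd: "coordinate_derivations p M V \<tau> \<omega> Dt Dw"
  and U: "opn M U" "V \<subseteq> U" and Y: "Y : vector_fields M U"
 shows "rst M V Y = (\<Oplus>\<^bsub>sec TM V\<^esub>i\<in>{..<p 0}. Y V (\<tau> i) \<odot>\<^bsub>sec TM V\<^esub> Dt i) \<oplus>\<^bsub>sec TM V\<^esub>
   (\<Oplus>\<^bsub>sec TM V\<^esub>a\<in>gens p. Y V (\<omega> a) \<odot>\<^bsub>sec TM V\<^esub> Dw a)"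
proof -
 interpret frame M V p h Ps "case_sum \<tau> \<omega>" J \<alpha> by (rule fr)
 note V = domD(1)[OF dom_V]
 interpret T: abelian_group "sec TM V" by (rule T_abelian_group[OF V])
 interpret R: ring "sec M V" by (rule rng[OF V])
 have \<tau>c: "\<tau> i : sects M V" if "i < p 0" for i using \<kappa>[of "Inl i"] that by (simp add: idx_def)
 have \<omega>c: "\<omega> a : sects M V" if "a : gens p" for a using \<kappa>[of "Inr a"] that by (simp add: idx_def)
 note Yc = sheaf_endoD(1)[OF vf_endo[OF Y] V U(2)]
 have Dtv: "Dt i : vector_fields M V" if "i < p 0" for i
  using cd that derivations_vf[OF V] unfolding coordinate_derivations_def by blast
 have Dwv: "Dw a : vector_fields M V" if "a : gens p" for a
  using cd that derivations_vf[OF V] unfolding coordinate_derivations_def by blast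
 have sm: "f \<odot>\<^bsub>sec TM V\<^esub> D : vector_fields M V" "(f \<odot>\<^bsub>sec TM V\<^esub> D) V g = f \<otimes>\<^bsub>sec M V\<^esub> D V g"
  if "f : sects M V" "D : vector_fields M V" "g : sects M V" for f D g
  unfolding tangent_simps using tsmult_vf[OF V that(2,1)] presheafD(4)[OF pre V that(1)] by (simp_all add: rst_eq[OF V subset_refl that(3)])
 let ?A = "\<Oplus>\<^bsub>sec TM V\<^esub>i\<in>{..<p 0}. Y V (\<tau> i) \<odot>\<^bsub>sec TM V\<^esub> Dt i" and ?B = "\<Oplus>\<^bsub>sec TM V\<^esub>a\<in>gens p. Y V (\<omega> a) \<odot>\<^bsub>sec TM V\<^esub> Dw a"
 have tv: "Y V (\<tau> i) \<odot>\<^bsub>sec TM V\<^esub> Dt i : vector_fields M V" if "i < p 0" for i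
  by (rule sm(1)[OF Yc[OF \<tau>c[OF that]] Dtv[OF that] R.zero_closed])
 have wv: "Y V (\<omega> a) \<odot>\<^bsub>sec TM V\<^esub> Dw a : vector_fields M V" if "a : gens p" for a
  by (rule sm(1)[OF Yc[OF \<omega>c[OF that]] Dwv[OF that] R.zero_closed])
 have AB: "?A : sects TM V" "?B : sects TM V"
  by (rule T.finsum_closed, use tv wv in \<open>simp add: tangent_simps(2) Pi_iff\<close>)+
 show ?thesis
 proof (rule vector_fields_eqI)
  show "rst M V Y : vector_fields M V" by (rule rst_vector_fields[OF alg_sheaf Y U(2)])
  show "?A \<oplus>\<^bsub>sec TM V\<^esub> ?B : vector_fields M V" using T.a_closed[OF AB] by (simp only: tangent_simps(2))
  fix ii assume i: "ii : idx p"
  let ?k = "case_sum \<tau> \<omega> ii"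
  note k = \<kappa>[OF i]
  have t1: "(Y V (\<tau> i) \<odot>\<^bsub>sec TM V\<^esub> Dt i) V ?k = (if ii = Inl i then Y V (\<tau> i) else \<zero>\<^bsub>sec M V\<^esub>)" if l: "i < p 0" for i
  proof -
   have "Dt i V ?k = (if ii = Inl i then \<one>\<^bsub>sec M V\<^esub> else \<zero>\<^bsub>sec M V\<^esub>)"
    using i
   proof (cases rule: idx_cases)
    case (1 j)
    then show ?thesis using cd l unfolding coordinate_derivations_def by auto
   qed (use cd l in \<open>simp add: coordinate_derivations_def\<close>)
   then show ?thesis unfolding sm(2)[OF Yc[OF \<tau>c[OF l]] Dtv[OF l] k] using Yc[OF \<tau>c[OF l]] by simp
  qed
  have t2: "(Y V (\<omega> a) \<odot>\<^bsub>sec TM V\<^esub> Dw a) V ?k = (if ii = Inr a then Y V (\<omega> a) else \<zero>\<^bsub>sec M V\<^esub>)" if l: "a : gens p" for a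
  proof -
   have "Dw a V ?k = (if ii = Inr a then \<one>\<^bsub>sec M V\<^esub> else \<zero>\<^bsub>sec M V\<^esub>)"
    using i
   proof (cases rule: idx_cases)
    case (2 b)
    then show ?thesis using cd l unfolding coordinate_derivations_def by auto
   qed (use cd l in \<open>simp add: coordinate_derivations_def\<close>)
   then show ?thesis unfolding sm(2)[OF Yc[OF \<omega>c[OF l]] Dwv[OF l] k] using Yc[OF \<omega>c[OF l]] by simp
  qed
  have "(?A \<oplus>\<^bsub>sec TM V\<^esub> ?B) V ?k = ?A V ?k \<oplus>\<^bsub>sec M V\<^esub> ?B V ?k"
   unfolding tangent_simps(4) by (rule rst_eq[OF V subset_refl k])
  also have "?A V ?k = (\<Oplus>\<^bsub>sec M V\<^esub>i\<in>{..<p 0}. if ii = Inl i then Y V (\<tau> i) else \<zero>\<^bsub>sec M V\<^esub>)"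
   by (subst TM_finsum[OF V k finite_lessThan], use tv in simp, rule R.finsum_cong') (use t1 Yc[OF \<tau>c] in auto)
  also have "?B V ?k = (\<Oplus>\<^bsub>sec M V\<^esub>a\<in>gens p. if ii = Inr a then Y V (\<omega> a) else \<zero>\<^bsub>sec M V\<^esub>)"
   by (subst TM_finsum[OF V k fin wv], assumption, rule R.finsum_cong') (use t2 Yc[OF \<omega>c] in auto)
  also have "(\<Oplus>\<^bsub>sec M V\<^esub>i\<in>{..<p 0}. if ii = Inl i then Y V (\<tau> i) else \<zero>\<^bsub>sec M V\<^esub>) \<oplus>\<^bsub>sec M V\<^esub>
    (\<Oplus>\<^bsub>sec M V\<^esub>a\<in>gens p. if ii = Inr a then Y V (\<omega> a) else \<zero>\<^bsub>sec M V\<^esub>) = Y V ?k"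
   using i
  proof (cases rule: idx_cases)
   case (1 i)
   have "(\<Oplus>\<^bsub>sec M V\<^esub>l\<in>{..<p 0}. if i = l then Y V (\<tau> l) else \<zero>\<^bsub>sec M V\<^esub>) = Y V (\<tau> i)"
    by (rule R.finsum_singleton) (use 1 Yc[OF \<tau>c] in auto)
   then show ?thesis using 1 Yc[OF \<tau>c[OF 1(2)]] by simp
  next
   case (2 a)
   have "(\<Oplus>\<^bsub>sec M V\<^esub>l\<in>gens p. if a = l then Y V (\<omega> l) else \<zero>\<^bsub>sec M V\<^esub>) = Y V (\<omega> a)"
    by (rule R.finsum_singleton) (use 2 fin Yc[OF \<omega>c] in auto)
   then show ?thesis using 2 Yc[OF \<omega>c[OF 2(2)]] by simp
  qed
  also have "Y V ?k = rst M V Y V ?k" by (simp add: rst_eq[OF V subset_refl k])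
  finally show "rst M V Y V ?k = (?A \<oplus>\<^bsub>sec TM V\<^esub> ?B) V ?k" ..
 qed
qed

lemma coordinate_derivations_exist:
 assumes "frame M V p h Ps (case_sum \<tau> \<omega>) J \<alpha>"
 shows "\<exists>Dt Dw. coordinate_derivations p M V \<tau> \<omega> Dt Dw"
proof -
 interpret frame M V p h Ps "case_sum \<tau> \<omega>" J \<alpha> by fact
 have "frame_derivation ii : derivations M V (- dg ii)"
  "i < p 0 ==> frame_derivation ii V (\<tau> i) = (if ii = Inl i then \<one>\<^bsub>sec M V\<^esub> else \<zero>\<^bsub>sec M V\<^esub>)"
  "a : gens p ==> frame_derivation ii V (\<omega> a) = (if ii = Inr a then \<one>\<^bsub>sec M V\<^esub> else \<zero>\<^bsub>sec M V\<^esub>)"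
  if "ii : idx p" for ii i a
  using frame_derivation[OF that] frame_derivation(2)[OF that, of "Inl i"] frame_derivation(2)[OF that, of "Inr a"]
  by (simp_all add: idx_def)
 note fd = this
 have i: "Inl i : idx p \<longleftrightarrow> i < p 0" "Inr a : idx p \<longleftrightarrow> a : gens p" for i a by (auto simp: idx_def)
 show ?thesis
  unfolding coordinate_derivations_def
  by (intro exI[of _ "%i. frame_derivation (Inl i)"] exI[of _ "%a. frame_derivation (Inr a)"])
   (use fd(1)[of "Inl _"] fd(1)[of "Inr _"] in \<open>auto simp: fd i\<close>)
qed

end

theorem theorem3p3:
  fixes M :: "('x, real, 'a) gpresheaf" and p :: "int \<Rightarrow> nat"
  assumes "graded_manifold p M"
    and "finite {j. p j \<noteq> 0}"
  shows "module_sheaf M (tangent_sheaf M) \<and> locally_free M (tangent_sheaf M) \<and>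
    (\<forall>V V' h H. trivialisation p M V V' h H \<longrightarrow>
       module_sheaf_iso (restrict_sheaf M V) (restrict_sheaf (tangent_sheaf M) V)
         (split_tangent_sheaf p M V h H) \<and>
       (\<forall>t w \<tau> \<omega>. global_coordinates (p 0) t \<and> graded_basis p w \<and>
          \<tau> = (\<lambda>i. H V' (fun_series V' (t i))) \<and> \<omega> = (\<lambda>a. H V' (linear_series V' (w a))) \<longrightarrow>
          (\<exists>Dt Dw. coordinate_derivations p M V \<tau> \<omega> Dt Dw) \<and>
          (\<forall>Dt Dw. coordinate_derivations p M V \<tau> \<omega> Dt Dw \<longrightarrow>
             (\<forall>U Y. openin (base M) U \<and> V \<subseteq> U \<and> Y \<in> carrier (sec (tangent_sheaf M) U) \<longrightarrow>
                (\<forall>i<p 0. Y V (\<tau> i) \<in> carrier (sec M V)) \<and>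
                (\<forall>a\<in>gens p. Y V (\<omega> a) \<in> carrier (sec M V)) \<and>
                (let T = sec (tangent_sheaf M) V in
                 res (tangent_sheaf M) U V Y =
                   finsum T (\<lambda>i. Y V (\<tau> i) \<odot>\<^bsub>T\<^esub> Dt i) {..<p 0} \<oplus>\<^bsub>T\<^esub>
                   finsum T (\<lambda>a. Y V (\<omega> a) \<odot>\<^bsub>T\<^esub> Dw a) (gens p))))))"
proof -
 interpret gmanifold M p by unfold_locales (rule assms)+
 \<comment> \<open>The isomorphism and the frame are obtained from one and the same chart.\<close>
 have *: "module_sheaf_iso (restrict_sheaf M V) (restrict_sheaf TM V) (split_tangent_sheaf p M V h H) \<and>
   (global_coordinates (p 0) t & graded_basis p w -->
    (\<exists>Ps J \<alpha>. frame M V p h Ps (case_sum (%i. H V' (fun_series V' (t i))) (%a. H V' (linear_series V' (w a)))) J \<alpha>))"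
  if triv: "trivialisation p M V V' h H" for V V' h H t w
 proof -
  obtain Ps where c: "mfd_chart M V p h Ps" and hV: "h ` V = V'"
   and H: "!!U s. opn M U ==> U \<subseteq> V ==> s : series_on p (h ` U) ==>
    H (h ` U) s : sects M U & Ps U (H (h ` U) s) = s"
   by (rule trivialisation_chart[OF gm finp triv]) (rule that)
  interpret mfd_chart M V p h Ps by (rule c)
  note HV = H[OF V_open subset_refl]
  have "\<exists>Ps J \<alpha>. frame M V p h Ps (case_sum (%i. H V' (fun_series V' (t i))) (%a. H V' (linear_series V' (w a)))) J \<alpha>"
   if t: "global_coordinates (p 0) t" and w: "graded_basis p w"
   unfolding hV[symmetric]
  proof (rule coordinate_frame[OF t w, where \<tau> = "%i. H (h ` V) (fun_series (h ` V) (t i))"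
     and \<omega> = "%a. H (h ` V) (linear_series (h ` V) (w a))"])
   fix i assume i: "i < p 0"
   have ts: "smooth_fun_on (p 0) (topspace (Euclidean_space (p 0))) (t i)"
    using t i unfolding global_coordinates_def Let_def by blast
   have "smooth_fun_on (p 0) (h ` V) (t i)"
    by (rule smooth_subset[OF openin_topspace img_open[OF dom_V] openin_subset[OF img_open[OF dom_V]] ts])
   then show "H (h ` V) (fun_series (h ` V) (t i)) : sects M V \<and>
     Ps V (H (h ` V) (fun_series (h ` V) (t i))) = fun_series (h ` V) (t i)"
    by (intro HV fun_series_on[where p = p, OF img_open[OF dom_V]])
  next
   fix a assume a: "a : gens p"
   have "w a b = 0" if "b \<notin> gens p" for b
    using w a that unfolding graded_basis_def by (cases a) (auto simp: vs_simps)
   then show "H (h ` V) (linear_series (h ` V) (w a)) : sects M V \<and>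
     Ps V (H (h ` V) (linear_series (h ` V) (w a))) = linear_series (h ` V) (w a)"
    by (intro HV linear_series_on[where p = p, OF img_open[OF dom_V]])
  qed blast
  then show ?thesis using tangent_split[OF tangent_free[OF c] H] by blast
 qed
 show ?thesis
  unfolding Let_def tangent_simps(2,7)
 proof (intro conjI T_module_sheaf T_locally_free allI impI)
  fix V V' h H assume triv: "trivialisation p M V V' h H"
  show "module_sheaf_iso (restrict_sheaf M V) (restrict_sheaf TM V) (split_tangent_sheaf p M V h H)"
   using *[OF triv] by blast
  fix t w \<tau> \<omega>
  assume tw: "global_coordinates (p 0) t & graded_basis p w \<and>
   \<tau> = (%i. H V' (fun_series V' (t i))) & \<omega> = (%a. H V' (linear_series V' (w a)))"
  then obtain Ps J \<alpha> where fr: "frame M V p h Ps (case_sum \<tau> \<omega>) J \<alpha>" using *[OF triv, of t w] by blast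
  interpret frame M V p h Ps "case_sum \<tau> \<omega>" J \<alpha> by (rule fr)
  show "\<exists>Dt Dw. coordinate_derivations p M V \<tau> \<omega> Dt Dw" by (rule coordinate_derivations_exist[OF fr])
  fix Dt Dw U Y assume cd: "coordinate_derivations p M V \<tau> \<omega> Dt Dw"
   and U: "opn M U & V \<subseteq> U & Y : vector_fields M U"
  then have U': "opn M U" "V \<subseteq> U" "Y : vector_fields M U" by auto
  note Yc = sheaf_endoD(1)[OF vf_endo[OF U'(3)] V_open U'(2)]
  show "Y V (\<tau> i) : sects M V" if "i < p 0" for i
   using Yc[OF \<kappa>[of "Inl i"]] that by (simp add: idx_def)
  show "\<forall>a\<in>gens p. Y V (\<omega> a) : sects M V"
   using Yc[OF \<kappa>[of "Inr _"]] by (simp add: idx_def)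
  show "rst M V Y = (\<Oplus>\<^bsub>sec TM V\<^esub>i\<in>{..<p 0}. Y V (\<tau> i) \<odot>\<^bsub>sec TM V\<^esub> Dt i) \<oplus>\<^bsub>sec TM V\<^esub>
    (\<Oplus>\<^bsub>sec TM V\<^esub>a\<in>gens p. Y V (\<omega> a) \<odot>\<^bsub>sec TM V\<^esub> Dw a)"
   by (rule coordinate_splitting[OF fr cd U'])
 qed
qed

end
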